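(* Let $N\ge 1$, let $\Omega\subset\mathbb{R}^N$ be a bounded domain, let $1<q<p<\infty$, and let $\lambda,\eta\in\mathbb{R}$. Let $m,a,f\in L^\gamma(\Omega)$, where $\gamma>N/p$ (for some such $\gamma$) if $N\ge p$ and $\gamma=1$ if $N<p$, with $m_+\not\equiv 0$, $a\not\equiv 0$, $f\not\equiv 0$. Let either of the following assumptions hold: (i) $\lambda\notin\sigma(-\Delta_p;m)$; (ii) $\lambda\in\sigma(-\Delta_p;m)$ and $\eta\int_\Omega a|u|^q\,dx>0$ for all $u\in ES(\lambda;m)\setminus\{0\}$; (iii) $\lambda\in\sigma(-\Delta_p;m)$ and $\eta\int_\Omega a|u|^q\,dx<0$ for all $u\in ES(\lambda;m)\setminus\{0\}$. Then the functional $$E_{\lambda,\eta}(u)=\frac1p\left(\int_\Omega|\nabla u|^p\,dx-\lambda\int_\Omega m|u|^p\,dx\right)-\frac{\eta}{q}\int_\Omega a|u|^q\,dx-\int_\Omega f u\,dx,\qquad u\in W_0^{1,p}(\Omega),$$ has at least one critical point, i.e., the problem $$-\Delta_p u=\lambda\,m(x)|u|^{p-2}u+\eta\,a(x)|u|^{q-2}u+f(x)\ \text{ in }\Omega,\qquad u=0\ \text{ on }\partial\Omega,$$ has at least one solution.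
   Context: Notation: $w_\pm=\max\{\pm w,0\}$; $\Delta_p u=\mathrm{div}(|\nabla u|^{p-2}\nabla u)$. A solution of a problem $-\Delta_p u=G(x,u)$ in $\Omega$, $u=0$ on $\partial\Omega$, is a function $u\in W_0^{1,p}(\Omega)$ with $\int_\Omega|\nabla u|^{p-2}\nabla u\cdot\nabla\xi\,dx=\int_\Omega G(x,u)\xi\,dx$ for all $\xi\in W_0^{1,p}(\Omega)$. $\sigma(-\Delta_p;m)$ is the set of all eigenvalues, i.e., of all $\lambda\in\mathbb{R}$ for which the problem $-\Delta_p u=\lambda m(x)|u|^{p-2}u$ in $\Omega$, $u=0$ on $\partial\Omega$, has a nonzero solution, and $ES(\lambda;m)$ is the set of all solutions $u\in W_0^{1,p}(\Omega)$ of this eigenvalue problem (including $0$). The functional $E_{\lambda,\eta}$ is of class $C^1$ on $W_0^{1,p}(\Omega)$. *)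

theory Defs
  imports "HOL-Analysis.Analysis"
begin

text \<open>
  Functions on \<open>\<Omega>\<close> are total functions on \<open>real ^ 'n\<close> of which only the values on \<open>\<Omega>\<close> matter.
  Classes modulo equality almost everywhere are not formed: the elements of the function spaces below
  are representatives, and "nonzero" means "not almost everywhere zero on \<open>\<Omega>\<close>".
\<close>

definition Lp_space :: "real \<Rightarrow> (real ^ 'n) set \<Rightarrow> (real ^ 'n \<Rightarrow> 'b::euclidean_space) set" where
  "Lp_space p \<Omega> = {f \<in> borel_measurable (lebesgue_on \<Omega>).
     integrable (lebesgue_on \<Omega>) (\<lambda>x. norm (f x) powr p)}"

definition ae_zero_on :: "(real ^ 'n) set \<Rightarrow> (real ^ 'n \<Rightarrow> real) \<Rightarrow> bool" where
  "ae_zero_on \<Omega> f \<longleftrightarrow> (AE x in lebesgue_on \<Omega>. f x = 0)"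

definition partial_deriv :: "'n \<Rightarrow> (real ^ 'n \<Rightarrow> real) \<Rightarrow> real ^ 'n \<Rightarrow> real" where
  "partial_deriv i f x = frechet_derivative f (at x) (axis i 1)"

primrec C_k :: "nat \<Rightarrow> (real ^ 'n \<Rightarrow> real) \<Rightarrow> bool" where
  "C_k 0 f \<longleftrightarrow> continuous_on UNIV f"
| "C_k (Suc k) f \<longleftrightarrow> (\<forall>x. f differentiable (at x)) \<and> (\<forall>i. C_k k (partial_deriv i f))"

definition test_functions :: "(real ^ 'n) set \<Rightarrow> (real ^ 'n \<Rightarrow> real) set" where
  "test_functions \<Omega> = {\<phi>. (\<forall>k. C_k k \<phi>) \<and>
     compact (closure {x. \<phi> x \<noteq> 0}) \<and> closure {x. \<phi> x \<noteq> 0} \<subseteq> \<Omega>}"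

definition locally_integrable ::
    "(real ^ 'n) set \<Rightarrow> (real ^ 'n \<Rightarrow> 'b::euclidean_space) \<Rightarrow> bool" where
  "locally_integrable \<Omega> f \<longleftrightarrow> (\<forall>K. compact K \<and> K \<subseteq> \<Omega> \<longrightarrow> integrable (lebesgue_on K) f)"

definition has_weak_gradient ::
    "(real ^ 'n) set \<Rightarrow> (real ^ 'n \<Rightarrow> real) \<Rightarrow> (real ^ 'n \<Rightarrow> real ^ 'n) \<Rightarrow> bool" where
  "has_weak_gradient \<Omega> u g \<longleftrightarrow> locally_integrable \<Omega> u \<and> locally_integrable \<Omega> g \<and>
     (\<forall>\<phi>\<in>test_functions \<Omega>. \<forall>i.
        (LINT x|lebesgue_on \<Omega>. u x * partial_deriv i \<phi> x) = - (LINT x|lebesgue_on \<Omega>. g x $ i * \<phi> x))"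

text \<open>For open \<open>\<Omega>\<close> a weak gradient is unique almost everywhere on \<open>\<Omega>\<close>, and every use below is
  insensitive to the representative that is chosen.\<close>

definition weak_grad :: "(real ^ 'n) set \<Rightarrow> (real ^ 'n \<Rightarrow> real) \<Rightarrow> real ^ 'n \<Rightarrow> real ^ 'n" where
  "weak_grad \<Omega> u = (SOME g. has_weak_gradient \<Omega> u g)"

definition W1p :: "real \<Rightarrow> (real ^ 'n) set \<Rightarrow> (real ^ 'n \<Rightarrow> real) set" where
  "W1p p \<Omega> = {u \<in> Lp_space p \<Omega>. \<exists>g\<in>Lp_space p \<Omega>. has_weak_gradient \<Omega> u g}"

definition W1p_norm :: "real \<Rightarrow> (real ^ 'n) set \<Rightarrow> (real ^ 'n \<Rightarrow> real) \<Rightarrow> real" where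
  "W1p_norm p \<Omega> u =
     ((LINT x|lebesgue_on \<Omega>. \<bar>u x\<bar> powr p) +
      (LINT x|lebesgue_on \<Omega>. norm (weak_grad \<Omega> u x) powr p)) powr (1 / p)"

definition W1p0 :: "real \<Rightarrow> (real ^ 'n) set \<Rightarrow> (real ^ 'n \<Rightarrow> real) set" where
  "W1p0 p \<Omega> = {u \<in> W1p p \<Omega>.
     \<forall>\<epsilon>>0. \<exists>\<phi>\<in>test_functions \<Omega>. W1p_norm p \<Omega> (\<lambda>x. u x - \<phi> x) < \<epsilon>}"

text \<open>Integrability of the right-hand side is required explicitly, since \<open>LINT\<close> is \<open>0\<close> on
  non-integrable functions; on the left it is automatic by Hoelder's inequality.\<close>

definition p_laplace_solution ::
    "real \<Rightarrow> (real ^ 'n) set \<Rightarrow> (real ^ 'n \<Rightarrow> real \<Rightarrow> real) \<Rightarrow> (real ^ 'n \<Rightarrow> real) \<Rightarrow> bool" where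
  "p_laplace_solution p \<Omega> G u \<longleftrightarrow> u \<in> W1p0 p \<Omega> \<and>
     (\<forall>\<xi>\<in>W1p0 p \<Omega>.
        integrable (lebesgue_on \<Omega>) (\<lambda>x. G x (u x) * \<xi> x) \<and>
        (LINT x|lebesgue_on \<Omega>.
           (norm (weak_grad \<Omega> u x) powr (p - 2) *\<^sub>R weak_grad \<Omega> u x) \<bullet> weak_grad \<Omega> \<xi> x) =
        (LINT x|lebesgue_on \<Omega>. G x (u x) * \<xi> x))"

definition ES ::
    "real \<Rightarrow> (real ^ 'n) set \<Rightarrow> real \<Rightarrow> (real ^ 'n \<Rightarrow> real) \<Rightarrow> (real ^ 'n \<Rightarrow> real) set" where
  "ES p \<Omega> lam m = {u. p_laplace_solution p \<Omega> (\<lambda>x s. lam * m x * \<bar>s\<bar> powr (p - 2) * s) u}"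

definition p_laplace_spectrum ::
    "real \<Rightarrow> (real ^ 'n) set \<Rightarrow> (real ^ 'n \<Rightarrow> real) \<Rightarrow> real set" where
  "p_laplace_spectrum p \<Omega> m = {lam. \<exists>u\<in>ES p \<Omega> lam m. \<not> ae_zero_on \<Omega> u}"

definition energy ::
    "real \<Rightarrow> real \<Rightarrow> (real ^ 'n) set \<Rightarrow> (real ^ 'n \<Rightarrow> real) \<Rightarrow> (real ^ 'n \<Rightarrow> real) \<Rightarrow>
     (real ^ 'n \<Rightarrow> real) \<Rightarrow> real \<Rightarrow> real \<Rightarrow> (real ^ 'n \<Rightarrow> real) \<Rightarrow> real" where
  "energy p q \<Omega> m a f lam \<eta> u =
     1 / p * ((LINT x|lebesgue_on \<Omega>. norm (weak_grad \<Omega> u x) powr p)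
              - lam * (LINT x|lebesgue_on \<Omega>. m x * \<bar>u x\<bar> powr p))
     - \<eta> / q * (LINT x|lebesgue_on \<Omega>. a x * \<bar>u x\<bar> powr q)
     - (LINT x|lebesgue_on \<Omega>. f x * u x)"

text \<open>The Frechet derivative at \<open>u\<close> of \<open>J\<close>, as a functional on the space \<open>W1p0 p \<Omega>\<close> normed by
  \<open>W1p_norm p \<Omega>\<close>, exists and is zero. The space is not a type, hence the explicit
  \<open>\<epsilon>\<close>-\<open>\<delta>\<close> form.\<close>

definition critical_point ::
    "real \<Rightarrow> (real ^ 'n) set \<Rightarrow> ((real ^ 'n \<Rightarrow> real) \<Rightarrow> real) \<Rightarrow> (real ^ 'n \<Rightarrow> real) \<Rightarrow> bool" where
  "critical_point p \<Omega> J u \<longleftrightarrow> u \<in> W1p0 p \<Omega> \<and>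
     (\<forall>\<epsilon>>0. \<exists>\<delta>>0. \<forall>v\<in>W1p0 p \<Omega>. W1p_norm p \<Omega> v < \<delta> \<longrightarrow>
        \<bar>J (\<lambda>x. u x + v x) - J u\<bar> \<le> \<epsilon> * W1p_norm p \<Omega> v)"

end

theory Submission
 imports Defs "HOL-Library.Z2"
begin

text \<open>
Write \<open>E(u) = E\<^sub>0(u) - l(u)\<close> with \<open>l(u) = \<integral> f u\<close>; then \<open>E\<^sub>0\<close> is even and \<open>l\<close> is linear. What the three alternatives
on \<open>\<lambda>\<close> have in common is that \<open>\<eta> \<integral> a |v|^q \<noteq> 0\<close> for every eigenfunction \<open>v\<close>. This excludes critical points at
infinity: if \<open>E\<^sub>0'\<close> stayed bounded along \<open>u\<^sub>j\<close> with \<open>c\<^sub>j = ||\<nabla> u\<^sub>j|| \<rightarrow> \<infinity>\<close> and \<open>E\<^sub>0(u\<^sub>j) = O(c\<^sub>j)\<close>, then \<open>u\<^sub>j / c\<^sub>j\<close>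
would converge strongly to an eigenfunction \<open>v\<close>, while \<open>E\<^sub>0(u) - E\<^sub>0'(u) u / p\<close> is a multiple of \<open>\<eta> \<integral> a |u|^q\<close>, so
that \<open>\<eta> \<integral> a |u\<^sub>j|^q = O(c\<^sub>j)\<close> and, as \<open>q > 1\<close>, \<open>\<eta> \<integral> a |v|^q = 0\<close> (\<open>no_critical_points_at_infinity\<close>).

The critical point comes from a linking argument for \<open>E\<close> near \<open>-\<infinity>\<close>, carried out in the spans \<open>V n\<close> of finitely
many test functions from a sequence dense in the gradient norm. Call a continuous odd map of the unit sphere of
\<open>\<real>\<^sup>k\<close> into some \<open>V n\<close> low if \<open>E\<^sub>0(u) - C (1 + ||\<nabla> u||^p)^(1/p) < -M\<close> on its image, where \<open>|l(u)| \<le> C ||\<nabla> u||\<close>. For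
\<open>k = 0\<close> such maps exist trivially for all \<open>M\<close>. For large \<open>k\<close> they do not: where finitely many linear functionals
vanish, \<open>\<integral> m |u|^p\<close> is a small part of \<open>\<integral> |\<nabla> u|^p\<close>, so that functional is bounded below there (\<open>finite_index\<close>), and by the
Borsuk-Ulam theorem the image of an odd map of a sphere of large dimension meets that set. So there is a first
jump, from a \<open>k\<close> with spheres below every level to \<open>k + 1\<close> without. Take a sphere for \<open>k\<close> on which \<open>E\<close> is very low
(\<open>odd_sphere_below\<close>), fill it in by a cone, and suppose that \<open>E'\<close> is nowhere small at the levels that the cone meets. A deformation along
a pseudo-gradient field then pushes the cone far down without moving its boundary, and this ball and its antipodal
image are the two hemispheres of a low odd map for \<open>k + 1\<close>, a contradiction (\<open>almost_critical_points\<close>). Although \<open>E\<close>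
itself is not even, only its even part enters the definition of low.

It remains to pass to the limit. By the first paragraph almost critical points in \<open>V n\<close> stay bounded, and
\<open>Galerkin_compactness\<close> gives a weak solution: lower order terms converge by a Rellich theorem for
weighted norms, and gradients converge strongly by uniform convexity of the p-th power
(\<open>monotone_type_strong_convergence\<close>). A weak solution is a critical point since the
energy is Frechet differentiable.

The coefficients \<open>m\<close>, \<open>a\<close>, \<open>f\<close> are treated together: they have densities bounded by 1 with respect to
\<open>\<mu> = wt dx\<close> for one weight \<open>wt \<ge> 1\<close> in \<open>L\<^sup>\<gamma>\<close>. So all terms except the gradient live in
\<open>L\<^sup>p(\<mu>)\<close> and \<open>L\<^sup>q(\<mu>)\<close> for a finite measure. The condition on \<open>\<gamma>\<close> enters through \<open>weighted_mean_oscillation\<close>,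
which leads to Poincare's inequality and Rellich compactness for \<open>L\<^sup>p(\<mu>)\<close>.
\<close>

section \<open>The Borsuk-Ulam theorem\<close>

declare add_bit_eq_xor [simp del] mult_bit_eq_and [simp del]

fun faces :: "'a list => 'a list list" where
 "faces [] = []"
| "faces (x # xs) = xs # map ((#) x) (faces xs)"

text \<open>A chain over the field \<open>bit\<close> is a list of simplices with repetitions allowed; a simplex is the list of its vertices. Two
chains are equal mod 2 iff all cochains \<open>g\<close> have the same sum over them, so identities of chains are stated as
identities of such sums.\<close>
abbreviation chain_sum :: "'a list list => ('a list => bit) => bit" where
 "chain_sum c g \<equiv> sum_list (map g c)"

abbreviation boundary_sum :: "'a list list => ('a list => bit) => bit" where
 "boundary_sum c g \<equiv> chain_sum c (%t. chain_sum (faces t) g)"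

lemma length_faces: "s \<in> set (faces t) ==> Suc (length s) = length t"
 by (induction t arbitrary: s) auto

lemma set_faces: "s \<in> set (faces t) ==> set s \<subseteq> set t"
 by (induction t arbitrary: s) fastforce+

lemma bit_double [simp]: "(x::bit) + x = 0"
 by (cases x) (auto simp: one_add_one)

lemma bit_double' [simp]: "(x::bit) + (x + y) = y"
 by (simp add: add.assoc [symmetric])

lemma chain_sum_concat: "chain_sum (concat (map F c)) g = sum_list (map (%t. chain_sum (F t) g) c)"
 by (induction c) auto

text \<open>The square of the boundary operator vanishes: each face of codimension two arises in two ways.\<close>
lemma faces_faces: "boundary_sum (faces t) g = 0"
proof (induction t arbitrary: g)
 case (Cons x xs)
 have "boundary_sum (faces (x # xs)) g
   = chain_sum (faces xs) g + (chain_sum (faces xs) g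
    + boundary_sum (faces xs) (g \<circ> (#) x))"
  by (simp add: sum_list_addf o_def)
 then show ?case using Cons[of "g \<circ> (#) x"] by simp
qed simp

definition barycentre :: "'a::real_vector list => 'a" where
 "barycentre t = (1 / real (length t)) *\<^sub>R sum_list t"

text \<open>Barycentric subdivision: the cone from the barycentre over the subdivided boundary.\<close>
function subdivide :: "'a::real_vector list => 'a list list" where
 "subdivide [] = [[]]"
| "subdivide (x # xs) = map ((#) (barycentre (x # xs))) (concat (map subdivide (faces (x # xs))))"
 by pat_completeness auto
termination
 by (relation "Wellfounded.measure length") (use length_faces in force)+

lemma subdivide_Cons:
 "t ~= [] ==> subdivide t = map ((#) (barycentre t)) (concat (map subdivide (faces t)))"
 by (cases t) auto

declare subdivide.simps(2) [simp del]

abbreviation subdivided_sum :: "'a::real_vector list list => ('a list => bit) => bit" where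
 "subdivided_sum c g \<equiv> chain_sum c (%t. chain_sum (subdivide t) g)"

lemma length_subdivide: "s \<in> set (subdivide t) ==> length s = length t"
proof (induction t arbitrary: s rule: subdivide.induct)
 case (2 x xs)
 then obtain f r where "f \<in> set (faces (x # xs))" "r \<in> set (subdivide f)"
   "s = barycentre (x # xs) # r"
  by (auto simp: subdivide_Cons[of "x # xs"])
 then show ?case using 2(1)[of f r] length_faces[of f "x # xs"] by simp
qed simp

text \<open>Subdivision is a chain map. The boundary of a cone is its base plus the cone over the boundary of
the base; here the base is the subdivided boundary, whose boundary vanishes by induction.\<close>
lemma subdivide_boundary:
 assumes "t ~= []"
 shows "boundary_sum (subdivide t) g
   = subdivided_sum (faces t) g"
 using assms
proof (induction t arbitrary: g rule: subdivide.induct)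
 case (2 x xs)
 let ?t = "x # xs" and ?b = "barycentre (x # xs)"
 let ?c = "concat (map subdivide (faces ?t))"
 have "boundary_sum (subdivide ?t) g
   = chain_sum ?c g + boundary_sum ?c (g \<circ> (#) ?b)"
  by (simp add: subdivide_Cons[of "x # xs"] sum_list_addf o_def)
 also have "boundary_sum ?c (g \<circ> (#) ?b) = 0"
 proof (cases "xs = []")
  case False
  have "boundary_sum ?c (g \<circ> (#) ?b)
   = chain_sum (faces ?t) (%f. boundary_sum (subdivide f) (g \<circ> (#) ?b))"
   by (rule chain_sum_concat)
  also have "... = chain_sum (faces ?t) (%f. subdivided_sum (faces f) (g \<circ> (#) ?b))"
  proof (rule arg_cong[where f = sum_list], rule map_cong[OF refl])
   fix f assume f: "f \<in> set (faces ?t)"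
   then have "f ~= []" using length_faces[OF f] False by auto
   with f show "boundary_sum (subdivide f) (g \<circ> (#) ?b)
    = subdivided_sum (faces f) (g \<circ> (#) ?b)"
    by (rule 2)
  qed
  also have "... = 0" by (rule faces_faces)
  finally show ?thesis .
 qed simp
 finally show ?case by (simp only: chain_sum_concat add_0_right)
qed simp

lemma barycentre_uminus: "barycentre (map uminus t) = - barycentre t"
proof -
 have "sum_list (map uminus t) = - sum_list t" by (induction t) auto
 then show ?thesis by (simp add: barycentre_def)
qed

lemma faces_map: "faces (map f t) = map (map f) (faces t)"
 by (induction t) auto

lemma subdivide_uminus: "subdivide (map uminus t) = map (map uminus) (subdivide t)"
proof (induction t rule: subdivide.induct)
 case (2 x xs)
 have "map subdivide (faces (map uminus (x # xs)))
   = map (map (map uminus)) (map subdivide (faces (x # xs)))"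
  unfolding faces_map map_map by (rule map_cong[OF refl]) (use 2 in simp)
 moreover have "barycentre (map uminus (x # xs)) = - barycentre (x # xs)"
  by (rule barycentre_uminus)
 moreover have "map uminus (x # xs) ~= []" "x # xs ~= []" by auto
 ultimately have "subdivide (map uminus (x # xs)) = map ((#) (- barycentre (x # xs)))
   (concat (map (map (map uminus)) (map subdivide (faces (x # xs)))))"
  using subdivide_Cons[of "map uminus (x # xs)"] by simp
 also have "... = map (map uminus) (subdivide (x # xs))"
  unfolding subdivide_Cons[OF list.distinct(2)] map_concat map_map o_def list.map(2) ..
 finally show ?case .
qed simp

text \<open>The cellular structure of the sphere with its antipodal map, reduced to what a parity argument needs: \<open>c i\<close> is a closed
hemisphere of dimension \<open>i\<close>, and its boundary, a sphere of dimension \<open>i - 1\<close>, is the sum of \<open>c (i - 1)\<close> and its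
antipodal image.\<close>
definition hemisphere_chains :: "(nat => 'a::real_vector list list) => bool" where
 "hemisphere_chains c \<longleftrightarrow> (\<exists>a. c 0 = [[a]]) & (\<forall>i. \<forall>t\<in>set (c i). length t = Suc i) \<and>
  (\<forall>i g. boundary_sum (c (Suc i)) g
     = chain_sum (c i) g + chain_sum (c i) (g \<circ> map uminus))"

primrec cross_polytope_chain :: "(nat => 'a::real_vector) => nat => 'a list list" where
 "cross_polytope_chain a 0 = [[a 0]]"
| "cross_polytope_chain a (Suc i) = map ((#) (a (Suc i)))
  (cross_polytope_chain a i @ map (map uminus) (cross_polytope_chain a i))"

lemma chain_sum_add: "sum_list (map (%t. f t + g t) c) = chain_sum c f + chain_sum c g"
 by (rule sum_list_addf)

lemma hemisphere_cross_polytope: "hemisphere_chains (cross_polytope_chain a)"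
proof -
 let ?c = "cross_polytope_chain a"
 have len: "t \<in> set (?c i) ==> length t = Suc i" for i t
  by (induction i arbitrary: t) auto
 have bd: "boundary_sum (?c (Suc i)) g
     = chain_sum (?c i) g + chain_sum (?c i) (g \<circ> map uminus)" for i g
 proof (induction i arbitrary: g)
  case 0
  show ?case by (simp add: add.commute add.left_commute)
 next
  case (Suc i)
  let ?b = "a (Suc (Suc i))" and ?e = "?c (Suc i)"
  let ?D = "%g. boundary_sum ?e g"
  have "boundary_sum (?c (Suc (Suc i))) g
   = chain_sum ?e g + chain_sum ?e (g \<circ> map uminus)
    + (?D (g \<circ> (#) ?b) + ?D (g \<circ> (#) ?b \<circ> map uminus))"
   unfolding cross_polytope_chain.simps(2)[of a "Suc i"]
   by (simp only: map_append map_map sum_list_append)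
    (simp add: chain_sum_add faces_map o_def algebra_simps del: cross_polytope_chain.simps)
  also have "?D (g \<circ> (#) ?b) + ?D (g \<circ> (#) ?b \<circ> map uminus) = 0"
   unfolding Suc by (simp add: o_def algebra_simps)
  finally show ?case by simp
 qed
 show ?thesis unfolding hemisphere_chains_def using len bd by auto
qed

definition subdivide_chain :: "'a::real_vector list list => 'a list list" where
 "subdivide_chain c = concat (map subdivide c)"

lemma hemisphere_subdivide:
 assumes "hemisphere_chains c"
 shows "hemisphere_chains (%i. subdivide_chain (c i))"
proof -
 obtain a where a: "c 0 = [[a]]" using assms by (auto simp: hemisphere_chains_def)
 have len: "t \<in> set (c i) ==> length t = Suc i" for i t
  using assms by (auto simp: hemisphere_chains_def)
 have 0: "subdivide_chain (c 0) = [[a]]"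
  by (simp add: a subdivide_chain_def subdivide_Cons[of "[a]"] barycentre_def)
 have "boundary_sum (subdivide_chain (c (Suc i))) g
   = chain_sum (subdivide_chain (c i)) g + chain_sum (subdivide_chain (c i)) (g \<circ> map uminus)" for i g
 proof -
  have "boundary_sum (subdivide_chain (c (Suc i))) g
   = sum_list (map (%t. boundary_sum (subdivide t) g) (c (Suc i)))"
   unfolding subdivide_chain_def by (rule chain_sum_concat)
  also have "... = sum_list (map (%t. subdivided_sum (faces t) g) (c (Suc i)))"
  proof (rule arg_cong[where f = sum_list], rule map_cong[OF refl], rule subdivide_boundary)
   show "t ~= []" if "t \<in> set (c (Suc i))" for t using len[OF that] by auto
  qed
  also have "... = chain_sum (c i) (%s. chain_sum (subdivide s) g)
    + chain_sum (c i) ((%s. chain_sum (subdivide s) g) \<circ> map uminus)"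
   using assms unfolding hemisphere_chains_def by blast
  also have "... = chain_sum (subdivide_chain (c i)) g + chain_sum (subdivide_chain (c i)) (g \<circ> map uminus)"
   unfolding subdivide_chain_def chain_sum_concat by (simp add: o_def subdivide_uminus)
  finally show ?thesis .
 qed
 note bd = this
 have len': "length t = Suc i" if t: "t \<in> set (subdivide_chain (c i))" for t i
  using t len by (auto simp: subdivide_chain_def dest: length_subdivide)
 show ?thesis unfolding hemisphere_chains_def
  by (intro conjI allI ballI) (rule exI[of _ a], rule 0, erule len', rule bd)
qed

text \<open>For sign patterns \<open>\<sigma>\<^sub>1, ..., \<sigma>\<^sub>k\<close> this is the cup product of the coboundaries of the \<open>\<sigma>\<^sub>i\<close>: it is 1 on a
simplex iff the i-th sign changes along the i-th edge for every \<open>i\<close>.\<close>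
fun sign_change_cochain :: "('a => bit) list => 'a list => bit" where
 "sign_change_cochain (\<sigma> # \<sigma>s) (x # y # xs) = (\<sigma> x + \<sigma> y) * sign_change_cochain \<sigma>s (y # xs)"
| "sign_change_cochain (\<sigma> # \<sigma>s) _ = 0"
| "sign_change_cochain [] _ = 1"

text \<open>The cup product of coboundaries is a cocycle, and it is the coboundary of the product in which the first factor is
replaced by \<open>\<sigma>\<close> itself. Both statements are needed together for the induction.\<close>
lemma sign_change_cochain_coboundary:
 assumes "length t = Suc (Suc (length \<sigma>s))"
 shows "chain_sum (faces t) (%s. \<sigma> (hd s) * sign_change_cochain \<sigma>s s) = sign_change_cochain (\<sigma> # \<sigma>s) t
  & chain_sum (faces t) (sign_change_cochain \<sigma>s) = 0"
 using assms
proof (induction \<sigma>s arbitrary: t \<sigma>)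
 case Nil
 then obtain x y where "t = [x, y]" by (auto simp: length_Suc_conv)
 then show ?case by (simp add: add.commute)
next
 case (Cons \<tau> \<tau>s)
 from Cons.prems obtain x y xs where t: "t = x # y # xs" and xs: "length xs = Suc (length \<tau>s)"
  by (auto simp: length_Suc_conv)
 let ?P = "sign_change_cochain (\<tau> # \<tau>s)"
 let ?Q = "%s. \<tau> (hd s) * sign_change_cochain \<tau>s s"
 have P: "?P s = chain_sum (faces s) ?Q" if "length s = Suc (Suc (length \<tau>s))" for s
  using Cons.IH[OF that, of \<tau>] by simp
 have "chain_sum (faces t) ?P = boundary_sum (faces t) ?Q"
  by (rule arg_cong[where f = sum_list], rule map_cong[OF refl], rule P)
   (use length_faces Cons.prems in fastforce)
 then have cocycle: "chain_sum (faces t) ?P = 0" by (simp only: faces_faces)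
 then have "?P (y # xs) + chain_sum (faces (y # xs)) (%s. ?P (x # s)) = 0"
  by (simp add: t o_def)
 then have c2: "chain_sum (faces (y # xs)) (%s. ?P (x # s)) = ?P (y # xs)"
  by (metis add.right_neutral bit_double')
 have "chain_sum (faces t) (%s. \<sigma> (hd s) * ?P s)
   = \<sigma> y * ?P (y # xs) + chain_sum (faces (y # xs)) (%s. \<sigma> x * ?P (x # s))"
  unfolding t by (simp add: o_def)
 also have "chain_sum (faces (y # xs)) (%s. \<sigma> x * ?P (x # s)) = \<sigma> x * ?P (y # xs)"
  by (simp only: c2 sum_list_const_mult)
 finally show ?case using cocycle unfolding t by (simp add: algebra_simps)
qed

lemma sign_change_cochain_uminus:
 assumes "!!\<sigma> x. \<sigma> \<in> set \<sigma>s ==> x \<in> set t ==> \<sigma> (- x) = \<sigma> x + 1"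
 shows "sign_change_cochain \<sigma>s (map uminus t) = sign_change_cochain \<sigma>s t"
  using assms
proof (induction \<sigma>s t rule: sign_change_cochain.induct)
 case (1 \<sigma> \<sigma>s x y xs)
 have "\<sigma> (- x) + \<sigma> (- y) = \<sigma> x + \<sigma> y"
  using 1(2)[of \<sigma> x] 1(2)[of \<sigma> y] by (simp add: algebra_simps)
 then show ?case using 1 by simp
qed simp_all

text \<open>The combinatorial form of the Borsuk-Ulam theorem. By Stokes the sum over a hemisphere moves to its boundary, that is,
to a smaller hemisphere and its antipode; since \<open>\<sigma>\<close> is odd, the two values of \<open>\<sigma>\<close> at antipodal points add up to 1, and
one factor disappears. In dimension 0 there remains a single point.\<close>
lemma sign_change_cochain_hemisphere:
 fixes c :: "nat => 'a::real_vector list list"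
 assumes c: "hemisphere_chains c"
  and "!!\<sigma> i t x. \<sigma> \<in> set \<sigma>s ==> i <= length \<sigma>s ==> t \<in> set (c i) ==> x \<in> set t ==> \<sigma> (- x) = \<sigma> x + 1"
 shows "chain_sum (c (length \<sigma>s)) (sign_change_cochain \<sigma>s) = 1"
 using assms(2)
proof (induction \<sigma>s)
 case Nil
 then show ?case using c by (auto simp: hemisphere_chains_def)
next
 case (Cons \<sigma> \<sigma>s)
 let ?n = "length \<sigma>s" and ?Q = "%s. \<sigma> (hd s) * sign_change_cochain \<sigma>s s"
 have len: "t \<in> set (c i) ==> length t = Suc i" for i t
  using c by (auto simp: hemisphere_chains_def)
 have "chain_sum (c (Suc ?n)) (sign_change_cochain (\<sigma> # \<sigma>s))
   = boundary_sum (c (Suc ?n)) ?Q"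
  by (rule arg_cong[where f = sum_list], rule map_cong[OF refl])
   (use sign_change_cochain_coboundary len in metis)
 also have "... = chain_sum (c ?n) ?Q + chain_sum (c ?n) (?Q \<circ> map uminus)"
  using c unfolding hemisphere_chains_def by blast
 also have "... = chain_sum (c ?n) (%t. ?Q t + ?Q (map uminus t))"
  by (simp only: chain_sum_add o_def)
 also have "... = chain_sum (c ?n) (sign_change_cochain \<sigma>s)"
 proof (rule arg_cong[where f = sum_list], rule map_cong[OF refl])
  fix t assume t: "t \<in> set (c ?n)"
  have "t ~= []" using len[OF t] by auto
  then obtain x xs where tx: "t = x # xs" by (meson neq_Nil_conv)
  have "sign_change_cochain \<sigma>s (map uminus t) = sign_change_cochain \<sigma>s t"
   by (rule sign_change_cochain_uminus) (use Cons.prems[of _ ?n t] t in auto)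
  moreover have "\<sigma> (- x) = \<sigma> x + 1" using Cons.prems[of \<sigma> ?n t x] t tx by simp
  ultimately show "?Q t + ?Q (map uminus t) = sign_change_cochain \<sigma>s t"
   by (simp add: tx algebra_simps)
 qed
 also have "... = 1" by (rule Cons.IH, rule Cons.prems) auto
 finally show ?case by simp
qed

lemma sign_change_cochain_nonzero:
 assumes "sign_change_cochain \<sigma>s t ~= 0" "j < length \<sigma>s"
 shows "Suc j < length t & (\<sigma>s ! j) (t ! j) ~= (\<sigma>s ! j) (t ! Suc j)"
 using assms
proof (induction \<sigma>s t arbitrary: j rule: sign_change_cochain.induct)
 case (1 \<sigma> \<sigma>s x y xs)
 then have "sign_change_cochain \<sigma>s (y # xs) ~= 0" "\<sigma> x + \<sigma> y ~= 0" by auto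
 note nz = this
 have "\<sigma> x ~= \<sigma> y" using nz(2) by (metis bit_double)
 show ?case
 proof (cases j)
  case 0
  then show ?thesis using \<open>\<sigma> x ~= \<sigma> y\<close> by simp
 next
  case (Suc i)
  then have "i < length \<sigma>s" using 1(3) by simp
  from 1(1)[OF nz(1) this] show ?thesis using Suc by simp
 qed
qed simp_all

subsection \<open>Mesh\<close>

lemma barycentre_in_hull: "t ~= [] ==> barycentre t \<in> convex hull (set t)"
proof -
 assume t: "t ~= []"
 have "barycentre t = (\<Sum>i<length t. (1 / real (length t)) *\<^sub>R t ! i)"
  unfolding barycentre_def sum_list_sum_nth by (simp add: atLeast0LessThan scaleR_sum_right)
 also have "... \<in> convex hull (set t)"
  by (rule convex_sum) (use t in \<open>auto intro: hull_inc\<close>)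
 finally show ?thesis .
qed

lemma subdivide_in_hull: "s \<in> set (subdivide t) ==> set s \<subseteq> convex hull (set t)"
proof (induction t arbitrary: s rule: subdivide.induct)
 case (2 x xs)
 then obtain f r where f: "f \<in> set (faces (x # xs))" "r \<in> set (subdivide f)"
   "s = barycentre (x # xs) # r"
  by (auto simp: subdivide_Cons[of "x # xs"])
 have "set r \<subseteq> convex hull (set f)" using 2(1)[OF f(1,2)] .
 also have "... \<subseteq> convex hull (set (x # xs))" using set_faces[OF f(1)] by (rule hull_mono)
 finally show ?case using f barycentre_in_hull[of "x # xs"] by auto
qed simp

text \<open>The vertex \<open>v\<close> itself is one of the at most \<open>m + 1\<close> points averaged.\<close>
lemma barycentre_dist:
 fixes t :: "'a::real_normed_vector list"
 assumes D: "!!x y. x \<in> set t ==> y \<in> set t ==> dist x y <= D" and v: "v \<in> set t"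
  and len: "length t <= Suc m"
 shows "dist (barycentre t) v <= real m / real (Suc m) * D"
proof -
 let ?n = "length t"
 obtain k where k: "k < ?n" "t ! k = v" using v by (metis in_set_conv_nth)
 have n: "?n > 0" using k by linarith
 have "D >= 0" using D[OF v v] by simp
 have "barycentre t - v = (1 / real ?n) *\<^sub>R (\<Sum>i<?n. t ! i - v)"
  unfolding barycentre_def sum_list_sum_nth sum_subtractf using n
  by (simp add: atLeast0LessThan scaleR_right_diff_distrib sum_constant_scaleR)
 also have "(\<Sum>i<?n. t ! i - v) = (\<Sum>i\<in>{..<?n} - {k}. t ! i - v)"
  using k by (intro sum.mono_neutral_right) auto
 finally have "dist (barycentre t) v = norm (\<Sum>i\<in>{..<?n} - {k}. t ! i - v) / real ?n"
  by (simp add: dist_norm)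
 also have "... <= (\<Sum>i\<in>{..<?n} - {k}. D) / real ?n"
  by (intro divide_right_mono sum_norm_le) (use D v in \<open>auto simp: dist_norm\<close>)
 also have "... = (real ?n - 1) / real ?n * D" using k n by (simp add: of_nat_diff)
 also have "... <= real m / real (Suc m) * D"
  using len n \<open>D >= 0\<close> by (intro mult_right_mono) (auto simp: field_simps)
 finally show ?thesis .
qed

lemma subdivide_mesh:
 fixes t :: "'a::real_normed_vector list"
 assumes "!!x y. x \<in> set t ==> y \<in> set t ==> dist x y <= D" "length t <= Suc m"
  "s \<in> set (subdivide t)" "x \<in> set s" "y \<in> set s"
 shows "dist x y <= real m / real (Suc m) * D"
 using assms
proof (induction t arbitrary: s x y rule: subdivide.induct)
 case (2 z zs)
 let ?t = "z # zs" and ?b = "barycentre (z # zs)" and ?d = "real m / real (Suc m) * D"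
 obtain f r where f: "f \<in> set (faces ?t)" "r \<in> set (subdivide f)" "s = ?b # r"
  using 2(4) by (auto simp: subdivide_Cons[of "z # zs"])
 have D: "!!x y. x \<in> set f ==> y \<in> set f ==> dist x y <= D"
  by (meson 2(2) set_faces[OF f(1)] subsetD)
 have IH: "dist x y <= ?d" if "x \<in> set r" "y \<in> set r" for x y
  by (rule 2(1)[OF f(1) D _ f(2) that]) (use 2(3) length_faces[OF f(1)] in auto)
 have "set ?t \<subseteq> cball ?b ?d" unfolding subset_iff mem_cball
  using barycentre_dist[OF 2(2) _ 2(3)] by blast
 then have "convex hull (set ?t) \<subseteq> cball ?b ?d" by (rule hull_minimal) (rule convex_cball)
 moreover have "set s \<subseteq> convex hull (set ?t)" using 2(4) by (rule subdivide_in_hull)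
 ultimately have "!!x. x \<in> set s ==> dist ?b x <= ?d" by (auto simp: subset_iff)
 then show ?case using IH 2(5,6) f(3) by (auto simp: dist_commute)
qed simp

subsection \<open>The theorem\<close>

text \<open>Spheres of all dimensions have to live in one type, since their dimension is found by a minimality argument. Bounded
sequences supported in the first \<open>k\<close> places serve as \<open>\<real>\<^sup>k\<close>.\<close>
definition coord_space :: "nat => (nat \<Rightarrow>\<^sub>C real) set" where
 "coord_space k = {x. \<forall>i\<ge>k. apply_bcontfun x i = 0}"

definition coord_vec :: "nat => (nat \<Rightarrow>\<^sub>C real)" where
 "coord_vec i = Bcontfun (%j. if j = i then 1 else 0)"

lemma coord_vec_apply [simp]: "apply_bcontfun (coord_vec i) j = (if j = i then 1 else 0)"
 unfolding coord_vec_def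
 by (subst Bcontfun_inverse) (auto simp: bcontfun_def continuous_on_discrete bounded_iff intro!: exI[of _ 1])

lemma bounded_linear_apply_bcontfun: "bounded_linear (%x. apply_bcontfun x i)"
 by (rule bounded_linear_intro[where K = 1]) (auto simp: norm_bounded)

lemmas continuous_on_apply_bcontfun' [continuous_intros] =
 bounded_linear.continuous_on[OF bounded_linear_apply_bcontfun]

lemmas tendsto_apply_bcontfun [tendsto_intros] =
 bounded_linear.tendsto[OF bounded_linear_apply_bcontfun]

lemma apply_bcontfun_sum [simp]: "apply_bcontfun (\<Sum>i\<in>A. f i) x = (\<Sum>i\<in>A. apply_bcontfun (f i) x)"
 by (rule linear_sum[OF bounded_linear.linear[OF bounded_linear_apply_bcontfun]])

lemma subspace_coord_space: "subspace (coord_space k)"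
 by (auto simp: subspace_def coord_space_def)

lemma coord_space_expand: "x \<in> coord_space k ==> x = (\<Sum>i<k. x i *\<^sub>R coord_vec i)"
 by (rule bcontfun_eqI) (auto simp: coord_space_def if_distrib[of "%c. _ * c"] cong: if_cong)

lemma compact_box_fun: "compact {c :: 'a => real. \<forall>i. \<bar>c i\<bar> <= R i}"
proof -
 have "compactin (product_topology (%i. euclidean) UNIV) (PiE UNIV (%i. {- R i..R i}))"
  unfolding compactin_PiE by auto
 moreover have "PiE UNIV (%i. {- R i..R i}) = {c. \<forall>i. \<bar>c i\<bar> <= R i}" by (auto simp: PiE_def abs_le_iff Pi_def) (metis minus_le_iff)+
 ultimately show ?thesis by (simp add: euclidean_product_topology)
qed

lemma compact_coord_space_ball: "compact {x \<in> coord_space k. norm x <= R}"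
proof -
 let ?K = "{c :: nat => real. \<forall>i. \<bar>c i\<bar> <= R}" and ?F = "%c :: nat => real. \<Sum>i<k. c i *\<^sub>R coord_vec i"
 have comp: "compact (?F ` ?K)"
  by (rule compact_continuous_image[OF _ compact_box_fun])
   (intro continuous_intros continuous_on_product_then_coordinatewise[OF continuous_on_id])
 have cl: "closed {x \<in> coord_space k. norm x <= R}"
 proof -
  have "{x \<in> coord_space k. norm x <= R} = (\<Inter>i\<in>{k..}. {x. apply_bcontfun x i = 0}) \<inter> {x. norm x <= R}"
   by (auto simp: coord_space_def)
  then show ?thesis
   by (auto intro!: closed_Int closed_INT closed_Collect_eq closed_Collect_le continuous_intros)
 qed
 have "{x \<in> coord_space k. norm x <= R} \<subseteq> ?F ` ?K"
 proof
  fix x :: "nat \<Rightarrow>\<^sub>C real" assume x: "x \<in> {x \<in> coord_space k. norm x <= R}"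
  then have "apply_bcontfun x \<in> ?K" using norm_bounded[of x] by (auto intro: order_trans)
  then show "x \<in> ?F ` ?K" using x coord_space_expand[of x k] by blast
 qed
 note sub = this
 show ?thesis using closed_Int_compact[OF cl comp] unfolding inf.absorb1[OF sub] .
qed

text \<open>A facet of the cross-polytope \<open>{x. \<Sum>j\<le>d. \<bar>x j\<bar> = 1}\<close>, that is, its part in one orthant. Convexity of facets keeps all
subdivided simplices on the cross-polytope, away from 0.\<close>
definition cross_face :: "nat => (nat => real) => (nat \<Rightarrow>\<^sub>C real) set" where
 "cross_face d s = {x \<in> coord_space (Suc d). (\<forall>j. 0 <= s j * apply_bcontfun x j) & (\<Sum>j\<le>d. s j * apply_bcontfun x j) = 1}"

lemma convex_cross_face: "convex (cross_face d s)"
proof (rule convexI)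
 fix x y :: "nat \<Rightarrow>\<^sub>C real" and u v :: real
 assume xy: "x \<in> cross_face d s" "y \<in> cross_face d s" and uv: "0 <= u" "0 <= v" "u + v = 1"
 have e: "s j * (u *\<^sub>R x + v *\<^sub>R y) j = u * (s j * x j) + v * (s j * y j)" for j
  by (simp add: algebra_simps)
 show "u *\<^sub>R x + v *\<^sub>R y \<in> cross_face d s"
  using xy uv unfolding cross_face_def mem_Collect_eq e sum.distrib sum_distrib_left[symmetric]
  by (auto simp: coord_space_def)
qed

lemma cross_face_norm:
 assumes "x \<in> cross_face d s" "!!j. \<bar>s j\<bar> = 1"
 shows "norm x <= 1" "(\<Sum>j\<le>d. \<bar>x j\<bar>) = 1"
proof -
 have a: "\<bar>x j\<bar> = s j * x j" for j
  using assms unfolding cross_face_def by (metis (no_types, lifting) abs_mult abs_of_nonneg mem_Collect_eq mult_1)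
 then show s: "(\<Sum>j\<le>d. \<bar>x j\<bar>) = 1" using assms by (simp add: cross_face_def)
 show "norm x <= 1"
 proof (rule norm_bound)
  fix j show "norm (x j) <= 1"
  proof (cases "j <= d")
   case True
   then have "\<bar>x j\<bar> <= (\<Sum>j\<le>d. \<bar>x j\<bar>)" by (intro member_le_sum) auto
   then show ?thesis using s by simp
  next
   case False then show ?thesis using assms by (simp add: cross_face_def coord_space_def)
  qed
 qed
qed

lemma cross_polytope_chain_vertices:
 assumes "t \<in> set (cross_polytope_chain a i)"
 shows "\<exists>s :: nat => real. (\<forall>j. \<bar>s j\<bar> = 1) & (\<forall>x\<in>set t. \<exists>j\<le>i. x = s j *\<^sub>R a j)"
 using assms
proof (induction i arbitrary: t)
 case 0
 then show ?case by (intro exI[of _ "%_. 1"]) auto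
next
 case (Suc i)
 then obtain r where r: "t = a (Suc i) # r"
   "r \<in> set (cross_polytope_chain a i) \<or> r \<in> map uminus ` set (cross_polytope_chain a i)"
  by auto
 have "\<exists>s :: nat => real. (\<forall>j. \<bar>s j\<bar> = 1) & (\<forall>x\<in>set r. \<exists>j\<le>i. x = s j *\<^sub>R a j)"
  using r(2)
 proof
  assume "r \<in> map uminus ` set (cross_polytope_chain a i)"
  then obtain r' where r': "r' \<in> set (cross_polytope_chain a i)" "r = map uminus r'" by auto
  from Suc.IH[OF r'(1)] obtain s :: "nat => real" where
   s: "\<forall>j. \<bar>s j\<bar> = 1" "\<forall>x\<in>set r'. \<exists>j\<le>i. x = s j *\<^sub>R a j" by auto
  show ?thesis by (rule exI[of _ "%j. - s j"]) (use s r'(2) in auto)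
 qed (rule Suc.IH)
 then obtain s :: "nat => real" where
  s: "\<forall>j. \<bar>s j\<bar> = 1" "\<forall>x\<in>set r. \<exists>j\<le>i. x = s j *\<^sub>R a j" by auto
 show ?case
 proof (rule exI[of _ "s(Suc i := 1)"], intro conjI allI ballI)
  show "\<bar>(s(Suc i := 1)) j\<bar> = 1" for j using s by simp
  fix x assume "x \<in> set t"
  then consider "x = a (Suc i)" | "x \<in> set r" using r(1) by auto
  then show "\<exists>j\<le>Suc i. x = (s(Suc i := 1)) j *\<^sub>R a j"
  proof cases
   case 1 then show ?thesis by (intro exI[of _ "Suc i"]) simp
  next
   case 2
   then obtain j where "j <= i" "x = s j *\<^sub>R a j" using s by auto
   then show ?thesis by (intro exI[of _ j]) auto
  qed
 qed
qed

definition fine_chain :: "nat => nat => (nat \<Rightarrow>\<^sub>C real) list list" where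
 "fine_chain N i = (subdivide_chain ^^ N) (cross_polytope_chain coord_vec i)"

lemma hemisphere_fine_chain: "hemisphere_chains (fine_chain N)"
proof (induction N)
 case 0
 then show ?case using hemisphere_cross_polytope[of coord_vec] by (simp add: fine_chain_def[abs_def])
next
 case (Suc N)
 from hemisphere_subdivide[OF this] show ?case by (simp add: fine_chain_def[abs_def])
qed

lemma fine_chain_mesh:
 assumes "t \<in> set (fine_chain N i)" "i <= d"
 shows "(\<exists>s. (\<forall>j. \<bar>s j\<bar> = 1) & set t \<subseteq> cross_face d s) \<and>
  (\<forall>x\<in>set t. \<forall>y\<in>set t. dist x y <= (real d / real (Suc d)) ^ N * 2)"
 using assms(1)
proof (induction N arbitrary: t)
 case 0
 then have "t \<in> set (cross_polytope_chain coord_vec i)" by (simp add: fine_chain_def)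
 from cross_polytope_chain_vertices[OF this] obtain s :: "nat => real" where
  s: "!!j. \<bar>s j\<bar> = 1" "!!x. x \<in> set t ==> \<exists>j\<le>i. x = s j *\<^sub>R coord_vec j" by auto
 have ss: "s j * s j = 1" for j using s(1)[of j] by (metis abs_mult_self_eq mult_1)
 have "x \<in> cross_face d s" if xt: "x \<in> set t" for x
 proof -
  obtain j where "j <= i" "x = s j *\<^sub>R coord_vec j" using s(2)[OF xt] by auto
  then show ?thesis using assms(2) ss
   by (auto simp: cross_face_def coord_space_def if_distrib[of "%c. _ * c"] cong: if_cong)
 qed
 then have sub: "set t \<subseteq> cross_face d s" by auto
 have "dist x y <= 2" if "x \<in> set t" "y \<in> set t" for x y
  using cross_face_norm(1)[OF subsetD[OF sub that(1)] s(1)] cross_face_norm(1)[OF subsetD[OF sub that(2)] s(1)]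
   norm_triangle_ineq4[of x y] by (simp add: dist_norm)
 then show ?case using sub s(1) by auto
next
 case (Suc N)
 then obtain t' where t': "t' \<in> set (fine_chain N i)" "t \<in> set (subdivide t')"
  by (auto simp: fine_chain_def subdivide_chain_def)
 from Suc.IH[OF t'(1)] obtain s where s: "\<forall>j. \<bar>s j\<bar> = 1" "set t' \<subseteq> cross_face d s"
  and D: "!!x y. x \<in> set t' ==> y \<in> set t' ==> dist x y <= (real d / real (Suc d)) ^ N * 2"
  by auto
 have "set t \<subseteq> convex hull (set t')" using t'(2) by (rule subdivide_in_hull)
 also have "... \<subseteq> cross_face d s" by (rule hull_minimal) (use s convex_cross_face in auto)
 finally have "set t \<subseteq> cross_face d s" .
 moreover have len: "length t' <= Suc d"
  using t'(1) hemisphere_fine_chain[of N] assms(2) by (auto simp: hemisphere_chains_def)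
 have "dist x y <= (real d / real (Suc d)) ^ Suc N * 2" if "x \<in> set t" "y \<in> set t" for x y
  using subdivide_mesh[OF D len t'(2) that] by simp
 ultimately show ?case using s(1) by auto
qed

text \<open>Label the vertices of finer and finer subdivisions of the cross-polytope with the signs of the \<open>f j\<close>. Each subdivision has
a simplex in which the sign of \<open>f j\<close> changes along the j-th edge; a limit point of these simplices is a common
zero. Where \<open>f j\<close> vanishes at a vertex, the label is the sign of the first nonzero coordinate, which keeps it odd.\<close>
theorem borsuk_ulam:
 fixes f :: "nat => (nat \<Rightarrow>\<^sub>C real) => real"
 assumes cont: "!!j. j < d ==> continuous_on (coord_space (Suc d) - {0}) (f j)"
  and odd: "!!j x. j < d ==> x \<in> coord_space (Suc d) ==> x ~= 0 ==> f j (- x) = - f j x"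
 shows "\<exists>x\<in>coord_space (Suc d). x ~= 0 & (\<forall>j<d. f j x = 0)"
proof -
 define pos where "pos x \<longleftrightarrow> apply_bcontfun x (LEAST i. x i ~= 0) > (0::real)" for x :: "nat \<Rightarrow>\<^sub>C real"
 have pos: "pos (- x) \<longleftrightarrow> ~ pos x" if "x ~= 0" for x
 proof -
  have "\<exists>i. x i ~= 0" using that bcontfun_eqI[of x 0] by auto
  then have "x (LEAST i. x i ~= 0) ~= 0" by (rule LeastI_ex)
  then show ?thesis by (auto simp: pos_def)
 qed
 define \<sigma> where "\<sigma> j x = (if f j x > 0 \<or> f j x = 0 & pos x then 1 else 0 :: bit)" for j x
 have \<sigma>: "\<sigma> j (- x) = \<sigma> j x + 1" if "j < d" "x \<in> coord_space (Suc d)" "x ~= 0" for j x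
  using odd[OF that] pos[OF that(3)] by (auto simp: \<sigma>_def)
 let ?S = "map \<sigma> [0..<d]"
 have face: "x \<in> coord_space (Suc d)" "norm x <= 1" "(\<Sum>j\<le>d. \<bar>x j\<bar>) = 1" "x ~= 0"
  if tx: "t \<in> set (fine_chain N i)" "i <= d" "x \<in> set t" for N i t x
 proof -
  obtain s where s: "\<forall>j. \<bar>s j\<bar> = 1" "x \<in> cross_face d s" using fine_chain_mesh[OF tx(1,2)] tx(3) by auto
  then show "x \<in> coord_space (Suc d)" "norm x <= 1" "(\<Sum>j\<le>d. \<bar>x j\<bar>) = 1"
   using cross_face_norm[OF s(2)] by (auto simp: cross_face_def)
  then show "x ~= 0" by auto
 qed
 have "\<exists>t\<in>set (fine_chain N d). sign_change_cochain ?S t ~= 0" for N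
 proof (rule ccontr)
  assume "~ ?thesis"
  then have "chain_sum (fine_chain N d) (sign_change_cochain ?S) = sum_list (map (%_. 0) (fine_chain N d))"
   by (intro arg_cong[where f = sum_list] map_cong) auto
  moreover have "chain_sum (fine_chain N (length ?S)) (sign_change_cochain ?S) = 1"
   by (rule sign_change_cochain_hemisphere[OF hemisphere_fine_chain]) (use \<sigma> face in auto)
  ultimately show False by simp
 qed
 then obtain t where t: "!!N. t N \<in> set (fine_chain N d)" "!!N. sign_change_cochain ?S (t N) ~= 0"
  by metis
 have len: "length (t N) = Suc d" for N
  using t(1) hemisphere_fine_chain[of N] by (auto simp: hemisphere_chains_def)
 then have in0: "t N ! j \<in> set (t N)" if "j <= d" for N j using that by simp
 have "\<forall>N. t N ! 0 \<in> {x \<in> coord_space (Suc d). norm x <= 1}"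
  using face[OF t(1) order_refl in0] by auto
 then have "\<exists>z\<in>{x \<in> coord_space (Suc d). norm x <= 1}. \<exists>r :: nat => nat. strict_mono r & ((%N. t N ! 0) \<circ> r) \<longlonglongrightarrow> z"
  using compact_coord_space_ball[of "Suc d" 1, unfolded compact_def, rule_format, of "%N. t N ! 0"] by simp
 then obtain z r where z: "z \<in> coord_space (Suc d)" and r: "strict_mono (r :: nat => nat)"
  and lim: "((%N. t N ! 0) \<circ> r) \<longlonglongrightarrow> z"
  by auto
 have mesh0: "(%N. (real d / real (Suc d)) ^ r N * 2) \<longlonglongrightarrow> 0"
  using LIMSEQ_subseq_LIMSEQ[OF LIMSEQ_realpow_zero r, of "real d / real (Suc d)"]
  by (auto simp: o_def intro!: tendsto_mult_left_zero)
 have lim_j: "(%N. t (r N) ! j) \<longlonglongrightarrow> z" if "j <= d" for j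
 proof -
  have "(%N. t (r N) ! j - t (r N) ! 0) \<longlonglongrightarrow> 0"
  proof (rule Lim_null_comparison[OF _ mesh0], rule always_eventually, rule allI)
   fix N
   show "norm (t (r N) ! j - t (r N) ! 0) <= (real d / real (Suc d)) ^ r N * 2"
    using fine_chain_mesh[OF t(1) order_refl] in0[OF that] in0[of 0] by (simp add: dist_norm)
  qed
  from tendsto_add[OF this lim[unfolded o_def]] show ?thesis by simp
 qed
 have "(%N. \<Sum>j\<le>d. \<bar>(t (r N) ! 0) j\<bar>) \<longlonglongrightarrow> (\<Sum>j\<le>d. \<bar>z j\<bar>)"
  by (intro tendsto_intros lim_j) simp
 moreover have "(\<Sum>j\<le>d. \<bar>(t (r N) ! 0) j\<bar>) = 1" for N
  by (rule face(3)[OF t(1) order_refl in0]) simp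
 ultimately have "(\<Sum>j\<le>d. \<bar>z j\<bar>) = 1" by (simp add: LIMSEQ_const_iff)
 then have "z ~= 0" by auto
 moreover have "f j z = 0" if j: "j < d" for j
 proof -
  have fl: "(%N. f j (t (r N) ! k)) \<longlonglongrightarrow> f j z" if "k <= d" for k
   by (rule continuous_on_tendsto_compose[OF cont[OF j] lim_j[OF that]])
    (use z \<open>z ~= 0\<close> face[OF t(1) order_refl in0[OF that]] in auto)
  have "(%N. f j (t (r N) ! j) * f j (t (r N) ! Suc j)) \<longlonglongrightarrow> f j z * f j z"
   by (intro tendsto_intros fl) (use j in auto)
  moreover have "f j (t N ! j) * f j (t N ! Suc j) <= 0" for N
  proof -
   have "\<sigma> j (t N ! j) ~= \<sigma> j (t N ! Suc j)"
    using sign_change_cochain_nonzero[OF t(2), of j N] j by simp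
   then show ?thesis unfolding \<sigma>_def by (auto split: if_splits simp: mult_le_0_iff)
  qed
  ultimately have "f j z * f j z <= 0" by (intro LIMSEQ_le_const2) auto
  then show ?thesis by (metis mult_eq_0_iff not_square_less_zero order_le_less)
 qed
 ultimately show ?thesis using z by auto
qed

section \<open>Deformations along approximate gradient fields\<close>

text \<open>A continuously differentiable functional on a finite-dimensional space with a norm \<open>r\<close> that may differ from the norm of
the ambient type. Compactness of balls takes the place of finite dimension.\<close>
locale C1_functional =
 fixes V :: "'a::real_normed_vector set" and r J :: "'a => real" and DJ :: "'a => 'a => real"
 assumes V: "subspace V"
  and r_triangle: "!!u v. u \<in> V ==> v \<in> V ==> r (u + v) <= r u + r v"
  and r_scale: "!!u c. u \<in> V ==> r (c *\<^sub>R u) = \<bar>c\<bar> * r u"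
  and r_cont: "continuous_on V r"
  and r_compact: "!!R. compact {u \<in> V. r u <= R}"
  and J_cont: "continuous_on V J"
  and DJ_cont: "continuous_on (V \<times> V) (%x. DJ (fst x) (snd x))"
  and DJ: "!!u v t. u \<in> V ==> v \<in> V ==>
   ((%t. J (u + t *\<^sub>R v)) has_real_derivative DJ (u + t *\<^sub>R v) v) (at t)"
  and DJ_add: "!!u v w. u \<in> V ==> v \<in> V ==> w \<in> V ==> DJ u (v + w) = DJ u v + DJ u w"
  and DJ_scale: "!!u v c. u \<in> V ==> v \<in> V ==> DJ u (c *\<^sub>R v) = c * DJ u v"
begin

lemma r_zero: "r 0 = 0"
 using r_scale[of 0 0] subspace_0[OF V] by simp

lemma r_minus: "u \<in> V ==> r (- u) = r u"
 using r_scale[of u "-1"] by simp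

lemma r_nonneg: "u \<in> V ==> 0 <= r u"
 using r_triangle[of u "- u"] subspace_neg[OF V, of u] by (simp add: r_minus r_zero)

lemma r_sum: "(!!i. i \<in> F ==> f i \<in> V) ==> r (\<Sum>i\<in>F. f i) <= (\<Sum>i\<in>F. r (f i))"
proof (induction F rule: infinite_finite_induct)
 case (insert i F)
 then have "r (f i + (\<Sum>i\<in>F. f i)) <= r (f i) + r (\<Sum>i\<in>F. f i)"
  by (intro r_triangle subspace_sum[OF V]) auto
 then show ?case using insert by fastforce
qed (auto simp: r_zero)

lemma DJ_zero: "u \<in> V ==> DJ u 0 = 0"
 using DJ_scale[of u 0 0] subspace_0[OF V] by simp

lemma DJ_sum: "u \<in> V ==> (!!i. i \<in> F ==> f i \<in> V) ==> DJ u (\<Sum>i\<in>F. f i) = (\<Sum>i\<in>F. DJ u (f i))"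
 by (induction F rule: infinite_finite_induct) (auto simp: DJ_zero DJ_add subspace_sum[OF V])

lemma DJ_even:
 assumes "!!u. u \<in> V ==> J (- u) = J u" "u \<in> V" "v \<in> V"
 shows "DJ (- u) v = - DJ u v"
proof -
 have "((%t. J (- u + t *\<^sub>R v)) has_real_derivative DJ (- u) v) (at 0)"
  using DJ[of "- u" v 0] assms(2,3) subspace_neg[OF V] by simp
 moreover have "((%t. J (u + t *\<^sub>R (- v))) has_real_derivative DJ u (- v)) (at 0)"
  using DJ[of u "- v" 0] assms(2,3) subspace_neg[OF V] by simp
 moreover have "J (- u + t *\<^sub>R v) = J (u + t *\<^sub>R (- v))" for t
 proof -
  have "u + t *\<^sub>R (- v) \<in> V" using assms(2,3) V by (intro subspace_add subspace_scale subspace_neg)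
  from assms(1)[OF this] show ?thesis by simp
 qed
 ultimately have "DJ (- u) v = DJ u (- v)" by (auto dest: DERIV_unique)
 then show ?thesis using DJ_scale[of u v "-1"] assms by simp
qed

text \<open>A direction of descent at one point works nearby, with slightly worse constants, by continuity. A partition of unity on
the compact set \<open>Q\<close> combines finitely many such directions. Division by \<open>max m (s v)\<close> instead of the sum \<open>s v\<close> of the
weights makes the field continuous on all of \<open>V\<close>.\<close>
lemma pseudo_gradient_field:
 assumes Q: "compact Q" "Q \<subseteq> V" and L: "L > 0"
  and desc: "!!u. u \<in> Q ==> \<exists>\<xi>\<in>V. 1 <= DJ u \<xi> & r \<xi> <= L * (1 + r u)"
 obtains W where "continuous_on V W" "!!u. u \<in> V ==> W u \<in> V"
  "!!u. u \<in> V ==> r (W u) <= 2 * L * (1 + r u)"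
  "!!u. u \<in> Q ==> 1 / 2 <= DJ u (W u)"
proof (cases "Q = {}")
 case True
 show ?thesis
  by (rule that[of "%_. 0"]) (use True V L r_nonneg in \<open>auto simp: subspace_0 r_zero DJ_zero\<close>)
next
 case False
 have "\<exists>\<xi> \<delta>. \<xi> \<in> V & \<delta> > 0 & (\<forall>v\<in>V. dist v u < \<delta> --> 1 / 2 < DJ v \<xi> & r \<xi> < 2 * L * (1 + r v))"
  if u: "u \<in> Q" for u
 proof -
  obtain \<xi> where \<xi>: "\<xi> \<in> V" "1 <= DJ u \<xi>" "r \<xi> <= L * (1 + r u)" using desc[OF u] by auto
  have uV: "u \<in> V" using u Q by auto
  have c1: "continuous_on V (%v. DJ v \<xi>)"
   by (rule continuous_on_compose2[OF DJ_cont, of V "%v. (v, \<xi>)", simplified])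
    (use \<xi>(1) in \<open>auto intro!: continuous_intros\<close>)
  have "((%v. DJ v \<xi>) \<longlongrightarrow> DJ u \<xi>) (at u within V)" "((%v. 2 * L * (1 + r v)) \<longlongrightarrow> 2 * L * (1 + r u)) (at u within V)"
   using c1 r_cont uV by (auto simp: continuous_on_def intro!: tendsto_intros)
  moreover have "0 < L * (1 + r u)" using L r_nonneg[OF uV] by simp
  then have "1/2 < DJ u \<xi>" "r \<xi> < 2 * L * (1 + r u)"
   using \<xi> by (auto intro: le_less_trans[OF \<xi>(3)])
  ultimately have "\<forall>\<^sub>F v in at u within V. 1 / 2 < DJ v \<xi> & r \<xi> < 2 * L * (1 + r v)"
   by (intro eventually_conj order_tendstoD(1)) auto
  then obtain \<delta> where "\<delta> > 0" "\<forall>v\<in>V. v ~= u & dist v u < \<delta> --> 1 / 2 < DJ v \<xi> & r \<xi> < 2 * L * (1 + r v)"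
   unfolding eventually_at by auto
  then show ?thesis using \<xi>(1) \<open>1/2 < DJ u \<xi>\<close> \<open>r \<xi> < 2 * L * (1 + r u)\<close>
   by (intro exI[of _ \<xi>] exI[of _ \<delta>]) metis
 qed
 then obtain \<xi> \<delta> where \<xi>: "!!u. u \<in> Q ==> \<xi> u \<in> V" and \<delta>: "!!u. u \<in> Q ==> \<delta> u > 0"
  and near: "!!u v. u \<in> Q ==> v \<in> V ==> dist v u < \<delta> u ==> 1 / 2 < DJ v (\<xi> u) & r (\<xi> u) < 2 * L * (1 + r v)"
  by metis
 have "Q \<subseteq> (\<Union>u\<in>Q. ball u (\<delta> u))" using \<delta> by auto
 from compactE_image[OF Q(1) _ this] obtain F where F: "F \<subseteq> Q" "finite F" "Q \<subseteq> (\<Union>u\<in>F. ball u (\<delta> u))"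
  by (metis open_ball)
 define \<theta> where "\<theta> u v = max 0 (\<delta> u - dist v u)" for u v
 define s where "s v = (\<Sum>u\<in>F. \<theta> u v)" for v
 have \<theta>0: "0 <= \<theta> u v" for u v by (simp add: \<theta>_def)
 have \<theta>c: "continuous_on A (%v. \<theta> u v)" for A u unfolding \<theta>_def by (intro continuous_intros)
 have sc: "continuous_on A s" for A unfolding s_def by (intro continuous_intros \<theta>c)
 have s_pos: "s v > 0" if "v \<in> Q" for v
 proof -
  obtain u where u: "u \<in> F" "dist u v < \<delta> u" using F(3) \<open>v \<in> Q\<close> by auto
  then have "0 < \<theta> u v" by (simp add: \<theta>_def dist_commute)
  also have "... <= s v" unfolding s_def by (intro member_le_sum u F \<theta>0)
  finally show ?thesis .
 qed
 obtain v0 where v0: "v0 \<in> Q" "!!v. v \<in> Q ==> s v0 <= s v"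
  using continuous_attains_inf[OF Q(1) False sc] by auto
 define m where "m = s v0"
 have m: "m > 0" using s_pos v0 by (simp add: m_def)
 define W where "W v = (1 / max m (s v)) *\<^sub>R (\<Sum>u\<in>F. \<theta> u v *\<^sub>R \<xi> u)" for v
 have M: "max m (s v) > 0" for v using m by auto
 have FV: "\<theta> u v *\<^sub>R \<xi> u \<in> V" if "u \<in> F" for u v
  using \<xi> F that V by (auto intro: subspace_scale)
 have sumV: "(\<Sum>u\<in>F. \<theta> u v *\<^sub>R \<xi> u) \<in> V" for v using FV by (intro subspace_sum[OF V]) auto
 have DW: "DJ v (W v) = (\<Sum>u\<in>F. \<theta> u v * DJ v (\<xi> u)) / max m (s v)" if "v \<in> V" for v
 proof -
  have "DJ v (W v) = (1 / max m (s v)) * (\<Sum>u\<in>F. DJ v (\<theta> u v *\<^sub>R \<xi> u))"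
   unfolding W_def using that sumV FV by (simp add: DJ_scale DJ_sum)
  also have "(\<Sum>u\<in>F. DJ v (\<theta> u v *\<^sub>R \<xi> u)) = (\<Sum>u\<in>F. \<theta> u v * DJ v (\<xi> u))"
   using that \<xi> F by (intro sum.cong refl DJ_scale) auto
  finally show ?thesis by simp
 qed
 have half: "\<theta> u v * (1 / 2) <= \<theta> u v * DJ v (\<xi> u)" if "u \<in> F" "v \<in> V" for u v
 proof (cases "dist v u < \<delta> u")
  case True
  then show ?thesis using near[of u v] that F \<theta>0 by (intro mult_left_mono) auto
 qed (simp add: \<theta>_def)
 have key: "s v / 2 <= (\<Sum>u\<in>F. \<theta> u v * DJ v (\<xi> u))" if "v \<in> V" for v
  using sum_mono[OF half[OF _ that], where K = F] unfolding s_def sum_divide_distrib by simp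
 show ?thesis
 proof (rule that[of W])
  show "continuous_on V W" unfolding W_def
   by (intro continuous_intros \<theta>c sc ballI less_imp_neq[OF M, symmetric])
  show "W u \<in> V" for u unfolding W_def by (intro subspace_scale[OF V] sumV)
  show "1 / 2 <= DJ u (W u)" if "u \<in> Q" for u
  proof -
   have "max m (s u) = s u" using v0(2)[OF that] by (simp add: m_def)
   moreover have uV: "u \<in> V" using Q that by auto
   ultimately have "(s u / 2) / s u <= DJ u (W u)"
    unfolding DW[OF uV] using key[OF uV] s_pos[OF that] by (simp add: divide_right_mono)
   then show ?thesis using s_pos[OF that] by simp
  qed
  show "r (W v) <= 2 * L * (1 + r v)" if v: "v \<in> V" for v
  proof -
   have b: "\<theta> u v * r (\<xi> u) <= \<theta> u v * (2 * L * (1 + r v))" if "u \<in> F" for u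
   proof (cases "dist v u < \<delta> u")
    case True
    then show ?thesis using near[of u v] that v F \<theta>0 by (intro mult_left_mono) auto
   qed (simp add: \<theta>_def)
   have "r (\<Sum>u\<in>F. \<theta> u v *\<^sub>R \<xi> u) <= (\<Sum>u\<in>F. r (\<theta> u v *\<^sub>R \<xi> u))" by (rule r_sum) (rule FV)
   also have "... = (\<Sum>u\<in>F. \<theta> u v * r (\<xi> u))"
    by (intro sum.cong refl) (use \<xi> F \<theta>0 in \<open>auto simp: r_scale\<close>)
   also have "... <= (\<Sum>u\<in>F. \<theta> u v * (2 * L * (1 + r v)))" by (intro sum_mono b)
   also have "... = s v * (2 * L * (1 + r v))" unfolding s_def sum_distrib_right ..
   also have "... <= max m (s v) * (2 * L * (1 + r v))"
    using L r_nonneg[OF v] by (intro mult_right_mono) auto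
   finally show ?thesis unfolding W_def using M[of v] sumV by (simp add: r_scale field_simps)
  qed
 qed
qed

text \<open>For even \<open>J\<close> the odd part of the field keeps all estimates, since its summand at \<open>- u\<close> is as good as the one at \<open>u\<close>.\<close>
lemma equivariant_pseudo_gradient_field:
 assumes Q: "compact Q" "Q \<subseteq> V" and L: "L > 0"
  and desc: "\<forall>u\<in>Q. \<exists>\<xi>\<in>V. 1 <= DJ u \<xi> & r \<xi> <= L * (1 + r u)"
  and sym: "(\<forall>u\<in>V. J (- u) = J u) --> (\<forall>u\<in>Q. - u \<in> Q)"
 shows "\<exists>W. continuous_on V W & (\<forall>u\<in>V. W u \<in> V) & (\<forall>u\<in>V. r (W u) <= 2 * L * (1 + r u)) \<and>
  (\<forall>u\<in>Q. 1 / 2 <= DJ u (W u)) & ((\<forall>u\<in>V. J (- u) = J u) --> (\<forall>u\<in>V. W (- u) = - W u))"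
proof -
 obtain W where W: "continuous_on V W" "!!u. u \<in> V ==> W u \<in> V"
  "!!u. u \<in> V ==> r (W u) <= 2 * L * (1 + r u)" "!!u. u \<in> Q ==> 1 / 2 <= DJ u (W u)"
  using pseudo_gradient_field[OF Q L] desc by metis
 show ?thesis
 proof (cases "\<forall>u\<in>V. J (- u) = J u")
  case True
  define W' where "W' u = (1/2) *\<^sub>R (W u + (- 1) *\<^sub>R W (- u))" for u
  have neg: "- u \<in> V" if "u \<in> V" for u using that V by (rule subspace_neg[rotated])
  have mem: "(- 1) *\<^sub>R W (- u) \<in> V" "W u + (- 1) *\<^sub>R W (- u) \<in> V" if "u \<in> V" for u
   using W(2) neg that V by (auto intro!: subspace_add subspace_neg subspace_diff)
  show ?thesis
  proof (intro exI[of _ W'] conjI ballI impI)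
   have "continuous_on V (%u. W (- u))"
    by (rule continuous_on_compose2[OF W(1) continuous_on_minus[OF continuous_on_id]]) (use neg in auto)
   then show "continuous_on V W'" unfolding W'_def by (intro continuous_intros W)
   show "W' u \<in> V" if "u \<in> V" for u unfolding W'_def by (intro subspace_scale[OF V] mem that)
   show "r (W' u) <= 2 * L * (1 + r u)" if "u \<in> V" for u
    using r_scale[OF mem(2)[OF that], of "1/2"] r_triangle[OF W(2)[OF that] mem(1)[OF that]] r_scale[OF W(2)[OF neg[OF that]], of "-1"]
     W(3)[OF that] W(3)[OF neg[OF that]] r_minus[OF that] by (simp add: W'_def)
   show "1 / 2 <= DJ u (W' u)" if uQ: "u \<in> Q" for u
   proof -
    have u: "u \<in> V" using uQ Q by auto
    have "DJ u (W' u) = (DJ u (W u) + DJ (- u) (W (- u))) / 2"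
     unfolding W'_def using mem[OF u] u W(2)[OF u] W(2)[OF neg[OF u]] True
     by (simp only: DJ_scale DJ_add DJ_even) (simp add: field_simps)
    then show ?thesis using W(4)[OF uQ] W(4)[OF bspec[OF mp[OF sym True] uQ]] by simp
   qed
   show "W' (- u) = - W' u" for u unfolding W'_def by (simp add: algebra_simps)
  qed
 qed (use W in auto)
qed

text \<open>The flow is replaced by many small Euler steps along the field, so that continuity suffices. The cut-off \<open>\<kappa>\<close> stops the
motion at level \<open>a\<close>, and while \<open>J\<close> exceeds \<open>a + \<epsilon>\<close> each step lowers \<open>J\<close> by a fixed amount. The speed is at most
proportional to \<open>1 + r u\<close>, so over the total time \<open>8 (b - a)\<close> the quantity \<open>1 + r u\<close> changes at most by the factor
\<open>exp (32 L (b - a))\<close>: points that start far out stay where \<open>1 + r u \<ge> \<rho>\<close>, which is where descent directions exist.\<close>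
theorem deformation:
 assumes ab: "a < b" and \<epsilon>: "\<epsilon> > 0" and L: "L > 0" and \<rho>: "\<rho> >= 0"
  and desc: "!!u. u \<in> V ==> \<rho> <= 1 + r u ==> a <= J u ==> J u <= b ==>
   \<exists>\<xi>\<in>V. 1 <= DJ u \<xi> & r \<xi> <= L * (1 + r u)"
  and S: "compact S" "S \<subseteq> V" "!!u. u \<in> S ==> J u <= b"
   "!!u. u \<in> S ==> J u <= a \<or> \<rho> * exp (32 * L * (b - a)) <= 1 + r u"
 shows "\<exists>D. continuous_on V D & (\<forall>u\<in>V. D u \<in> V) & (\<forall>u\<in>S. J (D u) < a + \<epsilon>) \<and>
  (\<forall>u\<in>V. J u <= a --> D u = u) & ((\<forall>u\<in>V. J (- u) = J u) --> (\<forall>u\<in>V. D (- u) = - D u))"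
proof -
 (* Above level a + \<epsilon> the functional decreases at least at the rate 1/4, hence by 2 (b - a) in this time. *)
 define T where "T = 8 * (b - a)"
 have T: "T > 0" using ab by (simp add: T_def)
 have "bounded (r ` S)"
  by (rule compact_imp_bounded, rule compact_continuous_image) (use S r_cont continuous_on_subset in blast)+
 then obtain R0 where R0: "!!u. u \<in> S ==> \<bar>r u\<bar> <= R0" unfolding bounded_iff by auto
 (* No point of S is moved out of the ball of radius R. *)
 define R where "R = (1 + \<bar>R0\<bar>) * exp (4 * L * T)"
 define Q where "Q = {u \<in> V. r u <= R} \<inter> {u \<in> V. \<rho> <= 1 + r u & a <= J u & J u <= b}"
 define K where "K = {u \<in> V. r u <= R}"
 have K: "compact K" unfolding K_def by (rule r_compact)
 have KV: "K \<subseteq> V" by (auto simp: K_def)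
 have "Q = K \<inter> {u \<in> K. \<rho> <= 1 + r u} \<inter> {u \<in> K. a <= J u} \<inter> {u \<in> K. J u <= b}"
  by (auto simp: Q_def K_def)
 moreover have "closed {u \<in> K. \<rho> <= 1 + r u}" "closed {u \<in> K. a <= J u}" "closed {u \<in> K. J u <= b}"
  by (intro continuous_on_closed_Collect_le continuous_on_subset[OF r_cont KV]
     continuous_on_subset[OF J_cont KV] continuous_intros compact_imp_closed K | simp)+
 ultimately have Q: "compact Q" using K by (simp add: compact_Int_closed)
 have QV: "Q \<subseteq> V" by (auto simp: Q_def)
 have descQ: "\<forall>u\<in>Q. \<exists>\<xi>\<in>V. 1 <= DJ u \<xi> & r \<xi> <= L * (1 + r u)"
  using desc by (auto simp: Q_def)
 have sym: "(\<forall>u\<in>V. J (- u) = J u) --> (\<forall>u\<in>Q. - u \<in> Q)"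
  using subspace_neg[OF V] by (auto simp: Q_def r_minus)
 obtain W where W': "continuous_on V W" "\<forall>u\<in>V. W u \<in> V" "\<forall>u\<in>V. r (W u) <= 2 * L * (1 + r u)" "\<forall>u\<in>Q. 1 / 2 <= DJ u (W u)"
  and Wodd: "(\<forall>u\<in>V. J (- u) = J u) --> (\<forall>u\<in>V. W (- u) = - W u)"
  using equivariant_pseudo_gradient_field[OF Q QV L descQ sym] by (elim exE conjE) (rule that)
 note W = W'[rule_format]
 define \<kappa> where "\<kappa> u = max 0 (min 1 ((J u - a) / \<epsilon>))" for u
 have \<kappa>: "0 <= \<kappa> u" "\<kappa> u <= 1" for u by (auto simp: \<kappa>_def)
 have \<kappa>c: "continuous_on V \<kappa>" unfolding \<kappa>_def by (intro continuous_intros J_cont) (use \<epsilon> in auto)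
 define G where "G x = DJ (snd x + (- fst x * \<kappa> (snd x)) *\<^sub>R W (snd x)) (W (snd x))" for x
 have GV: "u + c *\<^sub>R W u \<in> V" if "u \<in> V" for u c using that W(2) V by (intro subspace_add subspace_scale)
 have Gc: "continuous_on ({0..1} \<times> K) G"
 proof -
  have GV': "u - c *\<^sub>R W u \<in> V" if "u \<in> V" for u c using GV[OF that, of "- c"] by simp
  let ?g = "%x. (snd x + (- fst x * \<kappa> (snd x)) *\<^sub>R W (snd x), W (snd x))"
  have "continuous_on ({0..1} \<times> K) (%x. (%y. DJ (fst y) (snd y)) (?g x))"
   by (rule continuous_on_compose2[OF DJ_cont])
    (use KV W(2) GV' in \<open>auto intro!: continuous_intros continuous_on_compose2[OF \<kappa>c] continuous_on_compose2[OF W(1)]\<close>)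
  then show ?thesis by (simp add: G_def[abs_def])
 qed
 have "uniformly_continuous_on ({0..1} \<times> K) G"
  by (intro compact_uniformly_continuous Gc compact_Times K) simp
 then obtain \<delta> where \<delta>: "\<delta> > 0" "!!x y. x \<in> {0..1} \<times> K ==> y \<in> {0..1} \<times> K ==> dist x y < \<delta> ==> dist (G x) (G y) < 1/4"
  unfolding uniformly_continuous_on_def by (metis zero_less_divide_1_iff zero_less_numeral)
 have near: "1 / 4 <= G (\<tau>, u)" if "u \<in> Q" "0 <= \<tau>" "\<tau> < \<delta>" "\<tau> <= 1" for \<tau> u
 proof -
  have "dist (\<tau>, u) (0, u) < \<delta>" using that by (simp add: dist_prod_def)
  then have "dist (G (\<tau>, u)) (G (0, u)) < 1/4" using that by (intro \<delta>(2)) (auto simp: Q_def K_def)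
  moreover have "1 / 2 <= G (0, u)" using W(4)[OF that(1)] by (simp add: G_def)
  ultimately show ?thesis unfolding dist_real_def abs_less_iff by linarith
 qed
 obtain N :: nat where N: "real N > max (T / \<delta>) (max T (4 * L * T))" using reals_Archimedean2 by blast
 have N0: "real N > 0" using N T by linarith
 define s where "s = T / real N"
 have s: "s > 0" "s < \<delta>" "s <= 1" "4 * L * s <= 1" "real N * s = T"
  using N N0 T \<delta>(1) L by (auto simp: s_def field_simps)
 define step where "step u = u + (- s * \<kappa> u) *\<^sub>R W u" for u
 have stepV: "step u \<in> V" if "u \<in> V" for u unfolding step_def by (rule GV[OF that])
 have step_fix: "step u = u" if "J u <= a" for u
 proof -
  have "(J u - a) / \<epsilon> <= 0" using that \<epsilon> by (intro divide_nonpos_pos) auto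
  then have "\<kappa> u = 0" by (simp add: \<kappa>_def)
  then show ?thesis by (simp add: step_def)
 qed
 define c where "c = 4 * L * s"
 have c: "0 <= c" "c <= 1" "real N * c = 4 * L * T" using s L by (auto simp: c_def)
 have step_r: "(1 + r u) * exp (- c) <= 1 + r (step u)" "1 + r (step u) <= (1 + r u) * exp c" if u: "u \<in> V" for u
 proof -
  have "r ((- s * \<kappa> u) *\<^sub>R W u) = s * \<kappa> u * r (W u)"
   using r_scale[OF W(2)[OF u], of "- s * \<kappa> u"] s(1) \<kappa>[of u] by (simp add: abs_mult)
  also have "... <= s * 1 * (2 * L * (1 + r u))"
   using s(1) \<kappa>[of u] W(3)[OF u] r_nonneg[OF W(2)[OF u]] by (intro mult_mono) auto
  finally have d: "r ((- s * \<kappa> u) *\<^sub>R W u) <= c / 2 * (1 + r u)" by (simp add: c_def mult_ac)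
  have mV: "(- s * \<kappa> u) *\<^sub>R W u \<in> V" using W(2)[OF u] V by (intro subspace_scale)
  have ru: "0 <= 1 + r u" using r_nonneg[OF u] by simp
  have "r (step u) <= r u + r ((- s * \<kappa> u) *\<^sub>R W u)" unfolding step_def by (rule r_triangle[OF u mV])
  then have "1 + r (step u) <= 1 + r u + c / 2 * (1 + r u)" using d by linarith
  also have "... = (1 + r u) * (1 + c / 2)" by (simp add: algebra_simps)
  also have "... <= (1 + r u) * exp c" using exp_ge_add_one_self[of c] c(1) by (intro mult_left_mono[OF _ ru]) linarith
  finally show "1 + r (step u) <= (1 + r u) * exp c" .
  have "0 <= c * (1 - c)" using c by (intro mult_nonneg_nonneg) auto
  then have "1 <= (1 - c / 2) * (1 + c)" by (simp add: algebra_simps)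
  also have "... <= (1 - c / 2) * exp c" using exp_ge_add_one_self[of c] c by (intro mult_left_mono) auto
  finally have "exp (- c) <= 1 - c / 2" by (simp add: exp_minus field_simps)
  from mult_left_mono[OF this ru] have "(1 + r u) * exp (- c) <= 1 + r u - c / 2 * (1 + r u)" by (simp add: algebra_simps)
  moreover have "r u <= r (step u) + r (- ((- s * \<kappa> u) *\<^sub>R W u))"
   using r_triangle[OF stepV[OF u] subspace_neg[OF V mV]] by (simp add: step_def)
  ultimately show "(1 + r u) * exp (- c) <= 1 + r (step u)"
   using d r_minus[OF mV] by linarith
 qed
 have step_J: "J (step u) <= J u - s * \<kappa> u / 4" if u: "u \<in> Q" for u
 proof -
  have uV: "u \<in> V" using u QV by auto
  let ?v = "(- \<kappa> u) *\<^sub>R W u"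
  have vV: "?v \<in> V" using W(2)[OF uV] V by (intro subspace_scale)
  have "\<exists>z>0. z < s & J (u + s *\<^sub>R ?v) - J (u + 0 *\<^sub>R ?v) = (s - 0) * DJ (u + z *\<^sub>R ?v) ?v"
   by (rule MVT2[OF s(1), of "%t. J (u + t *\<^sub>R ?v)"]) (rule DJ[OF uV vV])
  then obtain z where z: "0 < z" "z < s" "J (step u) - J u = s * DJ (u + z *\<^sub>R ?v) ?v"
   by (auto simp: step_def)
  have "DJ (u + z *\<^sub>R ?v) ?v = - \<kappa> u * G (z, u)"
   unfolding G_def using DJ_scale[OF GV[OF uV, of "- z * \<kappa> u"] W(2)[OF uV], of "- \<kappa> u"] by simp
  moreover have "\<kappa> u * (1/4) <= \<kappa> u * G (z, u)"
   by (intro mult_left_mono near) (use u z s \<kappa> in auto)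
  ultimately have "J (step u) - J u = s * - (\<kappa> u * G (z, u))" "\<kappa> u * (1/4) <= \<kappa> u * G (z, u)" using z by auto
  moreover have "s * (\<kappa> u * (1/4)) <= s * (\<kappa> u * G (z, u))"
   by (rule mult_left_mono) (use s calculation in auto)
  ultimately show ?thesis by simp
 qed
 define D where "D = step ^^ N"
 have iterV: "(step ^^ i) u \<in> V" if "u \<in> V" for u i by (induction i) (auto simp: that stepV)
 have stepc: "continuous_on V step" unfolding step_def by (intro continuous_intros \<kappa>c W)
 have iterc: "continuous_on V (step ^^ i)" for i
 proof (induction i)
  case (Suc i)
  show ?case unfolding funpow.simps(2)
   by (rule continuous_on_compose[OF Suc continuous_on_subset[OF stepc]]) (use iterV in auto)
 qed (simp add: continuous_on_id)
 have inv: "J ((step ^^ i) u) <= a \<or>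
   (J ((step ^^ i) u) <= b & (1 + r u) * exp (- (real i * c)) <= 1 + r ((step ^^ i) u) \<and>
   1 + r ((step ^^ i) u) <= (1 + r u) * exp (real i * c) \<and>
   \<rho> * exp (4 * L * T) <= 1 + r u \<and>
   (J ((step ^^ i) u) < a + \<epsilon> \<or> J ((step ^^ i) u) <= b - real i * (s / 4)))"
  if u: "u \<in> S" and iN: "i <= N" for u i
  using iN
 proof (induction i)
  case 0
  have e: "4 * L * T = 32 * L * (b - a)" by (simp add: T_def algebra_simps)
  show ?case unfolding e using S(3,4)[OF u] by auto
 next
  case (Suc i)
  let ?v = "(step ^^ i) u"
  have uV: "u \<in> V" using u S by auto
  have vV: "?v \<in> V" by (rule iterV[OF uV])
  consider "J ?v <= a" | "a < J ?v" by linarith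
  then show ?case
  proof cases
   case 1
   then show ?thesis by (simp add: step_fix)
  next
   case 2
   with Suc have IH: "J ?v <= b" "(1 + r u) * exp (- (real i * c)) <= 1 + r ?v"
     "1 + r ?v <= (1 + r u) * exp (real i * c)" "\<rho> * exp (4 * L * T) <= 1 + r u"
     "J ?v < a + \<epsilon> \<or> J ?v <= b - real i * (s / 4)" by auto
   have "real i * c <= real N * c" using Suc c by (intro mult_right_mono) auto
   then have ic: "real i * c <= 4 * L * T" using c(3) by simp
   have "1 + r ?v <= (1 + \<bar>R0\<bar>) * exp (4 * L * T)"
    using R0[OF u] r_nonneg[OF uV] ic by (intro order_trans[OF IH(3)] mult_mono) auto
   then have rR: "r ?v <= R" by (simp add: R_def)
   have "\<rho> = \<rho> * exp (4 * L * T) * exp (- (4 * L * T))" by (simp add: exp_minus)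
   also have "... <= (1 + r u) * exp (- (real i * c))" using IH(4) ic r_nonneg[OF uV] by (intro mult_mono) auto
   also have "... <= 1 + r ?v" by (rule IH)
   finally have "\<rho> <= 1 + r ?v" by simp
   with rR 2 IH(1) vV have vQ: "?v \<in> Q" by (auto simp: Q_def)
   have J: "J (step ?v) <= J ?v - s * \<kappa> ?v / 4" by (rule step_J[OF vQ])
   moreover have "0 <= s * \<kappa> ?v / 4" using s \<kappa>[of ?v] by simp
   ultimately have J': "J (step ?v) <= J ?v" by linarith
   have "J (step ?v) < a + \<epsilon> \<or> J (step ?v) <= b - real (Suc i) * (s / 4)"
   proof (cases "J ?v < a + \<epsilon>")
    case False
    then have "\<kappa> ?v = 1" using \<epsilon> by (simp add: \<kappa>_def)
    have "real (Suc i) * (s / 4) = real i * (s / 4) + s / 4" by (simp add: distrib_right add_divide_distrib)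
    then show ?thesis using J IH(5) False unfolding \<open>\<kappa> ?v = 1\<close> by linarith
   qed (use J' in simp)
   moreover have e: "exp (- (real (Suc i) * c)) = exp (- (real i * c)) * exp (- c)" "exp (real (Suc i) * c) = exp (real i * c) * exp c"
    by (simp_all add: exp_add[symmetric] distrib_right)
   have "(1 + r u) * exp (- (real (Suc i) * c)) <= 1 + r (step ?v)"
    using order_trans[OF mult_right_mono[OF IH(2)] step_r(1)[OF vV]] unfolding e by (simp add: mult.assoc)
   moreover have "1 + r (step ?v) <= (1 + r u) * exp (real (Suc i) * c)"
    using order_trans[OF step_r(2)[OF vV] mult_right_mono[OF IH(3)]] unfolding e by (simp add: mult.assoc)
   ultimately show ?thesis using J' IH(1,4) by auto
  qed
 qed
 show ?thesis
 proof (intro exI[of _ D] conjI ballI impI)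
  show "continuous_on V D" unfolding D_def by (rule iterc)
  show "D u \<in> V" if "u \<in> V" for u unfolding D_def by (rule iterV[OF that])
  show "D u = u" if "J u <= a" for u
  proof -
   have "(step ^^ i) u = u" for i by (induction i) (use step_fix[OF that] in auto)
   then show ?thesis by (simp add: D_def)
  qed
  show "J (D u) < a + \<epsilon>" if "u \<in> S" for u
  proof -
   have e: "real N * (s / 4) = 2 * (b - a)" using s(5) by (simp add: T_def)
   have "b - real N * (s / 4) < a + \<epsilon>" unfolding e using \<epsilon> ab by (simp add: algebra_simps)
   moreover have "a < a + \<epsilon>" using \<epsilon> by simp
   moreover note inv[OF that order_refl]
   ultimately show ?thesis unfolding D_def by (meson le_less_trans)
  qed
  show "D (- u) = - D u" if ev: "\<forall>u\<in>V. J (- u) = J u" and u: "u \<in> V" for u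
  proof -
   have st: "step (- v) = - step v" if "v \<in> V" for v
    using Wodd ev that by (simp add: step_def \<kappa>_def)
   have "(step ^^ i) (- u) = - (step ^^ i) u" for i
    by (induction i) (use st iterV[OF u] in auto)
   then show ?thesis by (simp add: D_def)
  qed
 qed
qed

end

section \<open>A linking argument for perturbed even functionals\<close>

definition coord_sphere :: "nat => (nat \<Rightarrow>\<^sub>C real) set" where
 "coord_sphere k = {x \<in> coord_space k. norm x = 1}"

definition coord_ball :: "nat => (nat \<Rightarrow>\<^sub>C real) set" where
 "coord_ball k = {x \<in> coord_space k. norm x <= 1}"

lemma compact_coord_ball: "compact (coord_ball k)"
 unfolding coord_ball_def by (rule compact_coord_space_ball)

lemma compact_coord_sphere: "compact (coord_sphere k)"
proof -
 have "coord_sphere k = {x. norm x = 1} \<inter> coord_ball k" by (auto simp: coord_sphere_def coord_ball_def)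
 moreover have "closed {x :: nat \<Rightarrow>\<^sub>C real. norm x = 1}" by (intro closed_Collect_eq continuous_intros)
 ultimately show ?thesis using closed_Int_compact[OF _ compact_coord_ball] by simp
qed

lemma coord_sphere_minus: "x \<in> coord_sphere k ==> - x \<in> coord_sphere k"
 by (auto simp: coord_sphere_def coord_space_def)

lemma coord_space_normalize: "x \<in> coord_space k ==> x ~= 0 ==> (1 / norm x) *\<^sub>R x \<in> coord_sphere k"
 by (auto simp: coord_sphere_def coord_space_def)

lemma coord_sphere_0: "coord_sphere 0 = {}"
proof -
 have "x = 0" if "x \<in> coord_space 0" for x
  using that by (intro bcontfun_eqI) (auto simp: coord_space_def)
 then show ?thesis by (fastforce simp: coord_sphere_def)
qed

definition cone_extension :: "((nat \<Rightarrow>\<^sub>C real) => 'a) => (nat \<Rightarrow>\<^sub>C real) => 'a::real_normed_vector" where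
 "cone_extension h y = (if y = 0 then 0 else norm y *\<^sub>R h ((1 / norm y) *\<^sub>R y))"

lemma continuous_cone_extension:
 assumes h: "continuous_on (coord_sphere k) h"
 shows "continuous_on (coord_ball k) (cone_extension h)"
proof -
 let ?B = "coord_ball k" and ?S = "coord_sphere k"
 have nrm: "(1 / norm y) *\<^sub>R y \<in> ?S" if "y \<in> ?B - {0}" for y
  using that coord_space_normalize[of y k] by (auto simp: coord_ball_def)
 have "bounded (h ` ?S)"
  by (intro compact_imp_bounded compact_continuous_image h compact_coord_sphere)
 then obtain M where M: "!!x. x \<in> ?S ==> norm (h x) <= M" unfolding bounded_iff by auto
 have c: "continuous_on (?B - {0}) (%y. norm y *\<^sub>R h ((1 / norm y) *\<^sub>R y))"
  by (intro continuous_intros continuous_on_compose2[OF h]) (use nrm in auto)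
 have "continuous_on (?B - {0}) (cone_extension h)"
  by (rule continuous_on_eq[OF c]) (auto simp: cone_extension_def)
 then have away: "(cone_extension h \<longlongrightarrow> cone_extension h y) (at y within ?B - {0})" if "y \<in> ?B - {0}" for y
  using that by (auto simp: continuous_on_def)
 show ?thesis unfolding continuous_on_def
 proof (intro ballI)
  fix y assume y: "y \<in> ?B"
  show "(cone_extension h \<longlongrightarrow> cone_extension h y) (at y within ?B)"
  proof (cases "y = 0")
   case True
   have "(cone_extension h \<longlongrightarrow> 0) (at 0 within ?B)"
   proof (rule Lim_null_comparison)
    have "((%z :: nat \<Rightarrow>\<^sub>C real. norm z) \<longlongrightarrow> norm (0 :: nat \<Rightarrow>\<^sub>C real)) (at 0 within ?B)"
     by (intro tendsto_intros)
    then show "((%z. norm z * M) \<longlongrightarrow> 0) (at 0 within ?B)" by (intro tendsto_mult_left_zero) simp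
    show "\<forall>\<^sub>F z in at 0 within ?B. norm (cone_extension h z) <= norm z * M"
     unfolding eventually_at_filter
    proof (rule always_eventually, intro allI impI)
     fix z assume z: "z ~= 0" "z \<in> ?B"
     then show "norm (cone_extension h z) <= norm z * M"
      using M[OF nrm[of z]] by (auto simp: cone_extension_def intro!: mult_left_mono)
    qed
   qed
   then show ?thesis by (simp add: True cone_extension_def)
  next
   case False
   have "at y within ?B = at y within ?B - {0}"
    by (rule at_within_nhd[of y "- {0}"]) (use False in auto)
   then show ?thesis using away y False by simp
  qed
 qed
qed

lemma cone_extension_sphere: "x \<in> coord_sphere k ==> cone_extension h x = h x"
 by (auto simp: cone_extension_def coord_sphere_def)

text \<open>Dropping the last coordinate maps the upper hemisphere to the ball, and the lower one is reached by the antipodal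
map; the two definitions agree on the equator because \<open>g\<close> is odd there.\<close>
definition glue_hemispheres :: "nat => ((nat \<Rightarrow>\<^sub>C real) => 'a) => (nat \<Rightarrow>\<^sub>C real) => 'a::real_normed_vector" where
 "glue_hemispheres k g x =
  (if 0 <= x k then g (x - x k *\<^sub>R coord_vec k) else - g (- (x - x k *\<^sub>R coord_vec k)))"

lemma drop_coord_in_ball:
 assumes "x \<in> coord_sphere (Suc k)"
 shows "x - x k *\<^sub>R coord_vec k \<in> coord_ball k" "- (x - x k *\<^sub>R coord_vec k) \<in> coord_ball k"
proof -
 have 1: "x - x k *\<^sub>R coord_vec k \<in> coord_space k"
  using assms by (auto simp: coord_sphere_def coord_space_def le_Suc_eq Suc_le_eq)
 have "norm (x - x k *\<^sub>R coord_vec k) <= 1"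
 proof (rule norm_bound)
  fix i show "norm ((x - x k *\<^sub>R coord_vec k) i) <= 1"
   using norm_bounded[of x i] assms by (auto simp: coord_sphere_def)
 qed
 with 1 show "x - x k *\<^sub>R coord_vec k \<in> coord_ball k"
  unfolding coord_ball_def by blast
 then show "- (x - x k *\<^sub>R coord_vec k) \<in> coord_ball k"
  unfolding coord_ball_def mem_Collect_eq norm_minus_cancel using subspace_neg[OF subspace_coord_space] by blast
qed

lemma glue_hemispheres:
 assumes g: "continuous_on (coord_ball k) g"
  and odd: "!!x. x \<in> coord_sphere k ==> g (- x) = - g x"
 shows "continuous_on (coord_sphere (Suc k)) (glue_hemispheres k g)"
  and "x \<in> coord_sphere (Suc k) ==> glue_hemispheres k g (- x) = - glue_hemispheres k g x"
proof -
 let ?S = "coord_sphere (Suc k)"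
 let ?p = "%x. x - apply_bcontfun x k *\<^sub>R coord_vec k"
 have eq: "?p x = x" "x \<in> coord_sphere k" if "x \<in> ?S" "x k = 0" for x
 proof -
  have "apply_bcontfun x i = 0" if "k <= i" for i
   using \<open>x \<in> ?S\<close> \<open>x k = 0\<close> that by (cases "i = k") (auto simp: coord_sphere_def coord_space_def)
  then show "?p x = x" "x \<in> coord_sphere k"
   using \<open>x \<in> ?S\<close> \<open>x k = 0\<close> by (simp_all add: coord_sphere_def coord_space_def)
 qed
 have overlap: "g (?p x) = - g (- ?p x)" if "x \<in> ?S" "x k = 0" for x
  unfolding eq(1)[OF that] using odd[OF eq(2)[OF that]] by simp
 let ?U = "{x \<in> ?S. 0 <= apply_bcontfun x k}" and ?L = "{x \<in> ?S. apply_bcontfun x k <= 0}"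
 have S: "closed ?S" by (intro compact_imp_closed compact_coord_sphere)
 have xk: "continuous_on A (%x :: nat \<Rightarrow>\<^sub>C real. apply_bcontfun x k)" for A by (intro continuous_intros)
 have cl: "closed ?U" "closed ?L" by (intro continuous_on_closed_Collect_le S xk continuous_on_const)+
 have gp: "continuous_on ?S (%x. g (?p x))"
  by (rule continuous_on_compose2[OF g]) (intro continuous_intros, use drop_coord_in_ball(1) in blast)
 have gm: "continuous_on ?S (%x. - g (- ?p x))"
  by (rule continuous_on_minus, rule continuous_on_compose2[OF g])
   (intro continuous_intros, use drop_coord_in_ball(2) in blast)
 have "continuous_on (?U \<union> ?L) (%x. if 0 <= apply_bcontfun x k then g (?p x) else - g (- ?p x))"
 proof (rule continuous_on_cases[OF cl continuous_on_subset[OF gp] continuous_on_subset[OF gm]])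
  show "\<forall>x. x \<in> ?U & ~ 0 <= apply_bcontfun x k \<or> x \<in> ?L & 0 <= apply_bcontfun x k --> g (?p x) = - g (- ?p x)"
  proof (intro allI impI overlap)
   fix x assume x: "x \<in> ?U & ~ 0 <= apply_bcontfun x k \<or> x \<in> ?L & 0 <= apply_bcontfun x k"
   then show "x \<in> ?S" "x k = 0" by auto
  qed
 qed auto
 moreover have "?U \<union> ?L = ?S" by auto
 ultimately show "continuous_on ?S (glue_hemispheres k g)" unfolding glue_hemispheres_def by simp
 assume x: "x \<in> ?S"
 show "glue_hemispheres k g (- x) = - glue_hemispheres k g x"
 proof (cases "x k = 0")
  case True
  then show ?thesis using overlap[OF x True] by (simp add: glue_hemispheres_def)
 qed (auto simp: glue_hemispheres_def)
qed

text \<open>The functional \<open>E\<^sub>0 - l\<close> on an increasing sequence of spaces. Here \<open>w\<close> is a differentiable substitute for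
\<open>1 + r\<close>. Both final assumptions hold uniformly in \<open>n\<close>: there is no critical behaviour of \<open>E\<^sub>0\<close> far out at
energies of linear size, and \<open>E\<^sub>0 - C w\<close>, which lies below both \<open>E\<^sub>0 - l\<close> and \<open>E\<^sub>0 + l\<close>, is bounded below on a set
cut out by \<open>d\<close> odd functions.\<close>
locale perturbed_even_functional =
 fixes V :: "nat => 'a::real_normed_vector set" and r w :: "'a => real" and Dw :: "'a => 'a => real"
  and E\<^sub>0 :: "'a => real" and DE\<^sub>0 :: "'a => 'a => real" and l :: "'a => real" and C :: real
 assumes V_mono: "!!m n. m <= n ==> V m \<subseteq> V n"
  and E0: "!!n. C1_functional (V n) r E\<^sub>0 DE\<^sub>0"
  and w: "!!n. C1_functional (V n) r w Dw"
  and w_bounds: "!!n u. u \<in> V n ==> 1 <= w u & r u <= w u & w u <= 1 + r u"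
  and Dw_bound: "!!n u v. u \<in> V n ==> v \<in> V n ==> \<bar>Dw u v\<bar> <= r v"
  and even: "!!n u. u \<in> V n ==> E\<^sub>0 (- u) = E\<^sub>0 u & w (- u) = w u"
  and l_cont: "!!n. continuous_on (V n) l"
  and l_add: "!!n u v. u \<in> V n ==> v \<in> V n ==> l (u + v) = l u + l v"
  and l_scale: "!!n u c. u \<in> V n ==> l (c *\<^sub>R u) = c * l u"
  and C: "0 < C" and l_bound: "!!n u. u \<in> V n ==> \<bar>l u\<bar> <= C * r u"
  and no_critical_points_at_infinity: "!!B. \<exists>\<rho> n\<^sub>1. \<forall>n\<ge>n\<^sub>1. \<forall>u\<in>V n. \<rho> <= r u --> \<bar>E\<^sub>0 u\<bar> <= B * (1 + r u) -->
    (\<exists>\<xi>\<in>V n. r \<xi> <= 1 & B <= DE\<^sub>0 u \<xi>)"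
  and finite_index: "\<exists>d (\<Lambda> :: nat => 'a => real) M. (\<forall>i<d. \<forall>n. continuous_on (V n) (\<Lambda> i) & (\<forall>u\<in>V n. \<Lambda> i (- u) = - \<Lambda> i u))
    & (\<forall>n. \<forall>u\<in>V n. (\<forall>i<d. \<Lambda> i u = 0) --> - M <= E\<^sub>0 u - C * w u)"
begin

text \<open>In terms of the unit sphere of \<open>\<real>\<^sup>k\<close>; the space \<open>V n\<close> may depend on the map. For \<open>k = 0\<close> the sphere is
empty, so that \<open>odd_sphere 0 M\<close> holds for all \<open>M\<close>, which starts the search for a jump.\<close>
definition odd_sphere :: "nat => real => bool" where
 "odd_sphere k M \<longleftrightarrow> (\<exists>n h. continuous_on (coord_sphere k) h \<and>
  (\<forall>x\<in>coord_sphere k. h x \<in> V n & h (- x) = - h x & E\<^sub>0 (h x) - C * w (h x) < - M))"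

text \<open>By the Borsuk-Ulam theorem an odd image of the sphere in \<open>\<real>\<^sup>d\<^sup>+\<^sup>1\<close> meets the common zero set of \<open>d\<close> odd functions.\<close>
lemma odd_sphere_bounded: "\<exists>k M. ~ odd_sphere k M"
proof -
 obtain d and \<Lambda> :: "nat => 'a => real" and M where
  \<Lambda>: "\<forall>i<d. \<forall>n. continuous_on (V n) (\<Lambda> i) & (\<forall>u\<in>V n. \<Lambda> i (- u) = - \<Lambda> i u)" and
  M: "\<forall>n. \<forall>u\<in>V n. (\<forall>i<d. \<Lambda> i u = 0) --> - M <= E\<^sub>0 u - C * w u"
  using finite_index by (elim exE conjE)
 have cont: "continuous_on (V n) (\<Lambda> i)" and odd: "u \<in> V n ==> \<Lambda> i (- u) = - \<Lambda> i u" if "i < d" for i n u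
  using \<Lambda> that by simp_all
 have "~ odd_sphere (Suc d) M"
 proof
  assume "odd_sphere (Suc d) M"
  then obtain n h where hc: "continuous_on (coord_sphere (Suc d)) h"
   and h: "!!x. x \<in> coord_sphere (Suc d) ==> h x \<in> V n"
    "!!x. x \<in> coord_sphere (Suc d) ==> h (- x) = - h x"
    "!!x. x \<in> coord_sphere (Suc d) ==> E\<^sub>0 (h x) - C * w (h x) < - M"
   unfolding odd_sphere_def by auto
  define f where "f j x = \<Lambda> j (h ((1 / norm x) *\<^sub>R x))" for j and x :: "nat \<Rightarrow>\<^sub>C real"
  have "\<exists>x\<in>coord_space (Suc d). x ~= 0 & (\<forall>j<d. f j x = 0)"
  proof (rule borsuk_ulam)
   fix j assume j: "j < d"
   show "continuous_on (coord_space (Suc d) - {0}) (f j)" unfolding f_def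
    by (rule continuous_on_compose2[OF cont[OF j, of n]], rule continuous_on_compose2[OF hc])
     (use coord_space_normalize[of _ "Suc d"] h(1) in \<open>auto intro!: continuous_intros\<close>)
   fix x assume x: "x \<in> coord_space (Suc d)" "x ~= 0"
   show "f j (- x) = - f j x"
    using h(2)[OF coord_space_normalize[OF x]] odd[OF j h(1)[OF coord_space_normalize[OF x]]]
    by (simp add: f_def)
  qed
  then obtain x where x: "x \<in> coord_space (Suc d)" "x ~= 0" "!!j. j < d ==> f j x = 0" by auto
  let ?x = "(1 / norm x) *\<^sub>R x"
  have S: "?x \<in> coord_sphere (Suc d)" by (rule coord_space_normalize[OF x(1,2)])
  have "- M <= E\<^sub>0 (h ?x) - C * w (h ?x)"
   by (rule M[rule_format, OF h(1)[OF S]]) (use x(3) in \<open>simp add: f_def\<close>)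
  then show False using h(3)[OF S] by simp
 qed
 then show ?thesis by blast
qed

lemma odd_sphere_jump: obtains k M where "!!M'. odd_sphere k M'" "~ odd_sphere (Suc k) M"
proof -
 define k' where "k' = (LEAST k. \<exists>M. ~ odd_sphere k M)"
 have "\<exists>M. ~ odd_sphere k' M" unfolding k'_def by (rule LeastI_ex) (rule odd_sphere_bounded)
 then obtain M where M: "~ odd_sphere k' M" by auto
 have "odd_sphere 0 M'" for M' unfolding odd_sphere_def coord_sphere_0 by auto
 with M obtain k where k: "k' = Suc k" by (cases k') auto
 have "odd_sphere k M'" for M' using not_less_Least[of k "%k. \<exists>M. ~ odd_sphere k M"] k
  unfolding k'_def by auto
 with M k show ?thesis by (intro that[of k M]) auto
qed

lemma C1_functional_quotient:
 "C1_functional (V n) r (%u. E\<^sub>0 u / w u) (%u v. DE\<^sub>0 u v / w u - E\<^sub>0 u * Dw u v / (w u)\<^sup>2)"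
proof -
 interpret A: C1_functional "V n" r E\<^sub>0 DE\<^sub>0 by (rule E0)
 interpret B: C1_functional "V n" r w Dw by (rule w)
 have w0: "w u ~= 0" if "u \<in> V n" for u using w_bounds[OF that] by auto
 show ?thesis
 proof
  show "continuous_on (V n) (%u. E\<^sub>0 u / w u)" by (intro continuous_intros A.J_cont B.J_cont ballI w0)
  show "continuous_on (V n \<times> V n) (%x. DE\<^sub>0 (fst x) (snd x) / w (fst x) - E\<^sub>0 (fst x) * Dw (fst x) (snd x) / (w (fst x))\<^sup>2)"
   by (intro continuous_intros A.DJ_cont B.DJ_cont continuous_on_compose2[OF A.J_cont]
     continuous_on_compose2[OF B.J_cont]) (use w0 in auto)
  fix u v :: 'a and t :: real assume u: "u \<in> V n" and v: "v \<in> V n"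
  have uv: "u + t *\<^sub>R v \<in> V n" using u v A.V by (intro subspace_add subspace_scale)
  show "((%t. E\<^sub>0 (u + t *\<^sub>R v) / w (u + t *\<^sub>R v)) has_real_derivative
    DE\<^sub>0 (u + t *\<^sub>R v) v / w (u + t *\<^sub>R v) - E\<^sub>0 (u + t *\<^sub>R v) * Dw (u + t *\<^sub>R v) v / (w (u + t *\<^sub>R v))\<^sup>2) (at t)"
   using w0[OF uv] by (auto intro!: derivative_eq_intros A.DJ B.DJ u v simp: field_simps power2_eq_square)
 qed (use A.V A.r_triangle A.r_scale A.r_cont A.r_compact A.DJ_add A.DJ_scale B.DJ_add B.DJ_scale in
   \<open>auto simp: field_simps add_divide_distrib\<close>)
qed

lemma C1_functional_perturbed: "C1_functional (V n) r (%u. E\<^sub>0 u - l u) (%u v. DE\<^sub>0 u v - l v)"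
proof -
 interpret A: C1_functional "V n" r E\<^sub>0 DE\<^sub>0 by (rule E0)
 show ?thesis
 proof
  show "continuous_on (V n) (%u. E\<^sub>0 u - l u)" by (intro continuous_intros A.J_cont l_cont)
  show "continuous_on (V n \<times> V n) (%x. DE\<^sub>0 (fst x) (snd x) - l (snd x))"
   by (intro continuous_intros A.DJ_cont continuous_on_compose2[OF l_cont]) auto
  fix u v :: 'a and t :: real assume u: "u \<in> V n" and v: "v \<in> V n"
  have eq: "l (u + t *\<^sub>R v) = l u + t * l v" for t
   using l_add[OF u subspace_scale[OF A.V v]] l_scale[OF v] by simp
  show "((%t. E\<^sub>0 (u + t *\<^sub>R v) - l (u + t *\<^sub>R v)) has_real_derivative DE\<^sub>0 (u + t *\<^sub>R v) v - l v) (at t)"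
   unfolding eq by (auto intro!: derivative_eq_intros A.DJ u v)
 qed (use A.V A.r_triangle A.r_scale A.r_cont A.r_compact A.DJ_add A.DJ_scale l_add l_scale in
   \<open>auto simp: algebra_simps\<close>)
qed

text \<open>Low spheres for \<open>E\<^sub>0 - C w\<close> can be made low for \<open>E\<^sub>0 - l\<close>, although \<open>E\<^sub>0 - l\<close> is the larger of the two: the
even quotient \<open>E\<^sub>0 / w\<close> is deformed from values below \<open>C\<close> to values below \<open>- B + 1 = - C - M\<close>, by an odd map. Descent
directions of this quotient are those of \<open>E\<^sub>0\<close> scaled by \<open>w\<close>. A point of the sphere where the quotient exceeds \<open>- B\<close> has
large \<open>w\<close> if the sphere is low enough, so it starts out as far as the deformation requires; this determines \<open>M'\<close>.\<close>
lemma odd_sphere_below: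
 assumes k: "!!M'. odd_sphere k M'" and M: "0 <= M"
 obtains n h where "continuous_on (coord_sphere k) h" "!!x. x \<in> coord_sphere k ==> h x \<in> V n"
  "!!x. x \<in> coord_sphere k ==> h (- x) = - h x" "!!x. x \<in> coord_sphere k ==> E\<^sub>0 (h x) - l (h x) <= - M"
proof -
 define B where "B = C + M + 1"
 obtain \<rho> n\<^sub>1 where BL: "!!n u. n >= n\<^sub>1 ==> u \<in> V n ==> \<rho> <= r u ==> \<bar>E\<^sub>0 u\<bar> <= (B + 1) * (1 + r u) ==>
    \<exists>\<xi>\<in>V n. r \<xi> <= 1 & B + 1 <= DE\<^sub>0 u \<xi>"
  using no_critical_points_at_infinity[of "B + 1"] by blast
 define \<rho>' where "\<rho>' = \<bar>\<rho>\<bar> + 1"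
 let ?K = "\<rho>' * exp (32 * 1 * (C - (- B)))"
 define M' where "M' = ?K * (C + B)"
 have CB: "0 < C + B" using C M by (simp add: B_def)
 have M'0: "0 <= M'" using CB by (simp add: M'_def \<rho>'_def)
 obtain n0 h0 where hc: "continuous_on (coord_sphere k) h0"
   and h0: "!!x. x \<in> coord_sphere k ==> h0 x \<in> V n0 & h0 (- x) = - h0 x & E\<^sub>0 (h0 x) - C * w (h0 x) < - M'"
  using k[of M'] unfolding odd_sphere_def by auto
 define n where "n = max n0 n\<^sub>1"
 have hV: "h0 x \<in> V n" if "x \<in> coord_sphere k" for x
  using h0[OF that] V_mono[of n0 n] by (auto simp: n_def)
 interpret A: C1_functional "V n" r E\<^sub>0 DE\<^sub>0 by (rule E0)
 interpret J: C1_functional "V n" r "%u. E\<^sub>0 u / w u" "%u v. DE\<^sub>0 u v / w u - E\<^sub>0 u * Dw u v / (w u)\<^sup>2"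
  by (rule C1_functional_quotient)
 have w0: "0 < w u" if "u \<in> V n" for u using w_bounds[OF that] by auto
 have desc: "\<exists>\<xi>\<in>V n. 1 <= DE\<^sub>0 u \<xi> / w u - E\<^sub>0 u * Dw u \<xi> / (w u)\<^sup>2 & r \<xi> <= 1 * (1 + r u)"
  if u: "u \<in> V n" "\<rho>' <= 1 + r u" "- B <= E\<^sub>0 u / w u" "E\<^sub>0 u / w u <= C" for u
 proof -
  have B0: "0 <= B" using C M by (simp add: B_def)
  have q: "\<bar>E\<^sub>0 u / w u\<bar> <= B" using u(3,4) M unfolding B_def by (auto simp: abs_le_iff)
  then have "\<bar>E\<^sub>0 u\<bar> <= B * w u" using w0[OF u(1)] by (simp add: field_simps)
  also have "... <= (B + 1) * (1 + r u)"
   using w_bounds[OF u(1)] B0 by (intro mult_mono) auto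
  finally obtain \<xi> where \<xi>: "\<xi> \<in> V n" "r \<xi> <= 1" "B + 1 <= DE\<^sub>0 u \<xi>"
   using BL[of n u] u(1,2) abs_ge_self[of \<rho>] unfolding n_def \<rho>'_def by force
  have D: "\<bar>E\<^sub>0 u / w u * Dw u \<xi>\<bar> <= B * 1" unfolding abs_mult
   using q Dw_bound[OF u(1) \<xi>(1)] \<xi>(2) B0 by (intro mult_mono) auto
  let ?x = "w u *\<^sub>R \<xi>"
  have "DE\<^sub>0 u ?x / w u - E\<^sub>0 u * Dw u ?x / (w u)\<^sup>2 = w u * (DE\<^sub>0 u \<xi> / w u - E\<^sub>0 u * Dw u \<xi> / (w u)\<^sup>2)"
   by (rule J.DJ_scale[OF u(1) \<xi>(1)])
  also have "... = DE\<^sub>0 u \<xi> - E\<^sub>0 u / w u * Dw u \<xi>"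
   using w0[OF u(1)] by (simp add: field_simps power2_eq_square)
  finally have "1 <= DE\<^sub>0 u ?x / w u - E\<^sub>0 u * Dw u ?x / (w u)\<^sup>2" using \<xi>(3) D by linarith
  moreover have "r ?x <= 1 * (1 + r u)"
  proof -
   have "r ?x = w u * r \<xi>" using A.r_scale[OF \<xi>(1)] w0[OF u(1)] by simp
   also have "... <= (1 + r u) * 1" using w_bounds[OF u(1)] \<xi>(2) A.r_nonneg[OF \<xi>(1)] by (intro mult_mono) auto
   finally show ?thesis by simp
  qed
  moreover have "?x \<in> V n" by (rule subspace_scale[OF A.V \<xi>(1)])
  ultimately show ?thesis by blast
 qed
 have Sc: "compact (h0 ` coord_sphere k)" by (intro compact_continuous_image hc compact_coord_sphere)
 have S1: "E\<^sub>0 u / w u <= C" if "u \<in> h0 ` coord_sphere k" for u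
 proof -
  have "u \<in> V n" "E\<^sub>0 u - C * w u < - M'" using that h0 hV by auto
  then show ?thesis using w0[of u] M'0 by (auto simp: field_simps)
 qed
 have S2: "E\<^sub>0 u / w u <= - B \<or> \<rho>' * exp (32 * 1 * (C - (- B))) <= 1 + r u" if "u \<in> h0 ` coord_sphere k" for u
 proof (rule disjCI)
  assume neg: "~ \<rho>' * exp (32 * 1 * (C - (- B))) <= 1 + r u"
  have u: "u \<in> V n" "E\<^sub>0 u - C * w u < - M'" using that h0 hV by auto
  have "w u < ?K" using neg w_bounds[OF u(1)] by linarith
  then have "w u * (C + B) <= M'" unfolding M'_def using CB by (intro mult_right_mono) auto
  then have "E\<^sub>0 u <= - B * w u" using u(2) by (simp add: algebra_simps)
  then show "E\<^sub>0 u / w u <= - B" using w0[OF u(1)] by (simp add: field_simps)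
 qed
 have "- B < C" using CB by simp
 then obtain D where Dc: "continuous_on (V n) D" and DV: "\<forall>u\<in>V n. D u \<in> V n"
  and DJ: "\<forall>u\<in>h0 ` coord_sphere k. E\<^sub>0 (D u) / w (D u) < - B + 1"
  and Dodd: "(\<forall>u\<in>V n. E\<^sub>0 (- u) / w (- u) = E\<^sub>0 u / w u) --> (\<forall>u\<in>V n. D (- u) = - D u)"
  using J.deformation[of "- B" C 1 1 \<rho>' "h0 ` coord_sphere k", OF _ zero_less_one zero_less_one _ desc Sc _ S1 S2] hV
  by (auto simp: \<rho>'_def image_subset_iff)
 show ?thesis
 proof (rule that[of "D \<circ> h0" n])
  show "continuous_on (coord_sphere k) (D \<circ> h0)"
   by (rule continuous_on_compose[OF hc continuous_on_subset[OF Dc]]) (use hV in auto)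
  fix x assume x: "x \<in> coord_sphere k"
  show V: "(D \<circ> h0) x \<in> V n" using DV hV[OF x] by simp
  show "(D \<circ> h0) (- x) = - (D \<circ> h0) x"
   using Dodd hV[OF x] even h0[OF x] by simp
  let ?u = "(D \<circ> h0) x"
  have "E\<^sub>0 ?u / w ?u < - B + 1" using DJ x by simp
  then have "E\<^sub>0 ?u < (- B + 1) * w ?u" using w0[OF V] by (simp add: field_simps)
  then have "E\<^sub>0 ?u < - C * w ?u - M * w ?u" by (simp add: B_def algebra_simps)
  moreover have "C * r ?u <= C * w ?u" using w_bounds[OF V] C by (intro mult_left_mono) auto
  moreover have "M * 1 <= M * w ?u" using w_bounds[OF V] M by (intro mult_left_mono) auto
  ultimately show "E\<^sub>0 ?u - l ?u <= - M" using l_bound[OF V] by simp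
 qed
qed

text \<open>The factor \<open>1 + r u\<close> in front of the derivative (Cerami's condition) is what the deformation with speed of linear growth
provides. The levels \<open>\<alpha>\<close> and \<open>\<beta>\<close> depend only on the jump and on the cone over one low sphere in a fixed
\<open>V n\<^sub>0\<close>, so almost critical points occur in all larger spaces. The low sphere itself lies below level \<open>\<alpha>\<close> and is not moved by the deformation, which keeps
the boundary of the ball odd for gluing.\<close>
theorem almost_critical_points:
 "\<exists>\<alpha> \<beta>. \<forall>\<kappa>>0. \<forall>n\<^sub>1. \<exists>n\<ge>n\<^sub>1. \<exists>u\<in>V n. \<alpha> <= E\<^sub>0 u - l u & E\<^sub>0 u - l u <= \<beta> \<and>
  (\<forall>\<xi>\<in>V n. (1 + r u) * \<bar>DE\<^sub>0 u \<xi> - l \<xi>\<bar> <= \<kappa> * r \<xi>)"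
proof -
 obtain k M where k: "!!M'. odd_sphere k M'" and M: "~ odd_sphere (Suc k) M" using odd_sphere_jump by blast
 let ?E = "%u. E\<^sub>0 u - l u"
 obtain n\<^sub>0 h where hc: "continuous_on (coord_sphere k) h"
  and h: "!!x. x \<in> coord_sphere k ==> h x \<in> V n\<^sub>0" "!!x. x \<in> coord_sphere k ==> h (- x) = - h x"
   "!!x. x \<in> coord_sphere k ==> ?E (h x) <= - (\<bar>M\<bar> + 1)"
  by (rule odd_sphere_below[OF k, of "\<bar>M\<bar> + 1"]) auto
 let ?g = "cone_extension h"
 have gc: "continuous_on (coord_ball k) ?g" by (rule continuous_cone_extension[OF hc])
 interpret A0: C1_functional "V n\<^sub>0" r "%u. E\<^sub>0 u - l u" "%u v. DE\<^sub>0 u v - l v" by (rule C1_functional_perturbed)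
 have gV: "?g x \<in> V n\<^sub>0" if "x \<in> coord_ball k" for x
  using that h(1)[OF coord_space_normalize[of x k]] subspace_0[OF A0.V] subspace_scale[OF A0.V]
  by (auto simp: cone_extension_def coord_ball_def)
 define S where "S = ?g ` coord_ball k"
 have S: "compact S" unfolding S_def by (intro compact_continuous_image gc compact_coord_ball)
 have "compact (?E ` S)"
  by (intro compact_continuous_image S continuous_on_subset[OF A0.J_cont]) (use gV in \<open>auto simp: S_def\<close>)
 then have "bounded (?E ` S)" by (rule compact_imp_bounded)
 then obtain \<beta>0 where \<beta>0: "!!u. u \<in> S ==> \<bar>?E u\<bar> <= \<beta>0" unfolding bounded_iff by auto
 define \<alpha> where "\<alpha> = - (\<bar>M\<bar> + 1)"
 define \<beta> where "\<beta> = \<bar>\<beta>0\<bar>"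
 have ab: "\<alpha> < \<beta>" by (simp add: \<alpha>_def \<beta>_def)
 show ?thesis
 proof (rule exI[of _ \<alpha>], rule exI[of _ \<beta>], rule ccontr)
  assume "~ (\<forall>\<kappa>>0. \<forall>n\<^sub>1. \<exists>n\<ge>n\<^sub>1. \<exists>u\<in>V n. \<alpha> <= ?E u & ?E u <= \<beta> \<and>
   (\<forall>\<xi>\<in>V n. (1 + r u) * \<bar>DE\<^sub>0 u \<xi> - l \<xi>\<bar> <= \<kappa> * r \<xi>))"
  then obtain \<kappa> n\<^sub>1 where \<kappa>: "\<kappa> > 0" and neg: "!!n u. n >= n\<^sub>1 ==> u \<in> V n ==> \<alpha> <= ?E u ==> ?E u <= \<beta> ==>
   \<exists>\<xi>\<in>V n. \<kappa> * r \<xi> < (1 + r u) * \<bar>DE\<^sub>0 u \<xi> - l \<xi>\<bar>"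
   by (meson not_le)
  define n where "n = max n\<^sub>0 n\<^sub>1"
  have Vn: "V n\<^sub>0 \<subseteq> V n" by (rule V_mono) (simp add: n_def)
  interpret A: C1_functional "V n" r "%u. E\<^sub>0 u - l u" "%u v. DE\<^sub>0 u v - l v" by (rule C1_functional_perturbed)
  have desc: "\<exists>\<xi>\<in>V n. 1 <= DE\<^sub>0 u \<xi> - l \<xi> & r \<xi> <= (1 / \<kappa>) * (1 + r u)"
   if u: "u \<in> V n" "\<alpha> <= ?E u" "?E u <= \<beta>" for u
  proof -
   obtain \<xi> where \<xi>: "\<xi> \<in> V n" "\<kappa> * r \<xi> < (1 + r u) * \<bar>DE\<^sub>0 u \<xi> - l \<xi>\<bar>"
    using neg[of n u] u by (auto simp: n_def)
   let ?d = "DE\<^sub>0 u \<xi> - l \<xi>"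
   have d: "?d ~= 0"
   proof
    assume "?d = 0"
    then have "\<kappa> * r \<xi> < 0" using \<xi>(2) by simp
    moreover have "0 <= \<kappa> * r \<xi>" using A.r_nonneg[OF \<xi>(1)] \<kappa> by simp
    ultimately show False by simp
   qed
   let ?x = "(1 / ?d) *\<^sub>R \<xi>"
   have "DE\<^sub>0 u ?x - l ?x = 1" using A.DJ_scale[OF u(1) \<xi>(1), of "1 / ?d"] d by simp
   moreover have "r ?x <= (1 / \<kappa>) * (1 + r u)"
   proof -
    have "r ?x = r \<xi> / \<bar>?d\<bar>" using A.r_scale[OF \<xi>(1), of "1 / ?d"] by simp
    moreover have "\<kappa> * (r \<xi> / \<bar>?d\<bar>) < 1 + r u" using \<xi>(2) d by (simp add: field_simps)
    ultimately show ?thesis using \<kappa> by (simp add: field_simps)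
   qed
   moreover have "?x \<in> V n" by (rule subspace_scale[OF A.V \<xi>(1)])
   ultimately show ?thesis by (intro bexI[of _ ?x]) auto
  qed
  have "\<exists>D. continuous_on (V n) D & (\<forall>u\<in>V n. D u \<in> V n) & (\<forall>u\<in>S. ?E (D u) < \<alpha> + 1) \<and>
   (\<forall>u\<in>V n. ?E u <= \<alpha> --> D u = u) & ((\<forall>u\<in>V n. ?E (- u) = ?E u) --> (\<forall>u\<in>V n. D (- u) = - D u))"
  proof (rule A.deformation[of \<alpha> \<beta> 1 "1 / \<kappa>" 0 S])
   show "u \<in> S ==> ?E u <= \<beta>" for u using \<beta>0[of u] by (simp add: \<beta>_def)
   show "u \<in> S ==> ?E u <= \<alpha> \<or> 0 * exp (32 * (1 / \<kappa>) * (\<beta> - \<alpha>)) <= 1 + r u" for u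
    using A0.r_nonneg[of u] gV by (auto simp: S_def)
   show "S \<subseteq> V n" using gV Vn by (auto simp: S_def)
  qed (use ab \<kappa> desc S in auto)
  then obtain D where Dc: "continuous_on (V n) D" and DV: "!!u. u \<in> V n ==> D u \<in> V n"
   and DJ: "!!u. u \<in> S ==> ?E (D u) < \<alpha> + 1" and Dfix: "!!u. u \<in> V n ==> ?E u <= \<alpha> ==> D u = u"
   by metis
  let ?G = "D \<circ> ?g"
  have gVn: "?g x \<in> V n" if "x \<in> coord_ball k" for x using gV[OF that] Vn by auto
  have Gc: "continuous_on (coord_ball k) ?G"
   by (rule continuous_on_compose[OF gc continuous_on_subset[OF Dc]]) (use gVn in auto)
  have GV: "?G x \<in> V n" if "x \<in> coord_ball k" for x using DV[OF gVn[OF that]] by simp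
  have Glow: "?E (?G x) < - M" if "x \<in> coord_ball k" for x
   using DJ[of "?g x"] that by (auto simp: S_def \<alpha>_def)
  have Gh: "?G x = h x" if "x \<in> coord_sphere k" for x
   using Dfix[of "h x"] h(1,3)[OF that] Vn cone_extension_sphere[OF that, of h] by (auto simp: \<alpha>_def)
  have low: "E\<^sub>0 u - C * w u < - M" if "u \<in> V n" "?E u < - M" for u
  proof -
   have "C * r u <= C * w u" using w_bounds[OF that(1)] C by (intro mult_left_mono) auto
   then show ?thesis using l_bound[OF that(1)] that(2) by (simp add: abs_le_iff)
  qed
  have "odd_sphere (Suc k) M" unfolding odd_sphere_def
  proof (intro exI[of _ n] exI[of _ "glue_hemispheres k ?G"] conjI ballI)
   have odd: "?G (- x) = - ?G x" if "x \<in> coord_sphere k" for x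
    using Gh[OF that] Gh[OF coord_sphere_minus[OF that]] h(2)[OF that] by simp
   show "continuous_on (coord_sphere (Suc k)) (glue_hemispheres k ?G)"
    by (rule glue_hemispheres(1)[OF Gc odd])
   fix x assume x: "x \<in> coord_sphere (Suc k)"
   show "glue_hemispheres k ?G (- x) = - glue_hemispheres k ?G x"
    by (rule glue_hemispheres(2)[OF Gc odd x])
   show "glue_hemispheres k ?G x \<in> V n"
    using GV[OF drop_coord_in_ball(1)[OF x]] GV[OF drop_coord_in_ball(2)[OF x]] subspace_neg[OF A.V]
    unfolding glue_hemispheres_def by (simp del: o_apply)
   show "E\<^sub>0 (glue_hemispheres k ?G x) - C * w (glue_hemispheres k ?G x) < - M"
    using low[OF GV Glow, OF drop_coord_in_ball(1)[OF x] drop_coord_in_ball(1)[OF x]]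
     low[OF GV Glow, OF drop_coord_in_ball(2)[OF x] drop_coord_in_ball(2)[OF x]]
     even[OF GV[OF drop_coord_in_ball(2)[OF x]]]
    unfolding glue_hemispheres_def by (simp del: o_apply)
  qed
  with M show False ..
 qed
qed

end

section \<open>Pointwise inequalities for the p-th power of the norm\<close>

text \<open>The gradient of \<open>|a|^p / p\<close>. With \<open>a = \<nabla> u\<close> it is the flux of the p-Laplacian; with real \<open>a\<close> it is
\<open>|u|^(p-2) u\<close>.\<close>
definition duality_map :: "real => 'e::euclidean_space => 'e" where
 "duality_map p a = norm a powr (p - 2) *\<^sub>R a"

lemma duality_map_zero [simp]: "duality_map p 0 = 0"
 by (simp add: duality_map_def)

lemma norm_duality_map: "norm (duality_map p a) = norm a powr (p - 1)"
proof (cases "a = 0")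
 case False
 have "norm a powr (p - 2) * norm a = norm a powr (p - 2) * norm a powr 1" using False by simp
 also have "... = norm a powr (p - 1)" unfolding powr_add[symmetric] by simp
 finally show ?thesis by (simp add: duality_map_def)
qed simp

lemma duality_map_inner_self: "1 < p ==> duality_map p a \<bullet> a = norm a powr p"
proof (cases "a = 0")
 case False
 have "norm a powr (p - 2) * (norm a)\<^sup>2 = norm a powr (p - 2) * norm a powr 2"
  using False by (simp add: powr_numeral)
 also have "... = norm a powr p" unfolding powr_add[symmetric] by simp
 finally show ?thesis by (simp add: duality_map_def power2_norm_eq_inner)
qed simp

lemma duality_map_inner_le: "\<bar>duality_map p a \<bullet> b\<bar> <= norm a powr (p - 1) * norm b"
 using Cauchy_Schwarz_ineq2[of "duality_map p a" b] by (simp add: norm_duality_map)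

lemma duality_map_scale: "c > 0 ==> duality_map p (c *\<^sub>R a) = c powr (p - 1) *\<^sub>R duality_map p a"
proof -
 assume c: "c > 0"
 have "c powr (p - 2) * c = c powr (p - 2) * c powr 1" using c by simp
 also have "... = c powr (p - 1)" unfolding powr_add[symmetric] by simp
 finally have e: "c powr (p - 2) * c = c powr (p - 1)" .
 have "duality_map p (c *\<^sub>R a) = (norm a powr (p - 2) * (c powr (p - 2) * c)) *\<^sub>R a"
  using c by (simp add: duality_map_def powr_mult mult_ac)
 then show ?thesis unfolding e by (simp add: duality_map_def mult_ac)
qed

lemma duality_map_real: "duality_map p (s::real) = \<bar>s\<bar> powr (p - 2) * s"
 by (simp add: duality_map_def)

lemma continuous_duality_map: "1 < p ==> continuous_on UNIV (duality_map p :: 'e::euclidean_space => 'e)"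
 unfolding continuous_on_def
proof (intro ballI)
 fix a :: 'e assume p: "1 < p"
 show "(duality_map p \<longlongrightarrow> duality_map p a) (at a within UNIV)"
 proof (cases "a = 0")
  case True
  have "((%x::'e. norm x powr (p - 1)) \<longlongrightarrow> norm (0::'e) powr (p - 1)) (at 0)"
   using p by (intro tendsto_powr' tendsto_norm tendsto_ident_at tendsto_const) auto
  then have "((%x::'e. norm (duality_map p x)) \<longlongrightarrow> 0) (at 0)" by (simp add: norm_duality_map)
  then show ?thesis unfolding True by (simp add: tendsto_norm_zero_iff)
 next
  case False
  then show ?thesis unfolding duality_map_def
   by (intro tendsto_intros) auto
 qed
qed

lemmas continuous_on_duality_map [continuous_intros] = continuous_on_compose2[OF continuous_duality_map _ subset_UNIV]

lemma measurable_duality_map [measurable]: "duality_map p \<in> borel_measurable borel"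
 unfolding duality_map_def[abs_def] by measurable

text \<open>The graph of the strictly convex function \<open>t powr p\<close> lies above its tangent at 1.\<close>
lemma Bernoulli_powr_strict:
 fixes p t :: real
 assumes p: "1 < p" and t: "0 <= t" "t ~= 1"
 shows "p * t < p - 1 + t powr p"
proof -
 have D: "((%x. x powr p) has_real_derivative p * x powr (p - 1)) (at x)" if "0 < x" for x :: real
  using that by (auto intro!: derivative_eq_intros)
 consider "t = 0" | "0 < t" "t < 1" | "1 < t" using t by linarith
 then show ?thesis
 proof cases
  case 2
  have "\<exists>z>t. z < 1 & 1 powr p - t powr p = (1 - t) * (p * z powr (p - 1))"
   by (rule MVT2) (use D 2 in auto)
  then obtain z where z: "t < z" "z < 1" "1 - t powr p = (1 - t) * (p * z powr (p - 1))" by auto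
  have "z powr (p - 1) < 1 powr (p - 1)" using z 2 p by (intro powr_less_mono2) auto
  then have "(1 - t) * (p * z powr (p - 1)) < (1 - t) * (p * 1)"
   using 2 p by (intro mult_strict_left_mono) auto
  then show ?thesis using z(3) by (simp add: algebra_simps)
 next
  case 3
  have "\<exists>z>1. z < t & t powr p - 1 powr p = (t - 1) * (p * z powr (p - 1))"
   by (rule MVT2) (use D 3 in auto)
  then obtain z where z: "1 < z" "z < t" "t powr p - 1 = (t - 1) * (p * z powr (p - 1))" by auto
  have "1 powr (p - 1) < z powr (p - 1)" using z p by (intro powr_less_mono2) auto
  then have "(t - 1) * (p * 1) < (t - 1) * (p * z powr (p - 1))"
   using 3 p by (intro mult_strict_left_mono) auto
  then show ?thesis using z(3) by (simp add: algebra_simps)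
 qed (use p in simp)
qed

lemma Young_strict:
 fixes p x y :: real
 assumes p: "1 < p" and "0 <= x" "0 <= y" "x ~= y"
 shows "p * (x powr (p - 1) * y) < (p - 1) * x powr p + y powr p"
proof (cases "x = 0")
 case True
 then show ?thesis using assms by simp
next
 case False
 then have x: "x > 0" using assms by simp
 have e: "x powr (p - 1) * x = x powr p"
 proof -
  have "x powr (p - 1) * x = x powr (p - 1) * x powr 1" using x by simp
  then show ?thesis unfolding powr_add[symmetric] by simp
 qed
 have "p * (y / x) < p - 1 + (y / x) powr p"
  by (rule Bernoulli_powr_strict) (use assms x in auto)
 then have "x powr p * (p * (y / x)) < x powr p * (p - 1 + (y / x) powr p)"
  using x by (intro mult_strict_left_mono) auto
 moreover have "x powr p * (p * (y / x)) = p * (x powr (p - 1) * y)"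
  using x by (simp add: e[symmetric])
 moreover have "x powr p * (p - 1 + (y / x) powr p) = (p - 1) * x powr p + y powr p"
  using x by (simp add: powr_divide algebra_simps)
 ultimately show ?thesis by simp
qed

lemma powr_minus_one_mult: "0 <= x ==> x powr (p - 1) * x = x powr p" for x p :: real
 using powr_mult_base[of x "p - 1"] by (simp add: mult.commute)

lemma Young_weighted:
 fixes p x y :: real
 assumes p: "1 < p" and "0 <= x" "0 <= y"
 shows "p * (x powr (p - 1) * y) <= (p - 1) * x powr p + y powr p"
 using Young_strict[OF assms] powr_minus_one_mult[OF assms(2), of p]
 by (cases "x = y") (auto simp: algebra_simps)

text \<open>Strict convexity of \<open>|a|^p\<close>. If \<open>|a| = |b|\<close>, strictness comes from the Cauchy-Schwarz inequality, otherwise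
from Young's inequality.\<close>
lemma norm_powr_tangent_strict:
 fixes a b :: "'e::euclidean_space"
 assumes p: "1 < p" and "a ~= b"
 shows "norm a powr p + p * (duality_map p a \<bullet> (b - a)) < norm b powr p"
proof -
 have "p * (duality_map p a \<bullet> b) < (p - 1) * norm a powr p + norm b powr p"
 proof (cases "norm a = norm b")
  case False
  have "p * (duality_map p a \<bullet> b) <= p * (norm a powr (p - 1) * norm b)"
   using duality_map_inner_le[of p a b] p by (intro mult_left_mono) auto
  also have "... < (p - 1) * norm a powr p + norm b powr p"
   by (rule Young_strict[OF p]) (use False in auto)
  finally show ?thesis .
 next
  case True
  then have a0: "a ~= 0" using assms(2) by auto
  have "0 < (norm (a - b))\<^sup>2" using assms(2) by simp
  then have "a \<bullet> b < (norm a)\<^sup>2"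
   using True by (simp add: power2_norm_eq_inner inner_diff inner_commute norm_eq)
  then have "norm a powr (p - 2) * (a \<bullet> b) < norm a powr (p - 2) * (norm a)\<^sup>2"
   using a0 by (intro mult_strict_left_mono) auto
  then have "duality_map p a \<bullet> b < duality_map p a \<bullet> a"
   by (simp add: duality_map_def power2_norm_eq_inner)
  then have "p * (duality_map p a \<bullet> b) < p * norm a powr p"
   using p by (simp add: duality_map_inner_self)
  then show ?thesis using True by (simp add: algebra_simps)
 qed
 then show ?thesis using duality_map_inner_self[OF p, of a]
  by (simp add: inner_diff_right algebra_simps)
qed

lemma norm_powr_tangent:
 fixes a b :: "'e::euclidean_space"
 assumes p: "1 < p"
 shows "norm a powr p + p * (duality_map p a \<bullet> (b - a)) <= norm b powr p"
 using norm_powr_tangent_strict[OF p, of a b] by (cases "a = b") auto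

text \<open>By homogeneity it suffices to compare \<open>F\<close> and \<open>G\<close> on the compact set where the norms add up to 1. There \<open>F \<ge> \<epsilon>\<close>
forces \<open>G > 0\<close>, hence a bound for \<open>F / G\<close>. This one principle replaces separate estimates for \<open>p < 2\<close> and \<open>p \<ge> 2\<close>.\<close>
lemma homogeneous_compactness:
 fixes F G :: "'e::euclidean_space => 'e => real"
 assumes s: "0 < s" and F: "continuous_on UNIV (%x. F (fst x) (snd x))" and G: "continuous_on UNIV (%x. G (fst x) (snd x))"
  and Fh: "!!c a b. 0 < c ==> F (c *\<^sub>R a) (c *\<^sub>R b) = c powr s * F a b"
  and Gh: "!!c a b. 0 < c ==> G (c *\<^sub>R a) (c *\<^sub>R b) = c powr s * G a b"
  and G0: "!!a b. 0 <= G a b" and FG: "!!a b. G a b = 0 ==> F a b <= 0" and \<epsilon>: "0 < \<epsilon>"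
 shows "\<exists>C\<ge>0. \<forall>a b. F a b <= \<epsilon> * (norm a powr s + norm b powr s) + C * G a b"
proof -
 let ?n = "%a b::'e. norm a powr s + norm b powr s"
 have nc: "continuous_on UNIV (%x::'e\<times>'e. ?n (fst x) (snd x))"
  using s by (intro continuous_intros continuous_on_powr') auto
 define S where "S = {x :: 'e \<times> 'e. ?n (fst x) (snd x) = 1}"
 have "closed S" unfolding S_def by (intro closed_Collect_eq nc continuous_on_const)
 moreover have "norm x <= 2" if "x \<in> S" for x
 proof -
  have "norm (fst x) powr s + norm (snd x) powr s = 1" using that by (simp add: S_def)
  then have "norm (fst x) powr s <= 1" "norm (snd x) powr s <= 1"
   using powr_ge_zero[of "norm (fst x)" s] powr_ge_zero[of "norm (snd x)" s] by linarith+
  moreover have "1 < norm y powr s" if "1 < norm y" for y :: 'e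
   using powr_less_mono2[OF s _ that] by simp
  ultimately have "norm (fst x) <= 1" "norm (snd x) <= 1" by (meson not_le)+
  then show ?thesis using norm_Pair_le[of "fst x" "snd x"] by simp
 qed
 then have "bounded S" unfolding bounded_iff by blast
 ultimately have S: "compact S" by (simp add: compact_eq_bounded_closed)
 define K where "K = S \<inter> {x. \<epsilon> <= F (fst x) (snd x)}"
 have K: "compact K" unfolding K_def
  by (intro compact_Int_closed S closed_Collect_le F continuous_on_const)
 have Gpos: "0 < G (fst x) (snd x)" if "x \<in> K" for x
  using that FG[of "fst x" "snd x"] G0[of "fst x" "snd x"] \<epsilon> by (force simp: K_def)
 have "\<exists>C\<ge>0. \<forall>x\<in>K. F (fst x) (snd x) <= C * G (fst x) (snd x)"
 proof (cases "K = {}")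
  case False
  have "continuous_on K (%x. F (fst x) (snd x) / G (fst x) (snd x))"
   by (intro continuous_intros continuous_on_subset[OF F] continuous_on_subset[OF G])
    (use Gpos in force)+
  from continuous_attains_sup[OF K False this] obtain x0 where
   x0: "!!x. x \<in> K ==> F (fst x) (snd x) / G (fst x) (snd x) <= F (fst x0) (snd x0) / G (fst x0) (snd x0)" by blast
  show ?thesis
  proof (intro exI[of _ "\<bar>F (fst x0) (snd x0) / G (fst x0) (snd x0)\<bar>"] conjI ballI)
   fix x assume x: "x \<in> K"
   have "F (fst x) (snd x) / G (fst x) (snd x) <= \<bar>F (fst x0) (snd x0) / G (fst x0) (snd x0)\<bar>"
    using x0[OF x] by linarith
   then show "F (fst x) (snd x) <= \<bar>F (fst x0) (snd x0) / G (fst x0) (snd x0)\<bar> * G (fst x) (snd x)"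
    using Gpos[OF x] by (simp add: pos_divide_le_eq)
  qed simp
 qed auto
 then obtain C where C: "0 <= C" "!!x. x \<in> K ==> F (fst x) (snd x) <= C * G (fst x) (snd x)" by auto
 have onS: "F a b <= \<epsilon> + C * G a b" if "(a, b) \<in> S" for a b
 proof (cases "\<epsilon> <= F a b")
  case True
  then have "(a, b) \<in> K" using that by (simp add: K_def)
  from C(2)[OF this] show ?thesis using \<epsilon> by simp
 next
  case False
  have "0 <= C * G a b" using C(1) G0 by simp
  then show ?thesis using False by linarith
 qed
 show ?thesis
 proof (intro exI[of _ C] conjI allI C(1))
  fix a b :: 'e
  show "F a b <= \<epsilon> * ?n a b + C * G a b"
  proof (cases "a = 0 & b = 0")
   case True
   have "F 0 0 = 2 powr s * F 0 0" using Fh[of 2 0 0] by simp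
   moreover have "2 powr s > 1" using s by simp
   ultimately have "F 0 0 = 0" using s by auto
   then show ?thesis using True C(1) G0[of 0 0] by simp
  next
   case False
   define t where "t = ?n a b"
   have t: "t > 0" unfolding t_def using False by (auto simp: add_nonneg_pos add_pos_nonneg)
   define c where "c = t powr (- (1 / s))"
   have c: "c > 0" using t by (simp add: c_def)
   have cs: "c powr s = 1 / t" unfolding c_def powr_powr using t s by (simp add: powr_minus_divide)
   have "?n (c *\<^sub>R a) (c *\<^sub>R b) = c powr s * ?n a b" using c by (simp add: powr_mult algebra_simps)
   also have "... = 1" unfolding cs t_def[symmetric] using t by simp
   finally have "(c *\<^sub>R a, c *\<^sub>R b) \<in> S" by (simp add: S_def)
   from onS[OF this] have "F a b / t <= \<epsilon> + C * (G a b / t)"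
    using Fh[OF c] Gh[OF c] by (simp add: cs)
   then have "t * (F a b / t) <= t * (\<epsilon> + C * (G a b / t))" using t by (intro mult_left_mono) auto
   then show ?thesis using t unfolding t_def[symmetric] by (simp add: algebra_simps)
  qed
 qed
qed

lemma continuous_norm_powr [continuous_intros]:
 fixes f :: "'x::topological_space => 'e::real_normed_vector"
 assumes "0 < s" "continuous_on A f"
 shows "continuous_on A (%x. norm (f x) powr s)"
 using assms by (intro continuous_on_powr' continuous_intros) auto

text \<open>A quantitative form of uniform convexity: when the tangent inequality for \<open>|a|^p\<close> is nearly an equality, \<open>a\<close> and \<open>b\<close>
are close.\<close>
lemma tangent_defect_controls_distance:
 assumes p: "1 < p" and \<epsilon>: "0 < \<epsilon>"
 shows "\<exists>C\<ge>0. \<forall>a b :: 'e::euclidean_space. norm (b - a) powr p <= \<epsilon> * (norm a powr p + norm b powr p)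
  + C * (norm b powr p - norm a powr p - p * (duality_map p a \<bullet> (b - a)))"
proof (rule homogeneous_compactness)
 show "continuous_on UNIV (%x::'e\<times>'e. norm (snd x - fst x) powr p)"
  using p by (intro continuous_intros) auto
 show "continuous_on UNIV (%x::'e\<times>'e. norm (snd x) powr p - norm (fst x) powr p - p * (duality_map p (fst x) \<bullet> (snd x - fst x)))"
  using p by (intro continuous_intros) auto
 fix c :: real and a b :: 'e assume c: "0 < c"
 have e: "c *\<^sub>R b - c *\<^sub>R a = c *\<^sub>R (b - a)" by (simp add: algebra_simps)
 show "norm (c *\<^sub>R b - c *\<^sub>R a) powr p = c powr p * norm (b - a) powr p"
  unfolding e norm_scaleR powr_mult using c by simp
 have cp: "c powr p = c powr (p - 1) * c" using c by (simp add: powr_minus_one_mult)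
 show "norm (c *\<^sub>R b) powr p - norm (c *\<^sub>R a) powr p - p * (duality_map p (c *\<^sub>R a) \<bullet> (c *\<^sub>R b - c *\<^sub>R a))
   = c powr p * (norm b powr p - norm a powr p - p * (duality_map p a \<bullet> (b - a)))"
  unfolding e duality_map_scale[OF c] norm_scaleR powr_mult inner_scaleR_left inner_scaleR_right
  using c by (simp add: cp algebra_simps)
next
 fix a b :: 'e
 show "0 <= norm b powr p - norm a powr p - p * (duality_map p a \<bullet> (b - a))" using norm_powr_tangent[OF p, of a b] by simp
 show "norm (b - a) powr p <= 0" if "norm b powr p - norm a powr p - p * (duality_map p a \<bullet> (b - a)) = 0"
  using that norm_powr_tangent_strict[OF p, of a b] by (cases "a = b") auto
qed (use p \<epsilon> in auto)

lemma duality_map_continuity_pointwise: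
 assumes p: "1 < p" and \<epsilon>: "0 < \<epsilon>"
 shows "\<exists>C\<ge>0. \<forall>a b :: 'e::euclidean_space. norm (duality_map p (a + b) - duality_map p a)
  <= \<epsilon> * norm a powr (p - 1) + C * norm b powr (p - 1)"
proof -
 have "\<exists>C\<ge>0. \<forall>a b :: 'e. norm (duality_map p (a + b) - duality_map p a)
   <= \<epsilon> * (norm a powr (p - 1) + norm b powr (p - 1)) + C * norm b powr (p - 1)"
 proof (rule homogeneous_compactness)
  show "continuous_on UNIV (%x::'e\<times>'e. norm (duality_map p (fst x + snd x) - duality_map p (fst x)))"
   using p by (intro continuous_intros) auto
  show "continuous_on UNIV (%x::'e\<times>'e. norm (snd x) powr (p - 1))"
   using p by (intro continuous_intros) auto
  fix c :: real and a b :: 'e assume c: "0 < c"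
  have e: "c *\<^sub>R a + c *\<^sub>R b = c *\<^sub>R (a + b)" by (simp add: algebra_simps)
  show "norm (duality_map p (c *\<^sub>R a + c *\<^sub>R b) - duality_map p (c *\<^sub>R a))
    = c powr (p - 1) * norm (duality_map p (a + b) - duality_map p a)"
   unfolding e duality_map_scale[OF c] scaleR_diff_right[symmetric] by simp
  show "norm (c *\<^sub>R b) powr (p - 1) = c powr (p - 1) * norm b powr (p - 1)"
   using c by (simp add: powr_mult)
 qed (use p \<epsilon> in auto)
 then obtain C where C: "0 <= C" "!!a b :: 'e. norm (duality_map p (a + b) - duality_map p a)
   <= \<epsilon> * (norm a powr (p - 1) + norm b powr (p - 1)) + C * norm b powr (p - 1)" by auto
 show ?thesis
  by (rule exI[of _ "\<epsilon> + C"]) (use C \<epsilon> in \<open>auto simp: algebra_simps\<close>)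
qed

text \<open>By convexity the remainder lies between 0 and its value with the derivative taken at the other end point.\<close>
lemma norm_powr_expansion_pointwise:
 assumes p: "1 < p"
 shows "\<bar>norm (a + b) powr p - norm a powr p - p * (duality_map p a \<bullet> b)\<bar>
  <= p * (norm (duality_map p (a + b) - duality_map p a) * norm b)"
proof -
 have "norm (a + b) powr p - norm a powr p - p * (duality_map p a \<bullet> b) <= p * ((duality_map p (a + b) - duality_map p a) \<bullet> b)"
  using norm_powr_tangent[OF p, of "a + b" a] by (simp add: inner_diff_left algebra_simps)
 also have "... <= p * (norm (duality_map p (a + b) - duality_map p a) * norm b)"
  using p by (intro mult_left_mono norm_cauchy_schwarz) simp
 finally show ?thesis using norm_powr_tangent[OF p, of a "a + b"] by (simp add: abs_le_iff)
qed

section \<open>Spaces of p-integrable functions\<close>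

text \<open>Functions rather than classes, with values in a Euclidean space, so that gradients are included.\<close>
definition Lp :: "'x measure => real => ('x => 'e::euclidean_space) set" where
 "Lp M p = {f \<in> borel_measurable M. integrable M (%x. norm (f x) powr p)}"

definition Lp_norm :: "'x measure => real => ('x => 'e::euclidean_space) => real" where
 "Lp_norm M p f = (LINT x|M. norm (f x) powr p) powr (1 / p)"

abbreviation Lp_dist :: "'x measure => real => ('x => 'e::euclidean_space) => ('x => 'e) => real" where
 "Lp_dist M p f g \<equiv> Lp_norm M p (%x. f x - g x)"

abbreviation Lp_tendsto :: "'x measure => real => (nat => 'x => 'e::euclidean_space) => ('x => 'e) => bool" where
 "Lp_tendsto M p u f \<equiv> (%n. Lp_dist M p (u n) f) \<longlonglongrightarrow> 0"

abbreviation Lp_Cauchy :: "'x measure => real => (nat => 'x => 'e::euclidean_space) => bool" where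
 "Lp_Cauchy M p u \<equiv> \<forall>e>0. \<exists>N. \<forall>m\<ge>N. \<forall>n\<ge>N. Lp_dist M p (u m) (u n) < e"

lemma abs_integral_le:
 fixes f g :: "'x => real"
 assumes "integrable M f" "integrable M g" "!!x. x \<in> space M ==> \<bar>f x\<bar> <= g x"
 shows "\<bar>LINT x|M. f x\<bar> <= (LINT x|M. g x)"
 by (rule order_trans[OF integral_abs_bound integral_mono]) (use assms in auto)

text \<open>Coefficients are normalised to be bounded by 1; their size is put into the measure.\<close>
definition coefficient :: "'x measure => ('x => real) => bool" where
 "coefficient M b \<longleftrightarrow> b \<in> borel_measurable M & (\<forall>x\<in>space M. \<bar>b x\<bar> <= 1)"

lemma coefficientD: "coefficient M b ==> b \<in> borel_measurable M" "coefficient M b ==> x \<in> space M ==> \<bar>b x\<bar> <= 1"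
 by (auto simp: coefficient_def)

lemma coefficient_1: "coefficient M (%_. 1)" by (simp add: coefficient_def)

lemma LpD: "f \<in> Lp M p ==> f \<in> borel_measurable M" "f \<in> Lp M p ==> integrable M (%x. norm (f x) powr p)"
 by (auto simp: Lp_def)

lemma Lp_norm_nonneg [simp]: "0 <= Lp_norm M p f"
 by (simp add: Lp_norm_def)

lemma integral_norm_powr_nonneg: "0 <= (LINT x|M. norm (f x) powr p)"
 by (rule integral_nonneg_AE) simp

lemma Lp_norm_powr: "0 < p ==> Lp_norm M p f powr p = (LINT x|M. norm (f x) powr p)"
 using integral_norm_powr_nonneg[where f = f and p = p and M = M] by (simp add: Lp_norm_def powr_powr)

lemma norm_add_powr_le:
 fixes a b :: "'e::real_normed_vector"
 assumes "0 < p"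
 shows "norm (a + b) powr p <= 2 powr p * (norm a powr p + norm b powr p)"
proof -
 have "norm (a + b) <= 2 * max (norm a) (norm b)" using norm_triangle_ineq[of a b] by linarith
 then have "norm (a + b) powr p <= (2 * max (norm a) (norm b)) powr p" using assms by (intro powr_mono2) auto
 also have "... = 2 powr p * max (norm a) (norm b) powr p" by (rule powr_mult)
 also have "max (norm a) (norm b) powr p <= norm a powr p + norm b powr p" by (simp add: max_def)
 finally show ?thesis by simp
qed

lemma Lp_add:
 assumes "0 < p" "f \<in> Lp M p" "g \<in> Lp M p"
 shows "(%x. f x + g x) \<in> Lp M p"
 unfolding Lp_def
proof (safe)
 note [measurable] = LpD(1)[OF assms(2)] LpD(1)[OF assms(3)]
 show "(%x. f x + g x) \<in> borel_measurable M" by measurable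
 show "integrable M (%x. norm (f x + g x) powr p)"
 proof (rule Bochner_Integration.integrable_bound)
  show "integrable M (%x. 2 powr p * (norm (f x) powr p + norm (g x) powr p))"
   using LpD(2)[OF assms(2)] LpD(2)[OF assms(3)] by simp
  show "AE x in M. norm (norm (f x + g x) powr p) <= norm (2 powr p * (norm (f x) powr p + norm (g x) powr p))"
   using norm_add_powr_le[OF assms(1)] by (intro AE_I2) simp
 qed measurable
qed

lemma Lp_minus: "f \<in> Lp M p ==> (%x. - f x) \<in> Lp M p"
 by (auto simp: Lp_def)

lemma Lp_diff:
 assumes "0 < p" "f \<in> Lp M p" "g \<in> Lp M p"
 shows "(%x. f x - g x) \<in> Lp M p"
 using Lp_add[OF assms(1,2) Lp_minus[OF assms(3)]] by simp

lemma Lp_norm_scaleR: "0 < p ==> Lp_norm M p (%x. c *\<^sub>R f x) = \<bar>c\<bar> * Lp_norm M p f"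
 by (simp add: Lp_norm_def powr_mult powr_powr)

lemma Lp_norm_minus: "Lp_norm M p (%x. - f x) = Lp_norm M p f"
 by (simp add: Lp_norm_def)

lemma Lp_norm_minus_commute: "Lp_norm M p (%x. f x - g x) = Lp_norm M p (%x. g x - f x)"
 by (simp add: Lp_norm_def norm_minus_commute)

lemma Lp_norm_le_powr_iff:
 assumes "0 < p" "0 <= s" "(LINT x|M. norm (f x) powr p) <= s powr p"
 shows "Lp_norm M p f <= s"
proof -
 have "Lp_norm M p f <= (s powr p) powr (1 / p)"
  unfolding Lp_norm_def using assms integral_norm_powr_nonneg by (intro powr_mono2) auto
 then show ?thesis using assms by (simp add: powr_powr)
qed

lemma integrable_duality_product:
 assumes p: "1 < p" and f: "f \<in> Lp M p" and g: "g \<in> Lp M p"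
 shows "integrable M (%x. norm (f x) powr (p - 1) * norm (g x))"
proof (rule Bochner_Integration.integrable_bound)
 note [measurable] = LpD(1)[OF f] LpD(1)[OF g]
 show "integrable M (%x. norm (f x) powr p + norm (g x) powr p)" using LpD(2)[OF f] LpD(2)[OF g] by simp
 show "(%x. norm (f x) powr (p - 1) * norm (g x)) \<in> borel_measurable M" by measurable
 show "AE x in M. norm (norm (f x) powr (p - 1) * norm (g x)) <= norm (norm (f x) powr p + norm (g x) powr p)"
 proof (rule AE_I2)
  fix x
  have "p * (norm (f x) powr (p - 1) * norm (g x)) <= (p - 1) * norm (f x) powr p + norm (g x) powr p"
   by (rule Young_weighted[OF p]) auto
  also have "... <= p * (norm (f x) powr p + norm (g x) powr p)"
   using p mult_right_mono[of 1 p "norm (g x) powr p"] by (simp add: algebra_simps add_increasing)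
  finally show "norm (norm (f x) powr (p - 1) * norm (g x)) <= norm (norm (f x) powr p + norm (g x) powr p)"
   using p by simp
 qed
qed

lemma Lp_norm_zero_AE:
 assumes "0 < p" "f \<in> Lp M p" "Lp_norm M p f = 0"
 shows "AE x in M. f x = 0"
proof -
 have "(LINT x|M. norm (f x) powr p) = 0" using Lp_norm_powr[OF assms(1), of M f] assms(1,3) by simp
 then have "AE x in M. norm (f x) powr p = 0" using integral_nonneg_eq_0_iff_AE[OF LpD(2)[OF assms(2)]] by simp
 then show ?thesis by eventually_elim simp
qed

lemma Hoelder:
 assumes p: "1 < p" and f: "f \<in> Lp M p" and g: "g \<in> Lp M p"
 shows "(LINT x|M. norm (f x) powr (p - 1) * norm (g x)) <= Lp_norm M p f powr (p - 1) * Lp_norm M p g"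
proof (cases "Lp_norm M p f = 0 \<or> Lp_norm M p g = 0")
 case True
 then have "AE x in M. norm (f x) powr (p - 1) * norm (g x) = 0"
  using Lp_norm_zero_AE[OF _ f] Lp_norm_zero_AE[OF _ g] p by (auto elim: eventually_mono)
 then show ?thesis by (simp add: integral_eq_zero_AE)
next
 case False
 let ?s = "Lp_norm M p f" and ?t = "Lp_norm M p g"
 have pos: "0 < ?s" "0 < ?t" using False by (auto simp: less_le)
 have "(LINT x|M. norm (f x) powr (p - 1) * norm (g x))
  <= (LINT x|M. (?s powr (p - 1) * ?t / p) * ((p - 1) * (norm (f x) powr p / ?s powr p) + norm (g x) powr p / ?t powr p))"
 proof (rule integral_mono[OF integrable_duality_product[OF p f g]])
  fix x
  have "(?s powr (p - 1) * ?t / p) * (p * ((norm (f x) / ?s) powr (p - 1) * (norm (g x) / ?t)))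
    <= (?s powr (p - 1) * ?t / p) * ((p - 1) * (norm (f x) / ?s) powr p + (norm (g x) / ?t) powr p)"
   using p by (intro mult_left_mono Young_weighted) auto
  moreover have "(?s powr (p - 1) * ?t / p) * (p * ((norm (f x) / ?s) powr (p - 1) * (norm (g x) / ?t))) = norm (f x) powr (p - 1) * norm (g x)"
   using pos p by (simp add: powr_divide)
  ultimately show "norm (f x) powr (p - 1) * norm (g x) <= (?s powr (p - 1) * ?t / p) * ((p - 1) * (norm (f x) powr p / ?s powr p) + norm (g x) powr p / ?t powr p)"
   by (simp only: powr_divide)
 qed (use LpD(2)[OF f] LpD(2)[OF g] in simp)
 also have "... = (?s powr (p - 1) * ?t / p) * ((p - 1) * (?s powr p / ?s powr p) + ?t powr p / ?t powr p)"
  using LpD(2)[OF f] LpD(2)[OF g] p by (simp add: Lp_norm_powr)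
 also have "... = ?s powr (p - 1) * ?t" using pos p by simp
 finally show ?thesis .
qed

text \<open>From the inequality of Hoelder applied to \<open>|f + g|^(p-1)\<close> and the two summands.\<close>
lemma Minkowski:
 assumes p: "1 < p" and f: "f \<in> Lp M p" and g: "g \<in> Lp M p"
 shows "Lp_norm M p (%x. f x + g x) <= Lp_norm M p f + Lp_norm M p g"
proof (rule ccontr)
 let ?h = "%x. f x + g x" and ?s = "Lp_norm M p f + Lp_norm M p g"
 assume "~ ?thesis"
 then have less: "?s < Lp_norm M p ?h" by simp
 then have pos: "0 < Lp_norm M p ?h" using Lp_norm_nonneg[of M p f] Lp_norm_nonneg[of M p g] by linarith
 have h: "?h \<in> Lp M p" by (rule Lp_add[OF _ f g]) (use p in simp)
 note i = integrable_duality_product[OF p h f] integrable_duality_product[OF p h g]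
 have "Lp_norm M p ?h powr p <= (LINT x|M. norm (?h x) powr (p - 1) * norm (f x) + norm (?h x) powr (p - 1) * norm (g x))"
  unfolding Lp_norm_powr[OF less_trans[OF zero_less_one p]]
 proof (rule integral_mono[OF LpD(2)[OF h]])
  fix x
  have "norm (?h x) powr p = norm (?h x) powr (p - 1) * norm (?h x)" by (simp add: powr_minus_one_mult)
  also have "... <= norm (?h x) powr (p - 1) * (norm (f x) + norm (g x))" by (intro mult_left_mono norm_triangle_ineq) simp
  finally show "norm (?h x) powr p <= norm (?h x) powr (p - 1) * norm (f x) + norm (?h x) powr (p - 1) * norm (g x)"
   by (simp add: distrib_left)
 qed (use i in simp)
 also have "... <= Lp_norm M p ?h powr (p - 1) * ?s"
  using Hoelder[OF p h f] Hoelder[OF p h g] i by (simp add: distrib_left)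
 also have "... < Lp_norm M p ?h powr (p - 1) * Lp_norm M p ?h" using less pos by (intro mult_strict_left_mono) auto
 finally show False by (simp add: powr_minus_one_mult)
qed

lemma Minkowski_diff:
 assumes p: "1 < p" and f: "f \<in> Lp M p" and g: "g \<in> Lp M p"
 shows "Lp_norm M p f <= Lp_norm M p g + Lp_dist M p f g"
 using Minkowski[OF p g Lp_diff[OF _ f g]] p by simp

lemma Lp_norm_mono_exponent:
 fixes f :: "'x => 'e::euclidean_space"
 assumes "finite_measure M" and q: "1 < q" "q < p" and f: "f \<in> Lp M p"
 shows "f \<in> Lp M q" "Lp_norm M q f <= measure M (space M) powr ((p - q) / (p * q)) * Lp_norm M p f"
proof -
 interpret finite_measure M by fact
 note [measurable] = LpD(1)[OF f]
 define s where "s = p / (p - q)"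
 let ?F = "%x. norm (f x) powr (p - q)"
 have s: "1 < s" "(p - q) * (s - 1) = q" "(p - q) * s = p" using q by (auto simp: s_def field_simps)
 have F: "?F \<in> Lp M s" using LpD(2)[OF f] q by (simp add: Lp_def powr_powr s(3))
 have one: "(%_. 1 :: real) \<in> Lp M s" by (simp add: Lp_def)
 have e: "norm (?F x) powr (s - 1) * norm (1::real) = norm (f x) powr q" for x by (simp add: powr_powr s(2))
 show "f \<in> Lp M q" using integrable_duality_product[OF s(1) F one] unfolding e by (simp add: Lp_def)
 have "(LINT x|M. norm (f x) powr q) <= Lp_norm M s ?F powr (s - 1) * Lp_norm M s (%_. 1 :: real)"
  using Hoelder[OF s(1) F one] unfolding e .
 also have "Lp_norm M s ?F powr (s - 1) = Lp_norm M p f powr q"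
 proof -
  have "1 / s * (s - 1) = q / p" using q by (simp add: s_def field_simps)
  then show ?thesis by (simp add: Lp_norm_def powr_powr s(3))
 qed
 also have "Lp_norm M s (%_. 1 :: real) = (measure M (space M) powr ((p - q) / (p * q))) powr q"
  using q by (simp add: Lp_norm_def powr_powr s_def)
 finally show "Lp_norm M q f <= measure M (space M) powr ((p - q) / (p * q)) * Lp_norm M p f"
  using q by (intro Lp_norm_le_powr_iff) (auto simp: powr_mult mult.commute)
qed

subsection \<open>Power functionals\<close>

abbreviation Lp_pairing :: "'x measure => real => ('x => real) => ('x => 'e::euclidean_space) => ('x => 'e) => real" where
 "Lp_pairing M p b f g \<equiv> LINT x|M. b x * (duality_map p (f x) \<bullet> g x)"

abbreviation Lp_weighted :: "'x measure => real => ('x => real) => ('x => 'e::euclidean_space) => real" where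
 "Lp_weighted M p b f \<equiv> LINT x|M. b x * norm (f x) powr p"

text \<open>The remainder of the first order Taylor expansion of \<open>Lp_weighted\<close>.\<close>
abbreviation Lp_remainder :: "'x measure => real => ('x => real) => ('x => 'e::euclidean_space) => ('x => 'e) => real" where
 "Lp_remainder M p b f g \<equiv> Lp_weighted M p b (%x. f x + g x) - Lp_weighted M p b f - p * Lp_pairing M p b f g"

lemma integrable_duality_pairing:
 assumes p: "1 < p" and f: "f \<in> Lp M p" and g: "g \<in> Lp M p" and b: "coefficient M b"
 shows "integrable M (%x. b x * (duality_map p (f x) \<bullet> g x))"
  "\<bar>LINT x|M. b x * (duality_map p (f x) \<bullet> g x)\<bar> <= Lp_norm M p f powr (p - 1) * Lp_norm M p g"
proof -
 note [measurable] = LpD(1)[OF f] LpD(1)[OF g] coefficientD(1)[OF b]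
 have le: "\<bar>b x * (duality_map p (f x) \<bullet> g x)\<bar> <= norm (f x) powr (p - 1) * norm (g x)" if "x \<in> space M" for x
  using mult_mono[OF coefficientD(2)[OF b that] duality_map_inner_le[of p "f x" "g x"]] by (simp add: abs_mult)
 show i: "integrable M (%x. b x * (duality_map p (f x) \<bullet> g x))"
  by (rule Bochner_Integration.integrable_bound[OF integrable_duality_product[OF p f g]])
   (use le in \<open>auto intro!: AE_I2\<close>)
 show "\<bar>LINT x|M. b x * (duality_map p (f x) \<bullet> g x)\<bar> <= Lp_norm M p f powr (p - 1) * Lp_norm M p g"
  using abs_integral_le[OF i integrable_duality_product[OF p f g] le] Hoelder[OF p f g] by simp
qed

lemma exists_small_factor:
 fixes \<epsilon> A :: real
 assumes "0 < \<epsilon>" "0 <= A"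
 shows "\<exists>e>0. e * A <= \<epsilon>"
 using assms by (intro exI[of _ "\<epsilon> / (A + 1)"]) (simp add: field_simps)

abbreviation duality_increment :: "real => ('x => 'e::euclidean_space) => ('x => 'e) => ('x => 'e) => 'x => real" where
 "duality_increment p f f' g x \<equiv> norm (duality_map p (f' x) - duality_map p (f x)) * norm (g x)"

text \<open>Continuity of the duality map from \<open>L\<^sup>p\<close> to its dual, in integrated form: the pointwise bound
\<open>\<epsilon> |f|^(p-1) + C |f' - f|^(p-1)\<close> is paired with \<open>g\<close> by Hoelder's inequality.\<close>
lemma duality_map_continuity:
 fixes f :: "'x => 'e::euclidean_space"
 assumes p: "1 < p" and f: "f \<in> Lp M p" and \<epsilon>: "0 < \<epsilon>"
 shows "\<exists>\<delta>>0. \<forall>f'\<in>Lp M p. \<forall>g\<in>Lp M p. Lp_dist M p f' f < \<delta> -->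
  integrable M (duality_increment p f f' g) \<and>
  (LINT x|M. duality_increment p f f' g x) <= \<epsilon> * Lp_norm M p g"
proof -
 let ?F = "Lp_norm M p f powr (p - 1)"
 obtain e where e: "0 < e" "e * ?F <= \<epsilon> / 2" using exists_small_factor[of "\<epsilon> / 2" ?F] \<epsilon> by auto
 obtain C where C: "0 <= C" "!!a b :: 'e. norm (duality_map p (a + b) - duality_map p a) <= e * norm a powr (p - 1) + C * norm b powr (p - 1)"
  using duality_map_continuity_pointwise[OF p e(1)] by auto
 obtain d where d: "0 < d" "d * C <= \<epsilon> / 2" using exists_small_factor[of "\<epsilon> / 2" C] \<epsilon> C(1) by auto
 show ?thesis
 proof (intro exI[of _ "d powr (1 / (p - 1))"] conjI ballI impI)
  show "0 < d powr (1 / (p - 1))" using d by simp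
  fix f' g :: "'x => 'e" assume f': "f' \<in> Lp M p" and g: "g \<in> Lp M p" and close: "Lp_dist M p f' f < d powr (1 / (p - 1))"
  note [measurable] = LpD(1)[OF f] LpD(1)[OF f'] LpD(1)[OF g]
  have h: "(%x. f' x - f x) \<in> Lp M p" by (rule Lp_diff[OF _ f' f]) (use p in simp)
  let ?k = "%x. e * (norm (f x) powr (p - 1) * norm (g x)) + C * (norm (f' x - f x) powr (p - 1) * norm (g x))"
  note i = integrable_duality_product[OF p f g] integrable_duality_product[OF p h g]
  have le: "duality_increment p f f' g x <= ?k x" for x
   using mult_right_mono[OF C(2)[of "f x" "f' x - f x"], of "norm (g x)"] by (simp add: distrib_right mult.assoc)
  show j: "integrable M (duality_increment p f f' g)"
   by (rule Bochner_Integration.integrable_bound[of M ?k]) (use i order_trans[OF le abs_ge_self] in auto)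
  have "Lp_dist M p f' f powr (p - 1) <= (d powr (1 / (p - 1))) powr (p - 1)" using close p by (intro powr_mono2) auto
  then have "Lp_dist M p f' f powr (p - 1) <= d" using p d(1) by (simp add: powr_powr)
  from mult_left_mono[OF this C(1)] have small: "e * ?F + C * Lp_dist M p f' f powr (p - 1) <= \<epsilon>" using e(2) d(2) by (simp add: mult.commute)
  have "(LINT x|M. duality_increment p f f' g x) <= (LINT x|M. ?k x)"
   by (rule integral_mono[OF j _ le]) (use i in simp)
  also have "... = e * (LINT x|M. norm (f x) powr (p - 1) * norm (g x)) + C * (LINT x|M. norm (f' x - f x) powr (p - 1) * norm (g x))"
   using i by simp
  also have "... <= e * (?F * Lp_norm M p g) + C * (Lp_dist M p f' f powr (p - 1) * Lp_norm M p g)"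
   using e C(1) by (intro add_mono mult_left_mono Hoelder[OF p] f g h) auto
  also have "... <= \<epsilon> * Lp_norm M p g" using mult_right_mono[OF small Lp_norm_nonneg[of M p g]] by (simp add: algebra_simps)
  finally show "(LINT x|M. duality_increment p f f' g x) <= \<epsilon> * Lp_norm M p g" .
 qed
qed

lemma Lp_norm_tendsto:
 assumes p: "1 < p" and f: "f \<in> Lp M p" and u: "!!n. u n \<in> Lp M p"
  and lim: "Lp_tendsto M p u f"
 shows "(%n. Lp_norm M p (u n)) \<longlonglongrightarrow> Lp_norm M p f"
proof (rule LIM_zero_cancel, rule Lim_null_comparison[OF _ lim], rule always_eventually, rule allI)
 fix n
 have "Lp_norm M p (u n) <= Lp_norm M p f + Lp_norm M p (%x. u n x - f x)"
  by (rule Minkowski_diff[OF p u f])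
 moreover have "Lp_norm M p f <= Lp_norm M p (u n) + Lp_norm M p (%x. u n x - f x)"
  using Minkowski_diff[OF p f u[of n]] by (simp add: Lp_norm_minus_commute)
 ultimately show "norm (Lp_norm M p (u n) - Lp_norm M p f) <= Lp_norm M p (%x. u n x - f x)"
  by (simp add: abs_le_iff)
qed

lemma duality_pairing_tendsto:
 fixes f g :: "'x => 'e::euclidean_space"
 assumes p: "1 < p" and f: "f \<in> Lp M p" and u: "!!n. u n \<in> Lp M p" and g: "g \<in> Lp M p" and v: "!!n. v n \<in> Lp M p"
  and lim_u: "Lp_tendsto M p u f" and lim_v: "Lp_tendsto M p v g" and b: "coefficient M b"
 shows "(%n. LINT x|M. b x * (duality_map p (u n x) \<bullet> v n x)) \<longlonglongrightarrow> Lp_pairing M p b f g"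
proof -
 let ?B = "%f g. LINT x|M. b x * (duality_map p (f x) \<bullet> (g x :: 'e))"
 have p0: "0 < p" using p by simp
 note i = integrable_duality_pairing(1)[OF p _ _ b]
 obtain K where K: "0 < K" "!!n. Lp_norm M p (v n) <= K"
  using convergent_imp_Bseq[OF convergentI[OF Lp_norm_tendsto[OF p g v lim_v]]] unfolding Bseq_def by auto
 have 1: "(%n. ?B (u n) (v n) - ?B f (v n)) \<longlonglongrightarrow> 0"
 proof (rule LIMSEQ_I)
  fix e :: real assume "0 < e"
  then have e: "0 < e / (2 * K)" using K by simp
  from duality_map_continuity[OF p f this] obtain \<delta> where \<delta>: "0 < \<delta>" and H: "\<forall>f'\<in>Lp M p. \<forall>g\<in>Lp M p. Lp_dist M p f' f < \<delta> -->
  integrable M (duality_increment p f f' g) \<and>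
  (LINT x|M. duality_increment p f f' g x) <= e / (2 * K) * Lp_norm M p g"
   by (elim exE conjE) (rule that)
  obtain N where N: "!!n. N <= n ==> Lp_dist M p (u n) f < \<delta>"
   using order_tendstoD(2)[OF lim_u \<delta>] by (auto simp: eventually_sequentially)
  have "\<bar>?B (u n) (v n) - ?B f (v n)\<bar> < e" if "N <= n" for n
  proof -
   note h = H[rule_format, OF u v N[OF that]]
   have "?B (u n) (v n) - ?B f (v n) = (LINT x|M. b x * ((duality_map p (u n x) - duality_map p (f x)) \<bullet> v n x))"
    using i[OF u v] i[OF f v] by (subst Bochner_Integration.integral_diff[symmetric]) (auto simp: inner_diff_left right_diff_distrib)
   also have "\<bar>...\<bar> <= (LINT x|M. duality_increment p f (u n) (v n) x)"
   proof (rule abs_integral_le[OF _ conjunct1[OF h]])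
    show "integrable M (%x. b x * ((duality_map p (u n x) - duality_map p (f x)) \<bullet> v n x))"
     using i[OF u v] i[OF f v] by (simp add: inner_diff_left right_diff_distrib)
    show "\<bar>b x * ((duality_map p (u n x) - duality_map p (f x)) \<bullet> v n x)\<bar> <= duality_increment p f (u n) (v n) x"
     if "x \<in> space M" for x
     using mult_mono[OF coefficientD(2)[OF b that] Cauchy_Schwarz_ineq2[of "duality_map p (u n x) - duality_map p (f x)" "v n x"]] by (simp add: abs_mult)
   qed
   also have "... <= e / (2 * K) * K" using conjunct2[OF h] mult_left_mono[OF K(2) less_imp_le[OF e]] by (rule order_trans)
   also have "... < e" using K \<open>0 < e\<close> by simp
   finally show ?thesis by simp
  qed
  then show "\<exists>N. \<forall>n\<ge>N. norm (?B (u n) (v n) - ?B f (v n) - 0) < e" by auto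
 qed
 have 2: "(%n. ?B f (v n) - ?B f g) \<longlonglongrightarrow> 0"
 proof (rule Lim_null_comparison[OF always_eventually])
  show "(%n. Lp_norm M p f powr (p - 1) * Lp_dist M p (v n) g) \<longlonglongrightarrow> 0" using tendsto_mult_right_zero[OF lim_v] .
  show "\<forall>n. norm (?B f (v n) - ?B f g) <= Lp_norm M p f powr (p - 1) * Lp_dist M p (v n) g"
   using integrable_duality_pairing(2)[OF p f Lp_diff[OF p0 v g] b] i[OF f v] i[OF f g] by (simp add: inner_diff_right right_diff_distrib)
 qed
 show ?thesis using tendsto_add[OF 1 2] by (simp add: LIM_zero_iff)
qed

lemma power_functional_eq_pairing:
 "1 < p ==> (Lp_weighted M p b f) = Lp_pairing M p b f f"
 by (simp add: duality_map_inner_self)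

text \<open>Frechet differentiability: the pointwise remainder is an increment of the duality map times \<open>g\<close>.\<close>
lemma power_functional_differentiable:
 fixes f :: "'x => 'e::euclidean_space"
 assumes p: "1 < p" and f: "f \<in> Lp M p" and b: "coefficient M b" and \<epsilon>: "0 < \<epsilon>"
 shows "\<exists>\<delta>>0. \<forall>g\<in>Lp M p. Lp_norm M p g < \<delta> -->
  \<bar>Lp_remainder M p b f g\<bar> <= \<epsilon> * Lp_norm M p g"
proof -
 have p0: "0 < p" using p by simp
 have "0 < \<epsilon> / p" using \<epsilon> p by simp
 from duality_map_continuity[OF p f this] obtain \<delta> where \<delta>: "0 < \<delta>" and H: "\<forall>f'\<in>Lp M p. \<forall>g\<in>Lp M p. Lp_dist M p f' f < \<delta> -->
  integrable M (duality_increment p f f' g) \<and>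
  (LINT x|M. duality_increment p f f' g x) <= \<epsilon> / p * Lp_norm M p g"
  by (elim exE conjE) (rule that)
 show ?thesis
 proof (intro exI[of _ \<delta>] conjI ballI impI \<delta>)
  fix g :: "'x => 'e" assume g: "g \<in> Lp M p" and small: "Lp_norm M p g < \<delta>"
  have fg: "(%x. f x + g x) \<in> Lp M p" by (rule Lp_add[OF p0 f g])
  let ?D = "%x. norm (duality_map p (f x + g x) - duality_map p (f x)) * norm (g x)"
  let ?h = "%x. b x * norm (f x + g x) powr p - b x * norm (f x) powr p - p * (b x * (duality_map p (f x) \<bullet> g x))"
  have D: "integrable M ?D" "(LINT x|M. ?D x) <= \<epsilon> / p * Lp_norm M p g" using H[rule_format, OF fg g] small by simp_all
  note i = integrable_duality_pairing(1)[OF p fg fg b] integrable_duality_pairing(1)[OF p f f b] integrable_duality_pairing(1)[OF p f g b]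
  have "\<bar>LINT x|M. ?h x\<bar> <= (LINT x|M. p * ?D x)"
  proof (rule abs_integral_le)
   show "integrable M ?h" using i by (simp add: duality_map_inner_self[OF p])
   fix x assume "x \<in> space M"
   have "?h x = b x * (norm (f x + g x) powr p - norm (f x) powr p - p * (duality_map p (f x) \<bullet> g x))" by (simp add: algebra_simps)
   then show "\<bar>?h x\<bar> <= p * ?D x"
    using mult_mono[OF coefficientD(2)[OF b \<open>x \<in> space M\<close>] norm_powr_expansion_pointwise[OF p, of "f x" "g x"]] by (simp add: abs_mult)
  qed (use D in simp)
  also have "... <= \<epsilon> * Lp_norm M p g" using mult_left_mono[OF D(2), of p] p by simp
  finally show "\<bar>Lp_remainder M p b f g\<bar> <= \<epsilon> * Lp_norm M p g"
   using i by (simp add: duality_map_inner_self[OF p])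
 qed
qed

text \<open>The form used for the energy, where \<open>g\<close> depends linearly on a direction of size \<open>t\<close>.\<close>
corollary power_functional_differentiable_linear_bound:
 fixes f :: "'x => 'e::euclidean_space"
 assumes p: "1 < p" and f: "f \<in> Lp M p" and b: "coefficient M b" and \<epsilon>: "0 < \<epsilon>" and K: "0 <= K"
 shows "\<exists>\<delta>>0. \<forall>g\<in>Lp M p. \<forall>t. 0 <= t --> t < \<delta> --> Lp_norm M p g <= K * t -->
  \<bar>c * (Lp_remainder M p b f g)\<bar> <= \<epsilon> * t"
proof -
 let ?R = "Lp_remainder M p b f"
 obtain e where e: "0 < e" "e * (\<bar>c\<bar> * K) <= \<epsilon>" using exists_small_factor[OF \<epsilon>, of "\<bar>c\<bar> * K"] K by auto
 obtain d where d: "0 < d" "!!g. g \<in> Lp M p ==> Lp_norm M p g < d ==> \<bar>?R g\<bar> <= e * Lp_norm M p g"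
  using power_functional_differentiable[OF p f b e(1)] by blast
 obtain \<delta> where \<delta>: "0 < \<delta>" "\<delta> * K <= d / 2" using exists_small_factor[of "d / 2" K] d(1) K by auto
 have "\<bar>c * ?R g\<bar> <= \<epsilon> * t" if g: "g \<in> Lp M p" and t: "0 <= t" "t < \<delta>" and bd: "Lp_norm M p g <= K * t" for g t
 proof -
  have "K * t <= K * \<delta>" using t K by (intro mult_left_mono) auto
  then have "\<bar>?R g\<bar> <= e * (K * t)"
   using bd \<delta>(2) d(1) e(1) by (intro order_trans[OF d(2)[OF g]] mult_left_mono) (auto simp: mult.commute)
  then have "\<bar>c\<bar> * \<bar>?R g\<bar> <= \<bar>c\<bar> * (e * (K * t))" by (rule mult_left_mono) simp
  also have "... <= \<epsilon> * t" using mult_right_mono[OF e(2) t(1)] by (simp add: ac_simps)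
  finally show ?thesis by (simp only: abs_mult)
 qed
 then show ?thesis using \<delta>(1) by blast
qed

subsection \<open>Completeness and strong convergence\<close>

lemma Lp_imp_integrable:
 fixes f :: "'x => 'e::euclidean_space"
 assumes "finite_measure M" and p: "1 < p" and f: "f \<in> Lp M p"
 shows "integrable M f" "(LINT x|M. norm (f x)) <= Lp_norm M p (%_. 1 :: real) powr (p - 1) * Lp_norm M p f"
proof -
 interpret finite_measure M by fact
 have one: "(%_. 1 :: real) \<in> Lp M p" by (simp add: Lp_def)
 have "integrable M (%x. norm (f x))" using integrable_duality_product[OF p one f] by simp
 then show "integrable M f" using LpD(1)[OF f] by (simp add: integrable_norm_iff)
 show "(LINT x|M. norm (f x)) <= Lp_norm M p (%_. 1 :: real) powr (p - 1) * Lp_norm M p f"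
  using Hoelder[OF p one f] by simp
qed

text \<open>Riesz and Fischer: a subsequence with summable increments converges almost everywhere, and Fatou's lemma
identifies its pointwise limit as the limit in norm.\<close>
theorem Lp_complete:
 fixes u :: "nat => 'x => 'e::euclidean_space"
 assumes M: "finite_measure M" and p: "1 < p" and u: "!!n. u n \<in> Lp M p" and Cauchy: "Lp_Cauchy M p u"
 shows "\<exists>f\<in>Lp M p. Lp_tendsto M p u f"
proof -
 have p0: "0 < p" using p by simp
 have d: "(%x. u m x - u n x) \<in> Lp M p" for m n by (rule Lp_diff[OF p0 u u])
 note [measurable] = LpD(1)[OF u]
 have "\<forall>k. \<exists>N. \<forall>m\<ge>N. \<forall>n\<ge>N. Lp_dist M p (u m) (u n) < (1/2) ^ k" using Cauchy by simp
 then obtain N where N: "!!k m n. N k <= m ==> N k <= n ==> Lp_dist M p (u m) (u n) < (1/2) ^ k" by metis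
 define r where "r k = (\<Sum>i\<le>k. N i) + k" for k
 have rN: "N k <= r k" for k unfolding r_def by (intro trans_le_add1 member_le_sum) auto
 have r: "strict_mono r" by (rule strict_monoI_Suc) (simp add: r_def)
 define v where "v k x = u (r (Suc k)) x - u (r k) x" for k x
 have [measurable]: "v k \<in> borel_measurable M" for k unfolding v_def[abs_def] by measurable
 let ?c = "Lp_norm M p (%_. 1 :: real) powr (p - 1)"
 have "(\<integral>\<^sup>+x. ennreal (norm (v k x)) \<partial>M) <= ennreal (?c * (1/2) ^ k)" for k
 proof -
  have vL: "v k \<in> Lp M p" unfolding v_def[abs_def] by (rule d)
  have "Lp_norm M p (v k) <= (1/2) ^ k"
   unfolding v_def[abs_def] using rN[of k] strict_monoD[OF r, of k "Suc k"] by (intro less_imp_le[OF N]) auto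
  then have "(LINT x|M. norm (v k x)) <= ?c * (1/2) ^ k"
   using Lp_imp_integrable(2)[OF M p vL] by (meson mult_left_mono order_trans powr_ge_zero)
  then show ?thesis using nn_integral_eq_integral[OF integrable_norm[OF Lp_imp_integrable(1)[OF M p vL]]] by (simp add: ennreal_leI)
 qed
 then have "(\<Sum>k. \<integral>\<^sup>+x. ennreal (norm (v k x)) \<partial>M) <= (\<Sum>k. ennreal (?c * (1/2) ^ k))"
  by (intro suminf_le summableI)
 moreover have "(\<integral>\<^sup>+x. (\<Sum>k. ennreal (norm (v k x))) \<partial>M) = (\<Sum>k. \<integral>\<^sup>+x. ennreal (norm (v k x)) \<partial>M)"
  by (rule nn_integral_suminf) measurable
 ultimately have "(\<integral>\<^sup>+x. (\<Sum>k. ennreal (norm (v k x))) \<partial>M) <= (\<Sum>k. ennreal (?c * (1/2) ^ k))" by simp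
 also have "... = ennreal (\<Sum>k. ?c * (1/2) ^ k)" by (rule suminf_ennreal2) (auto intro!: summable_mult summable_geometric)
 also have "... < \<infinity>" by simp
 finally have "(\<integral>\<^sup>+x. (\<Sum>k. ennreal (norm (v k x))) \<partial>M) ~= \<infinity>" by simp
 then have "AE x in M. (\<Sum>k. ennreal (norm (v k x))) ~= \<infinity>" by (intro nn_integral_PInf_AE) measurable
 then have conv: "AE x in M. convergent (%k. u (r k) x)"
 proof eventually_elim
  case (elim x)
  have "summable (%k. norm (v k x))" by (rule summable_suminf_not_top[OF norm_ge_zero]) (use elim in simp)
  then have "summable (%k. v k x)" by (rule summable_norm_cancel)
  then have "convergent (%n. \<Sum>k<n. v k x)" unfolding summable_iff_convergent .
  moreover have "(\<Sum>k<n. v k x) = u (r n) x - u (r 0) x" for n unfolding v_def by (induction n) auto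
  ultimately have "convergent (%n. (u (r n) x - u (r 0) x) + u (r 0) x)" by (intro convergent_add convergent_const) simp
  then show ?case by simp
 qed
 define f where "f x = lim (%k. u (r k) x)" for x
 have [measurable]: "f \<in> borel_measurable M" unfolding f_def[abs_def] by measurable
 have conv_f: "AE x in M. (%k. u (r k) x) \<longlonglongrightarrow> f x"
  using conv by eventually_elim (simp add: f_def convergent_LIMSEQ_iff)
 have Fatou: "(%x. u n x - f x) \<in> Lp M p & Lp_dist M p (u n) f <= e"
  if e: "0 < e" "!!m. m >= n ==> Lp_dist M p (u n) (u m) < e" for n e
 proof -
  have "(\<integral>\<^sup>+x. ennreal (norm (u n x - f x) powr p) \<partial>M)
   <= (\<integral>\<^sup>+x. liminf (%k. ennreal (norm (u n x - u (r k) x) powr p)) \<partial>M)"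
  proof (rule nn_integral_mono_AE)
   show "AE x in M. ennreal (norm (u n x - f x) powr p) <= liminf (%k. ennreal (norm (u n x - u (r k) x) powr p))"
    using conv_f
   proof eventually_elim
    case (elim x)
    have "(%k. ennreal (norm (u n x - u (r k) x) powr p)) \<longlonglongrightarrow> ennreal (norm (u n x - f x) powr p)"
     using p0 by (intro tendsto_ennrealI tendsto_powr' tendsto_intros elim) auto
    from lim_imp_Liminf[OF sequentially_bot this] show ?case by simp
   qed
  qed
  also have "... <= liminf (%k. \<integral>\<^sup>+x. ennreal (norm (u n x - u (r k) x) powr p) \<partial>M)"
   by (rule nn_integral_liminf) measurable
  also have "... <= liminf (%k. ennreal (e powr p))"
  proof (rule Liminf_mono, rule eventually_sequentiallyI[of n])
   fix k assume "n <= k"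
   then have "Lp_dist M p (u n) (u (r k)) powr p <= e powr p"
    using seq_suble[OF r, of k] p0 by (intro powr_mono2 less_imp_le[OF e(2)]) auto
   then show "(\<integral>\<^sup>+x. ennreal (norm (u n x - u (r k) x) powr p) \<partial>M) <= ennreal (e powr p)"
    using nn_integral_eq_integral[OF LpD(2)[OF d[of n "r k"]]] p0 by (simp add: Lp_norm_powr ennreal_leI)
  qed
  also have "... = ennreal (e powr p)" by (simp add: Liminf_const)
  finally have le: "(\<integral>\<^sup>+x. ennreal (norm (u n x - f x) powr p) \<partial>M) <= ennreal (e powr p)" .
  then have i: "integrable M (%x. norm (u n x - f x) powr p)" by (intro integrableI_bounded) (auto intro: le_less_trans)
  have "(LINT x|M. norm (u n x - f x) powr p) <= e powr p"
   using le nn_integral_eq_integral[OF i] by (simp add: ennreal_le_iff)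
  then show ?thesis using i p0 e(1) by (auto simp: Lp_def intro!: Lp_norm_le_powr_iff)
 qed
 have ev: "\<exists>K. \<forall>n\<ge>K. (%x. u n x - f x) \<in> Lp M p & Lp_dist M p (u n) f <= e" if e: "0 < e" for e
 proof -
  obtain K where "!!m n. m >= K ==> n >= K ==> Lp_dist M p (u m) (u n) < e" using Cauchy e by blast
  then show ?thesis using e by (intro exI[of _ K] allI impI Fatou) auto
 qed
 obtain n where "(%x. u n x - f x) \<in> Lp M p" using ev[of 1] by auto
 from Lp_diff[OF p0 u[of n] this] have "f \<in> Lp M p" by simp
 moreover have "Lp_tendsto M p u f"
 proof (rule LIMSEQ_I)
  fix e :: real assume e: "0 < e"
  then obtain K where "\<forall>n\<ge>K. Lp_dist M p (u n) f <= e / 2" using ev[of "e / 2"] by auto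
  then show "\<exists>K. \<forall>n\<ge>K. norm (Lp_dist M p (u n) f - 0) < e" using e by (intro exI[of _ K]) fastforce
 qed
 ultimately show ?thesis by blast
qed

text \<open>The compactness property of the p-Laplacian (type (S+)), in a form that presupposes no weak limit: the pairing says that
\<open>u k\<close> is almost a critical point in the direction of the earlier \<open>u j\<close>. After passing to a subsequence the integrals of
\<open>|u n|^p\<close> converge, and the tangent defect of the power function between \<open>u k\<close> and \<open>u j\<close> tends to 0.\<close>
theorem monotone_type_strong_convergence:
 fixes u :: "nat => 'x => 'e::euclidean_space"
 assumes p: "1 < p" and u: "!!n. u n \<in> Lp M p" and R: "!!n. (LINT x|M. norm (u n x) powr p) <= R"
  and pair: "!!e. 0 < e ==> \<exists>N. \<forall>j\<ge>N. \<forall>k\<ge>j. - e <= (LINT x|M. duality_map p (u k x) \<bullet> (u j x - u k x))"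
 shows "\<exists>r::nat=>nat. strict_mono r & Lp_Cauchy M p (%n. u (r n))"
proof -
 have p0: "0 < p" using p by simp
 let ?I = "%n. LINT x|M. norm (u n x) powr p"
 have I: "0 <= ?I n" for n by (rule integral_norm_powr_nonneg)
 then have "\<forall>n. ?I n \<in> {0..R}" using R by auto
 then obtain l r where r: "strict_mono (r :: nat => nat)" and l: "(?I \<circ> r) \<longlonglongrightarrow> l"
  using compact_Icc[of 0 R, unfolded compact_def] by meson
 have R0: "0 <= R" using R[of 0] I[of 0] by linarith
 have d: "(%x. u m x - u n x) \<in> Lp M p" for m n by (rule Lp_diff[OF p0 u u])
 have "\<exists>N. \<forall>m\<ge>N. \<forall>n\<ge>N. Lp_dist M p (u (r m)) (u (r n)) < e" if e: "0 < e" for e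
 proof -
  obtain \<epsilon> where \<epsilon>: "0 < \<epsilon>" "\<epsilon> * (2 * R) <= e powr p / 4" using exists_small_factor[of "e powr p / 4" "2 * R"] e R0 by auto
  obtain C where C: "0 <= C" "!!a b :: 'e. norm (b - a) powr p <= \<epsilon> * (norm a powr p + norm b powr p)
   + C * (norm b powr p - norm a powr p - p * (duality_map p a \<bullet> (b - a)))"
   using tangent_defect_controls_distance[OF p \<epsilon>(1)] by blast
  (* The defect is at most 2 \<delta> from the difference of the two integrals plus p \<delta> from the pairing. *)
  obtain \<delta> where \<delta>: "0 < \<delta>" "\<delta> * (C * (2 + p)) <= e powr p / 4"
   using exists_small_factor[of "e powr p / 4" "C * (2 + p)"] e C(1) p by auto
  obtain N1 where N1: "!!j k. j >= N1 ==> k >= j ==> - \<delta> <= (LINT x|M. duality_map p (u k x) \<bullet> (u j x - u k x))"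
   using pair[OF \<delta>(1)] by auto
  obtain N2 where N2: "!!n. n >= N2 ==> \<bar>?I (r n) - l\<bar> < \<delta>"
   using l \<delta>(1) unfolding LIMSEQ_def o_def dist_real_def by meson
  have main: "Lp_dist M p (u (r j)) (u (r k)) < e" if jk: "max N1 N2 <= j" "j <= k" for j k
  proof -
   let ?f = "u (r j)" and ?g = "u (r k)"
   let ?P = "LINT x|M. duality_map p (?g x) \<bullet> (?f x - ?g x)"
   have i: "integrable M (%x. duality_map p (?g x) \<bullet> (?f x - ?g x))"
    using integrable_duality_pairing(1)[OF p u d coefficient_1] by simp
   have "- \<delta> <= ?P" by (rule N1) (use jk seq_suble[OF r, of j] strict_mono_less_eq[OF r] in auto)
   then have P: "p * - \<delta> <= p * ?P" using p by (intro mult_left_mono) auto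
   have "(LINT x|M. norm (?f x - ?g x) powr p) <= (LINT x|M. \<epsilon> * (norm (?g x) powr p + norm (?f x) powr p)
     + C * (norm (?f x) powr p - norm (?g x) powr p - p * (duality_map p (?g x) \<bullet> (?f x - ?g x))))"
    by (rule integral_mono[OF LpD(2)[OF d]]) (use i LpD(2)[OF u] C(2) in auto)
   also have "... = \<epsilon> * (?I (r k) + ?I (r j)) + C * (?I (r j) - ?I (r k) - p * ?P)" using i LpD(2)[OF u] by simp
   also have "... <= \<epsilon> * (2 * R) + C * (\<delta> * (2 + p))"
   proof (intro add_mono mult_left_mono C(1) less_imp_le[OF \<epsilon>(1)])
    show "?I (r k) + ?I (r j) <= 2 * R" using R[of "r k"] R[of "r j"] by linarith
    have "\<bar>?I (r j) - l\<bar> < \<delta>" "\<bar>?I (r k) - l\<bar> < \<delta>" using N2 jk by auto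
    then show "?I (r j) - ?I (r k) - p * ?P <= \<delta> * (2 + p)" using P by (simp add: algebra_simps abs_less_iff)
   qed
   also have "... <= e powr p / 4 + e powr p / 4" by (intro add_mono \<epsilon>(2) \<delta>(2)[unfolded mult.left_commute[of \<delta>]])
   also have "... < e powr p" using e by simp
   finally have "Lp_dist M p ?f ?g powr p < e powr p" using p0 by (simp add: Lp_norm_powr)
   then show ?thesis using powr_mono2[of p e "Lp_dist M p ?f ?g"] p0 e by (meson less_imp_le not_le)
  qed
  have "Lp_dist M p (u (r m)) (u (r n)) < e" if "max N1 N2 <= m" "max N1 N2 <= n" for m n
   using main[of m n] main[of n m] that Lp_norm_minus_commute[of M p "u (r m)" "u (r n)"] by (cases "m <= n") auto
  then show ?thesis by blast
 qed
 with r show ?thesis by blast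
qed

section \<open>Test functions\<close>

definition grad :: "(real ^ 'n => real) => real ^ 'n => real ^ 'n" where
 "grad f x = (\<chi> i. partial_deriv i f x)"

lemma grad_nth [simp]: "grad f x $ i = partial_deriv i f x"
 by (simp add: grad_def)

lemma linear_axis_expansion:
 fixes L :: "real ^ 'n => real"
 assumes "linear L"
 shows "L h = (\<Sum>i\<in>UNIV. h $ i * L (axis i 1))"
proof -
 have "h = (\<Sum>i\<in>UNIV. (h $ i) *\<^sub>R axis i 1)"
  by (auto simp: vec_eq_iff axis_def if_distrib cong: if_cong)
 then have "L h = L (\<Sum>i\<in>UNIV. (h $ i) *\<^sub>R axis i 1)" by simp
 also have "... = (\<Sum>i\<in>UNIV. h $ i * L (axis i 1))"
  using assms by (simp add: linear_sum linear_scale)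
 finally show ?thesis .
qed

lemma has_derivative_grad:
 assumes "f differentiable (at x)"
 shows "(f has_derivative (%h. grad f x \<bullet> h)) (at x)"
proof -
 let ?L = "frechet_derivative f (at x)"
 have L: "(f has_derivative ?L) (at x)" using assms by (simp add: frechet_derivative_works)
 have "?L h = grad f x \<bullet> h" for h
  using linear_axis_expansion[OF has_derivative_linear[OF L], of h]
  by (simp add: inner_vec_def partial_deriv_def mult.commute)
 then have "?L = (%h. grad f x \<bullet> h)" by auto
 with L show ?thesis by simp
qed

lemma partial_deriv_eqI: "(f has_derivative L) (at x) ==> partial_deriv i f x = L (axis i 1)"
 unfolding partial_deriv_def by (simp add: frechet_derivative_at[symmetric])

lemma partial_deriv_linear_comb:
 assumes "f differentiable (at x)" "g differentiable (at x)"
 shows "partial_deriv i (%x. a * f x + b * g x) x = a * partial_deriv i f x + b * partial_deriv i g x"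
proof -
 have "((%x. a * f x + b * g x) has_derivative (%h. a * (grad f x \<bullet> h) + b * (grad g x \<bullet> h))) (at x)"
  by (intro derivative_intros has_derivative_grad assms)
 from partial_deriv_eqI[OF this] show ?thesis by (simp add: inner_axis)
qed

lemma C_k_linear_comb: "C_k k f ==> C_k k g ==> C_k k (%x. a * f x + b * g x)"
proof (induction k arbitrary: f g)
 case 0
 then show ?case by (auto intro!: continuous_intros)
next
 case (Suc k)
 have "partial_deriv i (%x. a * f x + b * g x) = (%x. a * partial_deriv i f x + b * partial_deriv i g x)" for i
  using Suc.prems by (intro ext partial_deriv_linear_comb) auto
 then show ?case using Suc by (auto intro!: derivative_intros)
qed

lemma test_functionsD:
 assumes "\<phi> \<in> test_functions \<Omega>"
 shows "\<phi> differentiable (at x)" "continuous_on A \<phi>" "C_k k \<phi>"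
  "compact (closure {x. \<phi> x ~= 0})" "closure {x. \<phi> x ~= 0} \<subseteq> \<Omega>"
proof -
 have k: "C_k k \<phi>" for k using assms by (simp add: test_functions_def)
 show "\<phi> differentiable (at x)" "C_k k \<phi>" using k[of "Suc 0"] k[of k] by auto
 show "continuous_on A \<phi>" using k[of 0] continuous_on_subset[of UNIV \<phi> A] by simp
 show "compact (closure {x. \<phi> x ~= 0})" "closure {x. \<phi> x ~= 0} \<subseteq> \<Omega>"
  using assms by (simp_all add: test_functions_def)
qed

lemma support_zero:
 fixes \<phi> :: "'a::topological_space => real"
 shows "x \<notin> closure {x. \<phi> x ~= 0} ==> \<phi> x = 0"
 using closure_subset[of "{x. \<phi> x ~= 0}"] by blast

lemma test_function_zero_outside: "\<phi> \<in> test_functions \<Omega> ==> x \<notin> \<Omega> ==> \<phi> x = 0"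
 by (rule support_zero) (use test_functionsD(5) in blast)

lemma partial_deriv_zero_outside:
 assumes "x \<notin> closure {x. \<phi> x ~= 0}"
 shows "partial_deriv i \<phi> x = 0"
proof -
 have "(\<phi> has_derivative (%h. 0)) (at x)"
 proof (rule has_derivative_transform_within_open[of "%x. 0" _ _ _ "- closure {x. \<phi> x ~= 0}"])
  show "0 = \<phi> y" if "y \<in> - closure {x. \<phi> x ~= 0}" for y by (rule support_zero[symmetric]) (use that in simp)
 qed (use assms in auto)
 from partial_deriv_eqI[OF this] show ?thesis .
qed

lemma compact_closed_subset:
 fixes K :: "'a::heine_borel set"
 assumes "compact K" "closed S" "S \<subseteq> K"
 shows "compact S"
 using compact_Int_closed[OF assms(1,2)] assms(3) by (simp add: Int_absorb1)

lemma test_functionsI_support: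
 assumes "!!k. C_k k f" "\<phi> \<in> test_functions \<Omega>" "!!x. x \<notin> closure {x. \<phi> x ~= 0} ==> f x = 0"
 shows "f \<in> test_functions \<Omega>"
proof -
 have "{x. f x ~= 0} \<subseteq> closure {x. \<phi> x ~= 0}" using assms(3) by auto
 then have sub: "closure {x. f x ~= 0} \<subseteq> closure {x. \<phi> x ~= 0}" by (rule closure_minimal) simp
 moreover have "compact (closure {x. f x ~= 0})"
  by (rule compact_closed_subset[OF test_functionsD(4)[OF assms(2)] closed_closure sub])
 ultimately show ?thesis using assms(1) test_functionsD(5)[OF assms(2)] by (auto simp: test_functions_def)
qed

lemma test_functions_partial_deriv:
 assumes "\<phi> \<in> test_functions \<Omega>"
 shows "partial_deriv i \<phi> \<in> test_functions \<Omega>"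
proof (rule test_functionsI_support[OF _ assms partial_deriv_zero_outside])
 show "C_k k (partial_deriv i \<phi>)" for k using test_functionsD(3)[OF assms, of "Suc k"] by simp
qed

lemma test_functions_linear_comb:
 assumes "\<phi> \<in> test_functions \<Omega>" "\<psi> \<in> test_functions \<Omega>"
 shows "(%x. a * \<phi> x + b * \<psi> x) \<in> test_functions \<Omega>"
proof -
 let ?f = "%x. a * \<phi> x + b * \<psi> x"
 have "{x. ?f x ~= 0} \<subseteq> {x. \<phi> x ~= 0} \<union> {x. \<psi> x ~= 0}" by auto
 then have sub: "closure {x. ?f x ~= 0} \<subseteq> closure {x. \<phi> x ~= 0} \<union> closure {x. \<psi> x ~= 0}"
  using closure_mono[of "{x. ?f x ~= 0}" "{x. \<phi> x ~= 0} \<union> {x. \<psi> x ~= 0}"] by (simp only: closure_Un)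
 have K: "compact (closure {x. \<phi> x ~= 0} \<union> closure {x. \<psi> x ~= 0})"
  using assms by (intro compact_Un test_functionsD(4))
 have "compact (closure {x. ?f x ~= 0})"
  by (rule compact_closed_subset[OF K closed_closure sub])
 moreover have "C_k k ?f" for k using assms by (intro C_k_linear_comb test_functionsD(3))
 moreover have "closure {x. ?f x ~= 0} \<subseteq> \<Omega>" using sub test_functionsD(5)[OF assms(1)] test_functionsD(5)[OF assms(2)] by blast
 ultimately show ?thesis by (simp add: test_functions_def)
qed

lemma zero_test_function:
 fixes \<Omega> :: "(real ^ 'n) set"
 shows "(%x. 0) \<in> test_functions \<Omega>"
proof -
 have p: "partial_deriv i (%x::real^'n. 0 :: real) = (%x. 0)" for i
  by (rule ext, rule partial_deriv_eqI[of _ "%_. 0"]) simp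
 have "C_k k (%x::real^'n. 0 :: real)" for k by (induction k) (auto simp: p)
 then show ?thesis by (simp add: test_functions_def)
qed

lemma test_functions_simple_comb:
 assumes "\<phi> \<in> test_functions \<Omega>" "\<psi> \<in> test_functions \<Omega>"
 shows "(%x. \<phi> x + \<psi> x) \<in> test_functions \<Omega>" "(%x. \<phi> x - \<psi> x) \<in> test_functions \<Omega>" "(%x. c * \<phi> x) \<in> test_functions \<Omega>"
 using test_functions_linear_comb[OF assms, of 1 1] test_functions_linear_comb[OF assms, of 1 "-1"]
  test_functions_linear_comb[OF assms, of c 0] by simp_all

lemma grad_simple_comb:
 assumes "\<phi> \<in> test_functions \<Omega>" "\<psi> \<in> test_functions \<Omega>"
 shows "grad (%x. \<phi> x + \<psi> x) x = grad \<phi> x + grad \<psi> x" "grad (%x. \<phi> x - \<psi> x) x = grad \<phi> x - grad \<psi> x"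
  "grad (%x. c * \<phi> x) x = c *\<^sub>R grad \<phi> x"
 using partial_deriv_linear_comb[OF test_functionsD(1)[OF assms(1)] test_functionsD(1)[OF assms(2)], of _ 1 1 x]
  partial_deriv_linear_comb[OF test_functionsD(1)[OF assms(1)] test_functionsD(1)[OF assms(2)], of _ 1 "-1" x]
  partial_deriv_linear_comb[OF test_functionsD(1)[OF assms(1)] test_functionsD(1)[OF assms(2)], of _ c 0 x]
 by (simp_all add: vec_eq_iff)

lemma continuous_grad: "\<phi> \<in> test_functions \<Omega> ==> continuous_on A (grad \<phi>)"
 unfolding grad_def[abs_def]
 by (intro continuous_on_vec_lambda test_functionsD(2)[OF test_functions_partial_deriv])

lemma grad_zero_outside:
 assumes "\<phi> \<in> test_functions \<Omega>" "x \<notin> \<Omega>"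
 shows "grad \<phi> x = 0"
 using partial_deriv_zero_outside[of x \<phi>] test_functionsD(5)[OF assms(1)] assms(2) by (auto simp: vec_eq_iff)

lemma bounded_compact_support:
 fixes f :: "'a::euclidean_space => 'b::real_normed_vector"
 assumes "continuous_on UNIV f" "compact K" "!!x. x \<notin> K ==> f x = 0"
 shows "\<exists>B\<ge>0. \<forall>x. norm (f x) <= B"
proof -
 have "bounded (f ` K)"
  by (intro compact_imp_bounded compact_continuous_image assms continuous_on_subset[OF assms(1)]) simp
 then obtain B where B: "!!x. x \<in> K ==> norm (f x) <= B" unfolding bounded_iff by auto
 show ?thesis
 proof (intro exI[of _ "\<bar>B\<bar>"] conjI allI)
  show "norm (f x) <= \<bar>B\<bar>" for x using B[of x] assms(3)[of x] by (cases "x \<in> K") auto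
 qed simp
qed

lemma grad_zero_support: "x \<notin> closure {x. \<phi> x ~= 0} ==> grad \<phi> x = 0"
 unfolding grad_def using partial_deriv_zero_outside[of x \<phi>] by (simp add: vec_eq_iff)

lemma test_function_bounded: "\<phi> \<in> test_functions \<Omega> ==> \<exists>B\<ge>0. \<forall>x. \<bar>\<phi> x\<bar> <= B"
 unfolding real_norm_def[symmetric] by (rule bounded_compact_support[OF test_functionsD(2) test_functionsD(4) support_zero])

lemma grad_bounded: "\<phi> \<in> test_functions \<Omega> ==> \<exists>B\<ge>0. \<forall>x. norm (grad \<phi> x) <= B"
 by (rule bounded_compact_support[OF continuous_grad test_functionsD(4) grad_zero_support])

lemma integrable_compact_support:
 fixes f :: "'a::euclidean_space => real"
 assumes "continuous_on UNIV f" "compact K" "!!x. x \<notin> K ==> f x = 0"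
 shows "integrable lborel f"
proof -
 have "integrable lborel (%x. indicator K x *\<^sub>R f x)"
  by (rule borel_integrable_compact[OF assms(2) continuous_on_subset[OF assms(1)]]) simp
 moreover have "(%x. indicator K x *\<^sub>R f x) = f" by (rule ext) (use assms(3) in \<open>auto simp: indicator_def\<close>)
 ultimately show ?thesis by simp
qed

subsection \<open>Integration by parts\<close>

text \<open>The integral of \<open>f (x + e) - f x\<close> vanishes by translation invariance; by the fundamental theorem of calculus and
Fubini's theorem it is also the integral over \<open>0 \<le> t \<le> 1\<close> of the integrals of \<open>\<partial>\<^sub>i f (x + t e)\<close>, which do not depend on
\<open>t\<close>.\<close>
lemma integral_partial_deriv_zero:
 fixes f :: "real ^ 'n => real"
 assumes d: "!!x. f differentiable (at x)" and c: "continuous_on UNIV (grad f)"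
  and K: "compact K" "!!x. x \<notin> K ==> f x = 0" "!!x. x \<notin> K ==> grad f x = 0"
 shows "(LINT x|lborel. partial_deriv i f x) = 0"
proof -
 let ?e = "axis i (1::real) :: real ^ 'n" and ?D = "partial_deriv i f"
 have fc: "continuous_on UNIV f" by (intro continuous_at_imp_continuous_on ballI differentiable_imp_continuous_within d)
 have "continuous_on UNIV (%x. grad f x $ i)" by (intro continuous_intros c)
 then have Dc: "continuous_on UNIV ?D" by simp
 have D0: "?D x = 0" if "x \<notin> K" for x using arg_cong[OF K(3)[OF that], of "%v. v $ i"] by simp
 have fi: "integrable lborel f" by (rule integrable_compact_support[OF fc K(1,2)])
 note [measurable] = borel_measurable_continuous_onI[OF fc] borel_measurable_continuous_onI[OF Dc]
 have shift: "(LINT x|lborel. g (x + v)) = (LINT x|lborel. g x)" if "g \<in> borel_measurable borel" for g :: "real ^ 'n => real" and v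
  using integral_distr[of "(+) v" lborel borel g] that by (simp add: lborel_distr_plus add.commute)
 have "integrable (distr lborel borel ((+) ?e)) f" unfolding lborel_distr_plus by (rule fi)
 then have fs: "integrable lborel (%x. f (x + ?e))" by (subst (asm) integrable_distr_eq) (auto simp: add.commute)
 obtain R where R: "K \<subseteq> cball 0 R" using compact_imp_bounded[OF K(1)] unfolding bounded_iff by (auto simp: subset_iff)
 let ?B = "cball (0 :: real ^ 'n) (R + 1) \<times> {0..1::real}"
 have outside: "?D (x + t *\<^sub>R ?e) = 0" if "x \<notin> cball 0 (R + 1)" "t \<in> {0..1}" for x t
 proof (rule D0)
  have "norm x <= norm (x + t *\<^sub>R ?e) + norm (t *\<^sub>R ?e)" using norm_triangle_ineq4[of "x + t *\<^sub>R ?e" "t *\<^sub>R ?e"] by simp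
  then show "x + t *\<^sub>R ?e \<notin> K" using that R by (auto simp: subset_iff)
 qed
 have FTC: "(LINT t|lborel. indicator {0..1} t * ?D (x + t *\<^sub>R ?e)) = f (x + ?e) - f x" for x
 proof -
  have der: "((%t. f (x + t *\<^sub>R ?e)) has_real_derivative ?D (x + t *\<^sub>R ?e)) (at t)" for t
   unfolding has_field_derivative_def
   by (rule has_derivative_eq_rhs[OF has_derivative_compose[OF _ has_derivative_grad[OF d]]])
    (auto intro!: derivative_eq_intros simp: inner_axis)
  have "continuous_on UNIV (%t. ?D (x + t *\<^sub>R ?e))" by (intro continuous_on_compose2[OF Dc] continuous_intros) auto
  then show ?thesis using integral_FTC_Icc_real[of 0 1 "%t. f (x + t *\<^sub>R ?e)" "%t. ?D (x + t *\<^sub>R ?e)"] der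
   by (simp add: mult.commute continuous_on_eq_continuous_at)
 qed
 have "integrable lborel (%z. indicator ?B z *\<^sub>R ?D (fst z + snd z *\<^sub>R ?e))"
  by (rule borel_integrable_compact) (auto intro!: compact_Times continuous_intros continuous_on_compose2[OF Dc])
 moreover have "(%z. indicator ?B z *\<^sub>R ?D (fst z + snd z *\<^sub>R ?e)) = case_prod (%x t. indicator {0..1} t * ?D (x + t *\<^sub>R ?e))"
  by (rule ext, clarify) (use outside in \<open>auto simp: indicator_def\<close>)
 ultimately have "integrable (lborel \<Otimes>\<^sub>M lborel) (case_prod (%x t. indicator {0..1} t * ?D (x + t *\<^sub>R ?e)))" unfolding lborel_prod by simp
 from lborel_pair.Fubini_integral[OF this]
 have "(LINT t|lborel. LINT x|lborel. indicator {0..1} t * ?D (x + t *\<^sub>R ?e)) = (LINT x|lborel. LINT t|lborel. indicator {0..1} t * ?D (x + t *\<^sub>R ?e))" .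
 also have "(LINT t|lborel. LINT x|lborel. indicator {0..1} t * ?D (x + t *\<^sub>R ?e)) = (LINT x|lborel. ?D x)"
  by (simp add: shift)
 also have "(LINT x|lborel. LINT t|lborel. indicator {0..1} t * ?D (x + t *\<^sub>R ?e)) = (LINT x|lborel. f (x + ?e) - f x)" by (simp only: FTC)
 also have "(LINT x|lborel. f (x + ?e) - f x) = 0" using fs fi by (simp add: shift)
 finally show ?thesis .
qed

lemma integration_by_parts:
 fixes u \<phi> :: "real ^ 'n => real"
 assumes u: "u \<in> test_functions \<Omega>" and \<phi>: "\<phi> \<in> test_functions \<Omega>'"
 shows "(LINT x|lborel. u x * partial_deriv i \<phi> x) = - (LINT x|lborel. partial_deriv i u x * \<phi> x)"
proof -
 let ?f = "%x. u x * \<phi> x" and ?K = "closure {x. u x ~= 0}"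
 have D: "(?f has_derivative (%h. u x * (grad \<phi> x \<bullet> h) + (grad u x \<bullet> h) * \<phi> x)) (at x)" for x
  using has_derivative_mult[OF has_derivative_grad[OF test_functionsD(1)[OF u]] has_derivative_grad[OF test_functionsD(1)[OF \<phi>]]] .
 have P: "partial_deriv i ?f x = u x * partial_deriv i \<phi> x + partial_deriv i u x * \<phi> x" for x i
  using partial_deriv_eqI[OF D] by (simp add: inner_axis)
 have G: "grad ?f x = u x *\<^sub>R grad \<phi> x + \<phi> x *\<^sub>R grad u x" for x
  by (simp add: vec_eq_iff P)
 have u0: "u x = 0" "partial_deriv i u x = 0" if "x \<notin> ?K" for x i
  using that closure_subset[of "{x. u x ~= 0}"] partial_deriv_zero_outside[OF that] by auto
 have g0: "grad u x = 0" if "x \<notin> ?K" for x using u0(2)[OF that] by (simp add: vec_eq_iff)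
 have "(LINT x|lborel. partial_deriv i ?f x) = 0"
 proof (rule integral_partial_deriv_zero[OF _ _ test_functionsD(4)[OF u]])
  show "?f differentiable (at x)" for x using D unfolding differentiable_def by blast
  show "continuous_on UNIV (grad ?f)" unfolding G[abs_def]
   by (intro continuous_intros test_functionsD(2)[OF u] test_functionsD(2)[OF \<phi>] continuous_grad[OF u] continuous_grad[OF \<phi>])
  fix x assume x: "x \<notin> ?K"
  show "?f x = 0" using u0(1)[OF x] by simp
  show "grad ?f x = 0" unfolding G u0(1)[OF x] g0[OF x] by simp
 qed
 moreover have "integrable lborel (%x. u x * partial_deriv i \<phi> x)"
 proof (rule integrable_compact_support[OF _ test_functionsD(4)[OF u]])
  show "continuous_on UNIV (%x. u x * partial_deriv i \<phi> x)"
   by (intro continuous_on_mult test_functionsD(2)[OF u] test_functionsD(2)[OF test_functions_partial_deriv[OF \<phi>]])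
  show "u x * partial_deriv i \<phi> x = 0" if "x \<notin> ?K" for x unfolding u0(1)[OF that] by simp
 qed
 moreover have "integrable lborel (%x. partial_deriv i u x * \<phi> x)"
 proof (rule integrable_compact_support[OF _ test_functionsD(4)[OF u]])
  show "continuous_on UNIV (%x. partial_deriv i u x * \<phi> x)"
   by (intro continuous_on_mult test_functionsD(2)[OF \<phi>] test_functionsD(2)[OF test_functions_partial_deriv[OF u]])
  show "partial_deriv i u x * \<phi> x = 0" if "x \<notin> ?K" for x unfolding u0(2)[OF that] by simp
 qed
 ultimately show ?thesis by (simp add: P)
qed

subsection \<open>Bump functions\<close>

text \<open>A class of functions closed under differentiation that contains \<open>exp (- 1 / x)\<close>: smoothness of products of
such functions in the coordinates then follows by induction without a general theory of smooth maps.\<close>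
inductive smooth_generated :: "(real => real) => bool" where
 flat: "smooth_generated (%x. if x > 0 then exp (- (1 / x)) / x ^ k else 0)"
| sum: "smooth_generated f ==> smooth_generated g ==> smooth_generated (%x. a * f x + b * g x)"
| mult: "smooth_generated f ==> smooth_generated g ==> smooth_generated (%x. f x * g x)"
| affine: "smooth_generated f ==> smooth_generated (%x. f (a * x + b))"

text \<open>The factors \<open>1 *\<close> and \<open>(- real k) *\<close> exhibit the derivative as a linear combination within \<open>smooth_generated\<close>.\<close>
lemma flat_function_derivative:
 fixes k :: nat
 defines "h \<equiv> %k x :: real. if x > 0 then exp (- (1 / x)) / x ^ k else 0"
 shows "(h k has_real_derivative (1 * h (Suc (Suc k)) x + (- real k) * h (Suc k) x)) (at x)"
proof -
 consider "x > 0" | "x < 0" | "x = 0" by linarith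
 then show ?thesis
 proof cases
  case 1
  have "((%x. exp (- (1 / x)) / x ^ k) has_real_derivative (1 * h (Suc (Suc k)) x + (- real k) * h (Suc k) x)) (at x)"
  proof (cases k)
   case 0
   then show ?thesis using 1 by (auto intro!: derivative_eq_intros simp: h_def power2_eq_square field_simps)
  next
   case (Suc j)
   show ?thesis using 1 unfolding Suc
    by (auto intro!: derivative_eq_intros simp: h_def field_simps power2_eq_square) (cases j; simp)
  qed
  then show ?thesis
   by (rule has_field_derivative_transform_within_open[of _ _ _ "{0<..}"]) (use 1 in \<open>auto simp: h_def\<close>)
 next
  case 2
  have "((%x. 0) has_real_derivative 0) (at x)" by simp
  then have "(h k has_real_derivative 0) (at x)"
   by (rule has_field_derivative_transform_within_open[of _ _ _ "{..<0}"]) (use 2 in \<open>auto simp: h_def\<close>)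
  then show ?thesis using 2 by (simp add: h_def)
 next
  case 3
  have "((%t. h (Suc k) t) \<longlongrightarrow> 0) (at_right 0)"
  proof -
   have "((%t::real. (inverse t) ^ Suc k / exp (inverse t)) \<longlongrightarrow> 0) (at_right 0)"
    by (rule filterlim_compose[OF tendsto_power_div_exp_0 filterlim_inverse_at_top_right])
   moreover have "\<forall>\<^sub>F t in at_right (0::real). (inverse t) ^ Suc k / exp (inverse t) = h (Suc k) t"
    by (rule eventually_at_rightI[of 0 1]) (auto simp: h_def field_simps exp_minus)
   ultimately show ?thesis by (rule Lim_transform_eventually)
  qed
  moreover have "((%t. h (Suc k) t) \<longlongrightarrow> 0) (at_left 0)"
   by (rule tendsto_eventually) (auto simp: h_def intro!: eventually_at_leftI[of "-1"])
  ultimately have "((%t. h (Suc k) t) \<longlongrightarrow> 0) (at 0)" by (simp add: filterlim_at_split)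
  moreover have "h (Suc k) t = (h k (0 + t) - h k 0) / t" for t by (simp add: h_def field_simps)
  ultimately have "(h k has_real_derivative 0) (at 0)" by (simp add: DERIV_def)
  then show ?thesis unfolding 3 by (simp add: h_def)
 qed
qed

lemma smooth_generated_derivative:
 "smooth_generated f ==> \<exists>f'. smooth_generated f' & (\<forall>x. (f has_real_derivative f' x) (at x))"
proof (induction rule: smooth_generated.induct)
 case (flat k)
 show ?case
  by (rule exI, rule conjI, rule smooth_generated.sum[OF smooth_generated.flat[of "Suc (Suc k)"] smooth_generated.flat[of "Suc k"]],
    rule allI, rule flat_function_derivative)
next
 case (sum f g a b)
 then obtain f' g' where fg: "smooth_generated f'" "smooth_generated g'"
  "!!x. (f has_real_derivative f' x) (at x)" "!!x. (g has_real_derivative g' x) (at x)" by blast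
 show ?case
  by (rule exI, rule conjI, rule smooth_generated.sum[OF fg(1,2), of a b])
   (auto intro!: derivative_eq_intros fg)
next
 case (mult f g)
 then obtain f' g' where fg: "smooth_generated f'" "smooth_generated g'"
  "!!x. (f has_real_derivative f' x) (at x)" "!!x. (g has_real_derivative g' x) (at x)" by blast
 show ?case
  by (rule exI, rule conjI, rule smooth_generated.sum[OF smooth_generated.mult[OF fg(1) mult(2)] smooth_generated.mult[OF fg(2) mult(1)], of 1 1])
   (auto intro!: derivative_eq_intros fg)
next
 case (affine f a b)
 then obtain f' where f: "smooth_generated f'" "!!x. (f has_real_derivative f' x) (at x)" by blast
 show ?case
 proof (rule exI, rule conjI, rule smooth_generated.sum[OF smooth_generated.affine[OF f(1)] smooth_generated.affine[OF f(1)], of a a b 0 a b], rule allI)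
  fix x
  have "((%x. f (a * x + b)) has_real_derivative f' (a * x + b) * a) (at x)"
   by (rule DERIV_chain2[OF f(2)]) (auto intro!: derivative_eq_intros)
  then show "((%x. f (a * x + b)) has_real_derivative a * f' (a * x + b) + 0 * f' (a * x + b)) (at x)"
   by (simp add: mult.commute)
 qed
qed

lemma C_k_product:
 fixes b :: "'n::finite => real => real"
 assumes "!!j. smooth_generated (b j)"
 shows "C_k k (%x::real^'n. \<Prod>j\<in>UNIV. b j (x $ j))"
 using assms
proof (induction k arbitrary: b)
 case 0
 have "continuous_on UNIV (b j)" for j
 proof -
  obtain b' where "!!x. (b j has_real_derivative b' x) (at x)" using smooth_generated_derivative[OF 0] by blast
  then show ?thesis by (intro continuous_at_imp_continuous_on ballI) (rule DERIV_isCont)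
 qed
 note c = this
 have "continuous_on UNIV (%x::real^'n. b j (x $ j))" for j
  by (rule continuous_on_compose2[OF c[of j]]) (intro continuous_intros, simp)
 then show ?case unfolding C_k.simps by (intro continuous_on_prod)
next
 case (Suc k)
 obtain b' where b': "!!j. smooth_generated (b' j)" "!!j x. (b j has_real_derivative b' j x) (at x)"
  using smooth_generated_derivative[OF Suc.prems] by metis
 let ?f = "%x::real^'n. \<Prod>j\<in>UNIV. b j (x $ j)"
 have D: "(?f has_derivative (%h. \<Sum>i\<in>UNIV. (b' i (x $ i) * h $ i) * (\<Prod>j\<in>UNIV - {i}. b j (x $ j)))) (at x)" for x
 proof (rule has_derivative_prod)
  fix i
  have "(b i has_derivative (%h. b' i (x $ i) * h)) (at (x $ i))" using b'(2) by (simp add: has_field_derivative_def)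
  from has_derivative_compose[OF bounded_linear_imp_has_derivative[OF bounded_linear_vec_nth] this]
  show "((%x. b i (x $ i)) has_derivative (%h. b' i (x $ i) * h $ i)) (at x)" .
 qed
 have "partial_deriv i ?f = (%x. \<Prod>j\<in>UNIV. (b(i := b' i)) j (x $ j))" for i
 proof
  fix x :: "real ^ 'n"
  have "partial_deriv i ?f x = (\<Sum>k\<in>UNIV. (b' k (x $ k) * axis i 1 $ k) * (\<Prod>j\<in>UNIV - {k}. b j (x $ j)))"
   by (rule partial_deriv_eqI[OF D])
  also have "... = b' i (x $ i) * (\<Prod>j\<in>UNIV - {i}. b j (x $ j))"
   by (simp add: axis_def if_distrib[of "%c. _ * c"] if_distrib[of "%c. c * _"] cong: if_cong)
  also have "... = (\<Prod>j\<in>UNIV. (b(i := b' i)) j (x $ j))"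
   by (subst prod.remove[of UNIV i]) (auto intro!: prod.cong)
  finally show "partial_deriv i ?f x = (\<Prod>j\<in>UNIV. (b(i := b' i)) j (x $ j))" .
 qed
 moreover have "C_k k (%x. \<Prod>j\<in>UNIV. (b(i := b' i)) j (x $ j))" for i
  by (rule Suc.IH) (use b' Suc.prems in auto)
 moreover have "?f differentiable (at x)" for x using D unfolding differentiable_def by blast
 ultimately show ?case by simp
qed

definition flat :: "real => real" where
 "flat x = (if x > 0 then exp (- (1 / x)) else 0)"

text \<open>Smooth approximations of the indicator of an open box that vanish exactly outside the box.\<close>
definition box_bump :: "real ^ 'n => real ^ 'n => nat => real ^ 'n => real" where
 "box_bump a b n x = (\<Prod>j\<in>UNIV. flat (real (Suc n) * (x $ j - a $ j)) * flat (real (Suc n) * (b $ j - x $ j)))"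

lemma flat_bounds: "0 <= flat x" "flat x <= 1"
 by (auto simp: flat_def)

lemma box_bump_bounds: "0 <= box_bump a b n x" "box_bump a b n x <= 1"
proof -
 show "0 <= box_bump a b n x" unfolding box_bump_def
  by (intro prod_nonneg ballI mult_nonneg_nonneg flat_bounds)
 show "box_bump a b n x <= 1" unfolding box_bump_def
  by (intro prod_le_1 conjI mult_nonneg_nonneg mult_le_one flat_bounds)
qed

lemma box_bump_nonzero_iff: "box_bump a b n x ~= 0 \<longleftrightarrow> x \<in> box a b"
proof -
 have "flat (real (Suc n) * t) = 0 \<longleftrightarrow> ~ 0 < t" for t
  by (simp add: flat_def zero_less_mult_iff del: of_nat_Suc)
 then have "box_bump a b n x = 0 \<longleftrightarrow> (\<exists>j. ~ 0 < x $ j - a $ j \<or> ~ 0 < b $ j - x $ j)"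
  unfolding box_bump_def by (simp only: prod_zero_iff[OF finite] mult_eq_0_iff) simp
 then show ?thesis by (auto simp: mem_box_cart)
qed

lemma box_bump_test_function:
 assumes "cbox a b \<subseteq> \<Omega>"
 shows "box_bump a b n \<in> test_functions \<Omega>"
proof -
 have flat: "smooth_generated flat"
 proof -
  have "smooth_generated (%x::real. if x > 0 then exp (- (1 / x)) / x ^ 0 else 0)" by (rule smooth_generated.flat)
  moreover have "(%x::real. if x > 0 then exp (- (1 / x)) / x ^ 0 else 0) = flat" by (auto simp: flat_def)
  ultimately show ?thesis by simp
 qed
 have 1: "smooth_generated (%t. flat (real (Suc n) * (t - c)))" for c
  using smooth_generated.affine[OF flat, of "real (Suc n)" "- real (Suc n) * c"] by (simp add: algebra_simps)
 have 2: "smooth_generated (%t. flat (real (Suc n) * (c - t)))" for c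
  using smooth_generated.affine[OF flat, of "- real (Suc n)" "real (Suc n) * c"] by (simp add: algebra_simps)
 have "C_k k (box_bump a b n)" for k
  unfolding box_bump_def[abs_def] by (rule C_k_product) (rule smooth_generated.mult[OF 1 2])
 moreover have sub: "closure {x. box_bump a b n x ~= 0} \<subseteq> cbox a b"
  by (rule closure_minimal) (use box_subset_cbox in \<open>auto simp: box_bump_nonzero_iff\<close>)
 moreover have "compact (closure {x. box_bump a b n x ~= 0})"
  by (rule compact_closed_subset[OF compact_cbox closed_closure sub])
 ultimately show ?thesis using assms by (auto simp: test_functions_def)
qed

lemma box_bump_tendsto: "(%n. box_bump a b n x) \<longlonglongrightarrow> indicator (box a b) x"
proof (cases "x \<in> box a b")
 case True
 have fl: "(%n. flat (real (Suc n) * t)) \<longlonglongrightarrow> 1" if "t > 0" for t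
 proof -
  have "(%n. exp (- (1 / t * (1 / real (Suc n))))) \<longlonglongrightarrow> exp (- (1 / t * 0))"
   by (intro tendsto_intros LIMSEQ_Suc[OF lim_1_over_n])
  moreover have "flat (real (Suc n) * t) = exp (- (1 / t * (1 / real (Suc n))))" for n
  proof -
   have "0 < real (Suc n) * t" using that by simp
   then show ?thesis unfolding flat_def by (simp only: if_True divide_simps) (simp add: field_simps)
  qed
  ultimately show ?thesis by simp
 qed
 have "(%n. box_bump a b n x) \<longlonglongrightarrow> (\<Prod>j\<in>(UNIV::'a set). 1 * 1)"
  unfolding box_bump_def by (intro tendsto_prod tendsto_mult fl) (use True in \<open>auto simp: mem_box_cart\<close>)
 then show ?thesis using True by simp
next
 case False
 then have "box_bump a b n x = 0" for n using box_bump_nonzero_iff by blast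
 then show ?thesis using False by simp
qed

section \<open>Weak gradients\<close>

lemma integral_lebesgue_on_eq_lborel:
 fixes f :: "'a::euclidean_space => real"
 assumes "f \<in> borel_measurable borel" "!!x. x \<notin> \<Omega> ==> f x = 0" "\<Omega> \<in> sets lebesgue"
 shows "(LINT x|lebesgue_on \<Omega>. f x) = (LINT x|lborel. f x)"
  "integrable (lebesgue_on \<Omega>) f \<longleftrightarrow> integrable lborel f"
proof -
 have e: "(%x. indicator \<Omega> x *\<^sub>R f x) = f" by (rule ext) (use assms(2) in \<open>auto simp: indicator_def\<close>)
 have m: "f \<in> lborel \<rightarrow>\<^sub>M borel" using assms(1) by simp
 have O: "\<Omega> \<inter> space lebesgue \<in> sets lebesgue" using assms(3) by simp
 show "(LINT x|lebesgue_on \<Omega>. f x) = (LINT x|lborel. f x)"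
  unfolding integral_restrict_space[OF O] e by (rule integral_completion[OF m])
 show "integrable (lebesgue_on \<Omega>) f \<longleftrightarrow> integrable lborel f"
  unfolding integrable_restrict_space[OF O] e by (rule integrable_completion[OF m])
qed

lemma integrable_locally_integrable_mult:
 fixes g \<phi> :: "real ^ 'n => real"
 assumes \<Omega>: "\<Omega> \<in> sets lebesgue" and g: "integrable (lebesgue_on K) g" and K: "compact K" "K \<subseteq> \<Omega>"
  and \<phi>: "continuous_on UNIV \<phi>" "!!x. x \<notin> K ==> \<phi> x = 0"
 shows "integrable (lebesgue_on \<Omega>) (%x. g x * \<phi> x)"
proof -
 have Ks: "K \<inter> space lebesgue \<in> sets lebesgue" using K(1) by (simp add: lmeasurable_compact fmeasurableD)
 obtain B where B: "!!x. norm (\<phi> x) <= B" using bounded_compact_support[OF \<phi>(1) K(1) \<phi>(2)] by auto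
 have gi: "integrable lebesgue (%x. indicator K x *\<^sub>R g x)" using g by (simp only: integrable_restrict_space[OF Ks])
 have m: "\<phi> \<in> borel_measurable lebesgue"
  using borel_measurable_continuous_onI[OF \<phi>(1)] by (intro measurable_completion) simp
 have "integrable lebesgue (%x. indicator K x *\<^sub>R g x * \<phi> x)"
 proof (rule Bochner_Integration.integrable_bound)
  show "integrable lebesgue (%x. B * norm (indicator K x *\<^sub>R g x))" by (intro integrable_mult_right integrable_norm gi)
  show "(%x. indicator K x *\<^sub>R g x * \<phi> x) \<in> borel_measurable lebesgue"
   using borel_measurable_integrable[OF gi] m by (rule borel_measurable_times)
  show "AE x in lebesgue. norm (indicator K x *\<^sub>R g x * \<phi> x) <= norm (B * norm (indicator K x *\<^sub>R g x))"
  proof (rule AE_I2)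
   fix x
   have "norm (indicator K x *\<^sub>R g x * \<phi> x) = norm (\<phi> x) * norm (indicator K x *\<^sub>R g x)" by (simp add: abs_mult)
   also have "... <= B * norm (indicator K x *\<^sub>R g x)" by (intro mult_right_mono B) simp
   finally show "norm (indicator K x *\<^sub>R g x * \<phi> x) <= norm (B * norm (indicator K x *\<^sub>R g x))" by simp
  qed
 qed
 moreover have "(%x. indicator K x *\<^sub>R g x * \<phi> x) = (%x. indicator \<Omega> x *\<^sub>R (g x * \<phi> x))"
  by (rule ext) (use K(2) \<phi>(2) in \<open>auto simp: indicator_def\<close>)
 ultimately show ?thesis using \<Omega> by (simp add: integrable_restrict_space)
qed

lemma integrable_mult_test_function:
 assumes \<Omega>: "\<Omega> \<in> sets lebesgue" and g: "locally_integrable \<Omega> g" and \<phi>: "\<phi> \<in> test_functions \<Omega>"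
 shows "integrable (lebesgue_on \<Omega>) (%x. g x * \<phi> x :: real)"
proof (rule integrable_locally_integrable_mult[OF \<Omega> _ test_functionsD(4,5)[OF \<phi>] test_functionsD(2)[OF \<phi>]])
 show "integrable (lebesgue_on (closure {x. \<phi> x ~= 0})) g"
  using g test_functionsD(4,5)[OF \<phi>] by (simp add: locally_integrable_def)
qed (rule support_zero)

lemma integral_box_zero:
 fixes g :: "real ^ 'n => real"
 assumes \<Omega>: "open \<Omega>" and g: "locally_integrable \<Omega> g"
  and zero: "!!\<phi>. \<phi> \<in> test_functions \<Omega> ==> (LINT x|lebesgue_on \<Omega>. g x * \<phi> x) = 0"
  and box: "cbox c d \<subseteq> \<Omega>"
 shows "(LINT x|lebesgue. indicator (box c d) x * g x) = 0"
proof -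
 let ?g = "%x. indicator (cbox c d) x *\<^sub>R g x"
 have \<Omega>m: "\<Omega> \<inter> space lebesgue \<in> sets lebesgue" using \<Omega> by (simp add: borel_open)
 have "integrable (lebesgue_on (cbox c d)) g" using g box by (simp add: locally_integrable_def)
 then have gi: "integrable lebesgue ?g"
  by (subst (asm) integrable_restrict_space) (simp add: lmeasurable_cbox fmeasurableD)
 have bm: "box_bump c d n \<in> borel_measurable lebesgue" for n
  by (rule measurable_completion)
   (simp add: borel_measurable_continuous_onI test_functionsD(2)[OF box_bump_test_function[OF box]])
 have sup: "box_bump c d n x = 0" if "x \<notin> cbox c d" for n x
  using that box_bump_nonzero_iff[of c d n x] box_subset_cbox by blast
 have "(%n. LINT x|lebesgue. (?g x) * box_bump c d n x)
   \<longlonglongrightarrow> (LINT x|lebesgue. (?g x) * indicator (box c d) x)"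
 proof (rule integral_dominated_convergence[OF _ _ integrable_norm[OF gi]])
  show "AE x in lebesgue. (%n. (?g x) * box_bump c d n x) \<longlonglongrightarrow> (?g x) * indicator (box c d) x"
   by (intro AE_I2 tendsto_mult_left box_bump_tendsto)
  show "AE x in lebesgue. norm ((?g x) * box_bump c d n x) <= norm (?g x)" for n
  proof (rule AE_I2)
   fix x
   show "norm ((?g x) * box_bump c d n x) <= norm (?g x)"
    unfolding norm_mult using box_bump_bounds[of c d n x] by (intro mult_right_le_one_le) auto
  qed
  show "(%x. (?g x) * indicator (box c d) x) \<in> borel_measurable lebesgue"
   by (rule borel_measurable_times[OF borel_measurable_integrable[OF gi] borel_measurable_indicator]) (simp add: borel_open)
  show "(%x. (?g x) * box_bump c d n x) \<in> borel_measurable lebesgue" for n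
   by (rule borel_measurable_times[OF borel_measurable_integrable[OF gi] bm])
 qed
 moreover have "(LINT x|lebesgue. (?g x) * box_bump c d n x) = 0" for n
 proof -
  have "(%x. (?g x) * box_bump c d n x) = (%x. indicator \<Omega> x *\<^sub>R (g x * box_bump c d n x))"
   by (rule ext) (use sup box in \<open>auto simp: indicator_def\<close>)
  then have "(LINT x|lebesgue. (?g x) * box_bump c d n x) = (LINT x|lebesgue_on \<Omega>. g x * box_bump c d n x)"
   by (simp only: integral_restrict_space[OF \<Omega>m])
  also have "... = 0" by (rule zero[OF box_bump_test_function[OF box]])
  finally show ?thesis .
 qed
 ultimately have "(LINT x|lebesgue. (?g x) * indicator (box c d) x) = 0"
  by (simp add: LIMSEQ_const_iff)
 moreover have "(%x. (?g x) * indicator (box c d) x) = (%x. indicator (box c d) x * g x)"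
  by (rule ext) (use box_subset_cbox[of c d] in \<open>auto simp: indicator_def\<close>)
 ultimately show ?thesis by simp
qed

text \<open>The positive and the negative part of \<open>h\<close> are densities of two measures that agree on boxes, which generate the
Borel sets.\<close>
lemma AE_zero_if_box_integrals_zero:
 fixes h :: "'a::euclidean_space => real"
 assumes h: "integrable lborel h" and box: "!!c d. (LINT x|lborel. indicator (box c d) x * h x) = 0"
 shows "AE x in lborel. h x = 0"
proof -
 let ?p = "density lborel (%x. ennreal (h x))" and ?m = "density lborel (%x. ennreal (- h x))"
 let ?E = "range (%(a, b). box a b :: 'a set)" and ?B = "%n::nat. box (- (real n *\<^sub>R One)) (real n *\<^sub>R One) :: 'a set"
 have [measurable]: "h \<in> borel_measurable borel" using borel_measurable_integrable[OF h] by simp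
 have parts: "emeasure ?p X ~= \<infinity> & emeasure ?p X = emeasure ?m X" if X: "X \<in> ?E" for X
 proof -
  obtain c d where cd: "X = box c d" using X by auto
  let ?f = "%x. indicator X x * h x"
  have i: "integrable lborel ?f" using integrable_mult_indicator[OF _ h, of X] by (simp add: cd)
  have "emeasure ?p X = (\<integral>\<^sup>+x. ennreal (?f x) \<partial>lborel)" "emeasure ?m X = (\<integral>\<^sup>+x. ennreal (- ?f x) \<partial>lborel)"
   unfolding cd by (subst emeasure_density; auto intro!: nn_integral_cong simp: indicator_def)+
  then show ?thesis
   using real_lebesgue_integral_def[OF i] box[of c d] i[unfolded real_integrable_def]
   by (simp add: cd) (metis ennreal_enn2real infinity_ennreal_def less_top)
 qed
 have "?p = ?m"
 proof (rule measure_eqI_generator_eq)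
  show "Int_stable ?E" by (auto simp: Int_stable_def box_Int_box)
  show "sets ?p = sigma_sets UNIV ?E" "sets ?m = sigma_sets UNIV ?E" by (simp_all add: borel_eq_box)
  show "range ?B \<subseteq> ?E" "(\<Union>i. ?B i) = UNIV" using UN_box_eq_UNIV by auto
  show "emeasure ?p (?B i) ~= \<infinity>" for i using parts[of "?B i"] by auto
 qed (use parts in auto)
 then have "AE x in lborel. ennreal (h x) = ennreal (- h x)" by (intro sigma_finite_measure.density_unique[OF sigma_finite_lborel]) auto
 then show ?thesis
 proof eventually_elim
  case (elim x)
  then show ?case by (cases "0 <= h x") (auto simp: ennreal_neg dest: sym)
 qed
qed

text \<open>The fundamental lemma of the calculus of variations. Bump functions turn the hypothesis into vanishing integrals over
boxes inside \<open>\<Omega>\<close>, and \<open>\<Omega>\<close> is a countable union of such boxes.\<close>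
lemma fundamental_lemma:
 fixes g :: "real ^ 'n => real"
 assumes \<Omega>: "open \<Omega>" and g: "locally_integrable \<Omega> g"
  and zero: "!!\<phi>. \<phi> \<in> test_functions \<Omega> ==> (LINT x|lebesgue_on \<Omega>. g x * \<phi> x) = 0"
 shows "AE x in lebesgue_on \<Omega>. g x = 0"
proof -
 have cube: "AE x in lebesgue. x \<in> cbox a b --> g x = 0" if ab: "cbox a b \<subseteq> \<Omega>" for a b
 proof -
  have "integrable (lebesgue_on (cbox a b)) g" using g ab by (simp add: locally_integrable_def)
  then have gi0: "integrable lebesgue (%x. indicator (cbox a b) x *\<^sub>R g x)"
   by (subst (asm) integrable_restrict_space) (simp add: lmeasurable_cbox fmeasurableD)
  have "integrable lebesgue (%x. indicator (box a b) x *\<^sub>R (indicator (cbox a b) x *\<^sub>R g x))"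
   by (rule integrable_mult_indicator[OF _ gi0]) (simp add: borel_open)
  moreover have "(%x. indicator (box a b) x *\<^sub>R (indicator (cbox a b) x *\<^sub>R g x)) = (%x. indicator (box a b) x * g x)"
   by (rule ext) (use box_subset_cbox[of a b] in \<open>auto simp: indicator_def\<close>)
  ultimately have gi: "integrable lebesgue (%x. indicator (box a b) x * g x)" by simp
  obtain h where h: "h \<in> borel_measurable lborel" "AE x in lborel. indicator (box a b) x * g x = h x"
   using completion_ex_borel_measurable_real[OF borel_measurable_integrable[OF gi]] by auto
  have hAE: "AE x in lebesgue. indicator (box a b) x * g x = h x" by (rule AE_completion[OF h(2)])
  have hL: "h \<in> borel_measurable lebesgue" by (rule measurable_completion[OF h(1)])
  have "integrable lebesgue h"
   using integrable_cong_AE[OF borel_measurable_integrable[OF gi] hL hAE] gi by simp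
  then have hi: "integrable lborel h" using integrable_completion[OF h(1)] by simp
  have "AE x in lborel. h x = 0"
  proof (rule AE_zero_if_box_integrals_zero[OF hi])
   fix c d :: "real ^ 'n"
   have m: "(%x. indicator (box c d) x * h x) \<in> borel_measurable lborel"
    using h(1) by (intro borel_measurable_times borel_measurable_indicator) (simp_all add: borel_open)
   obtain c' d' where cd: "box c d \<inter> box a b = box c' d'" using box_Int_box by blast
   have "(LINT x|lborel. indicator (box c d) x * h x) = (LINT x|lebesgue. indicator (box c d) x * h x)"
    by (rule integral_completion[OF m, symmetric])
   also have "... = (LINT x|lebesgue. indicator (box c d) x * (indicator (box a b) x * g x))"
   proof (rule integral_cong_AE)
    show "(%x. indicator (box c d) x * h x) \<in> borel_measurable lebesgue" by (rule measurable_completion[OF m])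
    show "(%x. indicator (box c d) x * (indicator (box a b) x * g x)) \<in> borel_measurable lebesgue"
     by (rule borel_measurable_times[OF borel_measurable_indicator borel_measurable_integrable[OF gi]]) (simp add: borel_open)
    show "AE x in lebesgue. indicator (box c d) x * h x = indicator (box c d) x * (indicator (box a b) x * g x)"
     using hAE by eventually_elim simp
   qed
   also have "(%x. indicator (box c d) x * (indicator (box a b) x * g x)) = (%x. indicator (box c' d') x * g x)"
    unfolding cd[symmetric] by (auto simp: indicator_def)
   also have "(LINT x|lebesgue. indicator (box c' d') x * g x) = 0"
   proof (cases "box c' d' = {}")
    case True
    then show ?thesis by simp
   next
    case False
    then have "cbox c' d' = closure (box c' d')" by (simp add: closure_box)
    also have "... \<subseteq> cbox a b" unfolding cd[symmetric]
     by (rule closure_minimal) (use box_subset_cbox[of a b] in auto)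
    finally have "cbox c' d' \<subseteq> \<Omega>" using ab by auto
    then show ?thesis by (intro integral_box_zero[OF \<Omega> g] zero)
   qed
   finally show "(LINT x|lborel. indicator (box c d) x * h x) = 0" .
  qed
  then have "AE x in lebesgue. h x = 0" by (rule AE_completion)
  moreover have "cbox a b - box a b \<in> null_sets lebesgue"
   using negligible_frontier_interval[of a b] by (simp add: negligible_iff_null_sets)
  then have "AE x in lebesgue. x \<notin> cbox a b - box a b" by (rule AE_not_in)
  ultimately show ?thesis using hAE by eventually_elim (auto simp: indicator_def split: if_splits)
 qed
 obtain \<D> where \<D>: "countable \<D>" "\<D> \<subseteq> Pow \<Omega>" "!!X. X \<in> \<D> ==> \<exists>a b. X = cbox a b" "\<Union>\<D> = \<Omega>"
  using open_countable_Union_open_cbox[OF \<Omega>] by metis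
 have "AE x in lebesgue. \<forall>X\<in>\<D>. x \<in> X --> g x = 0"
  unfolding AE_ball_countable[OF \<D>(1)]
 proof
  fix X assume X: "X \<in> \<D>"
  then obtain a b where "X = cbox a b" using \<D>(3) by blast
  then show "AE x in lebesgue. x \<in> X --> g x = 0" using cube[of a b] X \<D>(2) by auto
 qed
 then have "AE x in lebesgue. x \<in> \<Omega> --> g x = 0"
  by eventually_elim (use \<D>(4) in blast)
 then show ?thesis by (subst AE_restrict_space_iff) (use \<Omega> in \<open>simp_all add: borel_open\<close>)
qed

lemma locally_integrable_comb:
 assumes "locally_integrable \<Omega> f" "locally_integrable \<Omega> g"
 shows "locally_integrable \<Omega> (%x. a *\<^sub>R f x + b *\<^sub>R g x)"
 using assms unfolding locally_integrable_def by auto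

lemma locally_integrable_component: "locally_integrable \<Omega> g ==> locally_integrable \<Omega> (%x. g x $ i)"
 unfolding locally_integrable_def
 by (auto intro: integrable_bounded_linear[OF bounded_linear_vec_nth])

lemma weak_gradient_unique:
 fixes u :: "real ^ 'n => real"
 assumes \<Omega>: "open \<Omega>" and g: "has_weak_gradient \<Omega> u g" and h: "has_weak_gradient \<Omega> u h"
 shows "AE x in lebesgue_on \<Omega>. g x = h x"
proof -
 have \<Omega>m: "\<Omega> \<in> sets lebesgue" using \<Omega> by (simp add: borel_open)
 have "AE x in lebesgue_on \<Omega>. g x $ i - h x $ i = 0" for i
 proof (rule fundamental_lemma[OF \<Omega>])
  have gi: "locally_integrable \<Omega> (%x. g x $ i)" and hi: "locally_integrable \<Omega> (%x. h x $ i)"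
   using g h by (auto simp: has_weak_gradient_def intro: locally_integrable_component)
  then show "locally_integrable \<Omega> (%x. g x $ i - h x $ i)"
   using locally_integrable_comb[OF gi hi, of 1 "-1"] by simp
  fix \<phi> assume \<phi>: "\<phi> \<in> test_functions \<Omega>"
  have "(LINT x|lebesgue_on \<Omega>. g x $ i * \<phi> x) = (LINT x|lebesgue_on \<Omega>. h x $ i * \<phi> x)"
  proof -
   have "(LINT x|lebesgue_on \<Omega>. u x * partial_deriv i \<phi> x) = - (LINT x|lebesgue_on \<Omega>. g x $ i * \<phi> x)"
    "(LINT x|lebesgue_on \<Omega>. u x * partial_deriv i \<phi> x) = - (LINT x|lebesgue_on \<Omega>. h x $ i * \<phi> x)"
    using g h \<phi> unfolding has_weak_gradient_def by blast+
   then show ?thesis by simp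
  qed
  then show "(LINT x|lebesgue_on \<Omega>. (g x $ i - h x $ i) * \<phi> x) = 0"
   using integrable_mult_test_function[OF \<Omega>m gi \<phi>] integrable_mult_test_function[OF \<Omega>m hi \<phi>]
   by (simp add: left_diff_distrib)
 qed
 then have "AE x in lebesgue_on \<Omega>. \<forall>i\<in>UNIV. g x $ i - h x $ i = 0"
  by (subst AE_ball_countable) auto
 then show ?thesis by eventually_elim (simp add: vec_eq_iff)
qed

lemma has_weak_gradient_weak_grad: "has_weak_gradient \<Omega> u g ==> has_weak_gradient \<Omega> u (weak_grad \<Omega> u)"
 unfolding weak_grad_def by (rule someI[of "has_weak_gradient \<Omega> u"])

lemma weak_grad_AE:
 assumes "open \<Omega>" "has_weak_gradient \<Omega> u g"
 shows "AE x in lebesgue_on \<Omega>. weak_grad \<Omega> u x = g x"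
 by (rule weak_gradient_unique[OF assms(1) has_weak_gradient_weak_grad[OF assms(2)] assms(2)])

lemma has_weak_gradient_comb:
 assumes \<Omega>: "open \<Omega>" and u: "has_weak_gradient \<Omega> u g" and v: "has_weak_gradient \<Omega> v h"
 shows "has_weak_gradient \<Omega> (%x. a * u x + b * v x) (%x. a *\<^sub>R g x + b *\<^sub>R h x)"
proof -
 have \<Omega>m: "\<Omega> \<in> sets lebesgue" using \<Omega> by (simp add: borel_open)
 have li: "locally_integrable \<Omega> u" "locally_integrable \<Omega> v" "locally_integrable \<Omega> g" "locally_integrable \<Omega> h"
  using u v by (auto simp: has_weak_gradient_def)
 show ?thesis unfolding has_weak_gradient_def
 proof (intro conjI ballI allI)
  show "locally_integrable \<Omega> (%x. a * u x + b * v x)" using locally_integrable_comb[OF li(1,2)] by simp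
  show "locally_integrable \<Omega> (%x. a *\<^sub>R g x + b *\<^sub>R h x)" by (rule locally_integrable_comb[OF li(3,4)])
  fix \<phi> i assume \<phi>: "\<phi> \<in> test_functions \<Omega>"
  note p = test_functions_partial_deriv[OF \<phi>, of i]
  have "(LINT x|lebesgue_on \<Omega>. (a * u x + b * v x) * partial_deriv i \<phi> x)
   = a * (LINT x|lebesgue_on \<Omega>. u x * partial_deriv i \<phi> x) + b * (LINT x|lebesgue_on \<Omega>. v x * partial_deriv i \<phi> x)"
   using integrable_mult_test_function[OF \<Omega>m li(1) p] integrable_mult_test_function[OF \<Omega>m li(2) p]
   by (simp add: distrib_right mult.assoc)
  also have "... = a * - (LINT x|lebesgue_on \<Omega>. g x $ i * \<phi> x) + b * - (LINT x|lebesgue_on \<Omega>. h x $ i * \<phi> x)"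
   using u v \<phi> by (simp add: has_weak_gradient_def)
  also have "... = - (LINT x|lebesgue_on \<Omega>. (a *\<^sub>R g x + b *\<^sub>R h x) $ i * \<phi> x)"
   using integrable_mult_test_function[OF \<Omega>m locally_integrable_component[OF li(3)] \<phi>, of i]
    integrable_mult_test_function[OF \<Omega>m locally_integrable_component[OF li(4)] \<phi>, of i]
   by (simp add: distrib_right mult.assoc)
  finally show "(LINT x|lebesgue_on \<Omega>. (a * u x + b * v x) * partial_deriv i \<phi> x) = - (LINT x|lebesgue_on \<Omega>. (a *\<^sub>R g x + b *\<^sub>R h x) $ i * \<phi> x)" .
 qed
qed

lemma locally_integrable_continuous:
 fixes f :: "'a::euclidean_space => 'b::euclidean_space"
 assumes "continuous_on UNIV f" and that: "compact K"
 shows "integrable (lebesgue_on K) f"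
proof -
 have K: "K \<inter> space lebesgue \<in> sets lebesgue" using that by (simp add: lmeasurable_compact fmeasurableD)
 have "integrable lborel (%x. indicator K x *\<^sub>R f x)"
  by (rule borel_integrable_compact[OF that continuous_on_subset[OF assms(1)]]) simp
 then have "integrable lebesgue (%x. indicator K x *\<^sub>R f x)"
  by (subst integrable_completion) (auto dest: borel_measurable_integrable)
 then show ?thesis by (simp add: integrable_restrict_space[OF K])
qed

lemma has_weak_gradient_test_function:
 assumes \<Omega>: "open \<Omega>" and u: "u \<in> test_functions \<Omega>"
 shows "has_weak_gradient \<Omega> u (grad u)"
 unfolding has_weak_gradient_def
proof (intro conjI ballI allI)
 have \<Omega>m: "\<Omega> \<in> sets lebesgue" using \<Omega> by (simp add: borel_open)
 show "locally_integrable \<Omega> u" "locally_integrable \<Omega> (grad u)"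
  unfolding locally_integrable_def
  using locally_integrable_continuous[OF test_functionsD(2)[OF u]] locally_integrable_continuous[OF continuous_grad[OF u]] by auto
 fix \<phi> i assume \<phi>: "\<phi> \<in> test_functions \<Omega>"
 have c: "continuous_on UNIV (%x. u x * partial_deriv i \<phi> x)" "continuous_on UNIV (%x. partial_deriv i u x * \<phi> x)"
  by (intro continuous_on_mult test_functionsD(2)[OF u] test_functionsD(2)[OF test_functions_partial_deriv[OF \<phi>]]
   test_functionsD(2)[OF \<phi>] test_functionsD(2)[OF test_functions_partial_deriv[OF u]])+
 have "(LINT x|lebesgue_on \<Omega>. u x * partial_deriv i \<phi> x) = (LINT x|lborel. u x * partial_deriv i \<phi> x)"
  by (rule integral_lebesgue_on_eq_lborel(1)[OF borel_measurable_continuous_onI[OF c(1)] _ \<Omega>m])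
   (simp add: test_function_zero_outside[OF u])
 also have "... = - (LINT x|lborel. partial_deriv i u x * \<phi> x)" by (rule integration_by_parts[OF u \<phi>])
 also have "(LINT x|lborel. partial_deriv i u x * \<phi> x) = (LINT x|lebesgue_on \<Omega>. grad u x $ i * \<phi> x)"
  unfolding grad_nth
  by (rule integral_lebesgue_on_eq_lborel(1)[OF borel_measurable_continuous_onI[OF c(2)] _ \<Omega>m, symmetric])
   (simp add: test_function_zero_outside[OF \<phi>])
 finally show "(LINT x|lebesgue_on \<Omega>. u x * partial_deriv i \<phi> x) = - (LINT x|lebesgue_on \<Omega>. grad u x $ i * \<phi> x)" .
qed

section \<open>The space of functions vanishing on the boundary\<close>

lemma finite_measure_lebesgue_on:
 assumes "open \<Omega>" "bounded \<Omega>"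
 shows "finite_measure (lebesgue_on \<Omega>)"
proof (rule finite_measureI)
 have "\<Omega> \<in> lmeasurable" using assms by (simp add: lmeasurable_open)
 from fmeasurableD2[OF this] have "emeasure lebesgue \<Omega> ~= top" .
 then show "emeasure (lebesgue_on \<Omega>) (space (lebesgue_on \<Omega>)) ~= \<infinity>"
  using assms(1) by (subst emeasure_restrict_space) (auto simp: borel_open)
qed

lemma Lp_space_eq: "Lp_space p \<Omega> = Lp (lebesgue_on \<Omega>) p"
 by (auto simp: Lp_space_def Lp_def)

lemma integrable_imp_locally_integrable:
 fixes f :: "real ^ 'n => 'b::euclidean_space"
 assumes \<Omega>: "open \<Omega>" and f: "integrable (lebesgue_on \<Omega>) f"
 shows "locally_integrable \<Omega> f"
 unfolding locally_integrable_def
proof (intro allI impI, elim conjE)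
 fix K assume K: "compact K" "K \<subseteq> \<Omega>"
 have Ks: "K \<inter> space lebesgue \<in> sets lebesgue" using K(1) by (simp add: lmeasurable_compact fmeasurableD)
 have \<Omega>s: "\<Omega> \<inter> space lebesgue \<in> sets lebesgue" using \<Omega> by (simp add: borel_open)
 have "integrable lebesgue (%x. indicator \<Omega> x *\<^sub>R f x)" using f by (simp only: integrable_restrict_space[OF \<Omega>s])
 from integrable_mult_indicator[OF _ this, of K]
 have "integrable lebesgue (%x. indicator K x *\<^sub>R (indicator \<Omega> x *\<^sub>R f x))" using Ks by simp
 moreover have "(%x. indicator K x *\<^sub>R (indicator \<Omega> x *\<^sub>R f x)) = (%x. indicator K x *\<^sub>R f x)"
  by (rule ext) (use K(2) in \<open>auto simp: indicator_def\<close>)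
 ultimately show "integrable (lebesgue_on K) f" by (simp add: integrable_restrict_space[OF Ks])
qed

lemma integral_bounded_tendsto:
 fixes f :: "'x => real"
 assumes fin: "finite_measure M" and p: "1 < p" and u: "!!n. u n \<in> Lp M p" and f: "f \<in> Lp M p"
  and lim: "Lp_tendsto M p u f" and b: "b \<in> borel_measurable M" "!!x. \<bar>b x\<bar> <= B"
 shows "(%n. LINT x|M. u n x * b x) \<longlonglongrightarrow> (LINT x|M. f x * b x)"
proof -
 interpret finite_measure M by fact
 have one: "(%_. 1 :: real) \<in> Lp M p" by (simp add: Lp_def)
 have B: "\<bar>b x\<bar> < B + 1" for x using b(2)[of x] by simp
 then have B0: "0 < B + 1" by (meson abs_ge_zero le_less_trans)
 have "coefficient M (%x. b x / (B + 1))" using b(1) B B0 by (simp add: coefficient_def less_imp_le)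
 note lim' = tendsto_mult_left[OF duality_pairing_tendsto[OF p one one f u _ lim this], of "B + 1"]
 have "(B + 1) * (LINT x|M. b x / (B + 1) * (duality_map p 1 \<bullet> g x)) = (LINT x|M. g x * b x)" for g
  by (subst integral_mult_right_zero[symmetric], rule Bochner_Integration.integral_cong)
   (use B0 in \<open>auto simp: duality_map_real\<close>)
 then show ?thesis using lim' p by (simp add: Lp_norm_def)
qed

lemma Lp_component:
 fixes g :: "'x => real ^ 'n"
 assumes p: "0 < p" and g: "g \<in> Lp M p"
 shows "(%x. g x $ i) \<in> Lp M p" "Lp_norm M p (%x. g x $ i) <= Lp_norm M p g"
proof -
 have le: "norm (g x $ i) powr p <= norm (g x) powr p" for x
  using p component_le_norm_cart[of "g x" i] by (intro powr_mono2) auto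
 have "(%x::real^'n. x $ i) \<in> borel_measurable borel"
  by (intro borel_measurable_continuous_onI continuous_intros)
 note m[measurable] = measurable_compose[OF LpD(1)[OF g] this]
 have i: "integrable M (%x. norm (g x $ i) powr p)"
  by (rule Bochner_Integration.integrable_bound[OF LpD(2)[OF g]]) (use le in \<open>auto\<close>)
 with m show "(%x. g x $ i) \<in> Lp M p" by (simp add: Lp_def)
 show "Lp_norm M p (%x. g x $ i) <= Lp_norm M p g"
  unfolding Lp_norm_def using integral_mono[OF i LpD(2)[OF g] le] integral_norm_powr_nonneg p by (intro powr_mono2) auto
qed

lemma Lp_norm_cong_AE:
 assumes "f \<in> borel_measurable M" "g \<in> borel_measurable M" "AE x in M. f x = g x"
 shows "Lp_norm M p f = Lp_norm M p g"
 unfolding Lp_norm_def using assms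
 by (intro arg_cong[where f = "%c. c powr (1 / p)"] integral_cong_AE) auto

lemma Lp_cong_AE:
 assumes "f \<in> Lp M p" "g \<in> borel_measurable M" "AE x in M. f x = g x"
 shows "g \<in> Lp M p"
proof -
 note [measurable] = LpD(1)[OF assms(1)] assms(2)
 have "integrable M (%x. norm (g x) powr p)"
  by (rule integrable_cong_AE_imp[OF LpD(2)[OF assms(1)]]) (use assms(3) in auto)
 then show ?thesis using assms(2) by (simp add: Lp_def)
qed

lemma continuous_measurable_lebesgue_on:
 fixes f :: "'a::euclidean_space => 'b::euclidean_space"
 assumes "continuous_on UNIV f"
 shows "f \<in> borel_measurable (lebesgue_on \<Omega>)"
proof -
 have "f \<in> borel_measurable lebesgue"
  using borel_measurable_continuous_onI[OF assms] by (intro measurable_completion) simp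
 then show ?thesis by (rule measurable_restrict_space1)
qed

text \<open>Both sides of the defining identity are continuous in the \<open>L\<^sup>p\<close> norms.\<close>
lemma weak_gradient_limit:
 fixes u :: "real ^ 'n => real"
 assumes \<Omega>: "open \<Omega>" "bounded \<Omega>" and p: "1 < p"
  and \<phi>: "!!k. has_weak_gradient \<Omega> (\<phi> k) (h k)" "!!k. \<phi> k \<in> Lp (lebesgue_on \<Omega>) p" "!!k. h k \<in> Lp (lebesgue_on \<Omega>) p"
  and u: "u \<in> Lp (lebesgue_on \<Omega>) p" and g: "g \<in> Lp (lebesgue_on \<Omega>) p"
  and lim_u: "Lp_tendsto (lebesgue_on \<Omega>) p \<phi> u" and lim_g: "Lp_tendsto (lebesgue_on \<Omega>) p h g"
 shows "has_weak_gradient \<Omega> u g"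
 unfolding has_weak_gradient_def
proof (intro conjI ballI allI)
 let ?M = "lebesgue_on \<Omega>"
 have p0: "0 < p" using p by simp
 have fin: "finite_measure ?M" by (rule finite_measure_lebesgue_on[OF \<Omega>])
 show "locally_integrable \<Omega> u" "locally_integrable \<Omega> g"
  by (rule integrable_imp_locally_integrable[OF \<Omega>(1)], rule Lp_imp_integrable(1)[OF fin p], fact)+
 fix \<psi> i assume \<psi>: "\<psi> \<in> test_functions \<Omega>"
 note \<psi>' = test_functions_partial_deriv[OF \<psi>, of i]
 obtain B where B: "!!x. \<bar>\<psi> x\<bar> <= B" using test_function_bounded[OF \<psi>] by auto
 obtain B' where B': "!!x. \<bar>partial_deriv i \<psi> x\<bar> <= B'" using test_function_bounded[OF \<psi>'] by auto
 have 1: "(%k. LINT x|?M. \<phi> k x * partial_deriv i \<psi> x) \<longlonglongrightarrow> (LINT x|?M. u x * partial_deriv i \<psi> x)"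
  by (rule integral_bounded_tendsto[OF fin p \<phi>(2) u lim_u continuous_measurable_lebesgue_on[OF test_functionsD(2)[OF \<psi>']] B'])
 have lim_i: "Lp_tendsto ?M p (%k x. h k x $ i) (%x. g x $ i)"
  by (rule Lim_null_comparison[OF always_eventually[OF allI] lim_g])
   (use Lp_component(2)[OF p0 Lp_diff[OF p0 \<phi>(3) g], of _ i] in simp)
 have 2: "(%k. LINT x|?M. h k x $ i * \<psi> x) \<longlonglongrightarrow> (LINT x|?M. g x $ i * \<psi> x)"
  by (rule integral_bounded_tendsto[OF fin p Lp_component(1)[OF p0 \<phi>(3)] Lp_component(1)[OF p0 g] lim_i continuous_measurable_lebesgue_on[OF test_functionsD(2)[OF \<psi>]] B])
 have "(LINT x|?M. \<phi> k x * partial_deriv i \<psi> x) = - (LINT x|?M. h k x $ i * \<psi> x)" for k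
  using \<phi>(1)[of k] \<psi> by (simp add: has_weak_gradient_def)
 then have "(%k. LINT x|?M. \<phi> k x * partial_deriv i \<psi> x) \<longlonglongrightarrow> - (LINT x|?M. g x $ i * \<psi> x)"
  using tendsto_minus[OF 2] by simp
 from LIMSEQ_unique[OF 1 this] show "(LINT x|?M. u x * partial_deriv i \<psi> x) = - (LINT x|?M. g x $ i * \<psi> x)" .
qed

lemma locally_integrable_measurable:
 fixes f :: "real ^ 'n => 'b::euclidean_space"
 assumes \<Omega>: "open \<Omega>" and f: "locally_integrable \<Omega> f"
 shows "f \<in> borel_measurable (lebesgue_on \<Omega>)"
proof -
 obtain \<D> where \<D>: "countable \<D>" "\<D> \<subseteq> Pow \<Omega>" "!!X. X \<in> \<D> ==> \<exists>a b. X = cbox a b" "\<Union>\<D> = \<Omega>"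
  using open_countable_Union_open_cbox[OF \<Omega>] by metis
 show ?thesis
 proof (rule measurable_piecewise_restrict[OF \<D>(1)])
  show "space (lebesgue_on \<Omega>) \<subseteq> \<Union>\<D>" using \<D>(4) by simp
  fix X assume X: "X \<in> \<D>"
  then obtain a b where ab: "X = cbox a b" using \<D>(3) by blast
  have sub: "X \<subseteq> \<Omega>" using X \<D>(2) by auto
  show "X \<inter> space (lebesgue_on \<Omega>) \<in> sets (lebesgue_on \<Omega>)"
   using \<Omega> sub by (auto simp: sets_restrict_space_iff borel_open ab lmeasurable_cbox fmeasurableD Int_absorb2)
  have "integrable (lebesgue_on X) f" using f sub unfolding locally_integrable_def ab by (metis compact_cbox)
  then have "f \<in> borel_measurable (lebesgue_on X)" by (rule borel_measurable_integrable)
  moreover have "restrict_space (lebesgue_on \<Omega>) X = lebesgue_on X"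
   using \<Omega> sub by (subst restrict_restrict_space) (auto simp: borel_open ab lmeasurable_cbox fmeasurableD Int_absorb1)
  ultimately show "f \<in> borel_measurable (restrict_space (lebesgue_on \<Omega>) X)" by simp
 qed
qed

lemma weak_grad_measurable:
 assumes "open \<Omega>" "has_weak_gradient \<Omega> u g"
 shows "weak_grad \<Omega> u \<in> borel_measurable (lebesgue_on \<Omega>)"
 using has_weak_gradient_weak_grad[OF assms(2)] locally_integrable_measurable[OF assms(1), of "weak_grad \<Omega> u"]
 by (simp add: has_weak_gradient_def)

lemma continuous_bounded_Lp:
 fixes f :: "real ^ 'n => 'e::euclidean_space"
 assumes "finite_measure M" "0 < p" "f \<in> borel_measurable M" "!!x. norm (f x) <= B"
 shows "f \<in> Lp M p"
proof -
 interpret finite_measure M by fact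
 note [measurable] = assms(3)
 have "integrable M (%x. norm (f x) powr p)"
 proof (rule integrable_const_bound[where B = "B powr p"])
  show "AE x in M. norm (norm (f x) powr p) <= B powr p"
   using assms(2,4) by (intro AE_I2) (auto intro!: powr_mono2)
 qed measurable
 then show ?thesis using assms(3) by (simp add: Lp_def)
qed

lemma test_function_Lp:
 assumes "open \<Omega>" "bounded \<Omega>" "0 < p" "\<phi> \<in> test_functions \<Omega>"
 shows "\<phi> \<in> Lp (lebesgue_on \<Omega>) p" "grad \<phi> \<in> Lp (lebesgue_on \<Omega>) p"
proof -
 have fin: "finite_measure (lebesgue_on \<Omega>)" by (rule finite_measure_lebesgue_on[OF assms(1,2)])
 obtain B where B: "!!x. \<bar>\<phi> x\<bar> <= B" using test_function_bounded[OF assms(4)] by auto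
 obtain B' where B': "!!x. norm (grad \<phi> x) <= B'" using grad_bounded[OF assms(4)] by auto
 show "\<phi> \<in> Lp (lebesgue_on \<Omega>) p"
  by (rule continuous_bounded_Lp[OF fin assms(3) continuous_measurable_lebesgue_on[OF test_functionsD(2)[OF assms(4)]], where B = B])
   (simp add: B)
 show "grad \<phi> \<in> Lp (lebesgue_on \<Omega>) p"
  by (rule continuous_bounded_Lp[OF fin assms(3) continuous_measurable_lebesgue_on[OF continuous_grad[OF assms(4)]] B'])
qed

lemma W1p_norm_powr:
 assumes "1 < p"
 shows "W1p_norm p \<Omega> u powr p = Lp_norm (lebesgue_on \<Omega>) p u powr p + Lp_norm (lebesgue_on \<Omega>) p (weak_grad \<Omega> u) powr p"
proof -
 let ?M = "lebesgue_on \<Omega>"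
 have "0 <= (LINT x|?M. norm (u x) powr p)" "0 <= (LINT x|?M. norm (weak_grad \<Omega> u x) powr p)"
  by (rule integral_norm_powr_nonneg)+
 then show ?thesis using assms unfolding W1p_norm_def by (simp add: powr_powr Lp_norm_powr add_nonneg_nonneg)
qed

lemma W1p_norm_nonneg: "0 <= W1p_norm p \<Omega> u"
 by (simp add: W1p_norm_def)

lemma Lp_norm_le_W1p_norm:
 assumes p: "1 < p"
 shows "Lp_norm (lebesgue_on \<Omega>) p u <= W1p_norm p \<Omega> u" "Lp_norm (lebesgue_on \<Omega>) p (weak_grad \<Omega> u) <= W1p_norm p \<Omega> u"
  "W1p_norm p \<Omega> u <= 2 * (Lp_norm (lebesgue_on \<Omega>) p u + Lp_norm (lebesgue_on \<Omega>) p (weak_grad \<Omega> u))"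
proof -
 have le: "a <= b" if "a powr p <= b powr p" "0 <= a" "0 <= b" for a b :: real
  using that p powr_less_mono2[of p b a] by (meson less_le_trans not_le less_trans zero_less_one)
 show "Lp_norm (lebesgue_on \<Omega>) p u <= W1p_norm p \<Omega> u" "Lp_norm (lebesgue_on \<Omega>) p (weak_grad \<Omega> u) <= W1p_norm p \<Omega> u"
  by (rule le; simp add: W1p_norm_powr[OF p] W1p_norm_nonneg)+
 let ?a = "Lp_norm (lebesgue_on \<Omega>) p u" and ?b = "Lp_norm (lebesgue_on \<Omega>) p (weak_grad \<Omega> u)"
 have "?a powr p + ?b powr p <= (?a + ?b) powr p + (?a + ?b) powr p" using p by (intro add_mono powr_mono2) auto
 also have "... = 2 powr 1 * (?a + ?b) powr p" by simp
 also have "... <= 2 powr p * (?a + ?b) powr p" using p by (intro mult_right_mono powr_mono) auto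
 finally show "W1p_norm p \<Omega> u <= 2 * (?a + ?b)"
  by - (rule le, simp_all only: W1p_norm_powr[OF p] powr_mult W1p_norm_nonneg mult_nonneg_nonneg add_nonneg_nonneg Lp_norm_nonneg zero_le_numeral)
qed

lemma Lp_norm_weak_grad_diff:
 assumes \<Omega>: "open \<Omega>" and hw: "has_weak_gradient \<Omega> u g" and \<phi>: "\<phi> \<in> test_functions \<Omega>"
 shows "Lp_norm (lebesgue_on \<Omega>) p (weak_grad \<Omega> (%x. u x - \<phi> x)) = Lp_dist (lebesgue_on \<Omega>) p (grad \<phi>) g"
proof -
 have hd: "has_weak_gradient \<Omega> (%x. u x - \<phi> x) (%x. g x - grad \<phi> x)"
  using has_weak_gradient_comb[OF \<Omega> hw has_weak_gradient_test_function[OF \<Omega> \<phi>], of 1 "-1"] by simp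
 then have "(%x. g x - grad \<phi> x) \<in> borel_measurable (lebesgue_on \<Omega>)"
  by (intro locally_integrable_measurable[OF \<Omega>]) (simp add: has_weak_gradient_def)
 then show ?thesis
  using Lp_norm_cong_AE[OF weak_grad_measurable[OF \<Omega> hd] _ weak_grad_AE[OF \<Omega> hd]]
  by (simp add: Lp_norm_minus_commute[of _ _ g])
qed

text \<open>By \<open>weak_gradient_limit\<close> the limit of the gradients is the weak gradient of the limit, so the convergence is one in the norm
of the space.\<close>
theorem W1p0I:
 fixes u :: "real ^ 'n => real"
 assumes \<Omega>: "open \<Omega>" "bounded \<Omega>" and p: "1 < p" and \<phi>: "!!k. \<phi> k \<in> test_functions \<Omega>"
  and u: "u \<in> Lp (lebesgue_on \<Omega>) p" and g: "g \<in> Lp (lebesgue_on \<Omega>) p"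
  and lim_u: "Lp_tendsto (lebesgue_on \<Omega>) p \<phi> u" and lim_g: "Lp_tendsto (lebesgue_on \<Omega>) p (%k. grad (\<phi> k)) g"
 shows "u \<in> W1p0 p \<Omega>" "has_weak_gradient \<Omega> u g"
proof -
 let ?M = "lebesgue_on \<Omega>"
 have p0: "0 < p" using p by simp
 show hw: "has_weak_gradient \<Omega> u g"
  by (rule weak_gradient_limit[OF \<Omega> p has_weak_gradient_test_function[OF \<Omega>(1) \<phi>]
     test_function_Lp(1)[OF \<Omega> p0 \<phi>] test_function_Lp(2)[OF \<Omega> p0 \<phi>] u g lim_u lim_g])
 have "\<exists>\<psi>\<in>test_functions \<Omega>. W1p_norm p \<Omega> (%x. u x - \<psi> x) < \<epsilon>" if "\<epsilon> > 0" for \<epsilon>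
 proof -
  have "(%k. 2 * (Lp_dist ?M p (\<phi> k) u + Lp_dist ?M p (grad (\<phi> k)) g)) \<longlonglongrightarrow> 2 * (0 + 0)"
   by (intro tendsto_intros lim_u lim_g)
  then have "\<forall>\<^sub>F k in sequentially. 2 * (Lp_dist ?M p (\<phi> k) u + Lp_dist ?M p (grad (\<phi> k)) g) < \<epsilon>"
   by (rule order_tendstoD) (use that in simp)
  then obtain k where k: "2 * (Lp_dist ?M p (\<phi> k) u + Lp_dist ?M p (grad (\<phi> k)) g) < \<epsilon>"
   by (auto simp: eventually_sequentially)
  then have "W1p_norm p \<Omega> (%x. u x - \<phi> k x) < \<epsilon>"
   using Lp_norm_le_W1p_norm(3)[OF p, of \<Omega> "%x. u x - \<phi> k x"]
    Lp_norm_weak_grad_diff[OF \<Omega>(1) hw \<phi>[of k]] Lp_norm_minus_commute[of ?M p u "\<phi> k"] by simp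
  then show ?thesis using \<phi> by blast
 qed
 moreover have "u \<in> W1p p \<Omega>" using u g hw by (auto simp: W1p_def Lp_space_eq)
 ultimately show "u \<in> W1p0 p \<Omega>" by (simp add: W1p0_def)
qed

theorem W1p0D:
 fixes u :: "real ^ 'n => real"
 assumes \<Omega>: "open \<Omega>" "bounded \<Omega>" and p: "1 < p" and u: "u \<in> W1p0 p \<Omega>"
 shows "u \<in> Lp (lebesgue_on \<Omega>) p" "weak_grad \<Omega> u \<in> Lp (lebesgue_on \<Omega>) p" "has_weak_gradient \<Omega> u (weak_grad \<Omega> u)"
  "\<exists>\<phi>. (\<forall>k. \<phi> k \<in> test_functions \<Omega>) & Lp_tendsto (lebesgue_on \<Omega>) p \<phi> u
   & Lp_tendsto (lebesgue_on \<Omega>) p (%k. grad (\<phi> k)) (weak_grad \<Omega> u)"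
proof -
 let ?M = "lebesgue_on \<Omega>"
 have p0: "0 < p" using p by simp
 obtain g where g: "g \<in> Lp ?M p" "has_weak_gradient \<Omega> u g" and uL: "u \<in> Lp ?M p"
  and dense: "!!\<epsilon>. \<epsilon> > 0 ==> \<exists>\<psi>\<in>test_functions \<Omega>. W1p_norm p \<Omega> (%x. u x - \<psi> x) < \<epsilon>"
  using u by (auto simp: W1p0_def W1p_def Lp_space_eq)
 show "u \<in> Lp ?M p" by fact
 show hw: "has_weak_gradient \<Omega> u (weak_grad \<Omega> u)" by (rule has_weak_gradient_weak_grad[OF g(2)])
 show wL: "weak_grad \<Omega> u \<in> Lp ?M p"
  by (rule Lp_cong_AE[OF g(1) weak_grad_measurable[OF \<Omega>(1) g(2)]])
   (use weak_grad_AE[OF \<Omega>(1) g(2)] in eventually_elim, simp)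
 have "\<forall>k. \<exists>\<psi>. \<psi> \<in> test_functions \<Omega> & W1p_norm p \<Omega> (%x. u x - \<psi> x) < 1 / real (Suc k)"
  using dense by (meson of_nat_0_less_iff zero_less_Suc zero_less_divide_1_iff)
 then obtain \<phi> where \<phi>: "!!k. \<phi> k \<in> test_functions \<Omega>" "!!k. W1p_norm p \<Omega> (%x. u x - \<phi> k x) < 1 / real (Suc k)"
  by metis
 have lim: "(%k. 1 / real (Suc k)) \<longlonglongrightarrow> 0" by (rule LIMSEQ_Suc[OF lim_1_over_n])
 have "Lp_dist ?M p (\<phi> k) u <= 1 / real (Suc k)" for k
  using Lp_norm_le_W1p_norm(1)[OF p, of \<Omega> "%x. u x - \<phi> k x"] \<phi>(2)[of k] Lp_norm_minus_commute[of ?M p u "\<phi> k"] by simp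
 then have "Lp_tendsto ?M p \<phi> u" by (intro Lim_null_comparison[OF always_eventually lim]) simp
 moreover have "Lp_dist ?M p (grad (\<phi> k)) (weak_grad \<Omega> u) <= 1 / real (Suc k)" for k
  using Lp_norm_le_W1p_norm(2)[OF p, of \<Omega> "%x. u x - \<phi> k x"] \<phi>(2)[of k] Lp_norm_weak_grad_diff[OF \<Omega>(1) hw \<phi>(1)[of k]] by simp
 then have "Lp_tendsto ?M p (%k. grad (\<phi> k)) (weak_grad \<Omega> u)" by (intro Lim_null_comparison[OF always_eventually lim]) simp
 ultimately show "\<exists>\<phi>. (\<forall>k. \<phi> k \<in> test_functions \<Omega>) & Lp_tendsto ?M p \<phi> u & Lp_tendsto ?M p (%k. grad (\<phi> k)) (weak_grad \<Omega> u)"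
  using \<phi>(1) by blast
qed

section \<open>Oscillation of test functions in a weighted norm\<close>

text \<open>Stated with \<open>nn_integral\<close> on the right, so that no integrability of the power has to be shown.\<close>
lemma jensen_powr:
 fixes f :: "'x => real"
 assumes M: "emeasure M (space M) = 1" and p: "1 <= p" and f: "integrable M f"
 shows "ennreal (\<bar>LINT x|M. f x\<bar> powr p) <= (\<integral>\<^sup>+x. ennreal (\<bar>f x\<bar> powr p) \<partial>M)"
proof (cases "p = 1 \<or> (\<integral>\<^sup>+x. ennreal (\<bar>f x\<bar> powr p) \<partial>M) = \<infinity>")
 case True
 show ?thesis
 proof (cases "p = 1")
  case True
  have "ennreal \<bar>LINT x|M. f x\<bar> <= (\<integral>\<^sup>+x. ennreal \<bar>f x\<bar> \<partial>M)"
   using integral_norm_bound_ennreal[OF f] by simp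
  then show ?thesis using True by (simp add: powr_one')
 qed (use True in simp)
next
 case False
 interpret finite_measure M by (rule finite_measureI) (simp add: M)
 have p1: "1 < p" using p False by simp
 have m [measurable]: "f \<in> borel_measurable M" using f by simp
 have i: "integrable M (%x. \<bar>f x\<bar> powr p)"
  by (rule integrableI_bounded) (use False in \<open>auto simp: less_top\<close>)
 then have fL: "f \<in> Lp M p" by (simp add: Lp_def)
 have "\<bar>LINT x|M. f x\<bar> <= (LINT x|M. norm (f x))" using integral_norm_bound[of M f] by simp
 also have "... <= Lp_norm M p (%_. 1 :: real) powr (p - 1) * Lp_norm M p f"
  by (rule Lp_imp_integrable(2)[OF _ p1 fL]) (rule finite_measure_axioms)
 also have "... = Lp_norm M p f" by (simp add: Lp_norm_def measure_def M)
 finally have "\<bar>LINT x|M. f x\<bar> powr p <= Lp_norm M p f powr p" using p by (intro powr_mono2) auto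
 also have "... = (LINT x|M. \<bar>f x\<bar> powr p)" using p by (simp add: Lp_norm_powr)
 finally have "ennreal (\<bar>LINT x|M. f x\<bar> powr p) <= ennreal (LINT x|M. \<bar>f x\<bar> powr p)" by (rule ennreal_leI)
 also have "... = (\<integral>\<^sup>+x. ennreal (\<bar>f x\<bar> powr p) \<partial>M)" by (rule nn_integral_eq_integral[symmetric, OF i]) simp
 finally show ?thesis .
qed

lemma nn_integral_le_powr_mean:
 fixes f :: "'x => real"
 assumes M: "emeasure M (space M) = 1" and p: "1 <= p" and f [measurable]: "f \<in> borel_measurable M" and pos: "!!x. 0 <= f x"
  and c: "0 <= c" "(\<integral>\<^sup>+x. ennreal (f x powr p) \<partial>M) <= ennreal c"
 shows "(\<integral>\<^sup>+x. ennreal (f x) \<partial>M) <= ennreal (c powr (1 / p))"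
proof -
 interpret finite_measure M by (rule finite_measureI) (simp add: M)
 have i: "integrable M (%x. f x powr p)"
  by (rule integrableI_bounded) (use c le_less_trans[OF c(2)] in auto)
 have fi: "integrable M f"
 proof (rule Bochner_Integration.integrable_bound)
  show "integrable M (%x. 1 + f x powr p)" using i by simp
  show "AE x in M. norm (f x) <= norm (1 + f x powr p)"
  proof (rule AE_I2)
   fix x
   have "f x <= f x powr p" if "1 <= f x" using powr_mono[OF p that] that by simp
   then show "norm (f x) <= norm (1 + f x powr p)"
    using pos[of x] powr_ge_zero[of "f x" p] by (cases "1 <= f x") (auto simp del: powr_ge_zero)
  qed
 qed simp
 have I0: "0 <= (LINT x|M. f x)" by (simp add: pos)
 have "ennreal ((LINT x|M. f x) powr p) <= (\<integral>\<^sup>+x. ennreal (f x powr p) \<partial>M)"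
  using jensen_powr[OF M p fi] pos I0 by simp
 also have "... <= ennreal c" by (rule c)
 finally have "(LINT x|M. f x) powr p <= c" using c(1) by (simp add: ennreal_le_iff)
 then have "((LINT x|M. f x) powr p) powr (1 / p) <= c powr (1 / p)" using p by (intro powr_mono2) auto
 then have "(LINT x|M. f x) <= c powr (1 / p)" using p I0 by (simp add: powr_powr)
 then show ?thesis using nn_integral_eq_integral[OF fi] pos by (simp add: ennreal_leI)
qed

lemma increment_powr_le:
 fixes h h' :: "real => real"
 assumes p: "1 <= p" and d: "!!t. (h has_real_derivative h' t) (at t)" and c: "continuous_on UNIV h'"
 shows "ennreal (\<bar>h 1 - h 0\<bar> powr p) <= (\<integral>\<^sup>+t. ennreal (\<bar>h' t\<bar> powr p) * indicator {0..1} t \<partial>lborel)"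
proof -
 let ?M = "restrict_space lborel {0..1::real}"
 have M: "emeasure ?M (space ?M) = 1"
  by (simp add: emeasure_restrict_space space_restrict_space)
 have cc: "continuous_on {0..1} h'" using c continuous_on_subset by blast
 have "integrable lborel (%x. indicator {0..1} x *\<^sub>R h' x)"
  using borel_integrable_compact[OF compact_Icc cc] by simp
 then have i: "integrable ?M h'" by (subst integrable_restrict_space) auto
 have "(LINT t|?M. h' t) = (LBINT t. indicator {0..1} t *\<^sub>R h' t)" by (subst integral_restrict_space) auto
 also have "... = h 1 - h 0"
  using integral_FTC_Icc_real[of 0 1 h h'] d c
  by (simp add: mult.commute continuous_on_eq_continuous_at)
 finally have e: "(LINT t|?M. h' t) = h 1 - h 0" .
 have "ennreal (\<bar>h 1 - h 0\<bar> powr p) <= (\<integral>\<^sup>+t. ennreal (\<bar>h' t\<bar> powr p) \<partial>?M)"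
  using jensen_powr[OF M p i] e by simp
 then show ?thesis by (subst (asm) nn_integral_restrict_space) auto
qed

text \<open>Averages over the ball of radius \<open>s\<close> around \<open>c\<close> are written as averages of \<open>f (c + s *\<^sub>R z)\<close> over the unit ball, so
that balls of all radii share one probability measure and Fubini's theorem applies directly.\<close>
definition unit_ball_average :: "(real ^ 'n) measure" where
 "unit_ball_average = uniform_measure lborel (ball 0 1)"

lemma unit_ball_average:
 "emeasure (unit_ball_average :: (real ^ 'n) measure) (space unit_ball_average) = 1"
 "sets (unit_ball_average :: (real ^ 'n) measure) = sets borel"
 "AE z in (unit_ball_average :: (real ^ 'n) measure). norm z <= 1"
proof -
 have e: "emeasure lborel (ball (0::real^'n) 1) ~= 0" "emeasure lborel (ball (0::real^'n) 1) ~= \<infinity>"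
  using emeasure_lborel_ball_finite[of 0 1] content_ball_pos[of 1 "0 :: real ^ 'n"] by (auto simp: measure_def)
 show "emeasure (unit_ball_average :: (real ^ 'n) measure) (space unit_ball_average) = 1"
  unfolding unit_ball_average_def
  using emeasure_uniform_measure_1[OF e] by simp
 show "sets (unit_ball_average :: (real ^ 'n) measure) = sets borel" by (simp add: unit_ball_average_def)
 show "AE z in (unit_ball_average :: (real ^ 'n) measure). norm z <= 1"
  unfolding unit_ball_average_def by (rule AE_uniform_measureI) (auto)
qed

lemma unit_ball_average_scaling:
 fixes f :: "real ^ 'n => ennreal"
 assumes f [measurable]: "f \<in> borel_measurable borel" and s: "s ~= 0"
 shows "(\<integral>\<^sup>+z. f (c + s *\<^sub>R z) \<partial>unit_ball_average)
   <= ennreal (1 / (\<bar>s\<bar> ^ CARD('n) * measure lborel (ball (0::real^'n) 1))) * (\<integral>\<^sup>+x. f x \<partial>lborel)"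
proof -
 let ?B = "ball 0 1 :: (real ^ 'n) set" and ?b = "measure lborel (ball (0::real^'n) 1)"
 have b0: "0 < ?b" using content_ball_pos[of 1 "0 :: real ^ 'n"] by simp
 have eB: "emeasure lborel ?B = ennreal ?b" using emeasure_lborel_ball_finite[of "0 :: real ^ 'n" 1] by (subst emeasure_eq_ennreal_measure) auto
 have "(\<integral>\<^sup>+x. f x \<partial>lborel) = (\<integral>\<^sup>+x. f x \<partial>density (distr lborel borel (%x. c + s *\<^sub>R x)) (%_. \<bar>s\<bar> ^ CARD('n)))"
  using lborel_affine[OF s, of c] by simp
 also have "... = ennreal (\<bar>s\<bar> ^ CARD('n)) * (\<integral>\<^sup>+x. f (c + s *\<^sub>R x) \<partial>lborel)"
  by (simp add: nn_integral_density nn_integral_distr nn_integral_cmult)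
 finally have 1: "(\<integral>\<^sup>+x. f x \<partial>lborel) = ennreal (\<bar>s\<bar> ^ CARD('n)) * (\<integral>\<^sup>+x. f (c + s *\<^sub>R x) \<partial>lborel)" .
 have "(\<integral>\<^sup>+z. f (c + s *\<^sub>R z) \<partial>unit_ball_average) = (\<integral>\<^sup>+z. f (c + s *\<^sub>R z) * indicator ?B z \<partial>lborel) / ennreal ?b"
  unfolding unit_ball_average_def by (subst nn_integral_uniform_measure) (auto simp: eB)
 also have "... <= (\<integral>\<^sup>+z. f (c + s *\<^sub>R z) \<partial>lborel) / ennreal ?b"
  by (intro divide_right_mono_ennreal nn_integral_mono) (auto split: split_indicator)
 also have "... = ennreal (1 / ?b) * (\<integral>\<^sup>+z. f (c + s *\<^sub>R z) \<partial>lborel)"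
  using b0 by (simp add: divide_ennreal_def inverse_ennreal inverse_eq_divide mult.commute)
 also have "... = ennreal (1 / (\<bar>s\<bar> ^ CARD('n) * ?b)) * (ennreal (\<bar>s\<bar> ^ CARD('n)) * (\<integral>\<^sup>+z. f (c + s *\<^sub>R z) \<partial>lborel))"
  using b0 s by (simp add: mult.assoc[symmetric] ennreal_mult[symmetric])
 finally show ?thesis using 1 by simp
qed

text \<open>The segment from \<open>x\<close> to \<open>x + v\<close> is parametrised by \<open>t ^ k\<close>. The factor \<open>t ^ (k - 1)\<close> gained at \<open>t = 0\<close> compensates
the concentration of averages over small balls in \<open>weighted_mean_oscillation\<close>.\<close>
lemma increment_path:
 fixes \<phi> :: "real ^ 'n => real" and k :: nat
 assumes \<phi>: "\<phi> \<in> test_functions \<Omega>" and p: "1 <= p" and k: "1 <= k" and v: "norm v <= s"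
 shows "ennreal (\<bar>\<phi> x - \<phi> (x + v)\<bar> powr p)
  <= (\<integral>\<^sup>+t. ennreal ((real k * s * t ^ (k - 1)) powr p * norm (grad \<phi> (x + (t ^ k) *\<^sub>R v)) powr p) * indicator {0..1} t \<partial>lborel)"
proof -
 let ?G = "%t. grad \<phi> (x + (t ^ k) *\<^sub>R v)" and ?c = "%t. real k * s * t ^ (k - 1)"
 let ?h = "%t. \<phi> (x + (t ^ k) *\<^sub>R v)"
 let ?h' = "%t. ?G t \<bullet> ((real k * t ^ (k - 1)) *\<^sub>R v)"
 have d: "(?h has_real_derivative ?h' t) (at t)" for t
 proof -
  have "((%t. x + (t ^ k) *\<^sub>R v) has_derivative (%e. (real k * e * t ^ (k - 1)) *\<^sub>R v)) (at t)"
   by (auto intro!: derivative_eq_intros simp: ac_simps)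
  then have "(?h has_derivative (%e. ?G t \<bullet> ((real k * e * t ^ (k - 1)) *\<^sub>R v))) (at t)"
   by (rule has_derivative_compose[OF _ has_derivative_grad[OF test_functionsD(1)[OF \<phi>]]])
  then show ?thesis unfolding has_field_derivative_def by (rule has_derivative_eq_rhs) (auto simp: ac_simps)
 qed
 have c: "continuous_on UNIV ?h'"
  by (intro continuous_intros continuous_on_compose2[OF continuous_grad[OF \<phi>, of UNIV]]) auto
 have "ennreal (\<bar>?h 1 - ?h 0\<bar> powr p) <= (\<integral>\<^sup>+t. ennreal (\<bar>?h' t\<bar> powr p) * indicator {0..1} t \<partial>lborel)"
  by (rule increment_powr_le[OF p d c])
 also have "... <= (\<integral>\<^sup>+t. ennreal (?c t powr p * norm (?G t) powr p) * indicator {0..1} t \<partial>lborel)"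
 proof (intro nn_integral_mono)
  fix t :: real
  show "ennreal (\<bar>?h' t\<bar> powr p) * indicator {0..1} t
   <= ennreal (?c t powr p * norm (?G t) powr p) * indicator {0..1} t"
  proof (cases "t \<in> {0..1}")
   case True
   have "\<bar>?h' t\<bar> <= norm (?G t) * norm ((real k * t ^ (k - 1)) *\<^sub>R v)"
    by (rule Cauchy_Schwarz_ineq2)
   also have "... <= norm (?G t) * (real k * t ^ (k - 1) * s)"
    using True v by (intro mult_left_mono) (auto intro!: mult_left_mono)
   finally have "\<bar>?h' t\<bar> powr p <= (?c t * norm (?G t)) powr p"
    using p by (intro powr_mono2) (auto simp: ac_simps)
   also have "... = ?c t powr p * norm (?G t) powr p"
    by (rule powr_mult)
   finally show ?thesis by (intro mult_right_mono ennreal_leI) auto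
  qed simp
 qed
 finally show ?thesis using k by (simp add: power_0_left abs_minus_commute)
qed

lemma sets_unit_ball_average [measurable_cong, simp]: "sets (unit_ball_average :: (real ^ 'n) measure) = sets borel"
 by (rule unit_ball_average(2))

lemma sigma_finite_unit_ball_average: "sigma_finite_measure (unit_ball_average :: (real ^ 'n) measure)"
proof -
 interpret finite_measure "unit_ball_average :: (real ^ 'n) measure"
  by (rule finite_measureI) (simp add: unit_ball_average(1))
 show ?thesis by (rule sigma_finite_measure_axioms)
qed

text \<open>By Jensen's inequality the mean of \<open>w\<close> over a ball of radius \<open>s\<close> is at most of the order of \<open>s powr (- CARD('n) / \<gamma>)\<close>.\<close>
lemma weighted_ball_average:
 fixes w :: "real ^ 'n => real"
 assumes w [measurable]: "w \<in> borel_measurable borel" and w0: "!!x. 0 <= w x" and g: "1 <= \<gamma>"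
  and K: "0 <= K" "(\<integral>\<^sup>+x. ennreal (w x powr \<gamma>) \<partial>lborel) <= ennreal K" and s: "0 < s"
 shows "(\<integral>\<^sup>+z. ennreal (w (y - s *\<^sub>R z)) \<partial>unit_ball_average)
  <= ennreal ((K / (s ^ CARD('n) * measure lborel (ball (0::real^'n) 1))) powr (1 / \<gamma>))"
proof (rule nn_integral_le_powr_mean[OF unit_ball_average(1) g])
 let ?b = "measure lborel (ball (0::real^'n) 1)"
 show "(%z. w (y - s *\<^sub>R z)) \<in> borel_measurable unit_ball_average" by measurable
 show "0 <= w (y - s *\<^sub>R z)" for z by (rule w0)
 show "0 <= K / (s ^ CARD('n) * ?b)" using K s by simp
 have "(\<integral>\<^sup>+z. ennreal (w (y - s *\<^sub>R z) powr \<gamma>) \<partial>unit_ball_average)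
   = (\<integral>\<^sup>+z. ennreal (w (y + (- s) *\<^sub>R z) powr \<gamma>) \<partial>unit_ball_average)" by simp
 also have "... <= ennreal (1 / (\<bar>- s\<bar> ^ CARD('n) * ?b)) * (\<integral>\<^sup>+x. ennreal (w x powr \<gamma>) \<partial>lborel)"
  by (rule unit_ball_average_scaling) (use s in auto)
 also have "... <= ennreal (1 / (\<bar>- s\<bar> ^ CARD('n) * ?b)) * ennreal K" by (intro mult_left_mono K) auto
 also have "... = ennreal (K / (s ^ CARD('n) * ?b))" using s K by (simp add: ennreal_mult[symmetric])
 finally show "(\<integral>\<^sup>+z. ennreal (w (y - s *\<^sub>R z) powr \<gamma>) \<partial>unit_ball_average) <= ennreal (K / (s ^ CARD('n) * ?b))" .
qed

lemma translated_weight_integral: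
 fixes w G :: "real ^ 'n => real"
 assumes w [measurable]: "w \<in> borel_measurable borel" and w0: "!!x. 0 <= w x" and g: "1 <= \<gamma>"
  and K: "0 <= K" "(\<integral>\<^sup>+x. ennreal (w x powr \<gamma>) \<partial>lborel) <= ennreal K" and s: "0 < s"
  and G [measurable]: "G \<in> borel_measurable borel" and G0: "!!x. 0 <= G x"
 shows "(\<integral>\<^sup>+z. (\<integral>\<^sup>+x. ennreal (w x * G (x + s *\<^sub>R z)) \<partial>lborel) \<partial>unit_ball_average)
  <= ennreal ((K / (s ^ CARD('n) * measure lborel (ball (0::real^'n) 1))) powr (1 / \<gamma>)) * (\<integral>\<^sup>+x. ennreal (G x) \<partial>lborel)"
proof -
 interpret U: sigma_finite_measure "unit_ball_average :: (real ^ 'n) measure" by (rule sigma_finite_unit_ball_average)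
 interpret P: pair_sigma_finite "unit_ball_average :: (real ^ 'n) measure" "lborel :: (real ^ 'n) measure" ..
 let ?c = "ennreal ((K / (s ^ CARD('n) * measure lborel (ball (0::real^'n) 1))) powr (1 / \<gamma>))"
 have "(\<integral>\<^sup>+x. ennreal (w x * G (x + s *\<^sub>R z)) \<partial>lborel) = (\<integral>\<^sup>+y. ennreal (G y) * ennreal (w (y - s *\<^sub>R z)) \<partial>lborel)" for z
 proof -
  have "(\<integral>\<^sup>+y. ennreal (G y) * ennreal (w (y - s *\<^sub>R z)) \<partial>lborel)
   = (\<integral>\<^sup>+y. ennreal (G y) * ennreal (w (y - s *\<^sub>R z)) \<partial>distr lborel borel ((+) (s *\<^sub>R z)))"
   using lborel_distr_plus[of "s *\<^sub>R z"] by simp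
  also have "... = (\<integral>\<^sup>+x. ennreal (w x * G (x + s *\<^sub>R z)) \<partial>lborel)"
   by (subst nn_integral_distr) (auto simp: ennreal_mult[OF w0 G0] ac_simps)
  finally show ?thesis by simp
 qed
 then have "(\<integral>\<^sup>+z. (\<integral>\<^sup>+x. ennreal (w x * G (x + s *\<^sub>R z)) \<partial>lborel) \<partial>unit_ball_average)
  = (\<integral>\<^sup>+z. (\<integral>\<^sup>+y. ennreal (G y) * ennreal (w (y - s *\<^sub>R z)) \<partial>lborel) \<partial>unit_ball_average)" by simp
 also have "... = (\<integral>\<^sup>+y. (\<integral>\<^sup>+z. ennreal (G y) * ennreal (w (y - s *\<^sub>R z)) \<partial>unit_ball_average) \<partial>lborel)"
  by (rule P.Fubini'[symmetric]) simp
 also have "... = (\<integral>\<^sup>+y. ennreal (G y) * (\<integral>\<^sup>+z. ennreal (w (y - s *\<^sub>R z)) \<partial>unit_ball_average) \<partial>lborel)"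
  by (intro nn_integral_cong nn_integral_cmult) simp
 also have "... <= (\<integral>\<^sup>+y. ennreal (G y) * ?c \<partial>lborel)"
  by (intro nn_integral_mono mult_left_mono weighted_ball_average[OF w w0 g K s]) auto
 also have "... = ?c * (\<integral>\<^sup>+x. ennreal (G x) \<partial>lborel)" by (simp add: nn_integral_multc mult.commute)
 finally show ?thesis .
qed

text \<open>After Fubini's theorem, for fixed \<open>t\<close> the point \<open>x + t ^ k * \<rho> *\<^sub>R z\<close> becomes the variable, and the weight is
averaged over a ball of radius \<open>t ^ k * \<rho>\<close>. This produces \<open>t\<close> to a power that is nonnegative once \<open>k\<close> is large, by
\<open>CARD('n) / \<gamma> < p\<close>, and a positive power of \<open>\<rho>\<close>.\<close>
lemma weighted_mean_oscillation:
 fixes w \<phi> :: "real ^ 'n => real" and k :: nat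
 assumes w [measurable]: "w \<in> borel_measurable borel" and w0: "!!x. 0 <= w x" and g: "1 <= \<gamma>"
  and K: "0 <= K" "(\<integral>\<^sup>+x. ennreal (w x powr \<gamma>) \<partial>lborel) <= ennreal K"
  and \<phi>: "\<phi> \<in> test_functions \<Omega>" and p: "1 <= p" and k: "1 <= k" "p <= real k * (p - real CARD('n) / \<gamma>)"
  and \<rho>: "0 < \<rho>"
 shows "(\<integral>\<^sup>+x. (\<integral>\<^sup>+z. ennreal (w x * \<bar>\<phi> x - \<phi> (x + \<rho> *\<^sub>R z)\<bar> powr p) \<partial>unit_ball_average) \<partial>lborel)
  <= ennreal (real k powr p * \<rho> powr (p - real CARD('n) / \<gamma>)
    * (K / measure lborel (ball (0::real^'n) 1)) powr (1 / \<gamma>)) * (\<integral>\<^sup>+x. ennreal (norm (grad \<phi> x) powr p) \<partial>lborel)"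
proof -
 let ?U = "unit_ball_average :: (real ^ 'n) measure" and ?b = "measure lborel (ball (0::real^'n) 1)"
 let ?I = "\<integral>\<^sup>+x. ennreal (norm (grad \<phi> x) powr p) \<partial>lborel"
 let ?\<theta> = "real CARD('n) / \<gamma>"
 let ?A = "real k powr p * \<rho> powr (p - ?\<theta>) * (K / ?b) powr (1 / \<gamma>)"
 let ?d = "%x z. w x * \<bar>\<phi> x - \<phi> (x + \<rho> *\<^sub>R z)\<bar> powr p"
 interpret U: sigma_finite_measure ?U by (rule sigma_finite_unit_ball_average)
 interpret LU: pair_sigma_finite "lborel :: real measure" ?U ..
 interpret UL: pair_sigma_finite ?U "lborel :: (real ^ 'n) measure" ..
 define G where "G y = norm (grad \<phi> y) powr p" for y
 have [measurable]: "grad \<phi> \<in> borel_measurable borel" by (rule borel_measurable_continuous_onI[OF continuous_grad[OF \<phi>]])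
 have [measurable]: "\<phi> \<in> borel_measurable borel" by (rule borel_measurable_continuous_onI[OF test_functionsD(2)[OF \<phi>]])
 have G [measurable]: "G \<in> borel_measurable borel" unfolding G_def[abs_def] by measurable
 have G0: "0 <= G y" for y by (simp add: G_def)
 let ?c = "%t. (real k * \<rho> * t ^ (k - 1)) powr p"
 let ?F = "%x z t. ennreal (?c t * (w x * G (x + (t ^ k * \<rho>) *\<^sub>R z))) * indicator {0..1} t"
 have "(\<integral>\<^sup>+x. (\<integral>\<^sup>+z. ennreal (?d x z) \<partial>?U) \<partial>lborel)
  <= (\<integral>\<^sup>+x. (\<integral>\<^sup>+z. (\<integral>\<^sup>+t. ?F x z t \<partial>lborel) \<partial>?U) \<partial>lborel)"
 proof (rule nn_integral_mono, rule nn_integral_mono_AE, rule AE_mp[OF unit_ball_average(3)], rule AE_I2, rule impI)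
  fix x z :: "real ^ 'n" assume "norm z <= 1"
  then have "norm (\<rho> *\<^sub>R z) <= \<rho>" using \<rho> by simp
  have "ennreal (?d x z) = ennreal (w x) * ennreal (\<bar>\<phi> x - \<phi> (x + \<rho> *\<^sub>R z)\<bar> powr p)"
   by (simp add: ennreal_mult w0)
  also have "... <= ennreal (w x) * (\<integral>\<^sup>+t. ennreal (?c t * norm (grad \<phi> (x + (t ^ k) *\<^sub>R \<rho> *\<^sub>R z)) powr p) * indicator {0..1} t \<partial>lborel)"
   by (intro mult_left_mono increment_path[OF \<phi> p k(1)] \<open>norm (\<rho> *\<^sub>R z) <= \<rho>\<close>) auto
  also have "... = (\<integral>\<^sup>+t. ennreal (w x) * (ennreal (?c t * norm (grad \<phi> (x + (t ^ k) *\<^sub>R \<rho> *\<^sub>R z)) powr p) * indicator {0..1} t) \<partial>lborel)"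
   by (rule nn_integral_cmult[symmetric]) measurable
  also have "... = (\<integral>\<^sup>+t. ?F x z t \<partial>lborel)"
   by (intro nn_integral_cong) (auto simp: G_def ennreal_mult w0 ac_simps split: split_indicator)
  finally show "ennreal (?d x z) <= (\<integral>\<^sup>+t. ?F x z t \<partial>lborel)" .
 qed
 also have "... = (\<integral>\<^sup>+x. (\<integral>\<^sup>+t. (\<integral>\<^sup>+z. ?F x z t \<partial>?U) \<partial>lborel) \<partial>lborel)"
  by (intro nn_integral_cong LU.Fubini') measurable
 also have "... = (\<integral>\<^sup>+t. (\<integral>\<^sup>+x. (\<integral>\<^sup>+z. ?F x z t \<partial>?U) \<partial>lborel) \<partial>lborel)"
  by (intro lborel_pair.Fubini') measurable
 also have "... = (\<integral>\<^sup>+t. (\<integral>\<^sup>+z. (\<integral>\<^sup>+x. ?F x z t \<partial>lborel) \<partial>?U) \<partial>lborel)"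
  by (intro nn_integral_cong UL.Fubini') measurable
 also have "... <= (\<integral>\<^sup>+t. ennreal ?A * ?I * indicator {0..1} t \<partial>(lborel :: real measure))"
 proof (rule nn_integral_mono_AE, rule AE_mp[OF AE_lborel_singleton[of 0]], rule AE_I2, rule impI)
  fix t :: real assume t: "t ~= 0"
  show "(\<integral>\<^sup>+z. (\<integral>\<^sup>+x. ?F x z t \<partial>lborel) \<partial>?U) <= ennreal ?A * ?I * indicator {0..1} t"
  proof (cases "t \<in> {0..1}")
   case True
   then have t01: "0 < t" "t <= 1" using t by auto
   let ?s = "t ^ k * \<rho>"
   have s: "0 < ?s" using t01 \<rho> by simp
   have "(\<integral>\<^sup>+z. (\<integral>\<^sup>+x. ?F x z t \<partial>lborel) \<partial>?U) = ennreal (?c t) * (\<integral>\<^sup>+z. (\<integral>\<^sup>+x. ennreal (w x * G (x + ?s *\<^sub>R z)) \<partial>lborel) \<partial>?U)"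
    using True by (simp add: ennreal_mult[OF powr_ge_zero mult_nonneg_nonneg[OF w0 G0]] nn_integral_cmult)
   also have "... <= ennreal (?c t) * (ennreal ((K / (?s ^ CARD('n) * ?b)) powr (1 / \<gamma>)) * (\<integral>\<^sup>+x. ennreal (G x) \<partial>lborel))"
    by (intro mult_left_mono translated_weight_integral[OF w w0 g K s G G0]) auto
   also have "... = ennreal (?c t * (K / (?s ^ CARD('n) * ?b)) powr (1 / \<gamma>)) * ?I"
    by (simp add: ennreal_mult mult.assoc G_def)
   also have "... <= ennreal ?A * ?I"
   proof (intro mult_right_mono ennreal_leI)
    have b: "0 < ?b" using content_ball_pos[of 1 "0 :: real ^ 'n"] by simp
    have e1: "?c t = real k powr p * \<rho> powr p * t powr (real (k - 1) * p)"
     using t01 \<rho> by (simp add: powr_mult powr_realpow[symmetric] powr_powr)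
    have e2: "(K / (?s ^ CARD('n) * ?b)) powr (1 / \<gamma>)
     = (K / ?b) powr (1 / \<gamma>) * (?s powr ?\<theta>) powr (- 1)"
    proof -
     have e: "real CARD('n) * - 1 * (1 / \<gamma>) = ?\<theta> * - 1" by simp
     have f: "K / (?s ^ CARD('n) * ?b) = (K / ?b) * (?s powr (real CARD('n))) powr (- 1)"
      using powr_neg_one[OF zero_less_power[OF s, of "CARD('n)"]] powr_realpow[OF s, of "CARD('n)"] by simp
     show ?thesis unfolding f powr_mult[of "K / ?b"] powr_powr e ..
    qed
    have e3: "(?s powr ?\<theta>) powr (- 1) = t powr (- (real k * ?\<theta>)) * \<rho> powr (- ?\<theta>)"
     using t01 \<rho> by (simp add: powr_mult powr_realpow[symmetric] powr_powr powr_minus field_simps)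
    have "?c t * (K / (?s ^ CARD('n) * ?b)) powr (1 / \<gamma>)
     = real k powr p * (\<rho> powr p * \<rho> powr (- ?\<theta>)) * (K / ?b) powr (1 / \<gamma>)
      * (t powr (real (k - 1) * p) * t powr (- (real k * ?\<theta>)))"
     unfolding e1 e2 e3 by (simp only: ac_simps)
    also have "... = ?A
      * t powr (real (k - 1) * p - real k * ?\<theta>)"
     by (simp add: powr_add[symmetric])
    also have "... <= ?A * 1"
    proof (intro mult_left_mono)
     have "0 <= real (k - 1) * p - real k * ?\<theta>" using k by (simp add: of_nat_diff algebra_simps)
     then show "t powr (real (k - 1) * p - real k * ?\<theta>) <= 1" using t01 by (intro powr_le1) auto
    qed (auto intro!: mult_nonneg_nonneg)
    finally show "?c t * (K / (?s ^ CARD('n) * ?b)) powr (1 / \<gamma>)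
     <= ?A" by simp
   qed simp
   finally show ?thesis using True by simp
  qed simp
 qed
 also have "... = ennreal ?A * ?I"
  by (subst nn_integral_cmult) auto
 finally show ?thesis .
qed

definition ball_mean :: "real => real ^ 'n => (real ^ 'n => real) => real" where
 "ball_mean \<rho> y \<phi> = (LINT z|unit_ball_average. \<phi> (y + \<rho> *\<^sub>R z))"

lemma integrable_ball_mean:
 assumes "\<phi> \<in> test_functions \<Omega>"
 shows "integrable (unit_ball_average :: (real ^ 'n) measure) (%z. \<phi> (y + \<rho> *\<^sub>R z))"
proof -
 interpret finite_measure "unit_ball_average :: (real ^ 'n) measure"
  by (rule finite_measureI) (simp add: unit_ball_average(1))
 have [measurable]: "\<phi> \<in> borel_measurable borel" by (rule borel_measurable_continuous_onI[OF test_functionsD(2)[OF assms]])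
 obtain B where "!!x. \<bar>\<phi> x\<bar> <= B" using test_function_bounded[OF assms] by auto
 then show ?thesis by (intro integrable_const_bound[of _ B]) auto
qed

lemma ball_mean_linear_comb:
 assumes "\<phi> \<in> test_functions \<Omega>" "\<psi> \<in> test_functions \<Omega>"
 shows "ball_mean \<rho> y (%x. a * \<phi> x + b * \<psi> x) = a * ball_mean \<rho> y \<phi> + b * ball_mean \<rho> y \<psi>"
 unfolding ball_mean_def using integrable_ball_mean[OF assms(1), of y \<rho>] integrable_ball_mean[OF assms(2), of y \<rho>] by simp

lemma integrable_grad_powr:
 assumes "\<phi> \<in> test_functions \<Omega>" "0 < p"
 shows "integrable lborel (%x. norm (grad \<phi> x) powr p)"
proof (rule integrable_compact_support[OF _ test_functionsD(4)[OF assms(1)]])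
 show "continuous_on UNIV (%x. norm (grad \<phi> x) powr p)"
  using assms(2) by (intro continuous_intros continuous_grad[OF assms(1)] continuous_on_powr') auto
qed (use grad_zero_support assms(2) in auto)

text \<open>Over balls of fixed radius the integrals along segments need no weight: each is an average of \<open>|\<nabla>\<phi>|^p\<close> over a ball.\<close>
lemma ball_shift:
 fixes \<phi> :: "real ^ 'n => real"
 assumes \<phi>: "\<phi> \<in> test_functions \<Omega>" and p: "1 <= p" and \<rho>: "0 < \<rho>"
 shows "(\<integral>\<^sup>+z. ennreal (\<bar>\<phi> (y + \<rho> *\<^sub>R z) - \<phi> (y + v + \<rho> *\<^sub>R z)\<bar> powr p) \<partial>unit_ball_average)
  <= ennreal (norm v powr p / (\<rho> ^ CARD('n) * measure lborel (ball (0::real^'n) 1)) * (LINT x|lborel. norm (grad \<phi> x) powr p))"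
proof -
 let ?U = "unit_ball_average :: (real ^ 'n) measure" and ?b = "measure lborel (ball (0::real^'n) 1)"
 let ?I = "\<integral>\<^sup>+x. ennreal (norm (grad \<phi> x) powr p) \<partial>lborel"
 let ?g = "%z t. norm v powr p * norm (grad \<phi> (y + \<rho> *\<^sub>R z + t *\<^sub>R v)) powr p"
 let ?d = "%z. \<bar>\<phi> (y + \<rho> *\<^sub>R z) - \<phi> (y + v + \<rho> *\<^sub>R z)\<bar> powr p"
 interpret U: sigma_finite_measure ?U by (rule sigma_finite_unit_ball_average)
 interpret LU: pair_sigma_finite "lborel :: real measure" ?U ..
 have [measurable]: "grad \<phi> \<in> borel_measurable borel" by (rule borel_measurable_continuous_onI[OF continuous_grad[OF \<phi>]])
 have "(\<integral>\<^sup>+z. ennreal (?d z) \<partial>?U)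
  <= (\<integral>\<^sup>+z. (\<integral>\<^sup>+t. ennreal (?g z t) * indicator {0..1} t \<partial>lborel) \<partial>?U)"
 proof (rule nn_integral_mono)
  fix z :: "real ^ 'n"
  have e: "y + v + \<rho> *\<^sub>R z = y + \<rho> *\<^sub>R z + v" by simp
  show "ennreal (?d z)
   <= (\<integral>\<^sup>+t. ennreal (?g z t) * indicator {0..1} t \<partial>lborel)"
   unfolding e using increment_path[OF \<phi> p, of 1 v "norm v" "y + \<rho> *\<^sub>R z"] by simp
 qed
 also have "... = (\<integral>\<^sup>+t. (\<integral>\<^sup>+z. ennreal (?g z t) * indicator {0..1} t \<partial>?U) \<partial>lborel)"
  by (rule LU.Fubini') measurable
 also have "... <= (\<integral>\<^sup>+t. ennreal (norm v powr p) * (ennreal (1 / (\<rho> ^ CARD('n) * ?b)) * ?I) * indicator {0..1} t \<partial>(lborel :: real measure))"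
 proof (rule nn_integral_mono)
  fix t :: real
  have "(\<integral>\<^sup>+z. ennreal (?g z t) \<partial>?U)
   = ennreal (norm v powr p) * (\<integral>\<^sup>+z. ennreal (norm (grad \<phi> ((y + t *\<^sub>R v) + \<rho> *\<^sub>R z)) powr p) \<partial>?U)"
   by (simp add: ennreal_mult nn_integral_cmult ac_simps)
  also have "... <= ennreal (norm v powr p) * (ennreal (1 / (\<bar>\<rho>\<bar> ^ CARD('n) * ?b)) * ?I)"
   by (intro mult_left_mono unit_ball_average_scaling) (use \<rho> in auto)
  finally show "(\<integral>\<^sup>+z. ennreal (?g z t) * indicator {0..1} t \<partial>?U)
   <= ennreal (norm v powr p) * (ennreal (1 / (\<rho> ^ CARD('n) * ?b)) * ?I) * indicator {0..1} t"
   using \<rho> by (simp split: split_indicator)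
 qed
 also have "... = ennreal (norm v powr p) * (ennreal (1 / (\<rho> ^ CARD('n) * ?b)) * ?I)"
  by (subst nn_integral_cmult) auto
 also have "?I = ennreal (LINT x|lborel. norm (grad \<phi> x) powr p)"
  by (rule nn_integral_eq_integral[OF integrable_grad_powr[OF \<phi>]]) (use p in auto)
 finally show ?thesis using \<rho> by (simp add: ennreal_mult[symmetric])
qed

text \<open>Compare with a ball so far away that \<open>\<phi>\<close> vanishes on it.\<close>
lemma ball_mean_bound:
 fixes \<phi> :: "real ^ 'n => real"
 assumes \<phi>: "\<phi> \<in> test_functions \<Omega>" and p: "1 <= p" and \<rho>: "0 < \<rho>" and R: "!!x. x \<in> \<Omega> ==> norm x <= R" "norm y <= R"
 shows "\<bar>ball_mean \<rho> y \<phi>\<bar> powr p <= (2 * R + \<rho> + 1) powr p / (\<rho> ^ CARD('n) * measure lborel (ball (0::real^'n) 1)) * (LINT x|lborel. norm (grad \<phi> x) powr p)"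
  (is "_ <= ?C * ?J")
proof -
 let ?U = "unit_ball_average :: (real ^ 'n) measure"
 have R0: "0 <= R" using R(2) norm_ge_zero[of y] by linarith
 define v :: "real ^ 'n" where "v = (2 * R + \<rho> + 1) *\<^sub>R axis undefined 1"
 have nv: "norm v = 2 * R + \<rho> + 1" using R0 \<rho> by (simp add: v_def)
 have z: "\<phi> (y + v + \<rho> *\<^sub>R z) = 0" if "norm z <= 1" for z
 proof (rule test_function_zero_outside[OF \<phi>])
  have "norm v <= norm (y + v + \<rho> *\<^sub>R z) + norm y + norm (\<rho> *\<^sub>R z)"
   using norm_triangle_ineq4[of "y + v + \<rho> *\<^sub>R z" "y + \<rho> *\<^sub>R z"] norm_triangle_ineq[of y "\<rho> *\<^sub>R z"] by simp
  moreover have "norm (\<rho> *\<^sub>R z) <= \<rho>" using that \<rho> by simp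
  ultimately show "y + v + \<rho> *\<^sub>R z \<notin> \<Omega>" using R(1)[of "y + v + \<rho> *\<^sub>R z"] R(2) nv by (smt (verit))
 qed
 have "ennreal (\<bar>ball_mean \<rho> y \<phi>\<bar> powr p) <= (\<integral>\<^sup>+z. ennreal (\<bar>\<phi> (y + \<rho> *\<^sub>R z)\<bar> powr p) \<partial>?U)"
  unfolding ball_mean_def by (rule jensen_powr[OF unit_ball_average(1) p integrable_ball_mean[OF \<phi>]])
 also have "... = (\<integral>\<^sup>+z. ennreal (\<bar>\<phi> (y + \<rho> *\<^sub>R z) - \<phi> (y + v + \<rho> *\<^sub>R z)\<bar> powr p) \<partial>?U)"
  by (rule nn_integral_cong_AE, rule AE_mp[OF unit_ball_average(3)], rule AE_I2, rule impI) (simp add: z)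
 also have "... <= ennreal (?C * ?J)" using ball_shift[OF \<phi> p \<rho>, of y v] nv by simp
 finally show ?thesis using p \<rho> by (subst (asm) ennreal_le_iff) (auto intro!: mult_nonneg_nonneg)
qed

lemma abs_add_powr_le:
 fixes a b c :: real
 assumes "0 < p"
 shows "\<bar>a + b\<bar> powr p <= 2 powr p * (\<bar>a\<bar> powr p + \<bar>b\<bar> powr p)"
 using norm_add_powr_le[OF assms, of a b] by simp

text \<open>First \<open>\<rho>\<close> is chosen so small that \<open>\<phi>\<close> differs little from its means over balls of radius \<open>\<rho>\<close> in the weighted norm,
then \<open>\<delta>\<close> so small that these means vary little over distances \<open>\<delta>\<close>; then the means at the points of a finite
\<open>\<delta>\<close>-net control \<open>\<phi>\<close>.\<close>
lemma weighted_compactness_estimate: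
 fixes w :: "real ^ 'n => real"
 assumes w [measurable]: "w \<in> borel_measurable borel" and w0: "!!x. 0 <= w x" and wO: "\<forall>x. x \<notin> \<Omega> --> w x = 0"
  and wi: "integrable lborel w" and wg: "integrable lborel (%x. w x powr \<gamma>)"
  and \<Omega>: "bounded \<Omega>" and p: "1 <= p" and g: "1 <= \<gamma>" "real CARD('n) / \<gamma> < p" and \<epsilon>: "0 < \<epsilon>"
 shows "\<exists>(d::nat) \<rho> y c C. 0 < \<rho> & 0 <= c & 0 <= C & (\<forall>\<phi>\<in>test_functions \<Omega>.
  (LINT x|lborel. w x * \<bar>\<phi> x\<bar> powr p) <= \<epsilon> * (LINT x|lborel. norm (grad \<phi> x) powr p) + (\<Sum>i<d. \<bar>c * ball_mean \<rho> (y i) \<phi>\<bar> powr p)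
  & (\<forall>i<d. \<bar>c * ball_mean \<rho> (y i) \<phi>\<bar> powr p <= C * (LINT x|lborel. norm (grad \<phi> x) powr p)))"
proof -
 let ?U = "unit_ball_average :: (real ^ 'n) measure" and ?b = "measure lborel (ball (0::real^'n) 1)"
 have b: "0 < ?b" using content_ball_pos[of 1 "0 :: real ^ 'n"] by simp
 define \<theta> where "\<theta> = p - real CARD('n) / \<gamma>"
 have \<theta>: "0 < \<theta>" using g by (simp add: \<theta>_def)
 define K where "K = (LINT x|lborel. w x powr \<gamma>)"
 have K: "0 <= K" "(\<integral>\<^sup>+x. ennreal (w x powr \<gamma>) \<partial>lborel) <= ennreal K"
  unfolding K_def using nn_integral_eq_integral[OF wg] by auto
 (* Makes the exponent of t in weighted_mean_oscillation nonnegative. *)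
 obtain k0 :: nat where k0: "p / \<theta> <= real k0" using real_arch_simple by blast
 define k where "k = Suc k0"
 have "p / \<theta> <= real k" using k0 by (simp add: k_def)
 then have k: "1 <= k" "p <= real k * (p - real CARD('n) / \<gamma>)" using \<theta> by (auto simp: k_def \<theta>_def field_simps)
 define A where "A = 4 powr p * (real k powr p * (K / ?b) powr (1 / \<gamma>))"
 have A: "0 <= A" by (simp add: A_def)
 obtain e1 where e1: "0 < e1" "e1 * A <= \<epsilon> / 2" using exists_small_factor[of "\<epsilon> / 2" A] \<epsilon> A by auto
 define \<rho> where "\<rho> = e1 powr (1 / \<theta>)"
 have \<rho>: "0 < \<rho>" "A * \<rho> powr \<theta> <= \<epsilon> / 2" using e1 \<theta> by (simp_all add: \<rho>_def powr_powr mult.commute)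
 define W where "W = (LINT x|lborel. w x)"
 have W: "0 <= W" using w0 by (simp add: W_def)
 define D where "D = W * 4 powr p / (\<rho> ^ CARD('n) * ?b)"
 have D: "0 <= D" using W \<rho> by (simp add: D_def)
 obtain e2 where e2: "0 < e2" "e2 * D <= \<epsilon> / 2" using exists_small_factor[of "\<epsilon> / 2" D] \<epsilon> D by auto
 define \<delta> where "\<delta> = e2 powr (1 / p)"
 have \<delta>: "0 < \<delta>" "D * \<delta> powr p <= \<epsilon> / 2" using e2 p by (simp_all add: \<delta>_def powr_powr mult.commute)
 obtain S where S: "finite S" "S \<subseteq> closure \<Omega>" "closure \<Omega> \<subseteq> (\<Union>x\<in>S. ball x \<delta>)"
 proof (rule compactE_image[of "closure \<Omega>" "closure \<Omega>" "%x. ball x \<delta>"])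
  show "compact (closure \<Omega>)" using \<Omega> by simp
  show "closure \<Omega> \<subseteq> (\<Union>x\<in>closure \<Omega>. ball x \<delta>)" using \<delta> by auto
 qed auto
 obtain ys where ys: "set ys = S" using finite_list[OF S(1)] by blast
 define y where "y i = ys ! i" for i
 obtain R where R: "!!x. x \<in> closure \<Omega> ==> norm x <= R" using bounded_closure[OF \<Omega>] unfolding bounded_iff by auto
 have RO: "norm x <= R" if "x \<in> \<Omega>" for x using R[of x] closure_subset that by blast
 define c where "c = 2 * W powr (1 / p)"
 have c: "0 <= c" "c powr p = 2 powr p * W" using p W by (auto simp: c_def powr_mult powr_powr)
 define C where "C = 2 powr p * W * ((2 * \<bar>R\<bar> + \<rho> + 1) powr p / (\<rho> ^ CARD('n) * ?b))"
 have "0 <= C" using W \<rho> by (simp add: C_def)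
 moreover have "(LINT x|lborel. w x * \<bar>\<phi> x\<bar> powr p) <= \<epsilon> * (LINT x|lborel. norm (grad \<phi> x) powr p) + (\<Sum>i<length ys. \<bar>c * ball_mean \<rho> (y i) \<phi>\<bar> powr p)
   & (\<forall>i<length ys. \<bar>c * ball_mean \<rho> (y i) \<phi>\<bar> powr p <= C * (LINT x|lborel. norm (grad \<phi> x) powr p))"
  if \<phi>: "\<phi> \<in> test_functions \<Omega>" for \<phi>
 proof
  let ?I = "LINT x|lborel. norm (grad \<phi> x) powr p"
  let ?\<Lambda> = "%i. ball_mean \<rho> (y i) \<phi>"
  let ?o = "%x z. \<bar>\<phi> x - \<phi> (x + \<rho> *\<^sub>R z)\<bar> powr p" and ?Y = "\<delta> powr p / (\<rho> ^ CARD('n) * ?b) * ?I"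
  let ?s = "%x i z. \<bar>\<phi> (x + \<rho> *\<^sub>R z) - \<phi> (x + (y i - x) + \<rho> *\<^sub>R z)\<bar> powr p"
  let ?wO = "%x. \<integral>\<^sup>+z. ennreal (w x * ?o x z) \<partial>?U"
  have Ie: "(\<integral>\<^sup>+x. ennreal (norm (grad \<phi> x) powr p) \<partial>lborel) = ennreal ?I"
   by (rule nn_integral_eq_integral[OF integrable_grad_powr[OF \<phi>]]) (use p in auto)
  have I0: "0 <= ?I" by simp
  have [measurable]: "\<phi> \<in> borel_measurable borel" by (rule borel_measurable_continuous_onI[OF test_functionsD(2)[OF \<phi>]])
  have scale: "\<bar>c * s\<bar> powr p = 2 powr p * W * \<bar>s\<bar> powr p" for s
   using c by (simp add: abs_mult powr_mult)
  show "\<forall>i<length ys. \<bar>c * ?\<Lambda> i\<bar> powr p <= C * ?I"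
  proof (intro allI impI)
   fix i assume "i < length ys"
   then have "norm (y i) <= \<bar>R\<bar>" using R[of "y i"] S(2) ys nth_mem[of i ys] by (auto simp: y_def)
   moreover have "!!x. x \<in> \<Omega> ==> norm x <= \<bar>R\<bar>" using RO by (meson abs_ge_self order_trans)
   ultimately have "\<bar>?\<Lambda> i\<bar> powr p <= (2 * \<bar>R\<bar> + \<rho> + 1) powr p / (\<rho> ^ CARD('n) * ?b) * ?I"
    by (intro ball_mean_bound[OF \<phi> p \<rho>(1)]) auto
   then have "2 powr p * W * \<bar>?\<Lambda> i\<bar> powr p <= 2 powr p * W * ((2 * \<bar>R\<bar> + \<rho> + 1) powr p / (\<rho> ^ CARD('n) * ?b) * ?I)"
    using W by (intro mult_left_mono) auto
   then show "\<bar>c * ?\<Lambda> i\<bar> powr p <= C * ?I" unfolding scale C_def by (simp only: mult.assoc)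
  qed
  define \<Sigma> where "\<Sigma> = (\<Sum>i<length ys. \<bar>?\<Lambda> i\<bar> powr p)"
  have \<Sigma>0: "0 <= \<Sigma>" by (simp add: \<Sigma>_def sum_nonneg)
  define T where "T = 4 powr p * ?Y + 2 powr p * \<Sigma>"
  have T0: "0 <= T" using \<Sigma>0 \<rho> I0 by (simp add: T_def)
  let ?Q = "%x. \<integral>\<^sup>+z. ennreal (?o x z) \<partial>?U"
  have pt: "ennreal (\<bar>\<phi> x\<bar> powr p) <= ennreal (4 powr p) * ?Q x + ennreal T" if x: "x \<in> \<Omega>" for x
  proof -
   obtain s where s: "s \<in> S" "dist s x < \<delta>" using S(3) x closure_subset[of \<Omega>] by (auto simp: subset_iff)
   then obtain i where i: "i < length ys" "y i = s" using ys by (auto simp: in_set_conv_nth y_def)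
   have "ennreal (\<bar>\<phi> x - ?\<Lambda> i\<bar> powr p) <= (\<integral>\<^sup>+z. ennreal (\<bar>\<phi> x - \<phi> (y i + \<rho> *\<^sub>R z)\<bar> powr p) \<partial>?U)"
   proof -
    interpret U: finite_measure ?U by (rule finite_measureI) (simp add: unit_ball_average(1))
    have "(LINT z|?U. \<phi> x - \<phi> (y i + \<rho> *\<^sub>R z)) = \<phi> x - ?\<Lambda> i"
     using integrable_ball_mean[OF \<phi>, of "y i" \<rho>] unit_ball_average(1)[where 'n='n] by (simp add: ball_mean_def measure_def)
    then show ?thesis
     using jensen_powr[OF unit_ball_average(1) p, of "%z. \<phi> x - \<phi> (y i + \<rho> *\<^sub>R z)"] integrable_ball_mean[OF \<phi>, of "y i" \<rho>] by simp
   qed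
   also have "... <= (\<integral>\<^sup>+z. ennreal (2 powr p) * (ennreal (?o x z)
     + ennreal (?s x i z)) \<partial>?U)"
   proof (rule nn_integral_mono)
    fix z
    have "\<bar>\<phi> x - \<phi> (y i + \<rho> *\<^sub>R z)\<bar> powr p <= 2 powr p * (?o x z + ?s x i z)"
     using abs_add_powr_le[of p "\<phi> x - \<phi> (x + \<rho> *\<^sub>R z)" "\<phi> (x + \<rho> *\<^sub>R z) - \<phi> (y i + \<rho> *\<^sub>R z)"] p by simp
    then show "ennreal (\<bar>\<phi> x - \<phi> (y i + \<rho> *\<^sub>R z)\<bar> powr p) <= ennreal (2 powr p) * (ennreal (?o x z)
     + ennreal (?s x i z))"
     by (simp add: ennreal_mult[symmetric] ennreal_plus[symmetric] ennreal_leI del: ennreal_plus)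
   qed
   also have "... = ennreal (2 powr p) * (?Q x + (\<integral>\<^sup>+z. ennreal (?s x i z) \<partial>?U))"
    by (simp add: nn_integral_cmult nn_integral_add)
   also have "... <= ennreal (2 powr p) * (?Q x + ennreal ?Y)"
   proof (intro mult_left_mono add_left_mono)
    have "norm (y i - x) powr p / (\<rho> ^ CARD('n) * ?b) * ?I <= ?Y"
     using s i p \<rho> by (intro mult_right_mono divide_right_mono powr_mono2) (auto simp: dist_norm)
    then show "(\<integral>\<^sup>+z. ennreal (?s x i z) \<partial>?U) <= ennreal ?Y"
     using ball_shift[OF \<phi> p \<rho>(1), of x "y i - x"] by (meson ennreal_leI order_trans)
   qed simp
   finally have 1: "ennreal (\<bar>\<phi> x - ?\<Lambda> i\<bar> powr p) <= ennreal (2 powr p) * (?Q x + ennreal ?Y)" .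
   have "\<bar>\<phi> x\<bar> powr p <= 2 powr p * (\<bar>\<phi> x - ?\<Lambda> i\<bar> powr p + \<bar>?\<Lambda> i\<bar> powr p)"
    using abs_add_powr_le[of p "\<phi> x - ?\<Lambda> i" "?\<Lambda> i"] p by simp
   also have "... <= 2 powr p * (\<bar>\<phi> x - ?\<Lambda> i\<bar> powr p + \<Sigma>)"
    using i unfolding \<Sigma>_def by (intro mult_left_mono add_left_mono member_le_sum) auto
   finally have "ennreal (\<bar>\<phi> x\<bar> powr p) <= ennreal (2 powr p) * (ennreal (\<bar>\<phi> x - ?\<Lambda> i\<bar> powr p) + ennreal \<Sigma>)"
    using \<Sigma>0 by (simp add: ennreal_mult[symmetric] ennreal_plus[symmetric] ennreal_leI del: ennreal_plus)
   also have "... <= ennreal (2 powr p) * (ennreal (2 powr p) * (?Q x + ennreal ?Y) + ennreal \<Sigma>)"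
    by (intro mult_left_mono add_right_mono 1) auto
   also have "... = ennreal (4 powr p) * ?Q x + ennreal T"
   proof -
    have 4: "ennreal (4 powr p) = ennreal (2 powr p) * ennreal (2 powr p)" by (simp flip: ennreal_mult powr_mult)
    have "0 <= ?Y" using \<rho> I0 by simp
    then have T: "ennreal T = ennreal (4 powr p) * ennreal ?Y + ennreal (2 powr p) * ennreal \<Sigma>"
     unfolding T_def using \<Sigma>0
     by (simp only: ennreal_plus[OF mult_nonneg_nonneg mult_nonneg_nonneg] ennreal_mult powr_ge_zero)
    show ?thesis unfolding T 4 by (simp only: distrib_left mult.assoc add.assoc)
   qed
   finally show ?thesis .
  qed
  have "ennreal (LINT x|lborel. w x * \<bar>\<phi> x\<bar> powr p) <= (\<integral>\<^sup>+x. ennreal (w x * \<bar>\<phi> x\<bar> powr p) \<partial>lborel)"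
   using nn_integral_eq_integral[of lborel "%x. w x * \<bar>\<phi> x\<bar> powr p"] w0
   by (cases "integrable lborel (%x. w x * \<bar>\<phi> x\<bar> powr p)") (auto simp: not_integrable_integral_eq)
  also have "... <= (\<integral>\<^sup>+x. ennreal (4 powr p) * ?wO x + ennreal T * ennreal (w x) \<partial>lborel)"
  proof (rule nn_integral_mono)
   fix x
   show "ennreal (w x * \<bar>\<phi> x\<bar> powr p) <= ennreal (4 powr p) * ?wO x + ennreal T * ennreal (w x)"
   proof (cases "x \<in> \<Omega>")
    case True
    have "ennreal (w x * \<bar>\<phi> x\<bar> powr p) = ennreal (w x) * ennreal (\<bar>\<phi> x\<bar> powr p)" using w0 by (simp add: ennreal_mult)
    also have "... <= ennreal (w x) * (ennreal (4 powr p) * ?Q x + ennreal T)" by (intro mult_left_mono pt True) simp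
    also have "... = ennreal (4 powr p) * (ennreal (w x) * ?Q x) + ennreal T * ennreal (w x)" by (simp add: algebra_simps)
    also have "ennreal (w x) * ?Q x = ?wO x"
     using w0 by (simp add: ennreal_mult nn_integral_cmult)
    finally show ?thesis .
   qed (simp add: wO)
  qed
  also have "... = ennreal (4 powr p) * (\<integral>\<^sup>+x. ?wO x \<partial>lborel) + ennreal T * ennreal W"
  proof -
   interpret U: sigma_finite_measure ?U by (rule sigma_finite_unit_ball_average)
   have [measurable]: "(%x. \<integral>\<^sup>+z. ennreal (w x * ?o x z) \<partial>?U) \<in> borel_measurable lborel"
    by measurable
   have "(\<integral>\<^sup>+x. ennreal (w x) \<partial>lborel) = ennreal W" unfolding W_def by (rule nn_integral_eq_integral[OF wi]) (simp add: w0)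
   then show ?thesis by (simp add: nn_integral_add nn_integral_cmult)
  qed
  also have "... <= ennreal (4 powr p) * (ennreal (real k powr p * \<rho> powr \<theta> * (K / ?b) powr (1 / \<gamma>)) * ennreal ?I) + ennreal T * ennreal W"
   using weighted_mean_oscillation[OF w w0 g(1) K \<phi> p k \<rho>(1)] unfolding \<theta>_def Ie by (intro add_right_mono mult_left_mono) auto
  also have "... = ennreal (A * \<rho> powr \<theta> * ?I + T * W)"
   using I0 T0 W by (simp add: ennreal_mult[symmetric] ennreal_plus[symmetric] A_def ac_simps del: ennreal_plus)
  finally have "(LINT x|lborel. w x * \<bar>\<phi> x\<bar> powr p) <= A * \<rho> powr \<theta> * ?I + T * W"
   using I0 T0 W A by (subst (asm) ennreal_le_iff) auto
  also have "T * W = D * \<delta> powr p * ?I + 2 powr p * W * \<Sigma>" by (simp add: T_def D_def field_simps)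
  also have "A * \<rho> powr \<theta> * ?I + (D * \<delta> powr p * ?I + 2 powr p * W * \<Sigma>) <= \<epsilon> / 2 * ?I + (\<epsilon> / 2 * ?I + 2 powr p * W * \<Sigma>)"
   using \<rho>(2) \<delta>(2) I0 W \<Sigma>0 by (intro add_mono mult_right_mono) auto
  also have "... = \<epsilon> * ?I + (\<Sum>i<length ys. \<bar>c * ?\<Lambda> i\<bar> powr p)"
   unfolding scale by (simp add: \<Sigma>_def sum_distrib_left)
  finally show "(LINT x|lborel. w x * \<bar>\<phi> x\<bar> powr p) <= \<epsilon> * ?I + (\<Sum>i<length ys. \<bar>c * ?\<Lambda> i\<bar> powr p)" .
 qed
 ultimately show ?thesis using \<rho>(1) c(1) by blast
qed

section \<open>Poincare inequality and Rellich compactness\<close>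

lemma diagonal_subsequence:
 fixes a :: "nat => 'i::countable => real"
 assumes "!!k i. \<bar>a k i\<bar> <= R i"
 shows "\<exists>s::nat=>nat. strict_mono s & (\<forall>i. convergent (%j. a (s j) i))"
proof -
 let ?S = "{c :: 'i => real. \<forall>i. \<bar>c i\<bar> <= R i}"
 have "seq_compact ?S" by (rule compact_imp_seq_compact[OF compact_box_fun])
 moreover have "\<forall>k. a k \<in> ?S" using assms by simp
 ultimately obtain l s where s: "strict_mono s" "(a \<circ> s) \<longlonglongrightarrow> l" by (rule seq_compactE)
 have "convergent (%j. a (s j) i)" for i
  using continuous_on_tendsto_compose[OF continuous_on_product_coordinates[of i] s(2)] by (auto simp: comp_def intro: convergentI)
 then show ?thesis using s(1) by blast
qed

text \<open>The weight is at least 1 on \<open>\<Omega>\<close>, so that convergence in \<open>L\<^sup>p(\<mu>)\<close> implies convergence in \<open>L\<^sup>p(\<Omega>)\<close>.\<close>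
locale weighted_domain =
 fixes \<Omega> :: "(real ^ 'n) set" and p \<gamma> :: real and wt :: "real ^ 'n => real"
 assumes open_domain: "open \<Omega>" and bounded_domain: "bounded \<Omega>"
  and p: "1 < p" and \<gamma>: "1 <= \<gamma>" "real CARD('n) / \<gamma> < p"
  and wt_borel [measurable]: "wt \<in> borel_measurable borel"
  and wt_ge_1: "!!x. x \<in> \<Omega> ==> 1 <= wt x" and wt_outside: "!!x. x \<notin> \<Omega> ==> wt x = 0"
  and wt_integrable: "integrable lborel wt" "integrable lborel (%x. wt x powr \<gamma>)"
begin

abbreviation "M \<equiv> lebesgue_on \<Omega>"
abbreviation "\<mu> \<equiv> density (lebesgue_on \<Omega>) (%x. ennreal (wt x))"
abbreviation "TF \<equiv> test_functions \<Omega>"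
abbreviation "r \<phi> \<equiv> Lp_norm (lebesgue_on \<Omega>) p (grad \<phi>)"

lemma p0: "0 < p" using p by simp

lemma domain_lebesgue: "\<Omega> \<in> sets lebesgue" using open_domain by (simp add: borel_open)

lemma wt_nonneg: "0 <= wt x" using wt_ge_1[of x] wt_outside[of x] by (cases "x \<in> \<Omega>") auto

lemma wt_measurable [measurable]: "wt \<in> borel_measurable M"
 by (rule measurable_restrict_space1, rule measurable_completion) (use wt_borel in simp)

lemma measurable_\<mu>: "borel_measurable \<mu> = borel_measurable M"
 by (rule measurable_cong_sets) auto

lemma finite_M: "finite_measure M" by (rule finite_measure_lebesgue_on[OF open_domain bounded_domain])

lemma integral_\<mu>:
 fixes f :: "real ^ 'n => real"
 assumes "f \<in> borel_measurable M"
 shows "integrable \<mu> f \<longleftrightarrow> integrable M (%x. wt x * f x)" "(LINT x|\<mu>. f x) = (LINT x|M. wt x * f x)"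
 using integrable_real_density[of wt M f] integral_real_density[of wt M f] assms wt_nonneg by auto

lemma wt_integrable_M: "integrable M wt"
 using integral_lebesgue_on_eq_lborel(2)[OF wt_borel wt_outside domain_lebesgue] wt_integrable(1) by simp

lemma finite_\<mu>: "finite_measure \<mu>"
proof (rule finite_measureI)
 have "emeasure \<mu> (space \<mu>) = (\<integral>\<^sup>+x. ennreal (wt x) \<partial>M)"
  by (subst emeasure_density) (auto intro!: nn_integral_cong simp: space_restrict_space)
 also have "... = ennreal (LINT x|M. wt x)" by (rule nn_integral_eq_integral[OF wt_integrable_M]) (simp add: wt_nonneg)
 finally show "emeasure \<mu> (space \<mu>) ~= \<infinity>" by simp
qed

lemma Lp_\<mu>_imp_Lp_M:
 fixes u :: "real ^ 'n => real"
 assumes s: "0 < s" and u: "u \<in> Lp \<mu> s"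
 shows "u \<in> Lp M s" "Lp_norm M s u <= Lp_norm \<mu> s u"
proof -
 have m [measurable]: "u \<in> borel_measurable M" using LpD(1)[OF u] unfolding measurable_\<mu> .
 have i: "integrable M (%x. wt x * (norm (u x) powr s))" using LpD(2)[OF u] by (simp add: integral_\<mu>)
 have le: "norm (u x) powr s <= wt x * (norm (u x) powr s)" if "x \<in> \<Omega>" for x
  using mult_right_mono[OF wt_ge_1[OF that], of "norm (u x) powr s"] by simp
 have i': "integrable M (%x. norm (u x) powr s)"
  by (rule Bochner_Integration.integrable_bound[OF i]) (use le wt_nonneg in \<open>auto intro!: AE_I2 simp: space_restrict_space\<close>)
 then show "u \<in> Lp M s" by (simp add: Lp_def)
 have "(LINT x|M. norm (u x) powr s) <= (LINT x|M. wt x * (norm (u x) powr s))"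
  by (rule integral_mono[OF i' i]) (use le in \<open>auto simp: space_restrict_space\<close>)
 also have "... = (LINT x|\<mu>. norm (u x) powr s)" by (rule integral_\<mu>(2)[symmetric]) simp
 finally show "Lp_norm M s u <= Lp_norm \<mu> s u" unfolding Lp_norm_def using s
  by (intro powr_mono2) (auto intro!: Bochner_Integration.integral_nonneg)
qed

lemma test_function_Lp_\<mu>: "0 < s ==> \<phi> \<in> TF ==> \<phi> \<in> Lp \<mu> s"
 using test_function_bounded[of \<phi> \<Omega>]
 by (auto intro!: continuous_bounded_Lp[OF finite_\<mu>] continuous_measurable_lebesgue_on test_functionsD(2) simp: measurable_\<mu>)

lemmas test_Lp = test_function_Lp[OF open_domain bounded_domain p0]

lemma r_lborel:
 assumes "\<phi> \<in> TF"
 shows "(LINT x|lborel. norm (grad \<phi> x) powr p) = r \<phi> powr p"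
proof -
 have [measurable]: "grad \<phi> \<in> borel_measurable borel" by (rule borel_measurable_continuous_onI[OF continuous_grad[OF assms]])
 show ?thesis
  using integral_lebesgue_on_eq_lborel(1)[of "%x. norm (grad \<phi> x) powr p" \<Omega>] p0 grad_zero_outside[OF assms] domain_lebesgue
  by (simp add: Lp_norm_powr)
qed

lemma \<mu>_lborel:
 assumes "\<phi> \<in> TF"
 shows "(LINT x|lborel. wt x * \<bar>\<phi> x\<bar> powr p) = Lp_norm \<mu> p \<phi> powr p"
proof -
 have c: "continuous_on UNIV \<phi>" by (rule test_functionsD(2)[OF assms])
 have [measurable]: "\<phi> \<in> borel_measurable borel" by (rule borel_measurable_continuous_onI[OF c])
 have [measurable]: "\<phi> \<in> borel_measurable M" by (rule continuous_measurable_lebesgue_on[OF c])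
 have "(LINT x|M. wt x * \<bar>\<phi> x\<bar> powr p) = (LINT x|lborel. wt x * \<bar>\<phi> x\<bar> powr p)"
  by (rule integral_lebesgue_on_eq_lborel(1)) (use wt_outside domain_lebesgue in auto)
 then show ?thesis using p0 by (simp add: Lp_norm_powr integral_\<mu>)
qed

lemma grad_fun:
 assumes "\<phi> \<in> TF" "\<psi> \<in> TF"
 shows "grad (%x. \<phi> x + \<psi> x) = (%x. grad \<phi> x + grad \<psi> x)" "grad (%x. \<phi> x - \<psi> x) = (%x. grad \<phi> x - grad \<psi> x)"
  "grad (%x. c * \<phi> x) = (%x. c *\<^sub>R grad \<phi> x)"
 by (rule ext, rule grad_simple_comb[OF assms])+

lemma r_add: "\<phi> \<in> TF ==> \<psi> \<in> TF ==> r (%x. \<phi> x + \<psi> x) <= r \<phi> + r \<psi>"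
 using Minkowski[OF p test_Lp(2) test_Lp(2), of \<phi> \<psi>] by (simp add: grad_fun(1))

lemma r_diff: "\<phi> \<in> TF ==> \<psi> \<in> TF ==> r (%x. \<phi> x - \<psi> x) <= r \<phi> + r \<psi>"
 using Minkowski[OF p test_Lp(2) Lp_minus[OF test_Lp(2)], of \<phi> \<psi>] by (simp add: grad_fun(2) Lp_norm_minus)

text \<open>Finitely many linear functionals that control the weighted norm up to a small multiple of the gradient norm. They
serve for Poincare's inequality, Rellich's theorem and a lower bound of the energy on a subspace of finite codimension.\<close>
definition compactness_control where
 "compactness_control \<epsilon> d \<Lambda> C \<longleftrightarrow> 0 <= C \<and>
  (\<forall>\<phi>\<in>TF. Lp_norm \<mu> p \<phi> powr p <= \<epsilon> * r \<phi> powr p + (\<Sum>i<d. \<bar>\<Lambda> i \<phi>\<bar> powr p) & (\<forall>i<d::nat. \<bar>\<Lambda> i \<phi>\<bar> <= C * r \<phi>)) \<and>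
  (\<forall>i. \<forall>\<phi>\<in>TF. \<forall>\<psi>\<in>TF. \<forall>a b. \<Lambda> i (%x. a * \<phi> x + b * \<psi> x) = a * \<Lambda> i \<phi> + b * \<Lambda> i \<psi>)"

lemma compactness_controlD:
 assumes "compactness_control \<epsilon> d \<Lambda> C"
 shows "0 <= C" "\<phi> \<in> TF ==> Lp_norm \<mu> p \<phi> powr p <= \<epsilon> * r \<phi> powr p + (\<Sum>i<d. \<bar>\<Lambda> i \<phi>\<bar> powr p)"
  "\<phi> \<in> TF ==> i < d ==> \<bar>\<Lambda> i \<phi>\<bar> <= C * r \<phi>"
  "\<phi> \<in> TF ==> \<psi> \<in> TF ==> \<Lambda> i (%x. a * \<phi> x + b * \<psi> x) = a * \<Lambda> i \<phi> + b * \<Lambda> i \<psi>"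
 using assms unfolding compactness_control_def by blast+

lemma compactness_functionals:
 assumes "0 < \<epsilon>"
 shows "\<exists>d \<Lambda> C. compactness_control \<epsilon> d \<Lambda> C"
proof -
 have p1: "1 <= p" and outside: "\<forall>x. x \<notin> \<Omega> --> wt x = 0" using p wt_outside by simp_all
 obtain d :: nat and \<rho> y c C where \<rho>: "0 < \<rho>" "0 <= c" "0 <= C" and
  E: "\<forall>\<phi>\<in>TF. (LINT x|lborel. wt x * \<bar>\<phi> x\<bar> powr p) <= \<epsilon> * (LINT x|lborel. norm (grad \<phi> x) powr p) + (\<Sum>i<d. \<bar>c * ball_mean \<rho> (y i) \<phi>\<bar> powr p)
   & (\<forall>i<d. \<bar>c * ball_mean \<rho> (y i) \<phi>\<bar> powr p <= C * (LINT x|lborel. norm (grad \<phi> x) powr p))"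
  using weighted_compactness_estimate[OF wt_borel wt_nonneg outside wt_integrable bounded_domain p1 \<gamma> assms]
  by (elim exE conjE) (rule that)
 have "compactness_control \<epsilon> d (%i \<phi>. c * ball_mean \<rho> (y i) \<phi>) (C powr (1 / p))"
  unfolding compactness_control_def
 proof (intro conjI ballI allI impI)
  fix \<phi> assume \<phi>: "\<phi> \<in> TF"
  show "Lp_norm \<mu> p \<phi> powr p <= \<epsilon> * r \<phi> powr p + (\<Sum>i<d. \<bar>c * ball_mean \<rho> (y i) \<phi>\<bar> powr p)"
   using E[rule_format, OF \<phi>, THEN conjunct1] by (simp add: r_lborel[OF \<phi>] \<mu>_lborel[OF \<phi>])
  fix i assume i: "i < d"
  have "(\<bar>c * ball_mean \<rho> (y i) \<phi>\<bar> powr p) powr (1 / p) <= (C * r \<phi> powr p) powr (1 / p)"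
   using E[rule_format, OF \<phi>, THEN conjunct2, rule_format, OF i] p0 unfolding r_lborel[OF \<phi>] by (intro powr_mono2) auto
  then show "\<bar>c * ball_mean \<rho> (y i) \<phi>\<bar> <= C powr (1 / p) * r \<phi>" using p0 by (simp add: powr_powr powr_mult)
 qed (simp_all add: ball_mean_linear_comb algebra_simps)
 then show ?thesis by blast
qed

lemma Poincare_test: "\<exists>P\<ge>0. \<forall>\<phi>\<in>TF. Lp_norm \<mu> p \<phi> <= P * r \<phi>"
proof -
 obtain d \<Lambda> C where "compactness_control 1 d \<Lambda> C" using compactness_functionals[OF zero_less_one] by blast
 note E = compactness_controlD[OF this]
 let ?P = "(1 + real d * C powr p) powr (1 / p)"
 have "Lp_norm \<mu> p \<phi> <= ?P * r \<phi>" if \<phi>: "\<phi> \<in> TF" for \<phi>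
 proof -
  have "Lp_norm \<mu> p \<phi> powr p <= 1 * r \<phi> powr p + (\<Sum>i<d. \<bar>\<Lambda> i \<phi>\<bar> powr p)" by (rule E(2)[OF \<phi>])
  also have "... <= 1 * r \<phi> powr p + (\<Sum>i<d. (C * r \<phi>) powr p)"
   using E(3)[OF \<phi>] p0 by (intro add_left_mono sum_mono powr_mono2) auto
  also have "... = (1 + real d * C powr p) * r \<phi> powr p" by (simp add: powr_mult algebra_simps)
  finally have "(Lp_norm \<mu> p \<phi> powr p) powr (1 / p) <= ((1 + real d * C powr p) * r \<phi> powr p) powr (1 / p)"
   using p0 by (intro powr_mono2) auto
  then show ?thesis using p0 by (simp add: powr_powr powr_mult)
 qed
 then show ?thesis by (intro exI[of _ ?P]) auto
qed

definition P where "P = (SOME P. 0 <= P & (\<forall>\<phi>\<in>TF. Lp_norm \<mu> p \<phi> <= P * r \<phi>))"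

lemma P: "0 <= P" "\<phi> \<in> TF ==> Lp_norm \<mu> p \<phi> <= P * r \<phi>"
proof -
 have "\<exists>P. 0 <= P & (\<forall>\<phi>\<in>TF. Lp_norm \<mu> p \<phi> <= P * r \<phi>)" using Poincare_test by blast
 from someI_ex[OF this] show "0 <= P" "\<phi> \<in> TF ==> Lp_norm \<mu> p \<phi> <= P * r \<phi>" unfolding P_def by auto
qed

text \<open>A diagonal sequence makes all values of the countably many functionals (one finite family for each \<open>\<epsilon> = 1 / n\<close>)
converge; the remaining error is \<open>\<epsilon>\<close> times a bounded quantity.\<close>
theorem Rellich:
 assumes \<phi>: "!!k. \<phi> k \<in> TF" and B: "!!k. r (\<phi> k) <= B"
 shows "\<exists>s::nat=>nat. strict_mono s & Lp_Cauchy \<mu> p (%i. \<phi> (s i))"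
proof -
 have "\<forall>n. \<exists>t. compactness_control (inverse (real (Suc n))) (fst t) (fst (snd t)) (snd (snd t))"
  using compactness_functionals by simp
 from choice[OF this] obtain t where t: "!!n. compactness_control (inverse (real (Suc n))) (fst (t n)) (fst (snd (t n))) (snd (snd (t n)))" by blast
 define d \<Lambda> C where "d n = fst (t n)" and "\<Lambda> n = fst (snd (t n))" and "C n = snd (snd (t n))" for n
 note E = compactness_controlD[OF t, folded d_def \<Lambda>_def C_def]
 have lin: "\<Lambda> n i (%x. \<phi> j x - \<phi> k x) = \<Lambda> n i (\<phi> j) - \<Lambda> n i (\<phi> k)" for n i j k
  using E(4)[OF \<phi> \<phi>, of n i 1 j "-1" k] by simp
 have B0: "0 <= B" using order_trans[OF Lp_norm_nonneg B] .
 define \<Phi> :: "nat => nat \<times> nat => real" where "\<Phi> k = (%(n, i). if i < d n then \<Lambda> n i (\<phi> k) else 0)" for k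
 have "\<bar>\<Lambda> n i (\<phi> k)\<bar> <= C n * B" if "i < d n" for n i k
  by (rule order_trans[OF E(3)[OF \<phi> that] mult_left_mono[OF B E(1)]])
 then have "\<bar>\<Phi> k z\<bar> <= C (fst z) * B" for k z using mult_nonneg_nonneg[OF E(1) B0] by (cases z) (simp add: \<Phi>_def)
 from diagonal_subsequence[of \<Phi>, OF this] obtain s where s: "strict_mono s" "\<forall>z. convergent (%j. \<Phi> (s j) z)" by (elim exE conjE)
 have coord: "Cauchy (%j. \<Phi> (s j) z)" for z
  unfolding Cauchy_convergent_iff by (rule s(2)[THEN spec])
 have "\<exists>N. \<forall>i\<ge>N. \<forall>j\<ge>N. Lp_dist \<mu> p (\<phi> (s i)) (\<phi> (s j)) < e" if e: "0 < e" for e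
 proof -
  have e4: "0 < e powr p / 4" using e by simp
  obtain e' where e': "0 < e'" "e' * (2 * B) powr p <= e powr p / 4" using exists_small_factor[OF e4, of "(2 * B) powr p"] by auto
  obtain n where n: "inverse (real (Suc n)) < e'" using reals_Archimedean[OF e'(1)] by blast
  obtain h' where h': "0 < h'" "h' * real (d n) <= e powr p / 4" using exists_small_factor[OF e4, of "real (d n)"] by auto
  define h where "h = h' powr (1 / p)"
  have h: "0 < h" "h powr p = h'" using h' p0 by (auto simp: h_def powr_powr)
  have "\<forall>i. \<exists>N. \<forall>j\<ge>N. \<forall>k\<ge>N. \<bar>\<Phi> (s j) (n, i) - \<Phi> (s k) (n, i)\<bar> < h"
   using coord h(1) unfolding Cauchy_def dist_real_def by blast
  then obtain N where N: "!!i j k. N i <= j ==> N i <= k ==> \<bar>\<Phi> (s j) (n, i) - \<Phi> (s k) (n, i)\<bar> < h" by metis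
  let ?N = "\<Sum>i<d n. N i"
  have "Lp_dist \<mu> p (\<phi> (s j)) (\<phi> (s k)) < e" if jk: "?N <= j" "?N <= k" for j k
  proof -
   let ?\<psi> = "%x. \<phi> (s j) x - \<phi> (s k) x"
   have "r ?\<psi> <= 2 * B" using r_diff[OF \<phi> \<phi>, of "s j" "s k"] B[of "s j"] B[of "s k"] by simp
   then have "inverse (real (Suc n)) * r ?\<psi> powr p <= e' * (2 * B) powr p"
    using p0 n e'(1) by (intro mult_mono powr_mono2) auto
   moreover have "(\<Sum>i<d n. \<bar>\<Lambda> n i ?\<psi>\<bar> powr p) <= (\<Sum>i<d n. h powr p)"
   proof (intro sum_mono powr_mono2)
    fix i assume i: "i \<in> {..<d n}"
    then have "N i <= ?N" by (intro member_le_sum) auto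
    then show "\<bar>\<Lambda> n i ?\<psi>\<bar> <= h" using N[of i j k] jk i by (simp add: \<Phi>_def lin)
   qed (use p0 in auto)
   moreover have "(\<Sum>i<d n. h powr p) <= e powr p / 4" using h'(2) by (simp add: h mult.commute)
   ultimately have "Lp_norm \<mu> p ?\<psi> powr p <= e powr p / 4 + e powr p / 4"
    using E(2)[OF test_functions_simple_comb(2)[OF \<phi> \<phi>], of "s j" "s k" n] e'(2) by linarith
   also have "... < e powr p" using e by simp
   finally show ?thesis using powr_mono2[of p e "Lp_norm \<mu> p ?\<psi>"] p0 e by (meson leD leI less_imp_le)
  qed
  then show ?thesis by blast
 qed
 then show ?thesis using s(1) by blast
qed

end

lemma Lp_limit_unique:
 fixes u v :: "'x => 'e::euclidean_space"
 assumes p: "1 < p" and u: "u \<in> Lp M p" and v: "v \<in> Lp M p" and f: "!!k. f k \<in> Lp M p"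
  and lim: "Lp_tendsto M p f u" "Lp_tendsto M p f v"
 shows "AE x in M. u x = v x"
proof -
 have p0: "0 < p" using p by simp
 have "Lp_dist M p u v <= Lp_dist M p (f k) v + Lp_dist M p (f k) u" for k
  using Minkowski[OF p Lp_diff[OF p0 f v] Lp_diff[OF p0 u f], of k k] Lp_norm_minus_commute[of M p u "f k"] by simp
 then have "Lp_dist M p u v <= 0 + 0" by (intro LIMSEQ_le_const[OF tendsto_add[OF lim(2,1)]]) auto
 then have "Lp_dist M p u v = 0" using Lp_norm_nonneg[of M p "%x. u x - v x"] by linarith
 from Lp_norm_zero_AE[OF p0 Lp_diff[OF p0 u v] this] show ?thesis by simp
qed

lemma Lp_tendsto_trans:
 fixes u v :: "nat => 'x => 'e::euclidean_space"
 assumes p: "1 < p" and u: "!!n. u n \<in> Lp M p" and v: "!!n. v n \<in> Lp M p" and f: "f \<in> Lp M p"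
  and lim: "(%n. Lp_dist M p (v n) (u n)) \<longlonglongrightarrow> 0" "Lp_tendsto M p u f"
 shows "Lp_tendsto M p v f"
proof (rule Lim_null_comparison[OF always_eventually[OF allI] tendsto_add_zero[OF lim]])
 have p0: "0 < p" using p by simp
 show "norm (Lp_dist M p (v n) f) <= Lp_dist M p (v n) (u n) + Lp_dist M p (u n) f" for n
  using Minkowski[OF p Lp_diff[OF p0 v u] Lp_diff[OF p0 u f], of n n n] by simp
qed

lemma grad_Lipschitz:
 fixes \<phi> :: "real ^ 'n => real"
 assumes \<phi>: "\<phi> \<in> test_functions \<Omega>"
 shows "\<exists>L. \<forall>x y. \<bar>grad \<phi> x $ i - grad \<phi> y $ i\<bar> <= L * norm (x - y)"
proof -
 note T = test_functions_partial_deriv[OF \<phi>, of i]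
 obtain B where "!!x. norm (grad (partial_deriv i \<phi>) x) <= B" using grad_bounded[OF T] by blast
 then have "norm (partial_deriv i \<phi> x - partial_deriv i \<phi> y) <= B * norm (x - y)" for x y
  by (intro differentiable_bound[OF convex_UNIV has_derivative_grad[OF test_functionsD(1)[OF T]]])
   (auto intro!: onorm_le order_trans[OF Cauchy_Schwarz_ineq2] mult_right_mono)
 then show ?thesis by auto
qed

context weighted_domain begin

text \<open>Gradients with a common bound and a common Lipschitz constant converge everywhere as soon as they converge at the points
of a countable dense set, hence in \<open>L\<^sup>p\<close> by dominated convergence. So a countable set of functions that is dense for
pointwise convergence on that set, which exists since countable products of separable metric spaces are hereditarily
separable, is dense in the gradient norm.\<close>
theorem test_functions_separable:
 "\<exists>D::nat => real ^ 'n => real. (\<forall>n. D n \<in> TF) & (\<forall>\<phi>\<in>TF. \<forall>e>0. \<exists>n. r (%x. \<phi> x - D n x) < e)"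
proof -
 obtain Q :: "(real ^ 'n) set" where Q: "countable Q" "!!X. open X ==> X ~= {} ==> \<exists>x\<in>Q. x \<in> X"
  using countable_dense_exists by (metis (no_types))
 define \<Phi> :: "(real ^ 'n => real) => nat => real ^ 'n" where "\<Phi> \<phi> k = grad \<phi> (from_nat_into Q k)" for \<phi> k
 define T where "T K = {\<phi>\<in>TF. (\<forall>x. norm (grad \<phi> x) <= real K) & (\<forall>x y i. \<bar>grad \<phi> x $ i - grad \<phi> y $ i\<bar> <= real K * norm (x - y))}" for K :: nat
 have "\<exists>R. countable R & R \<subseteq> T K & \<Phi> ` T K \<subseteq> closure (\<Phi> ` R)" for K
 proof -
  obtain S where S: "countable S" "S \<subseteq> \<Phi> ` T K" "\<Phi> ` T K \<subseteq> closure S" by (rule separable)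
  from iffD1[OF countable_subset_image conjI[OF S(1,2)]] obtain R where R: "countable R" "R \<subseteq> T K" "S = \<Phi> ` R" by (elim exE conjE)
  show ?thesis by (rule exI[of _ R]) (simp only: R(1,2) S(3)[unfolded R(3)] simp_thms)
 qed
 then have "\<forall>K. \<exists>R. countable R & R \<subseteq> T K & \<Phi> ` T K \<subseteq> closure (\<Phi> ` R)" ..
 from choice[OF this] obtain R where R: "\<forall>K. countable (R K) & R K \<subseteq> T K & \<Phi> ` T K \<subseteq> closure (\<Phi> ` R K)" ..
 define A where "A = insert (%x. 0) (\<Union>K. R K)"
 have A: "countable A" "A ~= {}" "A \<subseteq> TF" using R zero_test_function[of \<Omega>] by (auto simp: A_def T_def)
 have main: "\<exists>\<psi>\<in>A. r (%x. \<phi> x - \<psi> x) < e" if \<phi>: "\<phi> \<in> TF" and e: "0 < e" for \<phi> e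
 proof -
  obtain B where B: "!!x. norm (grad \<phi> x) <= B" using grad_bounded[OF \<phi>] by blast
  obtain L where L: "!!i x y. \<bar>grad \<phi> x $ i - grad \<phi> y $ i\<bar> <= L i * norm (x - y)" using grad_Lipschitz[OF \<phi>] by metis
  obtain K :: nat where "\<bar>B\<bar> + (\<Sum>i\<in>UNIV. \<bar>L i\<bar>) <= real K" using real_arch_simple by blast
  moreover have "\<bar>L i\<bar> <= (\<Sum>i\<in>UNIV. \<bar>L i\<bar>)" for i by (intro member_le_sum) auto
  ultimately have K: "B <= real K" "L i <= real K" for i by (smt (verit) sum_nonneg abs_ge_zero)+
  then have \<phi>K: "\<phi> \<in> T K"
   using \<phi> order_trans[OF B K(1)] order_trans[OF L mult_right_mono[OF K(2) norm_ge_zero]] by (simp add: T_def)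
  then have "\<Phi> \<phi> \<in> closure (\<Phi> ` R K)" using R by blast
  then obtain s where s: "!!l. s l \<in> \<Phi> ` R K" "s \<longlonglongrightarrow> \<Phi> \<phi>" unfolding closure_sequential by blast
  have "\<forall>l. \<exists>\<psi>. \<psi> \<in> R K & s l = \<Phi> \<psi>" using s(1) by blast
  from choice[OF this] obtain \<psi> where \<psi>: "!!l. \<psi> l \<in> R K" "!!l. s l = \<Phi> (\<psi> l)" by blast
  have \<psi>T: "\<psi> l \<in> T K" for l using \<psi>(1) R by blast
  have \<psi>TF: "\<psi> l \<in> TF" for l using \<psi>T by (simp add: T_def)
  let ?d = "%l x. grad \<phi> x - grad (\<psi> l) x"
  have dense: "(%l. grad (\<psi> l) x $ i) \<longlonglongrightarrow> grad \<phi> x $ i" if xQ: "x \<in> Q" for x i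
  proof -
   obtain k where "x = from_nat_into Q k" using from_nat_into_surj[OF Q(1) xQ] by metis
   then show ?thesis
    using continuous_on_tendsto_compose[OF continuous_on_product_coordinates[of k] s(2)]
    by (auto simp: \<psi>(2) \<Phi>_def simp flip: grad_nth intro: tendsto_vec_nth)
  qed
  have pointwise: "(%l. grad (\<psi> l) x) \<longlonglongrightarrow> grad \<phi> x" for x
  proof (rule vec_tendstoI, rule LIMSEQ_I)
   fix i and \<epsilon> :: real assume \<epsilon>: "0 < \<epsilon>"
   obtain h where h: "0 < h" "h * real K <= \<epsilon> / 4" using exists_small_factor[of "\<epsilon> / 4" "real K"] \<epsilon> by auto
   obtain y where y: "y \<in> Q" "y \<in> ball x h" using Q(2)[of "ball x h"] h(1) by auto
   have near: "\<bar>grad \<zeta> x $ i - grad \<zeta> y $ i\<bar> <= \<epsilon> / 4" if "\<zeta> \<in> T K" for \<zeta>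
   proof -
    have "\<bar>grad \<zeta> x $ i - grad \<zeta> y $ i\<bar> <= real K * norm (x - y)" using that by (simp only: T_def mem_Collect_eq)
    also have "... <= real K * h" using y(2) by (intro mult_left_mono) (simp_all add: dist_norm)
    finally show ?thesis using h(2) by (simp add: mult.commute)
   qed
   obtain N where N: "!!l. l >= N ==> norm (grad (\<psi> l) y $ i - grad \<phi> y $ i) < \<epsilon> / 4"
    using LIMSEQ_D[OF dense[OF y(1), of i], of "\<epsilon> / 4"] \<epsilon> by auto
   have "norm (grad (\<psi> l) x $ i - grad \<phi> x $ i) < \<epsilon>" if "l >= N" for l
    using N[OF that] near[OF \<psi>T[of l]] near[OF \<phi>K] unfolding real_norm_def by linarith
   then show "\<exists>N. \<forall>l\<ge>N. norm (grad (\<psi> l) x $ i - grad \<phi> x $ i) < \<epsilon>" by blast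
  qed
  interpret finite_measure M by (rule finite_M)
  have [measurable]: "grad \<zeta> \<in> borel_measurable M" if "\<zeta> \<in> TF" for \<zeta>
   by (rule continuous_measurable_lebesgue_on[OF continuous_grad[OF that]])
  note [measurable] = this[OF \<phi>] this[OF \<psi>TF]
  have "(%l. LINT x|M. norm (?d l x) powr p) \<longlonglongrightarrow> (LINT x|M. 0)"
  proof (rule integral_dominated_convergence[where w = "%_. (real K + real K) powr p"])
   show "AE x in M. (%l. norm (?d l x) powr p) \<longlonglongrightarrow> 0"
   proof (rule AE_I2)
    fix x
    have "(%l. norm (?d l x) powr p) \<longlonglongrightarrow> norm (grad \<phi> x - grad \<phi> x) powr p"
     using p0 by (intro tendsto_powr' tendsto_norm tendsto_diff tendsto_const pointwise) auto
    then show "(%l. norm (?d l x) powr p) \<longlonglongrightarrow> 0" using p0 by simp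
   qed
   show "AE x in M. norm (norm (?d l x) powr p) <= (real K + real K) powr p" for l
   proof (rule AE_I2)
    fix x
    have "norm (?d l x) <= real K + real K"
     using \<phi>K \<psi>T[of l] by (intro order_trans[OF norm_triangle_ineq4] add_mono) (auto simp: T_def)
    then show "norm (norm (?d l x) powr p) <= (real K + real K) powr p"
     using p0 by (simp add: powr_mono2)
   qed
  qed measurable
  then have "\<forall>\<^sub>F l in sequentially. (LINT x|M. norm (?d l x) powr p) < e powr p"
   using e by (intro order_tendstoD(2)) auto
  then obtain l where l: "(LINT x|M. norm (?d l x) powr p) < e powr p" by (auto simp: eventually_sequentially)
  have "r (%x. \<phi> x - \<psi> l x) powr p < e powr p"
   using l p0 by (simp only: Lp_norm_powr grad_fun(2)[OF \<phi> \<psi>TF])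
  then have "r (%x. \<phi> x - \<psi> l x) < e" using powr_mono2[of p e "r (%x. \<phi> x - \<psi> l x)"] p0 e by (meson leD leI less_imp_le)
  moreover have "\<psi> l \<in> A" using \<psi>(1) by (auto simp: A_def)
  ultimately show ?thesis by blast
 qed
 show ?thesis
 proof (intro exI[of _ "from_nat_into A"] conjI allI ballI impI)
  show "from_nat_into A n \<in> TF" for n using from_nat_into[OF A(2)] A(3) by blast
  fix \<phi> and e :: real assume "\<phi> \<in> TF" "0 < e"
  then obtain \<psi> where "\<psi> \<in> A" "r (%x. \<phi> x - \<psi> x) < e" using main by blast
  then show "\<exists>n. r (%x. \<phi> x - from_nat_into A n x) < e"
   using from_nat_into_surj[OF A(1)] by metis
 qed
qed

text \<open>The weighted norm is not part of the definition of the space, but it is controlled by the gradient through Poincare's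
inequality.\<close>
theorem convergence_in_weighted_space:
 assumes \<phi>: "!!k. \<phi> k \<in> TF" and u: "u \<in> Lp M p" and g: "g \<in> Lp M p"
  and lim_u: "Lp_tendsto M p \<phi> u" and lim_g: "Lp_tendsto M p (%k. grad (\<phi> k)) g"
 shows "u \<in> Lp \<mu> p" "Lp_tendsto \<mu> p \<phi> u"
proof -
 have "\<exists>N. \<forall>m\<ge>N. \<forall>n\<ge>N. Lp_dist \<mu> p (\<phi> m) (\<phi> n) < e" if e: "0 < e" for e
 proof -
  obtain e' where e': "0 < e'" "e' * (2 * P) <= e / 2" using exists_small_factor[of "e / 2" "2 * P"] e P(1) by auto
  obtain N where N: "!!k. N <= k ==> Lp_dist M p (grad (\<phi> k)) g < e'"
   using order_tendstoD(2)[OF lim_g e'(1)] by (auto simp: eventually_sequentially)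
  have "Lp_dist \<mu> p (\<phi> m) (\<phi> n) < e" if mn: "N <= m" "N <= n" for m n
  proof -
   have "r (%x. \<phi> m x - \<phi> n x) <= Lp_dist M p (grad (\<phi> m)) g + Lp_dist M p (grad (\<phi> n)) g"
    using Minkowski[OF p Lp_diff[OF p0 test_Lp(2)[OF \<phi>] g] Lp_diff[OF p0 g test_Lp(2)[OF \<phi>]], of m n]
     Lp_norm_minus_commute[of M p g "grad (\<phi> n)"] by (simp add: grad_fun(2)[OF \<phi> \<phi>])
   then have "P * r (%x. \<phi> m x - \<phi> n x) <= P * (e' + e')" using P(1) N[OF mn(1)] N[OF mn(2)] by (intro mult_left_mono) auto
   then show ?thesis using P(2)[OF test_functions_simple_comb(2)[OF \<phi> \<phi>], of m n] e'(2) e by (simp add: algebra_simps)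
  qed
  then show ?thesis by blast
 qed
 then have "\<exists>v\<in>Lp \<mu> p. Lp_tendsto \<mu> p \<phi> v"
  by (intro Lp_complete[OF finite_\<mu> p test_function_Lp_\<mu>[OF p0 \<phi>]] allI impI)
 then obtain v where v: "v \<in> Lp \<mu> p" and lim_v: "Lp_tendsto \<mu> p \<phi> v" by blast
 have vM: "v \<in> Lp M p" by (rule Lp_\<mu>_imp_Lp_M(1)[OF p0 v])
 have "Lp_tendsto M p \<phi> v"
  by (rule tendsto_sandwich[OF _ _ tendsto_const lim_v])
   (auto intro!: always_eventually Lp_\<mu>_imp_Lp_M(2)[OF p0] Lp_diff[OF p0] test_function_Lp_\<mu>[OF p0 \<phi>] v)
 then have "AE x in M. v x = u x" by (intro Lp_limit_unique[OF p vM u test_Lp(1)[OF \<phi>] _ lim_u])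
 then have ae: "AE x in \<mu>. v x = u x" by (subst AE_density) auto
 have um: "u \<in> borel_measurable \<mu>" using LpD(1)[OF u] by (simp only: measurable_\<mu>)
 show uL: "u \<in> Lp \<mu> p" by (rule Lp_cong_AE[OF v um ae])
 have "Lp_dist \<mu> p (\<phi> k) v = Lp_dist \<mu> p (\<phi> k) u" for k
  by (rule Lp_norm_cong_AE[OF LpD(1)[OF Lp_diff[OF p0 test_function_Lp_\<mu>[OF p0 \<phi>] v]] LpD(1)[OF Lp_diff[OF p0 test_function_Lp_\<mu>[OF p0 \<phi>] uL]]])
   (use ae in eventually_elim, simp)
 then show "Lp_tendsto \<mu> p \<phi> u" using lim_v by simp
qed

lemmas W1p0_props = W1p0D[OF open_domain bounded_domain p]

abbreviation W_tendsto :: "(nat => real ^ 'n => real) => (real ^ 'n => real) => bool" where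
 "W_tendsto u v \<equiv> Lp_tendsto \<mu> p u v & Lp_tendsto M p (%k. grad (u k)) (weak_grad \<Omega> v)"

lemma W1p0_approximation:
 assumes u: "u \<in> W1p0 p \<Omega>"
 shows "\<exists>\<phi>. (\<forall>k. \<phi> k \<in> TF) & W_tendsto \<phi> u"
 using W1p0_props(4)[OF u] convergence_in_weighted_space(2)[OF _ W1p0_props(1,2)[OF u]] by blast

lemma W1p0_Lp_\<mu>: "u \<in> W1p0 p \<Omega> ==> u \<in> Lp \<mu> p"
 using W1p0_props(4) convergence_in_weighted_space(1)[OF _ W1p0_props(1,2)] by blast

theorem Poincare:
 assumes u: "u \<in> W1p0 p \<Omega>"
 shows "Lp_norm \<mu> p u <= P * Lp_norm M p (weak_grad \<Omega> u)"
proof -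
 obtain \<phi> where \<phi>: "!!k. \<phi> k \<in> TF" and l: "Lp_tendsto \<mu> p \<phi> u" "Lp_tendsto M p (%k. grad (\<phi> k)) (weak_grad \<Omega> u)"
  using W1p0_approximation[OF u] by blast
 have "(%k. Lp_norm \<mu> p (\<phi> k)) \<longlonglongrightarrow> Lp_norm \<mu> p u"
  by (rule Lp_norm_tendsto[OF p W1p0_Lp_\<mu>[OF u] test_function_Lp_\<mu>[OF p0 \<phi>] l(1)])
 moreover have "(%k. P * r (\<phi> k)) \<longlonglongrightarrow> P * Lp_norm M p (weak_grad \<Omega> u)"
  by (intro tendsto_intros Lp_norm_tendsto[OF p W1p0_props(2)[OF u] test_Lp(2)[OF \<phi>] l(2)])
 ultimately show ?thesis by (rule LIMSEQ_le) (use P(2)[OF \<phi>] in blast)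
qed

end

section \<open>Power functionals on finite-dimensional spaces\<close>

text \<open>Two norms on the same span are needed below, the given one and that of the ambient type; this locale treats either.\<close>
locale norm_on_span =
 fixes B :: "'a::real_normed_vector set" and s :: "'a => real"
 assumes B: "finite B" "independent B"
  and add: "!!u v. u \<in> span B ==> v \<in> span B ==> s (u + v) <= s u + s v"
  and scale: "!!u c. u \<in> span B ==> s (c *\<^sub>R u) = \<bar>c\<bar> * s u"
  and pos: "!!u. u \<in> span B ==> s u = 0 ==> u = 0"
begin

lemma linear_combination_bound:
 shows "u \<in> span B ==> 0 <= s u" "u \<in> span B ==> v \<in> span B ==> \<bar>s u - s v\<bar> <= s (u - v)"
  "s (\<Sum>b\<in>B. d b *\<^sub>R b) <= (\<Sum>b\<in>B. \<bar>d b\<bar> * s b)"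
  "\<exists>\<delta>>0. \<forall>c. \<delta> * (\<Sum>b\<in>B. \<bar>c b\<bar>) <= s (\<Sum>b\<in>B. c b *\<^sub>R b)"
  "continuous_on UNIV (%c. s (\<Sum>b\<in>B. c b *\<^sub>R b))"
proof -
 let ?T = "%c. \<Sum>b\<in>B. c b *\<^sub>R b"
 have T: "?T c \<in> span B" for c by (intro span_sum span_scale span_base)
 have s0: "s 0 = 0" using scale[of 0 0] span_zero[of B] by simp
 have sneg: "s (- u) = s u" if "u \<in> span B" for u using scale[OF that, of "-1"] by simp
 show nonneg: "0 <= s u" if "u \<in> span B" for u using add[OF that span_neg[OF that]] by (simp add: s0 sneg[OF that])
 have le: "s (\<Sum>b\<in>F. c b *\<^sub>R b) <= (\<Sum>b\<in>F. \<bar>c b\<bar> * s b)" if "F \<subseteq> B" for F c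
  using finite_subset[OF that B(1)] that
 proof (induction F rule: finite_induct)
  case (insert x F)
  have "s (\<Sum>b\<in>insert x F. c b *\<^sub>R b) = s (c x *\<^sub>R x + (\<Sum>b\<in>F. c b *\<^sub>R b))" using insert by simp
  also have "... <= s (c x *\<^sub>R x) + s (\<Sum>b\<in>F. c b *\<^sub>R b)"
   using insert by (intro add span_sum span_scale span_base) auto
  also have "... <= \<bar>c x\<bar> * s x + (\<Sum>b\<in>F. \<bar>c b\<bar> * s b)"
   using insert by (intro add_mono) (auto simp: scale span_base)
  finally show ?case using insert by simp
 qed (simp add: s0)
 show bd: "s (?T c) <= (\<Sum>b\<in>B. \<bar>c b\<bar> * s b)" for c using le[of B] by simp
 show diff: "\<bar>s u - s v\<bar> <= s (u - v)" if "u \<in> span B" "v \<in> span B" for u v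
 proof -
  show ?thesis
   using add[OF span_diff[OF that] that(2)] add[OF span_diff[OF that(2,1)] that(1)] sneg[OF span_diff[OF that]] by simp
 qed
 show cont: "continuous_on UNIV (%c. s (?T c))"
  unfolding continuous_on_def
 proof
  fix c0 :: "'a => real"
  show "((%c. s (?T c)) \<longlongrightarrow> s (?T c0)) (at c0 within UNIV)"
  proof (rule LIM_zero_cancel, rule Lim_null_comparison)
   show "\<forall>\<^sub>F c in at c0 within UNIV. norm (s (?T c) - s (?T c0)) <= (\<Sum>b\<in>B. \<bar>c b - c0 b\<bar> * s b)"
   proof (rule always_eventually, rule allI)
    fix c
    have "?T c - ?T c0 = ?T (%b. c b - c0 b)" by (simp add: sum_subtractf scaleR_left_diff_distrib)
    then show "norm (s (?T c) - s (?T c0)) <= (\<Sum>b\<in>B. \<bar>c b - c0 b\<bar> * s b)"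
     using diff[OF T T, of c c0] bd[of "%b. c b - c0 b"] by simp
   qed
   have "continuous_on UNIV (%c::'a => real. \<Sum>b\<in>B. \<bar>c b - c0 b\<bar> * s b)"
    by (intro continuous_intros continuous_on_product_coordinates)
   from this[unfolded continuous_on_def, rule_format, of c0]
   show "((%c::'a => real. \<Sum>b\<in>B. \<bar>c b - c0 b\<bar> * s b) \<longlongrightarrow> 0) (at c0 within UNIV)" by simp
  qed
 qed
 define S where "S = {c :: 'a => real. \<forall>b. \<bar>c b\<bar> <= (if b \<in> B then 1 else 0)} \<inter> {c. (\<Sum>b\<in>B. \<bar>c b\<bar>) = 1}"
 have "closed {c :: 'a => real. (\<Sum>b\<in>B. \<bar>c b\<bar>) = 1}"
  by (intro closed_Collect_eq continuous_intros continuous_on_product_coordinates)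
 then have S: "compact S" unfolding S_def by (intro compact_Int_closed compact_box_fun)
 have "\<exists>\<delta>>0. \<forall>c\<in>S. \<delta> <= s (?T c)"
 proof (cases "S = {}")
  case True
  then show ?thesis by (auto intro: exI[of _ 1])
 next
  case False
  obtain c0 where c0: "c0 \<in> S" "!!c. c \<in> S ==> s (?T c0) <= s (?T c)"
   using continuous_attains_inf[OF S False continuous_on_subset[OF cont subset_UNIV]] by blast
  have "s (?T c0) ~= 0"
  proof
   assume "s (?T c0) = 0"
   then have "?T c0 = 0" by (rule pos[OF T])
   then have "c0 b = 0" if "b \<in> B" for b using independentD[OF B(2,1) order_refl, of c0 b] that by blast
   then show False using c0(1) by (simp add: S_def)
  qed
  then show ?thesis using nonneg[OF T, of c0] c0(2) by (intro exI[of _ "s (?T c0)"]) auto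
 qed
 then obtain \<delta> where \<delta>: "0 < \<delta>" "!!c. c \<in> S ==> \<delta> <= s (?T c)" by blast
 have "\<delta> * (\<Sum>b\<in>B. \<bar>c b\<bar>) <= s (?T c)" for c
 proof (cases "(\<Sum>b\<in>B. \<bar>c b\<bar>) = 0")
  case True
  then show ?thesis using nonneg[OF T] by simp
 next
  case False
  define \<sigma> where "\<sigma> = (\<Sum>b\<in>B. \<bar>c b\<bar>)"
  have \<sigma>: "0 < \<sigma>" using False sum_nonneg[of B "%b. \<bar>c b\<bar>"] unfolding \<sigma>_def by (simp add: less_le)
  define c' where "c' b = (if b \<in> B then c b / \<sigma> else 0)" for b
  have "\<bar>c b\<bar> <= \<sigma>" if "b \<in> B" for b unfolding \<sigma>_def using B(1) that by (intro member_le_sum) auto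
  moreover have "(\<Sum>b\<in>B. \<bar>c' b\<bar>) = (\<Sum>b\<in>B. \<bar>c b\<bar> / \<sigma>)" using \<sigma> by (intro sum.cong) (auto simp: c'_def abs_divide)
  then have "(\<Sum>b\<in>B. \<bar>c' b\<bar>) = 1" using \<sigma> by (simp add: sum_divide_distrib[symmetric] \<sigma>_def)
  ultimately have "c' \<in> S" using \<sigma> by (auto simp: S_def c'_def abs_divide)
  then have "\<delta> <= s (?T c')" by (rule \<delta>(2))
  moreover have "?T c = \<sigma> *\<^sub>R ?T c'"
   unfolding scaleR_sum_right using \<sigma> by (intro sum.cong) (auto simp: c'_def)
  ultimately have "s (?T c) = \<sigma> * s (?T c')" "\<delta> * \<sigma> <= \<sigma> * s (?T c')" using \<sigma> scale[OF T, of \<sigma> c'] by simp_all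
  then show ?thesis by (simp add: \<sigma>_def)
 qed
 then show "\<exists>\<delta>>0. \<forall>c. \<delta> * (\<Sum>b\<in>B. \<bar>c b\<bar>) <= s (?T c)" using \<delta>(1) by blast
qed

end

text \<open>The spans below carry the topology of the ambient type (the sup norm) but are measured by their gradient norm; the two
agree in finite dimension.\<close>
theorem finite_dimensional_norm:
 fixes A :: "'a::real_normed_vector set" and r :: "'a => real"
 assumes A: "finite A"
  and add: "!!u v. u \<in> span A ==> v \<in> span A ==> r (u + v) <= r u + r v"
  and scale: "!!u c. u \<in> span A ==> r (c *\<^sub>R u) = \<bar>c\<bar> * r u"
  and pos: "!!u. u \<in> span A ==> r u = 0 ==> u = 0"
 shows "continuous_on (span A) r" "compact {u \<in> span A. r u <= R}"
proof -
 obtain B where B': "B \<subseteq> A" "independent B" "A \<subseteq> span B" by (rule maximal_independent_subset)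
 have sB: "span A = span B" using B' span_eq[of A B] span_superset[of A] by blast
 have B: "finite B" "independent B" using B' finite_subset[OF _ A] by auto
 note add' = add[unfolded sB] and scale' = scale[unfolded sB] and pos' = pos[unfolded sB]
 let ?T = "%c. \<Sum>b\<in>B. c b *\<^sub>R b"
 have T: "?T c \<in> span B" for c by (intro span_sum span_scale span_base)
 have repr: "\<exists>c. u = ?T c" if "u \<in> span B" for u using that B(1) unfolding span_finite[OF B(1)] by auto
 interpret r: norm_on_span B r using B add' scale' pos' by unfold_locales
 interpret n: norm_on_span B norm using B by unfold_locales (auto intro: norm_triangle_ineq)
 note bound = r.linear_combination_bound
 obtain \<delta> where \<delta>: "0 < \<delta>" "!!c. \<delta> * (\<Sum>b\<in>B. \<bar>c b\<bar>) <= r (?T c)" using bound(4) by blast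
 obtain \<eta> where \<eta>: "0 < \<eta>" "!!c. \<eta> * (\<Sum>b\<in>B. \<bar>c b\<bar>) <= norm (?T c)" using n.linear_combination_bound(4) by blast
 define L where "L = (\<Sum>b\<in>B. r b) / \<eta>"
 have "0 <= r b" if "b \<in> B" for b by (rule bound(1)[OF span_base[OF that]])
 then have L0: "0 <= L" unfolding L_def using \<eta>(1) by (simp add: sum_nonneg)
 have lip: "r u <= L * norm u" if u: "u \<in> span B" for u
 proof -
  obtain c where c: "u = ?T c" using repr[OF u] by blast
  have "r u <= (\<Sum>b\<in>B. \<bar>c b\<bar> * r b)" unfolding c by (rule bound(3))
  also have "... <= (\<Sum>b\<in>B. (norm u / \<eta>) * r b)"
  proof (intro sum_mono mult_right_mono bound(1))
   fix b assume b: "b \<in> B"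
   have "\<bar>c b\<bar> <= (\<Sum>b\<in>B. \<bar>c b\<bar>)" using B(1) b by (intro member_le_sum) auto
   also have "... <= norm u / \<eta>" using \<eta>(2)[of c] \<eta>(1) c by (simp add: field_simps)
   finally show "\<bar>c b\<bar> <= norm u / \<eta>" .
   show "b \<in> span B" using b by (rule span_base)
  qed
  also have "... = L * norm u" unfolding sum_distrib_left[symmetric] by (simp add: L_def)
  finally show ?thesis .
 qed
 have "L-lipschitz_on (span B) r"
  using order_trans[OF bound(2) lip] L0 by (intro lipschitz_onI) (auto simp: dist_real_def dist_norm span_diff)
 then show "continuous_on (span A) r" unfolding sB by (rule lipschitz_on_continuous_on)
 let ?K = "{c :: 'a => real. \<forall>b. \<bar>c b\<bar> <= (if b \<in> B then \<bar>R\<bar> / \<delta> else 0)} \<inter> {c. r (?T c) <= R}"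
 have "closed {c. r (?T c) <= R}" by (intro closed_Collect_le bound(5) continuous_intros)
 then have K: "compact ?K" by (intro compact_Int_closed compact_box_fun)
 have "continuous_on ?K ?T"
  by (rule continuous_on_subset[OF _ subset_UNIV]) (intro continuous_intros continuous_on_product_coordinates)
 then have "compact (?T ` ?K)" using K by (rule compact_continuous_image)
 moreover have "?T ` ?K = {u \<in> span A. r u <= R}"
 proof (intro set_eqI iffI)
  fix u assume "u \<in> {u \<in> span A. r u <= R}"
  then have u: "u \<in> span B" "r u <= R" by (simp_all add: sB)
  obtain c where c: "u = ?T c" using repr[OF u(1)] by blast
  define c' where "c' b = (if b \<in> B then c b else 0)" for b
  have c': "u = ?T c'" unfolding c by (intro sum.cong) (auto simp: c'_def)
  have "\<bar>c b\<bar> <= \<bar>R\<bar> / \<delta>" if b: "b \<in> B" for b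
  proof -
   have "\<bar>c b\<bar> <= (\<Sum>b\<in>B. \<bar>c b\<bar>)" using B(1) b by (intro member_le_sum) auto
   also have "... <= r u / \<delta>" using \<delta>(2)[of c] \<delta>(1) c by (simp add: field_simps)
   also have "... <= \<bar>R\<bar> / \<delta>" using u(2) \<delta>(1) by (intro divide_right_mono) auto
   finally show ?thesis .
  qed
  then have "c' \<in> ?K" using u(2) c' by (auto simp: c'_def)
  then show "u \<in> ?T ` ?K" using c' by blast
 qed (use T sB in auto)
 ultimately show "compact {u \<in> span A. r u <= R}" by simp
qed

locale finite_dimensional_space =
 fixes V :: "'a::real_normed_vector set" and r :: "'a => real"
 assumes V: "subspace V"
  and r_triangle: "!!u v. u \<in> V ==> v \<in> V ==> r (u + v) <= r u + r v"
  and r_scale: "!!u c. u \<in> V ==> r (c *\<^sub>R u) = \<bar>c\<bar> * r u"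
  and r_cont: "continuous_on V r"
  and r_compact: "!!R. compact {u \<in> V. r u <= R}"
begin

lemma C1_functionalI:
 assumes "continuous_on V J" "continuous_on (V \<times> V) (%x. DJ (fst x) (snd x))"
  and "!!u v t. u \<in> V ==> v \<in> V ==> ((%t. J (u + t *\<^sub>R v)) has_real_derivative DJ (u + t *\<^sub>R v) v) (at t)"
  and "!!u v w. u \<in> V ==> v \<in> V ==> w \<in> V ==> DJ u (v + w) = DJ u v + DJ u w"
  and "!!u v c. u \<in> V ==> v \<in> V ==> DJ u (c *\<^sub>R v) = c * DJ u v"
 shows "C1_functional V r J DJ"
 using V r_triangle r_scale r_cont r_compact assms by (rule C1_functional.intro)

lemma r_null_sequence:
 assumes "u \<in> V" "!!n. x n \<in> V" "x \<longlonglongrightarrow> u"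
 shows "(%n. r (x n - u)) \<longlonglongrightarrow> 0"
proof -
 have r0: "r 0 = 0" using r_scale[of 0 0] subspace_0[OF V] by simp
 have "(%n. x n - u) \<longlonglongrightarrow> 0" using assms(3) by (simp add: LIM_zero)
 then have "(r \<circ> (%n. x n - u)) \<longlonglongrightarrow> r 0"
  by (intro r_cont[unfolded continuous_on_sequentially, rule_format, OF subspace_0[OF V]] conjI allI subspace_diff[OF V assms(2,1)])
 then show ?thesis by (simp add: comp_def r0)
qed

text \<open>Here \<open>T\<close> is either the evaluation \<open>u \<mapsto> u\<close> into \<open>L\<^sup>p(\<mu>)\<close> or \<open>L\<^sup>q(\<mu>)\<close>, or the gradient into \<open>L\<^sup>p(\<Omega>)\<close>.\<close>
lemma C1_functional_power:
 fixes T :: "'a => 'x => 'e::euclidean_space"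
 assumes s: "1 < s" and T_add: "!!u v x. u \<in> V ==> v \<in> V ==> T (u + v) x = T u x + T v x"
  and T_scale: "!!u c x. u \<in> V ==> T (c *\<^sub>R u) x = c *\<^sub>R T u x"
  and T_Lp: "!!u. u \<in> V ==> T u \<in> Lp N s" and T_bound: "!!u. u \<in> V ==> Lp_norm N s (T u) <= C * r u"
  and b: "coefficient N b"
 shows "C1_functional V r (%u. LINT x|N. b x * norm (T u x) powr s)
  (%u v. s * Lp_pairing N s b (T u) (T v))"
proof (rule C1_functionalI)
 have T_diff: "T (u - v) = (%x. T u x - T v x)" if "u \<in> V" "v \<in> V" for u v
  using T_add[OF subspace_diff[OF V that] that(2)] by (intro ext) (metis add_diff_cancel_right' diff_add_cancel)
 have lim: "Lp_tendsto N s (%n. T (x n)) (T u)" if "u \<in> V" "!!n. x n \<in> V" "x \<longlonglongrightarrow> u" for x u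
 proof (rule Lim_null_comparison[OF always_eventually])
  show "(%n. C * r (x n - u)) \<longlonglongrightarrow> 0" using tendsto_mult_right_zero[OF r_null_sequence[OF that]] .
  show "\<forall>n. norm (Lp_dist N s (T (x n)) (T u)) <= C * r (x n - u)"
   using T_bound[OF subspace_diff[OF V that(2,1)]] by (simp add: T_diff[OF that(2,1)])
 qed
 have "continuous_on (V \<times> V) (%z. LINT x|N. b x * (duality_map s (T (fst z) x) \<bullet> T (snd z) x))"
  unfolding continuous_on_sequentially
 proof (intro allI ballI impI, elim conjE)
  fix z and w :: "'a \<times> 'a" assume w: "w \<in> V \<times> V" and z: "\<forall>n. z n \<in> V \<times> V" "z \<longlonglongrightarrow> w"
  have w': "fst w \<in> V" "snd w \<in> V" and z': "!!n. fst (z n) \<in> V" "!!n. snd (z n) \<in> V" using w z(1) by (auto simp: mem_Times_iff)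
  show "((%z. LINT x|N. b x * (duality_map s (T (fst z) x) \<bullet> T (snd z) x)) \<circ> z)
   \<longlonglongrightarrow> (Lp_pairing N s b (T (fst w)) (T (snd w)))"
   unfolding comp_def
   by (intro duality_pairing_tendsto[OF s _ _ _ _ lim[OF w'(1) z'(1) tendsto_fst[OF z(2)]] lim[OF w'(2) z'(2) tendsto_snd[OF z(2)]] b] T_Lp w' z')
 qed
 note cont = this
 show "continuous_on (V \<times> V) (%z. s * (Lp_pairing N s b (T (fst z)) (T (snd z))))"
  by (intro continuous_intros cont)
 show "continuous_on V (%u. LINT x|N. b x * norm (T u x) powr s)"
  unfolding power_functional_eq_pairing[OF s]
  using continuous_on_compose2[OF cont continuous_on_Pair[OF continuous_on_id continuous_on_id]] by fastforce
 show "((%t. LINT x|N. b x * norm (T (u + t *\<^sub>R v) x) powr s) has_real_derivative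
   s * (Lp_pairing N s b (T (u + t *\<^sub>R v)) (T v))) (at t)" if u: "u \<in> V" and v: "v \<in> V" for u v t
 proof -
  let ?J = "%u. LINT x|N. b x * norm (T u x) powr s"
  let ?w = "u + t *\<^sub>R v"
  let ?D = "s * Lp_pairing N s b (T ?w) (T v)"
  let ?G = "Lp_norm N s (T v)"
  have w: "?w \<in> V" by (intro subspace_add[OF V] subspace_scale[OF V] u v)
  have hv: "h *\<^sub>R v \<in> V" for h by (intro subspace_scale[OF V] v)
  show ?thesis unfolding DERIV_def
  proof (rule LIM_I)
   fix e :: real assume e: "0 < e"
   then have "0 < e / 2" by simp
   obtain d where d: "0 < d" and H: "\<forall>g\<in>Lp N s. \<forall>h. 0 <= h --> h < d --> Lp_norm N s g <= ?G * h -->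
    \<bar>1 * Lp_remainder N s b (T ?w) g\<bar> <= e / 2 * h"
    using power_functional_differentiable_linear_bound[OF s T_Lp[OF w] b \<open>0 < e / 2\<close> Lp_norm_nonneg, of N s "T v" 1] by (elim exE conjE) (rule that)
   show "\<exists>d>0. \<forall>h. h ~= 0 & norm (h - 0) < d --> norm ((?J (u + (t + h) *\<^sub>R v) - ?J ?w) / h - ?D) < e"
   proof (intro exI[of _ d] conjI allI impI d)
    fix h :: real assume h: "h ~= 0 & norm (h - 0) < d"
    have nh: "Lp_norm N s (T (h *\<^sub>R v)) <= ?G * \<bar>h\<bar>"
     unfolding T_scale[OF v, abs_def] using s by (simp add: Lp_norm_scaleR)
    have eq: "u + (t + h) *\<^sub>R v = ?w + h *\<^sub>R v" by (simp add: scaleR_left_distrib)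
    have D: "s * (Lp_pairing N s b (T ?w) (T (h *\<^sub>R v))) = h * ?D"
     unfolding T_scale[OF v] inner_scaleR_right mult.left_commute[of "b _"] by simp
    have "\<bar>h\<bar> < d" using h by simp
    from H[rule_format, OF T_Lp[OF hv] abs_ge_zero this nh]
    have "\<bar>?J (u + (t + h) *\<^sub>R v) - ?J ?w - h * ?D\<bar> <= e / 2 * \<bar>h\<bar>"
     unfolding D eq T_add[OF w hv] mult_1 .
    also have "... < \<bar>h\<bar> * e" using h e by simp
    finally have "\<bar>?J (u + (t + h) *\<^sub>R v) - ?J ?w - h * ?D\<bar> / \<bar>h\<bar> < e" using h by (simp add: divide_less_eq mult.commute)
    moreover have "(?J (u + (t + h) *\<^sub>R v) - ?J ?w) / h - ?D = (?J (u + (t + h) *\<^sub>R v) - ?J ?w - h * ?D) / h"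
     using h by (simp add: diff_divide_distrib)
    ultimately show "norm ((?J (u + (t + h) *\<^sub>R v) - ?J ?w) / h - ?D) < e" by (simp only: real_norm_def abs_divide)
   qed
  qed
 qed
 show "s * (Lp_pairing N s b (T u) (T (v + w)))
   = s * Lp_pairing N s b (T u) (T v) + s * Lp_pairing N s b (T u) (T w)"
  if "u \<in> V" "v \<in> V" "w \<in> V" for u v w
  using integrable_duality_pairing(1)[OF s T_Lp[OF that(1)] T_Lp[OF that(2)] b] integrable_duality_pairing(1)[OF s T_Lp[OF that(1)] T_Lp[OF that(3)] b]
  by (simp add: T_add[OF that(2,3)] inner_add_right distrib_left)
 show "s * (Lp_pairing N s b (T u) (T (c *\<^sub>R v))) = c * (s * Lp_pairing N s b (T u) (T v))"
  if "u \<in> V" "v \<in> V" for u v c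
  unfolding T_scale[OF that(2)] inner_scaleR_right mult.left_commute[of "b _"] by simp
qed

lemma C1_functional_linear_comb:
 assumes 1: "C1_functional V r J DJ" and 2: "C1_functional V r J' DJ'"
 shows "C1_functional V r (%u. a * J u + b * J' u) (%u v. a * DJ u v + b * DJ' u v)"
proof (rule C1_functionalI)
 interpret J: C1_functional V r J DJ by fact
 interpret J': C1_functional V r J' DJ' by fact
 show "continuous_on V (%u. a * J u + b * J' u)" by (intro continuous_intros J.J_cont J'.J_cont)
 show "continuous_on (V \<times> V) (%x. a * DJ (fst x) (snd x) + b * DJ' (fst x) (snd x))"
  by (intro continuous_intros J.DJ_cont J'.DJ_cont)
 show "((%t. a * J (u + t *\<^sub>R v) + b * J' (u + t *\<^sub>R v)) has_real_derivative a * DJ (u + t *\<^sub>R v) v + b * DJ' (u + t *\<^sub>R v) v) (at t)"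
  if "u \<in> V" "v \<in> V" for u v t
  by (intro DERIV_add DERIV_cmult J.DJ J'.DJ that)
qed (simp_all add: C1_functional.DJ_add[OF 1] C1_functional.DJ_add[OF 2] C1_functional.DJ_scale[OF 1] C1_functional.DJ_scale[OF 2] algebra_simps)

lemma C1_functional_compose:
 assumes 1: "C1_functional V r J DJ" and g: "!!u. u \<in> V ==> (g has_real_derivative g' (J u)) (at (J u))"
  and g': "continuous_on (J ` V) g'"
 shows "C1_functional V r (%u. g (J u)) (%u v. g' (J u) * DJ u v)"
proof (rule C1_functionalI)
 interpret J: C1_functional V r J DJ by fact
 have gc: "continuous_on (J ` V) g" using g by (auto intro!: continuous_at_imp_continuous_on DERIV_isCont)
 show "continuous_on V (%u. g (J u))" by (rule continuous_on_compose2[OF gc J.J_cont]) simp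
 have "continuous_on (V \<times> V) (%x. J (fst x))" by (rule continuous_on_compose2[OF J.J_cont]) (auto intro: continuous_intros)
 then have "continuous_on (V \<times> V) (%x. g' (J (fst x)))" by (rule continuous_on_compose2[OF g']) auto
 then show "continuous_on (V \<times> V) (%x. g' (J (fst x)) * DJ (fst x) (snd x))"
  by (intro continuous_intros J.DJ_cont)
 show "((%t. g (J (u + t *\<^sub>R v))) has_real_derivative g' (J (u + t *\<^sub>R v)) * DJ (u + t *\<^sub>R v) v) (at t)"
  if "u \<in> V" "v \<in> V" for u v t
  by (rule DERIV_chain2[OF g J.DJ[OF that]]) (intro subspace_add[OF V] subspace_scale[OF V] that)
qed (simp_all add: C1_functional.DJ_add[OF 1] C1_functional.DJ_scale[OF 1] algebra_simps)

end

section \<open>Galerkin spaces\<close>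

text \<open>Bounded continuous functions provide a normed vector space that contains all test functions, whatever \<open>\<Omega>\<close> is.\<close>
type_synonym 'n bcf = "(real ^ 'n) \<Rightarrow>\<^sub>C real"

context weighted_domain begin

abbreviation ev :: "'n bcf => real ^ 'n => real" where
 "ev \<equiv> apply_bcontfun"

abbreviation gv :: "'n bcf => real ^ 'n => real ^ 'n" where
 "gv u \<equiv> grad (ev u)"

definition TB :: "'n bcf set" where
 "TB = {\<phi>. ev \<phi> \<in> TF}"

abbreviation rb :: "'n bcf => real" where
 "rb \<phi> \<equiv> r (ev \<phi>)"

lemma TBD: "\<phi> \<in> TB ==> ev \<phi> \<in> TF" by (simp add: TB_def)

lemma ev_arith:
 fixes \<phi> \<psi> :: "'n bcf"
 shows "ev (\<phi> + \<psi>) = (%x. ev \<phi> x + ev \<psi> x)"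
  "ev (\<phi> - \<psi>) = (%x. ev \<phi> x - ev \<psi> x)"
  "ev (c *\<^sub>R \<phi>) = (%x. c * ev \<phi> x)"
  "ev (0 :: 'n bcf) = (%x. 0)"
  "ev (- \<phi>) = (%x. - ev \<phi> x)"
 by (rule ext, simp)+

lemma subspace_TB: "subspace TB"
 unfolding subspace_def TB_def
 using zero_test_function[of \<Omega>] test_functions_simple_comb by (auto simp: ev_arith)

lemma test_function_bcontfun: "\<phi> \<in> TF ==> \<exists>\<psi>\<in>TB. ev \<psi> = \<phi>"
proof -
 assume \<phi>: "\<phi> \<in> TF"
 have "\<phi> \<in> bcontfun" unfolding bcontfun_def
  using test_functionsD(2)[OF \<phi>, of UNIV] test_function_bounded[OF \<phi>] by (auto simp: bounded_iff)
 then have "ev (Bcontfun \<phi>) = \<phi>" by (rule Bcontfun_inverse)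
 then show ?thesis using \<phi> by (intro bexI[of _ "Bcontfun \<phi>"]) (auto simp: TB_def)
qed

lemma rb_add: "\<phi> \<in> TB ==> \<psi> \<in> TB ==> rb (\<phi> + \<psi>) <= rb \<phi> + rb \<psi>"
 unfolding ev_arith by (rule r_add[OF TBD TBD])

lemma rb_scale: "\<phi> \<in> TB ==> rb (c *\<^sub>R \<phi>) = \<bar>c\<bar> * rb \<phi>"
 unfolding ev_arith grad_fun(3)[OF TBD TBD] by (rule Lp_norm_scaleR[OF p0])

lemma test_function_AE_zero:
 assumes \<phi>: "\<phi> \<in> TF" and ae: "AE x in M. \<phi> x = 0"
 shows "\<phi> x = 0"
proof (rule ccontr)
 assume "\<phi> x ~= 0"
 let ?S = "{x. \<phi> x ~= 0}"
 have S: "open ?S" by (intro open_Collect_neq test_functionsD(2)[OF \<phi>] continuous_intros)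
 have "AE x in lebesgue. x \<in> \<Omega> --> \<phi> x = 0" using ae domain_lebesgue by (subst (asm) AE_restrict_space_iff) auto
 then have "AE x in lebesgue. x \<notin> ?S"
  by eventually_elim (use test_function_zero_outside[OF \<phi>] in auto)
 then have "?S \<in> null_sets lebesgue" using S by (subst AE_iff_null_sets) (auto simp: borel_open)
 then have "negligible ?S" by (simp add: negligible_iff_null_sets)
 then show False using open_not_negligible[OF S] \<open>\<phi> x ~= 0\<close> by blast
qed

lemma r_zero_imp_zero:
 assumes \<phi>: "\<phi> \<in> TF" and "r \<phi> = 0"
 shows "\<phi> = (%x. 0)"
proof -
 have "Lp_norm \<mu> p \<phi> = 0" using P(2)[OF \<phi>] assms(2) Lp_norm_nonneg[of \<mu> p \<phi>] by simp
 then have "Lp_norm M p \<phi> = 0"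
  using Lp_\<mu>_imp_Lp_M(2)[OF p0 test_function_Lp_\<mu>[OF p0 \<phi>]] Lp_norm_nonneg[of M p \<phi>] by simp
 then have "AE x in M. \<phi> x = 0" using Lp_norm_zero_AE[OF p0 test_Lp(1)[OF \<phi>]] by simp
 then show ?thesis using test_function_AE_zero[OF \<phi>] by blast
qed

definition basis :: "nat => 'n bcf" where
 "basis = (SOME B. (\<forall>n. B n \<in> TB) & (\<forall>\<phi>\<in>TF. \<forall>e>0. \<exists>n. r (%x. \<phi> x - ev (B n) x) < e))"

lemma basis: "basis n \<in> TB" "\<phi> \<in> TF ==> 0 < e ==> \<exists>n. r (%x. \<phi> x - ev (basis n) x) < e"
proof -
 obtain D :: "nat => real ^ 'n => real" where D: "\<forall>n. D n \<in> TF" "\<forall>\<phi>\<in>TF. \<forall>e>0. \<exists>n. r (%x. \<phi> x - D n x) < e"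
  using test_functions_separable by (elim exE conjE) (rule that)
 have "\<forall>n. \<exists>\<psi>. \<psi> \<in> TB & ev \<psi> = D n" using test_function_bcontfun D(1) by blast
 from choice[OF this] obtain B where B: "\<forall>n. B n \<in> TB & ev (B n) = D n" ..
 have ex: "\<exists>B :: nat => 'n bcf. (\<forall>n. B n \<in> TB) & (\<forall>\<phi>\<in>TF. \<forall>e>0. \<exists>n. r (%x. \<phi> x - ev (B n) x) < e)"
  by (rule exI[of _ B]) (use B D(2) in simp)
 from someI_ex[OF ex] show "basis n \<in> TB" "\<phi> \<in> TF ==> 0 < e ==> \<exists>n. r (%x. \<phi> x - ev (basis n) x) < e"
  unfolding basis_def[symmetric] by blast+
qed

definition V :: "nat => 'n bcf set" where
 "V n = span (basis ` {..<n})"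

lemma V_TB: "V n \<subseteq> TB"
 unfolding V_def by (rule span_minimal[OF _ subspace_TB]) (use basis(1) in auto)

lemma V_TF: "\<phi> \<in> V n ==> ev \<phi> \<in> TF"
 using V_TB TBD by blast

lemma V_mono: "m <= n ==> V m \<subseteq> V n"
 unfolding V_def by (intro span_mono image_mono) auto

lemma subspace_V: "subspace (V n)" unfolding V_def by simp

sublocale Vn: finite_dimensional_space "V n" rb for n
proof
 have fin: "finite (basis ` {..<n})" by simp
 have add: "!!u v. u \<in> span (basis ` {..<n}) ==> v \<in> span (basis ` {..<n}) ==> rb (u + v) <= rb u + rb v"
  and scale: "!!u c. u \<in> span (basis ` {..<n}) ==> rb (c *\<^sub>R u) = \<bar>c\<bar> * rb u"
  by (rule rb_add rb_scale; use V_TB[of n] in \<open>unfold V_def, blast\<close>)+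
 have pos: "u = 0" if "u \<in> span (basis ` {..<n})" "rb u = 0" for u
 proof (rule bcontfun_eqI)
  have "u \<in> V n" unfolding V_def by (rule that(1))
  from r_zero_imp_zero[OF V_TF[OF this] that(2)] have e: "ev u = (%x. 0)" .
  show "ev u x = ev 0 x" for x unfolding e by simp
 qed
 show "continuous_on (V n) rb" unfolding V_def by (rule finite_dimensional_norm(1)[OF fin add scale pos])
 show "compact {u \<in> V n. rb u <= R}" for R unfolding V_def by (rule finite_dimensional_norm(2)[OF fin add scale pos])
 show "subspace (V n)" by (rule subspace_V)
 show "!!u v. u \<in> V n ==> v \<in> V n ==> rb (u + v) <= rb u + rb v" using add unfolding V_def .
 show "!!u c. u \<in> V n ==> rb (c *\<^sub>R u) = \<bar>c\<bar> * rb u" using scale unfolding V_def .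
qed

theorem Galerkin_approximation:
 assumes \<xi>: "\<xi> \<in> W1p0 p \<Omega>"
 shows "\<exists>\<psi> n. (\<forall>k. \<psi> k \<in> V (n k)) & W_tendsto (%k. ev (\<psi> k)) \<xi>"
proof -
 obtain \<phi> where \<phi>: "!!k. \<phi> k \<in> TF" and lim: "W_tendsto \<phi> \<xi>" using W1p0_approximation[OF \<xi>] by blast
 have "\<forall>k. \<exists>n. r (%x. \<phi> k x - ev (basis n) x) < 1 / real (Suc k)" using basis(2)[OF \<phi>] by simp
 from choice[OF this] obtain N where N: "!!k. r (%x. \<phi> k x - ev (basis (N k)) x) < 1 / real (Suc k)" by blast
 let ?\<psi> = "%k. ev (basis (N k))"
 have \<psi>: "?\<psi> k \<in> TF" for k by (rule TBD[OF basis(1)])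
 have "\<bar>r (%x. \<phi> k x - ?\<psi> k x)\<bar> <= 1 / real (Suc k)" for k using N[of k] by simp
 then have d: "(%k. r (%x. \<phi> k x - ?\<psi> k x)) \<longlonglongrightarrow> 0"
  by (intro Lim_null_comparison[OF always_eventually LIMSEQ_Suc[OF lim_1_over_n]]) simp
 have "\<forall>k. norm (Lp_dist \<mu> p (?\<psi> k) (\<phi> k)) <= P * r (%x. \<phi> k x - ?\<psi> k x)"
  using P(2)[OF test_functions_simple_comb(2)[OF \<phi> \<psi>]] Lp_norm_minus_commute[of \<mu> p "\<phi> _" "?\<psi> _"] by simp
 from Lim_null_comparison[OF always_eventually[OF this] tendsto_mult_right_zero[OF d]]
 have d1: "(%k. Lp_dist \<mu> p (?\<psi> k) (\<phi> k)) \<longlonglongrightarrow> 0" .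
 have d2: "(%k. Lp_dist M p (grad (?\<psi> k)) (grad (\<phi> k))) \<longlonglongrightarrow> 0"
  using d unfolding grad_fun(2)[OF \<phi> \<psi>] Lp_norm_minus_commute[of M p "grad (\<phi> _)"] .
 have "W_tendsto ?\<psi> \<xi>"
  by (rule conjI, rule Lp_tendsto_trans[OF p test_function_Lp_\<mu>[OF p0 \<phi>] test_function_Lp_\<mu>[OF p0 \<psi>] W1p0_Lp_\<mu>[OF \<xi>] d1 conjunct1[OF lim]],
   rule Lp_tendsto_trans[OF p test_Lp(2)[OF \<phi>] test_Lp(2)[OF \<psi>] W1p0_props(2)[OF \<xi>] d2 conjunct2[OF lim]])
 moreover have "basis (N k) \<in> V (Suc (N k))" for k unfolding V_def by (intro span_base) auto
 ultimately show ?thesis by (intro exI[of _ "%k. basis (N k)"] exI[of _ "%k. Suc (N k)"]) auto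
qed

lemma continuous_on_V_bounded_linear:
 assumes add: "!!u v. u \<in> V n ==> v \<in> V n ==> L (u - v) = L u - L v" and bd: "!!u. u \<in> V n ==> \<bar>L u\<bar> <= C * rb u"
 shows "continuous_on (V n) (L :: _ => real)"
 unfolding continuous_on_sequentially
proof (intro allI ballI impI, elim conjE)
 fix x u assume u: "u \<in> V n" and x: "\<forall>n'. x n' \<in> V n" "x \<longlonglongrightarrow> u"
 have "\<forall>k. norm ((L \<circ> x) k - L u) <= C * rb (x k - u)" using x(1) u bd[OF subspace_diff[OF subspace_V]] by (simp add: add)
 then show "(L \<circ> x) \<longlonglongrightarrow> L u"
  by (rule LIM_zero_cancel[OF Lim_null_comparison[OF always_eventually tendsto_mult_right_zero[OF Vn.r_null_sequence[OF u x(1)[rule_format] x(2)]]]])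
qed

end

section \<open>Limits of Galerkin solutions\<close>

lemma lower_power_absorption:
 fixes s p \<delta> c :: real
 assumes "0 < s" "s < p" "0 < \<delta>" "0 <= c"
 shows "\<exists>K\<ge>0. \<forall>x\<ge>0. c * x powr s <= \<delta> * x powr p + K"
proof -
 define x0 where "x0 = (c / \<delta>) powr (1 / (p - s))"
 have "c * x powr s <= \<delta> * x powr p + c * x0 powr s" if x: "0 <= x" for x
 proof (cases "x <= x0")
  case True
  then have "c * x powr s <= c * x0 powr s" using assms x by (intro mult_left_mono powr_mono2) auto
  then show ?thesis using assms by (simp add: add_increasing)
 next
  case False
  have "0 <= x0" by (simp add: x0_def)
  then have "0 < x" using False by linarith
  have "c / \<delta> = x0 powr (p - s)" using assms by (simp add: x0_def powr_powr)
  also have "... <= x powr (p - s)" using False assms \<open>0 <= x0\<close> by (intro powr_mono2) auto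
  finally have "c <= \<delta> * x powr (p - s)" using assms by (simp add: field_simps)
  then have "c * x powr s <= \<delta> * x powr (p - s) * x powr s" by (intro mult_right_mono) auto
  also have "... = \<delta> * x powr p" by (simp add: mult.assoc powr_add[symmetric])
  finally show ?thesis using assms by (simp add: add_increasing2)
 qed
 then show ?thesis using assms by (intro exI[of _ "c * x0 powr s"]) auto
qed

text \<open>The equation with densities \<open>bm\<close>, \<open>ba\<close>, \<open>bf\<close> relative to \<open>\<mu>\<close>. The assumption \<open>nondegenerate\<close> says that the
\<open>q\<close>-homogeneous term does not vanish on nonzero solutions of the eigenvalue problem.\<close>
locale p_laplace_problem = weighted_domain \<Omega> p \<gamma> wt
 for \<Omega> :: "(real ^ 'n) set" and p \<gamma> :: real and wt :: "real ^ 'n => real" +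
 fixes q lam \<eta> :: real and bm ba bf :: "real ^ 'n => real"
 assumes q: "1 < q" "q < p"
  and coefficients: "coefficient (lebesgue_on \<Omega>) bm" "coefficient (lebesgue_on \<Omega>) ba" "coefficient (lebesgue_on \<Omega>) bf"
  and nondegenerate: "!!u. u \<in> W1p0 p \<Omega> ==>
   (!!\<xi>. \<xi> \<in> W1p0 p \<Omega> ==> (LINT x|lebesgue_on \<Omega>. duality_map p (weak_grad \<Omega> u x) \<bullet> weak_grad \<Omega> \<xi> x)
     = lam * (LINT x|density (lebesgue_on \<Omega>) (%x. ennreal (wt x)). bm x * (duality_map p (u x) \<bullet> \<xi> x))) ==>
   ~ (AE x in lebesgue_on \<Omega>. u x = 0) ==>
   \<eta> * (LINT x|density (lebesgue_on \<Omega>) (%x. ennreal (wt x)). ba x * norm (u x) powr q) ~= 0"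
begin

lemma q0: "0 < q" using q by simp

lemma coeff: "coefficient \<mu> bm" "coefficient \<mu> ba" "coefficient \<mu> bf"
 using coefficients by (simp_all add: coefficient_def measurable_\<mu>)

definition \<kappa> where "\<kappa> = measure \<mu> (space \<mu>) powr ((p - q) / (p * q))"

lemma \<kappa>: "0 <= \<kappa>" "f \<in> Lp \<mu> p ==> f \<in> Lp \<mu> q" "f \<in> Lp \<mu> p ==> Lp_norm \<mu> q f <= \<kappa> * Lp_norm \<mu> p (f :: real ^ 'n => real)"
 using Lp_norm_mono_exponent[OF finite_\<mu> q, of f] by (simp_all add: \<kappa>_def)

definition \<nu> where "\<nu> = Lp_norm \<mu> p (%_. 1 :: real) powr (p - 1)"

lemma one_Lp: "(%_. 1 :: real) \<in> Lp \<mu> p"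
proof -
 interpret finite_measure \<mu> by (rule finite_\<mu>)
 show ?thesis by (simp add: Lp_def)
qed

lemma source_term:
 assumes \<xi>: "\<xi> \<in> Lp \<mu> p"
 shows "integrable \<mu> (%x. bf x * \<xi> x)" "\<bar>LINT x|\<mu>. bf x * \<xi> x\<bar> <= \<nu> * Lp_norm \<mu> p \<xi>"
 using integrable_duality_pairing[OF p one_Lp \<xi> coeff(3)] by (simp_all add: \<nu>_def duality_map_real)

text \<open>The weak form tested with \<open>\<xi>\<close>, with factors \<open>s\<close> and \<open>t\<close> on the two lower order terms: \<open>s = t = 1\<close> is the equation,
\<open>t = 0\<close> belongs to the even part, and \<open>s = t = 0\<close> is the eigenvalue problem. The gradients \<open>g\<close> and \<open>h\<close> are separate
arguments, since test functions come with a classical gradient and their limits with a weak one.\<close>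
definition weak_form where
 "weak_form s t u g \<xi> h = (LINT x|M. duality_map p (g x) \<bullet> (h x :: real ^ 'n)) - lam * Lp_pairing \<mu> p bm u \<xi>
  - s * (\<eta> * Lp_pairing \<mu> q ba u \<xi>) - t * (LINT x|\<mu>. bf x * \<xi> x)"

abbreviation weak_form_at where
 "weak_form_at s t u \<xi> \<equiv> weak_form s t u (weak_grad \<Omega> u) \<xi> (weak_grad \<Omega> \<xi>)"

lemma Lp_tendsto_q:
 assumes "!!n. u n \<in> Lp \<mu> p" "f \<in> Lp \<mu> p" "Lp_tendsto \<mu> p u f"
 shows "(%n. Lp_norm \<mu> q (%x. u n x - f x :: real)) \<longlonglongrightarrow> 0"
 by (rule Lim_null_comparison[OF always_eventually[OF allI] tendsto_mult_right_zero[OF assms(3)]])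
  (use \<kappa>(3)[OF Lp_diff[OF p0 assms(1,2)]] in simp)

lemma Lp_tendsto_const: "Lp_tendsto N p (%_. f) f"
 using p0 by (simp add: Lp_norm_def)

lemma weak_form_tendsto:
 assumes u: "!!n. u n \<in> Lp \<mu> p" "u' \<in> Lp \<mu> p" and g: "!!n. g n \<in> Lp M p" "g' \<in> Lp M p"
  and \<xi>: "!!n. \<xi> n \<in> Lp \<mu> p" "\<xi>' \<in> Lp \<mu> p" and h: "!!n. h n \<in> Lp M p" "h' \<in> Lp M p"
  and lim: "Lp_tendsto \<mu> p u u'" "Lp_tendsto M p g g'" "Lp_tendsto \<mu> p \<xi> \<xi>'" "Lp_tendsto M p h h'"
  and s: "s \<longlonglongrightarrow> s'" and t: "t \<longlonglongrightarrow> t'"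
 shows "(%n. weak_form (s n) (t n) (u n) (g n) (\<xi> n) (h n)) \<longlonglongrightarrow> weak_form s' t' u' g' \<xi>' h'"
 unfolding weak_form_def
proof (intro tendsto_diff tendsto_mult s t tendsto_const)
 show "(%n. LINT x|M. duality_map p (g n x) \<bullet> h n x) \<longlonglongrightarrow> (LINT x|M. duality_map p (g' x) \<bullet> h' x)"
  using duality_pairing_tendsto[OF p g(2,1) h(2,1) lim(2,4) coefficient_1] by simp
 show "(%n. LINT x|\<mu>. bm x * (duality_map p (u n x) \<bullet> \<xi> n x)) \<longlonglongrightarrow> Lp_pairing \<mu> p bm u' \<xi>'"
  by (rule duality_pairing_tendsto[OF p u(2,1) \<xi>(2,1) lim(1,3) coeff(1)])
 show "(%n. LINT x|\<mu>. ba x * (duality_map q (u n x) \<bullet> \<xi> n x)) \<longlonglongrightarrow> Lp_pairing \<mu> q ba u' \<xi>'"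
  by (rule duality_pairing_tendsto[OF q(1) \<kappa>(2)[OF u(2)] \<kappa>(2)[OF u(1)] \<kappa>(2)[OF \<xi>(2)] \<kappa>(2)[OF \<xi>(1)]
     Lp_tendsto_q[OF u lim(1)] Lp_tendsto_q[OF \<xi> lim(3)] coeff(2)])
 show "(%n. LINT x|\<mu>. bf x * \<xi> n x) \<longlonglongrightarrow> (LINT x|\<mu>. bf x * \<xi>' x)"
  using duality_pairing_tendsto[OF p one_Lp one_Lp \<xi>(2,1) Lp_tendsto_const lim(3) coeff(3)] by (simp add: duality_map_real)
qed

text \<open>All terms but the principal one are controlled by the weighted norm of \<open>\<xi>\<close>, which is small for differences along a
convergent sequence.\<close>
lemma weak_form_lower_order:
 assumes u: "u \<in> Lp \<mu> p" and \<xi>: "\<xi> \<in> Lp \<mu> p"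
  and R: "Lp_norm \<mu> p u <= R" and s: "\<bar>s\<bar> <= S" and t: "\<bar>t\<bar> <= S"
 shows "\<bar>weak_form s t u g \<xi> h - (LINT x|M. duality_map p (g x) \<bullet> h x)\<bar>
  <= (\<bar>lam\<bar> * R powr (p - 1) + S * \<bar>\<eta>\<bar> * ((\<kappa> * R) powr (q - 1) * \<kappa>) + S * \<nu>) * Lp_norm \<mu> p \<xi>"
proof -
 let ?X = "Lp_norm \<mu> p \<xi>"
 have R0: "0 <= R" using R Lp_norm_nonneg order_trans by blast
 have S0: "0 <= S" using s by linarith
 have "\<bar>LINT x|\<mu>. bm x * (duality_map p (u x) \<bullet> \<xi> x)\<bar> <= Lp_norm \<mu> p u powr (p - 1) * ?X"
  by (rule integrable_duality_pairing(2)[OF p u \<xi> coeff(1)])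
 also have "... <= R powr (p - 1) * ?X" using R p by (intro mult_right_mono powr_mono2) auto
 finally have 1: "\<bar>lam * Lp_pairing \<mu> p bm u \<xi>\<bar> <= \<bar>lam\<bar> * (R powr (p - 1) * ?X)"
  unfolding abs_mult by (rule mult_left_mono) simp
 have "\<bar>LINT x|\<mu>. ba x * (duality_map q (u x) \<bullet> \<xi> x)\<bar> <= Lp_norm \<mu> q u powr (q - 1) * Lp_norm \<mu> q \<xi>"
  by (rule integrable_duality_pairing(2)[OF q(1) \<kappa>(2)[OF u] \<kappa>(2)[OF \<xi>] coeff(2)])
 also have "... <= (\<kappa> * R) powr (q - 1) * (\<kappa> * ?X)"
  using q order_trans[OF \<kappa>(3)[OF u] mult_left_mono[OF R \<kappa>(1)]] by (intro mult_mono powr_mono2 \<kappa>(3)[OF \<xi>]) auto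
 finally have "\<bar>s\<bar> * (\<bar>\<eta>\<bar> * \<bar>LINT x|\<mu>. ba x * (duality_map q (u x) \<bullet> \<xi> x)\<bar>) <= S * (\<bar>\<eta>\<bar> * ((\<kappa> * R) powr (q - 1) * (\<kappa> * ?X)))"
  using s S0 by (intro mult_mono) auto
 then have 2: "\<bar>s * (\<eta> * Lp_pairing \<mu> q ba u \<xi>)\<bar> <= S * (\<bar>\<eta>\<bar> * ((\<kappa> * R) powr (q - 1) * (\<kappa> * ?X)))"
  by (simp only: abs_mult)
 have 3: "\<bar>t * (LINT x|\<mu>. bf x * \<xi> x)\<bar> <= S * (\<nu> * ?X)"
  unfolding abs_mult using t S0 source_term(2)[OF \<xi>] by (intro mult_mono) auto
 have "\<bar>weak_form s t u g \<xi> h - (LINT x|M. duality_map p (g x) \<bullet> h x)\<bar> <= \<bar>lam\<bar> * (R powr (p - 1) * ?X) + S * (\<bar>\<eta>\<bar> * ((\<kappa> * R) powr (q - 1) * (\<kappa> * ?X))) + S * (\<nu> * ?X)"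
  unfolding weak_form_def using 1 2 3 by (simp only: abs_le_iff) linarith
 also have "... = (\<bar>lam\<bar> * R powr (p - 1) + S * \<bar>\<eta>\<bar> * ((\<kappa> * R) powr (q - 1) * \<kappa>) + S * \<nu>) * ?X" by (simp add: algebra_simps)
 finally show ?thesis .
qed

end

lemma monotone_subsequence:
 fixes n :: "nat => nat"
 assumes "!!j. j <= n j"
 shows "\<exists>k::nat=>nat. strict_mono k & mono (%j. n (k j))"
proof -
 obtain k where k: "strict_mono k" "monoseq (%j. n (k j))" using seq_monosub[of n] by blast
 have "~ decseq (%j. n (k j))"
 proof
  assume "decseq (%j. n (k j))"
  then have "n (k (Suc (n (k 0)))) <= n (k 0)" by (rule decseqD) simp
  moreover have "Suc (n (k 0)) <= n (k (Suc (n (k 0))))"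
   using strict_mono_imp_increasing[OF k(1), of "Suc (n (k 0))"] assms[of "k (Suc (n (k 0)))"] by linarith
  ultimately show False by simp
 qed
 then show ?thesis using k by (auto simp: monoseq_iff)
qed

context p_laplace_problem begin

abbreviation "weak_form_test s t u \<xi> \<equiv>
 weak_form s t (ev u) (gv u) (ev \<xi>) (gv \<xi>)"

text \<open>After Rellich's theorem, test the j-th approximate equation with differences of members of the sequence: lower order
terms tend to 0, so the principal part satisfies the hypothesis of \<open>monotone_type_strong_convergence\<close>. Differences with
earlier members are admissible because \<open>n\<close> can be made monotone. The convergent parameters \<open>s\<close> and \<open>t\<close> cover both
the equation itself and its rescaling to the eigenvalue problem.\<close>
theorem Galerkin_compactness:
 assumes u: "!!j. u j \<in> V (n j)" and n: "!!j. j <= n j" and R: "!!j. rb (u j) <= R"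
  and s: "s \<longlonglongrightarrow> s'" and t: "t \<longlonglongrightarrow> t'" and \<epsilon>: "\<epsilon> \<longlonglongrightarrow> 0"
  and eq: "!!j \<xi>. \<xi> \<in> V (n j) ==> \<bar>weak_form_test (s j) (t j) (u j) \<xi>\<bar> <= \<epsilon> j * rb \<xi>"
 shows "\<exists>(k :: nat => nat) v. strict_mono k & v \<in> W1p0 p \<Omega>
  & W_tendsto (%j. ev (u (k j))) v
  & (\<forall>\<xi>\<in>W1p0 p \<Omega>. weak_form_at s' t' v \<xi> = 0)"
proof -
 (* With monotone n, the space belonging to an index contains all earlier members of the sequence. *)
 obtain k0 :: "nat => nat" where k0: "strict_mono k0" "mono (%j. n (k0 j))" using monotone_subsequence[of n] n by blast
 have uT: "ev (u j) \<in> TF" for j by (rule V_TF[OF u])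
 obtain k1 :: "nat => nat" where k1: "strict_mono k1"
  and C1: "Lp_Cauchy \<mu> p (%i. ev (u (k0 (k1 i))))"
  using Rellich[OF uT R, of k0] by blast
 define l where "l j = k0 (k1 j)" for j
 have l: "strict_mono l" unfolding l_def[abs_def] by (rule strict_mono_compose[OF k0(1) k1])
 have nl: "n (l i) <= n (l j)" if "i <= j" for i j
  unfolding l_def using monoD[OF k0(2)] that k1 by (simp add: strict_mono_less_eq)
 obtain S where S: "!!j. \<bar>s j\<bar> <= S" "!!j. \<bar>t j\<bar> <= S"
 proof -
  obtain S1 where "!!j. \<bar>s j\<bar> <= S1" using convergent_imp_Bseq[OF convergentI[OF s]] unfolding Bseq_def by auto
  moreover obtain S2 where "!!j. \<bar>t j\<bar> <= S2" using convergent_imp_Bseq[OF convergentI[OF t]] unfolding Bseq_def by auto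
  ultimately show ?thesis by (intro that[of "max S1 S2"]) (meson max.coboundedI1 max.coboundedI2)+
 qed
 have R0: "0 <= R" using order_trans[OF Lp_norm_nonneg R] .
 have uP: "Lp_norm \<mu> p (ev (u j)) <= P * R" for j
  by (rule order_trans[OF P(2)[OF uT] mult_left_mono[OF R P(1)]])
 define K where "K = \<bar>lam\<bar> * (P * R) powr (p - 1) + S * \<bar>\<eta>\<bar> * ((\<kappa> * (P * R)) powr (q - 1) * \<kappa>) + S * \<nu>"
 have S0: "0 <= S" using S(1)[of 0] by linarith
 have K0: "0 <= K" unfolding K_def using S0 \<kappa>(1) by (intro add_nonneg_nonneg mult_nonneg_nonneg) (auto simp: \<nu>_def)
 have gL: "gv (u j) \<in> Lp M p" for j by (rule test_Lp(2)[OF uT])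
 have pL: "ev (u j) \<in> Lp \<mu> p" for j by (rule test_function_Lp_\<mu>[OF p0 uT])
 let ?I = "%j k. LINT x|M. duality_map p (gv (u (l k)) x) \<bullet> (gv (u (l j)) x - gv (u (l k)) x)"
 have almost_monotone: "\<exists>N. \<forall>j\<ge>N. \<forall>k\<ge>j. - e <= ?I j k"
  if e: "0 < e" for e
 proof -
  obtain e1 where e1: "0 < e1" "e1 * K <= e / 2" using exists_small_factor[of "e / 2" K] e K0 by auto
  obtain N1 where N1: "!!i j. N1 <= i ==> N1 <= j ==> Lp_dist \<mu> p (ev (u (l i))) (ev (u (l j))) < e1"
   using C1 e1(1) unfolding l_def by blast
  obtain e2 where e2: "0 < e2" "e2 * (R + R) <= e / 2" using exists_small_factor[of "e / 2" "R + R"] e R0 by auto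
  have "(%j. \<epsilon> (l j)) \<longlonglongrightarrow> 0" using LIMSEQ_subseq_LIMSEQ[OF \<epsilon> l] by (simp add: comp_def)
  from order_tendstoD(2)[OF tendsto_rabs_zero[OF this] e2(1)]
  obtain N2 where N2: "!!j. N2 <= j ==> \<bar>\<epsilon> (l j)\<bar> < e2" by (auto simp: eventually_sequentially)
  have "- e <= ?I j k"
   if j: "max N1 N2 <= j" and k: "j <= k" for j k
  proof -
   let ?\<xi> = "u (l j) - u (l k)"
   have \<xi>: "?\<xi> \<in> V (n (l k))" using u[of "l j"] u[of "l k"] V_mono[OF nl[OF k]] by (intro subspace_diff[OF subspace_V]) auto
   have g\<xi>: "gv ?\<xi> = (%x. gv (u (l j)) x - gv (u (l k)) x)"
    unfolding ev_arith by (rule grad_fun(2)[OF uT uT])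
   have "rb ?\<xi> <= R + R" unfolding ev_arith using r_diff[OF uT uT, of "l j" "l k"] R[of "l j"] R[of "l k"] by linarith
   then have "\<bar>\<epsilon> (l k)\<bar> * rb ?\<xi> <= e2 * (R + R)" using N2[of k] j k by (intro mult_mono) auto
   then have 1: "\<bar>\<epsilon> (l k)\<bar> * rb ?\<xi> <= e / 2" using e2(2) by linarith
   have "\<bar>weak_form_test (s (l k)) (t (l k)) (u (l k)) ?\<xi>\<bar> <= \<epsilon> (l k) * rb ?\<xi>" by (rule eq[OF \<xi>])
   also have "... <= \<bar>\<epsilon> (l k)\<bar> * rb ?\<xi>" by (intro mult_right_mono) auto
   finally have 2: "\<bar>weak_form_test (s (l k)) (t (l k)) (u (l k)) ?\<xi>\<bar> <= e / 2" using 1 by linarith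
   have "\<bar>weak_form_test (s (l k)) (t (l k)) (u (l k)) ?\<xi> - ?I j k\<bar> <= K * Lp_norm \<mu> p (ev ?\<xi>)"
    using weak_form_lower_order[OF pL test_function_Lp_\<mu>[OF p0 V_TF[OF \<xi>]] uP S, where g = "gv (u (l k))" and h = "gv ?\<xi>"]
    unfolding K_def g\<xi> .
   also have "... <= K * e1" unfolding ev_arith using N1[of j k] j k by (intro mult_left_mono K0) auto
   also have "... <= e / 2" using e1(2) by (simp add: mult.commute)
   finally show "- e <= ?I j k" using 2 by (simp only: abs_le_iff) linarith
  qed
  then show ?thesis by blast
 qed
 have bdd: "(LINT x|M. norm (gv (u (l j)) x) powr p) <= R powr p" for j
  unfolding Lp_norm_powr[OF p0, symmetric] using p0 R by (intro powr_mono2) auto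
 obtain k2 :: "nat => nat" where k2: "strict_mono k2"
  and C2: "Lp_Cauchy M p (%i. gv (u (l (k2 i))))"
  using monotone_type_strong_convergence[OF p gL bdd almost_monotone] by blast
 define k where "k j = l (k2 j)" for j
 have k: "strict_mono k" unfolding k_def[abs_def] by (rule strict_mono_compose[OF l k2])
 have "\<exists>N. \<forall>i\<ge>N. \<forall>j\<ge>N. Lp_dist \<mu> p (ev (u (k i))) (ev (u (k j))) < e" if e: "0 < e" for e
 proof -
  obtain N where "\<forall>i\<ge>N. \<forall>j\<ge>N. Lp_dist \<mu> p (ev (u (k0 (k1 i)))) (ev (u (k0 (k1 j)))) < e" using C1 e by blast
  then show ?thesis unfolding k_def l_def using strict_mono_imp_increasing[OF k2] by (meson order_trans)
 qed
 then have "\<exists>v\<in>Lp \<mu> p. Lp_tendsto \<mu> p (%j. ev (u (k j))) v" by (intro Lp_complete[OF finite_\<mu> p pL] allI impI)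
 then obtain v where v: "v \<in> Lp \<mu> p" "Lp_tendsto \<mu> p (%j. ev (u (k j))) v" by blast
 obtain g where g: "g \<in> Lp M p" "Lp_tendsto M p (%j. gv (u (k j))) g"
  using Lp_complete[OF finite_M p gL C2] unfolding k_def by blast
 have "Lp_tendsto M p (%j. ev (u (k j))) v"
  by (rule tendsto_sandwich[OF _ _ tendsto_const v(2)])
   (auto intro!: always_eventually Lp_\<mu>_imp_Lp_M(2)[OF p0] Lp_diff[OF p0] pL v(1))
 note W = W1p0I[OF open_domain bounded_domain p uT Lp_\<mu>_imp_Lp_M(1)[OF p0 v(1)] g(1) this g(2)]
 note wg = W1p0_props(2)[OF W(1)]
 have "Lp_dist M p (gv (u (k j))) (weak_grad \<Omega> v) = Lp_dist M p (gv (u (k j))) g" for j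
  by (rule Lp_norm_cong_AE[OF LpD(1)[OF Lp_diff[OF p0 gL wg]] LpD(1)[OF Lp_diff[OF p0 gL g(1)]]])
   (use weak_grad_AE[OF open_domain W(2)] in eventually_elim, simp)
 with g(2) have gconv: "Lp_tendsto M p (%j. gv (u (k j))) (weak_grad \<Omega> v)" by simp
 have sk: "(%j. s (k j)) \<longlonglongrightarrow> s'" "(%j. t (k j)) \<longlonglongrightarrow> t'" "(%j. \<epsilon> (k j)) \<longlonglongrightarrow> 0"
  using LIMSEQ_subseq_LIMSEQ[OF s k] LIMSEQ_subseq_LIMSEQ[OF t k] LIMSEQ_subseq_LIMSEQ[OF \<epsilon> k] by (simp_all add: comp_def)
 have test: "weak_form s' t' v (weak_grad \<Omega> v) (ev \<xi>) (gv \<xi>) = 0" if \<xi>: "\<xi> \<in> V m" for \<xi> m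
 proof (rule LIMSEQ_unique)
  show "(%j. weak_form_test (s (k j)) (t (k j)) (u (k j)) \<xi>) \<longlonglongrightarrow> weak_form s' t' v (weak_grad \<Omega> v) (ev \<xi>) (gv \<xi>)"
   using test_function_Lp_\<mu>[OF p0 V_TF[OF \<xi>]] test_Lp(2)[OF V_TF[OF \<xi>]]
   by (intro weak_form_tendsto pL gL v gconv wg sk Lp_tendsto_const)
  show "(%j. weak_form_test (s (k j)) (t (k j)) (u (k j)) \<xi>) \<longlonglongrightarrow> 0"
  proof (rule Lim_null_comparison)
   show "(%j. \<epsilon> (k j) * rb \<xi>) \<longlonglongrightarrow> 0" using tendsto_mult_right[OF sk(3), of "rb \<xi>"] by simp
   show "\<forall>\<^sub>F j in sequentially. norm (weak_form_test (s (k j)) (t (k j)) (u (k j)) \<xi>) <= \<epsilon> (k j) * rb \<xi>"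
    using eventually_ge_at_top[of m]
   proof eventually_elim
    case (elim j)
    have "m <= n (k j)" using elim strict_mono_imp_increasing[OF k, of j] n[of "k j"] by linarith
    then have "\<xi> \<in> V (n (k j))" using \<xi> V_mono by blast
    then show ?case unfolding real_norm_def by (rule eq)
   qed
  qed
 qed
 have "weak_form_at s' t' v \<xi> = 0" if \<xi>: "\<xi> \<in> W1p0 p \<Omega>" for \<xi>
 proof -
  obtain \<psi> m where \<psi>: "!!i. \<psi> i \<in> V (m i)" "W_tendsto (%k. ev (\<psi> k)) \<xi>"
   using Galerkin_approximation[OF \<xi>] by blast
  have 1: "(%i. weak_form s' t' v (weak_grad \<Omega> v) (ev (\<psi> i)) (gv (\<psi> i))) \<longlonglongrightarrow> weak_form_at s' t' v \<xi>"
   by (intro weak_form_tendsto tendsto_const v(1) wg Lp_tendsto_const conjunct1[OF \<psi>(2)] conjunct2[OF \<psi>(2)] test_function_Lp_\<mu>[OF p0 V_TF[OF \<psi>(1)]] test_Lp(2)[OF V_TF[OF \<psi>(1)]] W1p0_Lp_\<mu>[OF \<xi>] W1p0_props(2)[OF \<xi>])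
  have 2: "(%i. weak_form s' t' v (weak_grad \<Omega> v) (ev (\<psi> i)) (gv (\<psi> i))) \<longlonglongrightarrow> 0"
   by (simp only: test[OF \<psi>(1)] tendsto_const)
  show ?thesis by (rule LIMSEQ_unique[OF 1 2])
 qed
 then show ?thesis using k W(1) v(2) gconv by blast
qed

section \<open>The even part of the energy\<close>

definition Fg :: "'n bcf => real" where
 "Fg u = (LINT x|M. 1 * norm (gv u x) powr p)"

definition Fm :: "'n bcf => real" where
 "Fm u = Lp_weighted \<mu> p bm (ev u)"

definition Fa :: "'n bcf => real" where
 "Fa u = Lp_weighted \<mu> q ba (ev u)"

definition E0 :: "'n bcf => real" where
 "E0 u = 1 / p * (Fg u - lam * Fm u) - \<eta> / q * Fa u"

definition DE0 :: "'n bcf => 'n bcf => real" where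
 "DE0 u \<xi> = weak_form_test 1 0 u \<xi>"

definition source :: "'n bcf => real" where
 "source u = (LINT x|\<mu>. bf x * ev u x)"

definition pairing :: "'n bcf => 'n bcf => real" where
 "pairing u \<xi> = (LINT x|M. 1 * (duality_map p (gv u x) \<bullet> gv \<xi> x))"

text \<open>The norm smoothed at 0 to become differentiable.\<close>
definition wn :: "'n bcf => real" where
 "wn u = (1 + Fg u) powr (1 / p)"

definition Dwn :: "'n bcf => 'n bcf => real" where
 "Dwn u \<xi> = (1 / p * (1 + Fg u) powr (1 / p - 1)) * (p * pairing u \<xi>)"

lemma Fg_eq: "Fg u = rb u powr p" unfolding Fg_def using p0 by (simp add: Lp_norm_powr)

lemma V_Lp: "u \<in> V n ==> ev u \<in> Lp \<mu> p" "u \<in> V n ==> gv u \<in> Lp M p"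
 "u \<in> V n ==> ev u \<in> Lp \<mu> q"
 using test_function_Lp_\<mu>[OF p0 V_TF] test_Lp(2)[OF V_TF] test_function_Lp_\<mu>[OF q0 V_TF] by blast+

lemma C1_Fg: "C1_functional (V n) rb Fg (%u \<xi>. p * pairing u \<xi>)"
 unfolding Fg_def[abs_def] pairing_def[abs_def]
proof (rule Vn.C1_functional_power[where C = 1, OF p _ _ _ _ coefficient_1])
 fix u v and x :: "real ^ 'n" and c :: real assume "u \<in> V n" "v \<in> V n"
 then have T: "ev u \<in> TF" "ev v \<in> TF" using V_TF by blast+
 show "gv (u + v) x = gv u x + gv v x"
  unfolding ev_arith by (rule grad_simple_comb(1)[OF T])
next
 fix u c and x :: "real ^ 'n" assume "u \<in> V n"
 then have T: "ev u \<in> TF" by (rule V_TF)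
 show "gv (c *\<^sub>R u) x = c *\<^sub>R gv u x"
  unfolding ev_arith by (rule grad_simple_comb(3)[OF T T])
qed (auto intro: V_Lp)

lemma C1_Fm: "C1_functional (V n) rb Fm (%u \<xi>. p * Lp_pairing \<mu> p bm (ev u) (ev \<xi>))"
 unfolding Fm_def[abs_def]
 by (rule Vn.C1_functional_power[where C = P, OF p _ _ V_Lp(1) P(2)[OF V_TF] coeff(1)]) auto

lemma C1_Fa: "C1_functional (V n) rb Fa (%u \<xi>. q * Lp_pairing \<mu> q ba (ev u) (ev \<xi>))"
 unfolding Fa_def[abs_def]
proof (rule Vn.C1_functional_power[where C = "\<kappa> * P", OF q(1) _ _ V_Lp(3) _ coeff(2)])
 fix u assume u: "u \<in> V n"
 show "Lp_norm \<mu> q (ev u) <= \<kappa> * P * rb u"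
  using order_trans[OF \<kappa>(3)[OF V_Lp(1)[OF u]] mult_left_mono[OF P(2)[OF V_TF[OF u]] \<kappa>(1)]] by (simp add: mult.assoc)
qed auto

lemma C1_E0: "C1_functional (V n) rb E0 DE0"
proof -
 have e: "E0 = (%u. 1 * (1 / p * Fg u + (- (lam / p)) * Fm u) + (- (\<eta> / q)) * Fa u)"
  by (rule ext) (simp add: E0_def algebra_simps)
 have d: "DE0 = (%u \<xi>. 1 * (1 / p * (p * pairing u \<xi>) + (- (lam / p)) * (p * Lp_pairing \<mu> p bm (ev u) (ev \<xi>)))
  + (- (\<eta> / q)) * (q * Lp_pairing \<mu> q ba (ev u) (ev \<xi>)))"
  by (intro ext) (use p0 q0 in \<open>simp add: DE0_def weak_form_def pairing_def\<close>)
 show ?thesis unfolding e d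
  by (intro Vn.C1_functional_linear_comb C1_Fg C1_Fm C1_Fa)
qed

lemma C1_wn: "C1_functional (V n) rb wn Dwn"
 unfolding wn_def[abs_def] Dwn_def[abs_def]
proof (rule Vn.C1_functional_compose[OF C1_Fg])
 fix u
 have pos: "0 < 1 + Fg u" by (simp add: Fg_eq add_pos_nonneg)
 show "((%t. (1 + t) powr (1 / p)) has_real_derivative 1 / p * (1 + Fg u) powr (1 / p - 1)) (at (Fg u))"
  using pos p0 by (auto intro!: derivative_eq_intros simp: powr_diff)
next
 show "continuous_on (Fg ` V n) (%t. 1 / p * (1 + t) powr (1 / p - 1))"
 proof (intro continuous_intros ballI)
  fix t assume "t \<in> Fg ` V n"
  then obtain u where "t = Fg u" by blast
  then have "0 < 1 + t" by (simp add: Fg_eq add_pos_nonneg)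
  then show "1 + t ~= 0" by simp
 qed
qed

lemma powr_inverse_exponent: "0 <= x ==> (x powr p) powr (1 / p) = x"
 using p0 by (simp add: powr_powr)

lemma wn_bounds: "1 <= wn u" "rb u <= wn u" "wn u <= 1 + rb u"
proof -
 have "1 powr (1 / p) <= wn u" unfolding wn_def using p0 by (intro powr_mono2) (auto simp: Fg_eq)
 then show "1 <= wn u" by simp
 have "(rb u powr p) powr (1 / p) <= wn u" unfolding wn_def using p0 by (intro powr_mono2) (auto simp: Fg_eq)
 then show "rb u <= wn u" by (simp add: powr_inverse_exponent)
 have "1 + rb u powr p <= (1 + rb u) powr p"
 proof -
  have "1 powr p + rb u powr p = 1 powr (p - 1) * 1 + rb u powr (p - 1) * rb u"
   by (simp add: powr_minus_one_mult)
  also have "... <= (1 + rb u) powr (p - 1) * 1 + (1 + rb u) powr (p - 1) * rb u"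
   using p by (intro add_mono mult_right_mono powr_mono2) auto
  also have "... = (1 + rb u) powr (p - 1) * (1 + rb u)" by (simp add: algebra_simps)
  also have "... = (1 + rb u) powr p" by (rule powr_minus_one_mult) simp
  finally show ?thesis by simp
 qed
 then have "wn u <= ((1 + rb u) powr p) powr (1 / p)" unfolding wn_def Fg_eq using p0 by (intro powr_mono2) auto
 then show "wn u <= 1 + rb u" by (simp add: powr_inverse_exponent)
qed

text \<open>Since \<open>|\<nabla> u|^(p-1)\<close> is normalised by \<open>(1 + ||\<nabla> u||^p)^((p-1)/p)\<close>.\<close>
lemma Dwn_bound:
 assumes u: "u \<in> V n" and v: "v \<in> V n"
 shows "\<bar>Dwn u v\<bar> <= rb v"
proof -
 have 1: "\<bar>pairing u v\<bar> <= rb u powr (p - 1) * rb v"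
  unfolding pairing_def by (rule integrable_duality_pairing(2)[OF p V_Lp(2)[OF u] V_Lp(2)[OF v] coefficient_1])
 have "(1 + Fg u) powr (1 / p - 1) * rb u powr (p - 1) <= 1"
 proof -
  have "rb u powr (p - 1) = (Fg u) powr ((p - 1) / p)" using p0 by (simp add: Fg_eq powr_powr)
  also have "... <= (1 + Fg u) powr ((p - 1) / p)" using p by (intro powr_mono2) (auto simp: Fg_eq)
  finally have "(1 + Fg u) powr (1 / p - 1) * rb u powr (p - 1) <= (1 + Fg u) powr (1 / p - 1) * (1 + Fg u) powr ((p - 1) / p)"
   by (rule mult_left_mono) simp
  also have "... = (1 + Fg u) powr (1 / p - 1 + (p - 1) / p)" by (simp add: powr_add)
  also have "1 / p - 1 + (p - 1) / p = 0" using p0 by (simp add: field_simps)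
  also have "(1 + Fg u) powr 0 = 1" by (simp add: Fg_eq add_nonneg_eq_0_iff)
  finally show ?thesis .
 qed
 then have 2: "(1 + Fg u) powr (1 / p - 1) * rb u powr (p - 1) * rb v <= 1 * rb v" by (rule mult_right_mono) simp
 have "\<bar>Dwn u v\<bar> = (1 + Fg u) powr (1 / p - 1) * \<bar>pairing u v\<bar>" unfolding Dwn_def using p0 by (simp add: abs_mult)
 also have "... <= (1 + Fg u) powr (1 / p - 1) * (rb u powr (p - 1) * rb v)" by (intro mult_left_mono 1) simp
 finally show ?thesis using 2 by (simp add: mult.assoc)
qed

lemma even: "u \<in> V n ==> E0 (- u) = E0 u" "u \<in> V n ==> wn (- u) = wn u"
proof -
 assume u: "u \<in> V n"
 have "rb (- u) = rb u" using Vn.r_scale[OF u, of "-1"] by simp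
 then show "E0 (- u) = E0 u" "wn (- u) = wn u"
  by (simp_all add: E0_def wn_def Fg_eq Fm_def Fa_def)
qed

lemma source_props:
 assumes u: "u \<in> V n" and v: "v \<in> V n"
 shows "source (u + v) = source u + source v" "source (u - v) = source u - source v" "source (c *\<^sub>R u) = c * source u"
  "\<bar>source u\<bar> <= \<nu> * P * rb u"
proof -
 note i = source_term(1)[OF V_Lp(1)[OF u]] source_term(1)[OF V_Lp(1)[OF v]]
 show "source (u + v) = source u + source v" "source (u - v) = source u - source v"
  using i by (simp_all add: source_def distrib_left right_diff_distrib)
 show "source (c *\<^sub>R u) = c * source u" by (simp add: source_def mult.left_commute[of "bf _"])
 have "\<bar>source u\<bar> <= \<nu> * Lp_norm \<mu> p (ev u)" unfolding source_def by (rule source_term(2)[OF V_Lp(1)[OF u]])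
 also have "... <= \<nu> * (P * rb u)" by (intro mult_left_mono P(2) V_TF[OF u]) (simp add: \<nu>_def)
 finally show "\<bar>source u\<bar> <= \<nu> * P * rb u" by (simp add: mult.assoc)
qed

lemma DE0_source: "DE0 u \<xi> - source \<xi> = weak_form_test 1 1 u \<xi>"
 by (simp add: DE0_def weak_form_def source_def)

lemma DE0_scale: "u \<in> V n ==> v \<in> V n ==> DE0 u (c *\<^sub>R v) = c * DE0 u v"
 by (rule C1_functional.DJ_scale[OF C1_E0])

lemma duality_map_scale_real: "0 < c ==> duality_map s (c * x) = c powr (s - 1) * duality_map s (x::real)"
 using duality_map_scale[of c s x] by simp

text \<open>Rescaling turns the lower power into a coefficient \<open>c powr (q - p)\<close>, which tends to 0 for large \<open>c\<close>.\<close>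
lemma DE0_homogeneity:
 assumes u: "u \<in> V n" and c: "0 < c"
 shows "DE0 (c *\<^sub>R u) \<xi> = c powr (p - 1) * weak_form_test (c powr (q - p)) 0 u \<xi>"
proof -
 note T = V_TF[OF u]
 have g: "gv (c *\<^sub>R u) = (%x. c *\<^sub>R gv u x)"
  unfolding ev_arith by (rule grad_fun(3)[OF T T])
 have e: "c powr (q - 1) = c powr (p - 1) * c powr (q - p)" by (simp add: powr_add[symmetric])
 have dual: "duality_map s (ev (c *\<^sub>R u) x) = c powr (s - 1) * duality_map s (ev u x)" for s x
  by (simp add: duality_map_scale_real[OF c])
 have I: "(Lp_pairing N s b (ev (c *\<^sub>R u)) (ev \<xi>))
   = c powr (s - 1) * Lp_pairing N s b (ev u) (ev \<xi>)" for N s and b :: "real ^ 'n => real"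
  unfolding dual integral_mult_right_zero[symmetric] by (rule Bochner_Integration.integral_cong) (simp_all add: inner_real_def mult.assoc mult.left_commute)
 have J: "(LINT x|M. duality_map p (gv (c *\<^sub>R u) x) \<bullet> gv \<xi> x)
   = c powr (p - 1) * (LINT x|M. duality_map p (gv u x) \<bullet> gv \<xi> x)"
  unfolding g duality_map_scale[OF c] inner_scaleR_left by simp
 show ?thesis
  unfolding DE0_def weak_form_def I J e by (simp add: right_diff_distrib mult.left_commute mult.assoc)
qed

lemma Fa_homogeneity: "0 < c ==> Fa (c *\<^sub>R u) = c powr q * Fa u"
 by (simp add: Fa_def abs_mult powr_mult mult.left_commute[of "ba _"])

text \<open>The p-homogeneous part cancels by Euler's identity.\<close>
lemma energy_identity:
 "E0 u - 1 / p * DE0 u u = - ((1 / q - 1 / p) * (\<eta> * Fa u))"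
proof -
 have 1: "(LINT x|M. duality_map p (gv u x) \<bullet> gv u x) = Fg u"
  unfolding Fg_def duality_map_inner_self[OF p] by simp
 have 2: "Lp_pairing \<mu> p bm (ev u) (ev u) = Fm u"
  unfolding Fm_def duality_map_inner_self[OF p] ..
 have 3: "Lp_pairing \<mu> q ba (ev u) (ev u) = Fa u"
  unfolding Fa_def duality_map_inner_self[OF q(1)] ..
 show ?thesis unfolding E0_def DE0_def weak_form_def 1 2 3 by (simp add: algebra_simps)
qed

text \<open>Otherwise the normalised sequence converges to a solution of the eigenvalue problem. It is nonzero because gradients
converge strongly, so its gradient has norm 1. Energies of size \<open>O(c)\<close> and \<open>energy_identity\<close> bound
\<open>\<eta> \<integral> a |u|^q\<close> by \<open>O(c)\<close>, which after division by \<open>c powr q\<close> contradicts \<open>nondegenerate\<close>.\<close>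
theorem no_critical_points_at_infinity:
 "\<exists>\<rho> n1. \<forall>n\<ge>n1. \<forall>u\<in>V n. \<rho> <= rb u --> \<bar>E0 u\<bar> <= B * (1 + rb u) --> (\<exists>\<xi>\<in>V n. rb \<xi> <= 1 & B <= DE0 u \<xi>)"
proof (rule ccontr)
 assume neg: "~ ?thesis"
 define Q where "Q j n u \<longleftrightarrow> j <= n & u \<in> V n & real (Suc j) <= rb u & \<bar>E0 u\<bar> <= B * (1 + rb u) & (\<forall>\<xi>\<in>V n. rb \<xi> <= 1 --> DE0 u \<xi> < B)" for j n u
 have "\<exists>n u. Q j n u" for j using neg unfolding Q_def by (meson not_le)
 then obtain n u where "Q j (n j) (u j)" for j by metis
 then have n: "j <= n j" and u: "u j \<in> V (n j)" and big: "real (Suc j) <= rb (u j)" and E: "\<bar>E0 (u j)\<bar> <= B * (1 + rb (u j))"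
  and small: "!!\<xi>. \<xi> \<in> V (n j) ==> rb \<xi> <= 1 ==> DE0 (u j) \<xi> < B" for j
  unfolding Q_def by blast+
 have DE0_0: "DE0 (u j) 0 = 0" for j using DE0_scale[OF u u, of j 0] by simp
 have B: "0 < B"
 proof -
  have "rb 0 <= 1" using Vn.r_scale[OF u[of 0], of 0] by (simp add: ev_arith)
  then show ?thesis using small[OF subspace_0[OF subspace_V], of 0] DE0_0[of 0] by simp
 qed
 have bound: "\<bar>DE0 (u j) \<xi>\<bar> <= B * rb \<xi>" if \<xi>: "\<xi> \<in> V (n j)" for j \<xi>
 proof (cases "rb \<xi> = 0")
  case True
  have "\<xi> = 0"
   by (rule bcontfun_eqI) (simp add: r_zero_imp_zero[OF V_TF[OF \<xi>] True])
  then show ?thesis using B DE0_0[of j] by simp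
 next
  case False
  then have r: "0 < rb \<xi>" using Lp_norm_nonneg[of M p "gv \<xi>"] by linarith
  have "DE0 (u j) ((c / rb \<xi>) *\<^sub>R \<xi>) < B" if "\<bar>c\<bar> = 1" for c
  proof (rule small)
   show "(c / rb \<xi>) *\<^sub>R \<xi> \<in> V (n j)" by (rule subspace_scale[OF subspace_V \<xi>])
   show "rb ((c / rb \<xi>) *\<^sub>R \<xi>) <= 1" unfolding Vn.r_scale[OF \<xi>] using r that by (simp add: abs_divide)
  qed
  from this[of 1] this[of "-1"] have "DE0 (u j) \<xi> / rb \<xi> < B" "- (DE0 (u j) \<xi> / rb \<xi>) < B"
   unfolding DE0_scale[OF u \<xi>] by simp_all
  then show ?thesis using r by (simp add: abs_le_iff field_simps)
 qed
 define c where "c j = rb (u j)" for j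
 have c: "1 <= c j" "0 < c j" for j using big[of j] unfolding c_def by linarith+
 have c_lim: "filterlim c at_top sequentially"
 proof (rule filterlim_at_top_mono[OF filterlim_real_sequentially])
  show "\<forall>\<^sub>F j in sequentially. real j <= c j" using big unfolding c_def by (intro always_eventually allI) (simp add: less_imp_le order_trans[OF _ big])
 qed
 define v where "v j = (1 / c j) *\<^sub>R u j" for j
 have v: "v j \<in> V (n j)" for j unfolding v_def by (rule subspace_scale[OF subspace_V u])
 have uv: "u j = c j *\<^sub>R v j" for j using c(2)[of j] by (simp add: v_def)
 have rv: "rb (v j) = 1" for j unfolding v_def Vn.r_scale[OF u] using c(2)[of j] by (simp add: c_def[symmetric])
 have weak: "\<bar>weak_form_test (c j powr (q - p)) 0 (v j) \<xi>\<bar> <= B * c j powr (1 - p) * rb \<xi>" if \<xi>: "\<xi> \<in> V (n j)" for j \<xi>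
 proof -
  have "c j powr (p - 1) * \<bar>weak_form_test (c j powr (q - p)) 0 (v j) \<xi>\<bar> <= B * rb \<xi>"
   using bound[OF \<xi>] unfolding uv[of j] DE0_homogeneity[OF v c(2)] by (simp add: abs_mult)
  then have "c j powr (1 - p) * (c j powr (p - 1) * \<bar>weak_form_test (c j powr (q - p)) 0 (v j) \<xi>\<bar>) <= c j powr (1 - p) * (B * rb \<xi>)"
   by (rule mult_left_mono) simp
  moreover have "c j powr (1 - p) * c j powr (p - 1) = 1" using c(2)[of j] by (simp add: powr_add[symmetric])
  ultimately show ?thesis by (simp add: mult.assoc[symmetric] mult.commute)
 qed
 have lim0: "(%j. c j powr a) \<longlonglongrightarrow> 0" if "a < 0" for a by (rule tendsto_neg_powr[OF that c_lim])
 have s: "(%j. c j powr (q - p)) \<longlonglongrightarrow> 0" using q by (intro lim0) simp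
 have \<epsilon>: "(%j. B * c j powr (1 - p)) \<longlonglongrightarrow> 0" using tendsto_mult_left[OF lim0[of "1 - p"], of B] p by simp
 have rv1: "rb (v j) <= 1" for j using rv by simp
 obtain k :: "nat => nat" and w where k: "strict_mono k" and w: "w \<in> W1p0 p \<Omega>"
  and wl: "W_tendsto (%j. ev (v (k j))) w"
  and weq: "\<forall>\<xi>\<in>W1p0 p \<Omega>. weak_form_at 0 0 w \<xi> = 0"
  using Galerkin_compactness[OF v n rv1 s tendsto_const \<epsilon> weak] by blast
 have eigen: "(LINT x|M. duality_map p (weak_grad \<Omega> w x) \<bullet> weak_grad \<Omega> \<xi> x) = lam * Lp_pairing \<mu> p bm w \<xi>"
  if "\<xi> \<in> W1p0 p \<Omega>" for \<xi> using weq that by (simp add: weak_form_def)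
 have "(%j. Lp_norm M p (gv (v (k j)))) \<longlonglongrightarrow> Lp_norm M p (weak_grad \<Omega> w)"
  by (rule Lp_norm_tendsto[OF p W1p0_props(2)[OF w] V_Lp(2)[OF v] conjunct2[OF wl]])
 then have norm1: "Lp_norm M p (weak_grad \<Omega> w) = 1" by (simp add: rv LIMSEQ_const_iff)
 have nz: "~ (AE x in M. w x = 0)"
 proof
  assume "AE x in M. w x = 0"
  then have "AE x in \<mu>. w x = 0" by (subst AE_density) auto
  then have "AE x in \<mu>. bm x * (duality_map p (w x) \<bullet> w x) = 0" by eventually_elim simp
  then have "Lp_pairing \<mu> p bm w w = 0" by (rule integral_eq_zero_AE)
  then have "(LINT x|M. norm (weak_grad \<Omega> w x) powr p) = 0" using eigen[OF w] by (simp add: duality_map_inner_self[OF p])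
  then show False using norm1 by (simp add: Lp_norm_def)
 qed
 have wp: "w \<in> Lp \<mu> p" by (rule W1p0_Lp_\<mu>[OF w])
 have Fa_lim: "(%j. Fa (v (k j))) \<longlonglongrightarrow> Lp_weighted \<mu> q ba w"
  unfolding Fa_def power_functional_eq_pairing[OF q(1)]
  by (rule duality_pairing_tendsto[OF q(1) \<kappa>(2)[OF wp] V_Lp(3)[OF v] \<kappa>(2)[OF wp] V_Lp(3)[OF v]
     Lp_tendsto_q[OF V_Lp(1)[OF v] wp conjunct1[OF wl]] Lp_tendsto_q[OF V_Lp(1)[OF v] wp conjunct1[OF wl]] coeff(2)])
 define \<theta> where "\<theta> = 1 / q - 1 / p"
 have \<theta>: "0 < \<theta>" using q by (simp add: \<theta>_def field_simps)
 have Fa_bound: "\<bar>\<theta> * (\<eta> * Fa (v j))\<bar> <= 3 * B * c j powr (1 - q)" for j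
 proof -
  have "\<bar>DE0 (u j) (u j)\<bar> <= B * c j" unfolding c_def by (rule bound[OF u])
  then have "1 / p * \<bar>DE0 (u j) (u j)\<bar> <= 1 * (B * c j)" using p by (intro mult_mono) auto
  then have "\<bar>1 / p * DE0 (u j) (u j)\<bar> <= B * c j" unfolding abs_mult using p0 by simp
  moreover have "\<bar>E0 (u j)\<bar> <= B * (c j + c j)" using E[of j] c(1)[of j] B unfolding c_def[symmetric]
   by (intro order_trans[OF E[unfolded c_def[symmetric]]] mult_left_mono) auto
  ultimately have "\<bar>E0 (u j) - 1 / p * DE0 (u j) (u j)\<bar> <= B * (c j + c j) + B * c j"
   by (intro order_trans[OF abs_triangle_ineq4 add_mono])
  then have "\<bar>E0 (u j) - 1 / p * DE0 (u j) (u j)\<bar> <= 3 * B * c j" by (simp add: algebra_simps)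
  then have "\<bar>\<theta> * (\<eta> * Fa (u j))\<bar> <= 3 * B * c j" unfolding energy_identity \<theta>_def by simp
  then have "c j powr q * \<bar>\<theta> * (\<eta> * Fa (v j))\<bar> <= 3 * B * c j" unfolding uv[of j] Fa_homogeneity[OF c(2)] using c(2)[of j] by (simp add: abs_mult ac_simps)
  then have "c j powr (- q) * (c j powr q * \<bar>\<theta> * (\<eta> * Fa (v j))\<bar>) <= c j powr (- q) * (3 * B * c j)" by (rule mult_left_mono) simp
  moreover have "c j powr (- q) * c j powr q = 1" using c(2)[of j] by (simp add: powr_add[symmetric])
  moreover have "c j powr (- q) * c j = c j powr (1 - q)" using powr_mult_base[of "c j" "- q"] c(2)[of j] by (simp add: mult.commute)
  ultimately have "1 * \<bar>\<theta> * (\<eta> * Fa (v j))\<bar> <= 3 * B * c j powr (1 - q)"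
   by (simp only: mult.assoc[symmetric]) (simp only: mult.assoc mult.left_commute[of "c j powr (- q)"])
  then show ?thesis by simp
 qed
 have "(%j. \<theta> * (\<eta> * Fa (v (k j)))) \<longlonglongrightarrow> 0"
 proof (rule Lim_null_comparison)
  show "\<forall>\<^sub>F j in sequentially. norm (\<theta> * (\<eta> * Fa (v (k j)))) <= 3 * B * c (k j) powr (1 - q)"
   using Fa_bound by simp
  have "(%j. 3 * B * c j powr (1 - q)) \<longlonglongrightarrow> 0" using tendsto_mult_left[OF lim0[of "1 - q"], of "3 * B"] q by simp
  from LIMSEQ_subseq_LIMSEQ[OF this k] show "(%j. 3 * B * c (k j) powr (1 - q)) \<longlonglongrightarrow> 0" by (simp add: comp_def)
 qed
 moreover have "(%j. \<theta> * (\<eta> * Fa (v (k j)))) \<longlonglongrightarrow> \<theta> * (\<eta> * Lp_weighted \<mu> q ba w)"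
  by (intro tendsto_mult_left Fa_lim)
 ultimately have "\<theta> * (\<eta> * Lp_weighted \<mu> q ba w) = 0" using LIMSEQ_unique by blast
 then have "\<eta> * Lp_weighted \<mu> q ba w = 0" using \<theta> by simp
 then show False using nondegenerate[OF w eigen nz] by blast
qed

section \<open>Existence of a weak solution\<close>

definition C0 where "C0 = \<nu> * P + 1"

lemma C0: "0 < C0" using P(1) by (simp add: C0_def \<nu>_def add_nonneg_pos)

lemma source_bound: "u \<in> V n ==> \<bar>source u\<bar> <= C0 * rb u"
 using source_props(4)[of u n u] by (simp add: C0_def distrib_right add_increasing2)

lemma power_functional_bound:
 fixes f :: "real ^ 'n => real"
 assumes s: "1 < s" and f: "f \<in> Lp \<mu> s" and b: "coefficient \<mu> b"
 shows "\<bar>LINT x|\<mu>. b x * norm (f x) powr s\<bar> <= Lp_norm \<mu> s f powr s"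
 unfolding power_functional_eq_pairing[OF s]
 using integrable_duality_pairing(2)[OF s f f b] by (simp add: powr_minus_one_mult)

text \<open>Where the control functionals for \<open>\<epsilon> \<le> 1 / (2 |\<lambda>|)\<close> vanish, half of \<open>\<integral> |\<nabla> u|^p\<close> survives in the p-homogeneous
part, and it absorbs the powers \<open>q\<close> and 1 of the norm.\<close>
theorem finite_index:
 "\<exists>(d::nat) (\<Lambda> :: nat => 'n bcf => real) K. (\<forall>i<d. \<forall>n. continuous_on (V n) (\<Lambda> i) & (\<forall>u\<in>V n. \<Lambda> i (- u) = - \<Lambda> i u))
    & (\<forall>n. \<forall>u\<in>V n. (\<forall>i<d. \<Lambda> i u = 0) --> - K <= E0 u - C0 * wn u)"
proof -
 obtain \<epsilon> where \<epsilon>: "0 < \<epsilon>" "\<epsilon> * \<bar>lam\<bar> <= 1 / 2" using exists_small_factor[of "1 / 2" "\<bar>lam\<bar>"] by auto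
 obtain d \<Lambda> C where "compactness_control \<epsilon> d \<Lambda> C" using compactness_functionals[OF \<epsilon>(1)] by blast
 note H = compactness_controlD[OF this]
 let ?\<Lambda> = "%i u. \<Lambda> i (ev u)"
 define c1 where "c1 = \<bar>\<eta>\<bar> / q * (\<kappa> * P) powr q"
 have c1: "0 <= c1" using q0 by (simp add: c1_def)
 have d4: "0 < 1 / (4 * p)" using p0 by simp
 obtain K1 where K1: "0 <= K1" "!!x. 0 <= x ==> c1 * x powr q <= 1 / (4 * p) * x powr p + K1"
  using lower_power_absorption[OF q0 q(2) d4 c1] by blast
 obtain K2 where K2: "0 <= K2" "!!x. 0 <= x ==> C0 * x powr 1 <= 1 / (4 * p) * x powr p + K2"
  using lower_power_absorption[OF zero_less_one p d4 less_imp_le[OF C0]] by blast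
 show ?thesis
 proof (intro exI[of _ d] exI[of _ ?\<Lambda>] exI[of _ "K1 + K2 + C0"] conjI allI ballI impI)
  fix i n assume i: "i < d"
  show "continuous_on (V n) (?\<Lambda> i)"
  proof (rule continuous_on_V_bounded_linear[where C = C])
   fix u v assume "u \<in> V n" "v \<in> V n"
   then have T: "ev u \<in> TF" "ev v \<in> TF" using V_TF by blast+
   show "?\<Lambda> i (u - v) = ?\<Lambda> i u - ?\<Lambda> i v" using H(4)[OF T, of i 1 "-1"] by (simp add: ev_arith)
  next
   fix u assume "u \<in> V n"
   then show "\<bar>?\<Lambda> i u\<bar> <= C * rb u" using H(3)[OF V_TF i] by blast
  qed
  fix u assume "u \<in> V n"
  then have T: "ev u \<in> TF" by (rule V_TF)
  show "?\<Lambda> i (- u) = - ?\<Lambda> i u" using H(4)[OF T T, of i "-1" 0] by (simp add: ev_arith)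
 next
  fix n u assume u: "u \<in> V n" and zero: "\<forall>i<d. ?\<Lambda> i u = 0"
  have "Lp_norm \<mu> p (ev u) powr p <= \<epsilon> * rb u powr p + (\<Sum>i<d. \<bar>?\<Lambda> i u\<bar> powr p)"
   by (rule H(2)[OF V_TF[OF u]])
  also have "(\<Sum>i<d. \<bar>?\<Lambda> i u\<bar> powr p) = 0" using zero by simp
  finally have "\<bar>Fm u\<bar> <= \<epsilon> * rb u powr p"
   using power_functional_bound[OF p V_Lp(1)[OF u] coeff(1)] unfolding Fm_def by simp
  then have "\<bar>lam * Fm u\<bar> <= \<bar>lam\<bar> * (\<epsilon> * rb u powr p)" unfolding abs_mult by (rule mult_left_mono) simp
  also have "... <= 1 / 2 * rb u powr p" using mult_right_mono[OF \<epsilon>(2), of "rb u powr p"] by (simp add: ac_simps)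
  finally have "1 / 2 * rb u powr p <= Fg u - lam * Fm u" unfolding Fg_eq by linarith
  then have 1: "1 / p * (1 / 2 * rb u powr p) <= 1 / p * (Fg u - lam * Fm u)" using p0 by (intro mult_left_mono) auto
  have "\<bar>Fa u\<bar> <= Lp_norm \<mu> q (ev u) powr q"
   unfolding Fa_def by (rule power_functional_bound[OF q(1) V_Lp(3)[OF u] coeff(2)])
  also have "... <= (\<kappa> * (P * rb u)) powr q"
   using order_trans[OF \<kappa>(3)[OF V_Lp(1)[OF u]] mult_left_mono[OF P(2)[OF V_TF[OF u]] \<kappa>(1)]] q0 by (intro powr_mono2) auto
  finally have "\<bar>Fa u\<bar> <= (\<kappa> * P) powr q * rb u powr q" by (simp add: powr_mult mult.assoc)
  then have "\<bar>\<eta> / q * Fa u\<bar> <= \<bar>\<eta>\<bar> / q * ((\<kappa> * P) powr q * rb u powr q)"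
   unfolding abs_mult using q0 by (intro mult_mono) auto
  also have "... = c1 * rb u powr q" by (simp add: c1_def)
  also have "... <= 1 / (4 * p) * rb u powr p + K1" by (rule K1(2)) simp
  finally have 2: "\<eta> / q * Fa u <= 1 / (4 * p) * rb u powr p + K1" by linarith
  have "C0 * wn u <= C0 * (1 + rb u)" using C0 wn_bounds(3) by (intro mult_left_mono) auto
  also have "... <= C0 + (1 / (4 * p) * rb u powr p + K2)" using K2(2)[of "rb u"] by (simp add: distrib_left)
  finally have 3: "C0 * wn u <= C0 + (1 / (4 * p) * rb u powr p + K2)" .
  have "1 / p * (1 / 2 * rb u powr p) = 1 / (4 * p) * rb u powr p + 1 / (4 * p) * rb u powr p" using p0 by (simp add: field_simps)
  then have 4: "1 / (4 * p) * rb u powr p + 1 / (4 * p) * rb u powr p <= 1 / p * (Fg u - lam * Fm u)" using 1 by simp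
  have "- (K1 + K2 + c) <= e - f - g" if "x + x <= e" "f <= x + K1" "g <= c + (x + K2)" for e f g x c :: real using that by linarith
  from this[OF 4 2 3] show "- (K1 + K2 + C0) <= E0 u - C0 * wn u" unfolding E0_def .
 qed
qed

sublocale Minimax: perturbed_even_functional V rb wn Dwn E0 DE0 source C0
proof (rule perturbed_even_functional.intro)
 show "\<exists>d (\<Lambda> :: nat => 'n bcf => real) K. (\<forall>i<d. \<forall>n. continuous_on (V n) (\<Lambda> i) & (\<forall>u\<in>V n. \<Lambda> i (- u) = - \<Lambda> i u))
    & (\<forall>n. \<forall>u\<in>V n. (\<forall>i<d. \<Lambda> i u = 0) --> - K <= E0 u - C0 * wn u)" by (rule finite_index)
 show "continuous_on (V n) source" for n
  by (rule continuous_on_V_bounded_linear[OF source_props(2) source_bound])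
 show "!!m n. m <= n ==> V m \<subseteq> V n" by (rule V_mono)
 show "!!n. C1_functional (V n) rb E0 DE0" by (rule C1_E0)
 show "!!n. C1_functional (V n) rb wn Dwn" by (rule C1_wn)
 show "!!n u. u \<in> V n ==> 1 <= wn u & rb u <= wn u & wn u <= 1 + rb u" by (intro conjI wn_bounds)
 show "!!n u v. u \<in> V n ==> v \<in> V n ==> \<bar>Dwn u v\<bar> <= rb v" by (rule Dwn_bound)
 show "!!n u. u \<in> V n ==> E0 (- u) = E0 u & wn (- u) = wn u" by (intro conjI even)
 show "!!n u v. u \<in> V n ==> v \<in> V n ==> source (u + v) = source u + source v" by (rule source_props(1))
 show "!!n u c. u \<in> V n ==> source (c *\<^sub>R u) = c * source u" by (rule source_props(3))
 show "0 < C0" by (rule C0)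
 show "!!n u. u \<in> V n ==> \<bar>source u\<bar> <= C0 * rb u" by (rule source_bound)
 show "!!B. \<exists>\<rho> n1. \<forall>n\<ge>n1. \<forall>u\<in>V n. \<rho> <= rb u --> \<bar>E0 u\<bar> <= B * (1 + rb u) --> (\<exists>\<xi>\<in>V n. rb \<xi> <= 1 & B <= DE0 u \<xi>)"
  by (rule no_critical_points_at_infinity)
qed

text \<open>The level bounds and \<open>no_critical_points_at_infinity\<close> keep the almost critical points in a ball independent
of \<open>n\<close>, whence \<open>Galerkin_compactness\<close> applies.\<close>
theorem weak_solution_exists:
 "\<exists>u\<in>W1p0 p \<Omega>. \<forall>\<xi>\<in>W1p0 p \<Omega>. weak_form_at 1 1 u \<xi> = 0"
proof -
 obtain \<alpha> \<beta> where ab: "\<forall>\<kappa>>0. \<forall>n1. \<exists>n\<ge>n1. \<exists>u\<in>V n. \<alpha> <= E0 u - source u & E0 u - source u <= \<beta>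
   & (\<forall>\<xi>\<in>V n. (1 + rb u) * \<bar>DE0 u \<xi> - source \<xi>\<bar> <= \<kappa> * rb \<xi>)"
  using Minimax.almost_critical_points by (elim exE) (rule that)
 (* Larger than C0 + 1, the bound for DE0 in unit directions at an almost critical point. *)
 define B where "B = \<bar>\<alpha>\<bar> + \<bar>\<beta>\<bar> + C0 + 2"
 obtain \<rho> n1 where esc: "\<forall>n\<ge>n1. \<forall>u\<in>V n. \<rho> <= rb u --> \<bar>E0 u\<bar> <= B * (1 + rb u) --> (\<exists>\<xi>\<in>V n. rb \<xi> <= 1 & B <= DE0 u \<xi>)"
  using no_critical_points_at_infinity[of B] by (elim exE) (rule that)
 define Q where "Q j n u \<longleftrightarrow> j <= n & u \<in> V n & rb u <= \<rho> & (\<forall>\<xi>\<in>V n. \<bar>weak_form_test 1 1 u \<xi>\<bar> <= 1 / real (Suc j) * rb \<xi>)" for j n u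
 have "\<exists>n u. Q j n u" for j
 proof -
  have "0 < 1 / real (Suc j)" by simp
  from ab[rule_format, OF this, of "max j n1"] obtain n u where n: "max j n1 <= n" and u: "u \<in> V n" and E: "\<alpha> <= E0 u - source u" "E0 u - source u <= \<beta>"
   and D: "!!\<xi>. \<xi> \<in> V n ==> (1 + rb u) * \<bar>DE0 u \<xi> - source \<xi>\<bar> <= 1 / real (Suc j) * rb \<xi>" by blast
  have D': "\<bar>weak_form_test 1 1 u \<xi>\<bar> <= 1 / real (Suc j) * rb \<xi>" if "\<xi> \<in> V n" for \<xi>
  proof -
   have "1 * \<bar>DE0 u \<xi> - source \<xi>\<bar> <= (1 + rb u) * \<bar>DE0 u \<xi> - source \<xi>\<bar>" by (intro mult_right_mono) auto
   then show ?thesis using D[OF that] unfolding DE0_source by linarith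
  qed
  have "rb u <= \<rho>"
  proof (rule ccontr)
   assume "~ rb u <= \<rho>"
   then have \<rho>: "\<rho> <= rb u" by simp
   have "\<bar>E0 u\<bar> <= \<bar>\<alpha>\<bar> + \<bar>\<beta>\<bar> + C0 * rb u" using E source_bound[OF u] by linarith
   also have "... <= (\<bar>\<alpha>\<bar> + \<bar>\<beta>\<bar> + 2) * (1 + rb u) + C0 * (1 + rb u)"
   proof (intro add_mono mult_left_mono)
    have "(\<bar>\<alpha>\<bar> + \<bar>\<beta>\<bar>) * 1 <= (\<bar>\<alpha>\<bar> + \<bar>\<beta>\<bar> + 2) * (1 + rb u)" by (intro mult_mono) auto
    then show "\<bar>\<alpha>\<bar> + \<bar>\<beta>\<bar> <= (\<bar>\<alpha>\<bar> + \<bar>\<beta>\<bar> + 2) * (1 + rb u)" by simp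
   qed (use C0 in auto)
   also have "... = B * (1 + rb u)" by (simp add: B_def algebra_simps)
   finally obtain \<xi> where \<xi>: "\<xi> \<in> V n" "rb \<xi> <= 1" "B <= DE0 u \<xi>" using esc[rule_format, of n u] n u \<rho> by auto
   have "\<bar>DE0 u \<xi> - source \<xi>\<bar> <= 1 / real (Suc j) * rb \<xi>" using D'[OF \<xi>(1)] unfolding DE0_source .
   also have "... <= 1 * 1" using \<xi>(2) by (intro mult_mono) auto
   finally have "DE0 u \<xi> <= 1 + \<bar>source \<xi>\<bar>" by linarith
   also have "\<bar>source \<xi>\<bar> <= C0" by (rule order_trans[OF source_bound[OF \<xi>(1)]]) (use \<xi>(2) C0 in simp)
   finally show False using \<xi>(3) by (simp add: B_def)
  qed
  then have "Q j n u" using n u D' by (simp add: Q_def)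
  then show ?thesis by blast
 qed
 then obtain n u where "Q j (n j) (u j)" for j by metis
 then have 1: "u j \<in> V (n j)" and 2: "j <= n j" and 3: "rb (u j) <= \<rho>"
  and 4: "!!\<xi>. \<xi> \<in> V (n j) ==> \<bar>weak_form_test 1 1 (u j) \<xi>\<bar> <= 1 / real (Suc j) * rb \<xi>" for j
  unfolding Q_def by blast+
 show ?thesis
  using Galerkin_compactness[OF 1 2 3 tendsto_const tendsto_const LIMSEQ_Suc[OF lim_1_over_n] 4] by blast
qed

end

section \<open>The weight and the energy functional\<close>

text \<open>A Borel version of \<open>1 + |m| + |a| + |f|\<close>, cut off outside \<open>\<Omega>\<close>. For a Borel function
\<open>wt\<close> the translates \<open>wt (y - s *\<^sub>R z)\<close> are measurable in both variables, as Fubini's theorem requires.\<close>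
lemma ex_weight:
 fixes m a f :: "real ^ 'n => real"
 assumes \<Omega>: "open \<Omega>" "bounded \<Omega>" and g: "1 <= \<gamma>"
  and m: "m \<in> Lp_space \<gamma> \<Omega>" and a: "a \<in> Lp_space \<gamma> \<Omega>" and f: "f \<in> Lp_space \<gamma> \<Omega>"
 shows "\<exists>wt. wt \<in> borel_measurable borel & (\<forall>x\<in>\<Omega>. 1 <= wt x) & (\<forall>x. x \<notin> \<Omega> --> wt x = 0)
  & integrable lborel wt & integrable lborel (%x. wt x powr \<gamma>)
  & (AE x in lebesgue_on \<Omega>. \<bar>m x\<bar> <= wt x & \<bar>a x\<bar> <= wt x & \<bar>f x\<bar> <= wt x)"
proof -
 let ?M = "lebesgue_on \<Omega>"
 have \<Omega>s: "\<Omega> \<in> sets lebesgue" "\<Omega> \<inter> space lebesgue \<in> sets lebesgue" using \<Omega> by (simp_all add: borel_open)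
 have [measurable]: "\<Omega> \<in> sets borel" using \<Omega>(1) by (rule borel_open)
 have g0: "0 < \<gamma>" using g by simp
 have abs: "(%x. \<bar>u x\<bar>) \<in> Lp ?M \<gamma>" if "u \<in> Lp_space \<gamma> \<Omega>" for u :: "real ^ 'n => real"
  using that by (auto simp: Lp_space_def Lp_def)
 interpret finite_measure ?M by (rule finite_measure_lebesgue_on[OF \<Omega>])
 have one: "(%x. 1 :: real) \<in> Lp ?M \<gamma>" by (simp add: Lp_def)
 define h where "h x = 1 + \<bar>m x\<bar> + \<bar>a x\<bar> + \<bar>f x\<bar>" for x
 have hL: "h \<in> Lp ?M \<gamma>" unfolding h_def[abs_def] by (intro Lp_add[OF g0] one abs m a f)
 define H where "H x = (if x \<in> \<Omega> then h x else 0)" for x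
 have "H \<in> borel_measurable lebesgue" unfolding H_def[abs_def] by (rule borel_measurable_if_I[OF LpD(1)[OF hL] \<Omega>s(1)])
 then obtain G where G [measurable]: "G \<in> borel_measurable lborel" and HG: "AE x in lborel. H x = G x"
  using completion_ex_borel_measurable_real by blast
 define wt where "wt x = (if x \<in> \<Omega> then max 1 (G x) else 0)" for x
 have wtm: "wt \<in> borel_measurable borel" unfolding wt_def[abs_def] using G by measurable
 have h1: "1 <= h x" for x by (simp add: h_def)
 have eq: "AE x in lebesgue. wt x = H x"
  using AE_completion[OF HG]
 proof eventually_elim
  case (elim x)
  then show ?case using h1[of x] by (auto simp: wt_def H_def)
 qed
 have ge1: "1 <= wt x" if "x \<in> \<Omega>" for x using that by (simp add: wt_def)
 have "integrable ?M (%x. \<bar>h x\<bar> powr \<gamma>)" using LpD(2)[OF hL] by simp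
 then have "integrable lebesgue (%x. indicator \<Omega> x *\<^sub>R (\<bar>h x\<bar> powr \<gamma>))" by (simp only: integrable_restrict_space[OF \<Omega>s(2)])
 moreover have wg: "(%x. wt x powr \<gamma>) \<in> lborel \<rightarrow>\<^sub>M borel" using wtm by simp
 moreover have "AE x in lebesgue. indicator \<Omega> x *\<^sub>R (\<bar>h x\<bar> powr \<gamma>) = wt x powr \<gamma>"
  using eq by eventually_elim (use g0 h1 in \<open>auto simp: H_def indicator_def abs_of_nonneg order_trans[OF zero_le_one]\<close>)
 ultimately have "integrable lebesgue (%x. wt x powr \<gamma>)"
  using integrable_cong_AE[of "%x. indicator \<Omega> x *\<^sub>R (\<bar>h x\<bar> powr \<gamma>)" lebesgue "%x. wt x powr \<gamma>"] measurable_completion[OF wg] by blast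
 then have i: "integrable lborel (%x. wt x powr \<gamma>)" by (simp only: integrable_completion[OF wg])
 have i1: "integrable lborel wt"
 proof (rule Bochner_Integration.integrable_bound[OF i])
  show "wt \<in> borel_measurable lborel" using wtm by simp
  show "AE x in lborel. norm (wt x) <= norm (wt x powr \<gamma>)"
  proof (rule AE_I2)
   fix x
   show "norm (wt x) <= norm (wt x powr \<gamma>)"
    using powr_mono[OF g ge1[of x]] ge1[of x] by (cases "x \<in> \<Omega>") (auto simp: wt_def)
  qed
 qed
 have "AE x in ?M. \<bar>m x\<bar> <= wt x & \<bar>a x\<bar> <= wt x & \<bar>f x\<bar> <= wt x"
 proof (subst AE_restrict_space_iff[OF \<Omega>s(2)])
  show "AE x in lebesgue. x \<in> \<Omega> --> \<bar>m x\<bar> <= wt x & \<bar>a x\<bar> <= wt x & \<bar>f x\<bar> <= wt x"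
   using eq by eventually_elim (auto simp: H_def h_def)
 qed
 then show ?thesis using wtm ge1 i i1 by (intro exI[of _ wt]) (auto simp: wt_def)
qed

context weighted_domain begin

text \<open>Cutting off where \<open>\<bar>c\<bar> \<le> wt\<close> fails, which is a null set, makes the bound by 1 hold everywhere.\<close>
definition density_of :: "(real ^ 'n => real) => real ^ 'n => real" where
 "density_of c x = (if \<bar>c x\<bar> <= wt x then c x / wt x else 0)"

lemma density_of_bound: "\<bar>density_of c x\<bar> <= 1"
 using wt_nonneg[of x] by (cases "wt x = 0") (auto simp: density_of_def abs_divide divide_le_eq_1)

lemma density_of_measurable: "c \<in> borel_measurable M ==> density_of c \<in> borel_measurable M"
 unfolding density_of_def[abs_def]
 by (intro measurable_If borel_measurable_divide wt_measurable borel_measurable_le borel_measurable_abs measurable_const) simp_all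

lemma density_of_integral:
 assumes c: "c \<in> borel_measurable M" and le: "AE x in M. \<bar>c x\<bar> <= wt x" and g: "g \<in> borel_measurable M"
 shows "integrable M (%x. c x * g x) \<longleftrightarrow> integrable \<mu> (%x. density_of c x * g x)"
  "(LINT x|M. c x * g x) = (LINT x|\<mu>. density_of c x * g x)"
proof -
 have d: "(%x. density_of c x * g x) \<in> borel_measurable M" by (rule borel_measurable_times[OF density_of_measurable[OF c] g])
 note m = borel_measurable_times[OF c g] borel_measurable_times[OF wt_measurable d]
 have "AE x in M. c x * g x = wt x * (density_of c x * g x)"
  using le AE_space[of M]
 proof eventually_elim
  case (elim x)
  then have "1 <= wt x" by (intro wt_ge_1) (simp add: space_restrict_space)
  then show ?case using elim by (simp add: density_of_def)
 qed
 note ae = this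
 show "integrable M (%x. c x * g x) \<longleftrightarrow> integrable \<mu> (%x. density_of c x * g x)"
  unfolding integral_\<mu>(1)[OF d] by (rule integrable_cong_AE[OF m ae])
 show "(LINT x|M. c x * g x) = (LINT x|\<mu>. density_of c x * g x)"
  unfolding integral_\<mu>(2)[OF d] by (rule integral_cong_AE[OF m ae])
qed

end

context p_laplace_problem begin

lemma weak_grad_add:
 assumes u: "u \<in> W1p0 p \<Omega>" and v: "v \<in> W1p0 p \<Omega>"
 shows "(LINT x|M. norm (weak_grad \<Omega> (%x. u x + v x) x) powr p) = (LINT x|M. norm (weak_grad \<Omega> u x + weak_grad \<Omega> v x) powr p)"
proof -
 have hw: "has_weak_gradient \<Omega> (%x. u x + v x) (%x. weak_grad \<Omega> u x + weak_grad \<Omega> v x)"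
  using has_weak_gradient_comb[OF open_domain W1p0_props(3)[OF u] W1p0_props(3)[OF v], of 1 1] by simp
 note [measurable] = weak_grad_measurable[OF open_domain hw] LpD(1)[OF W1p0_props(2)[OF u]] LpD(1)[OF W1p0_props(2)[OF v]]
 show ?thesis
  by (rule integral_cong_AE) (use weak_grad_AE[OF open_domain hw] in \<open>auto elim: eventually_mono\<close>)
qed

definition energy_functional :: "(real ^ 'n => real) => real" where
 "energy_functional u = 1 / p * ((LINT x|M. norm (weak_grad \<Omega> u x) powr p) - lam * Lp_weighted \<mu> p bm u)
  - \<eta> / q * Lp_weighted \<mu> q ba u - (LINT x|\<mu>. bf x * u x)"

text \<open>Each of the three powers is differentiable in its own \<open>L\<^sup>p\<close> or \<open>L\<^sup>q\<close> space, whose norm is dominated by the norm of the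
space by Poincare's inequality.\<close>
theorem energy_functional_expansion:
 assumes u: "u \<in> W1p0 p \<Omega>" and \<epsilon>: "0 < \<epsilon>"
 shows "\<exists>\<delta>>0. \<forall>v\<in>W1p0 p \<Omega>. W1p_norm p \<Omega> v < \<delta> -->
  \<bar>energy_functional (%x. u x + v x) - energy_functional u - weak_form_at 1 1 u v\<bar> <= \<epsilon> * W1p_norm p \<Omega> v"
proof -
 let ?g = "weak_grad \<Omega> u"
 have gL: "?g \<in> Lp M p" and uL: "u \<in> Lp \<mu> p" and uq: "u \<in> Lp \<mu> q"
  using W1p0_props(2)[OF u] W1p0_Lp_\<mu>[OF u] \<kappa>(2) by auto
 let ?R1 = "Lp_remainder M p (%_. 1) ?g"
 let ?R2 = "Lp_remainder \<mu> p bm u"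
 let ?R3 = "Lp_remainder \<mu> q ba u"
 have \<epsilon>3: "0 < \<epsilon> / 3" and \<kappa>P: "0 <= \<kappa> * P" using \<epsilon> \<kappa>(1) P(1) by simp_all
 obtain d1 where d1: "0 < d1" "!!h t. h \<in> Lp M p ==> 0 <= t ==> t < d1 ==> Lp_norm M p h <= 1 * t ==> \<bar>1 / p * ?R1 h\<bar> <= \<epsilon> / 3 * t"
  using power_functional_differentiable_linear_bound[OF p gL coefficient_1 \<epsilon>3 zero_le_one, of "1 / p"] by blast
 obtain d2 where d2: "0 < d2" "!!v t. v \<in> Lp \<mu> p ==> 0 <= t ==> t < d2 ==> Lp_norm \<mu> p v <= P * t ==> \<bar>lam / p * ?R2 v\<bar> <= \<epsilon> / 3 * t"
  using power_functional_differentiable_linear_bound[OF p uL coeff(1) \<epsilon>3 P(1), of "lam / p"] by blast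
 obtain d3 where d3: "0 < d3" "!!v t. v \<in> Lp \<mu> q ==> 0 <= t ==> t < d3 ==> Lp_norm \<mu> q v <= \<kappa> * P * t ==> \<bar>\<eta> / q * ?R3 v\<bar> <= \<epsilon> / 3 * t"
  using power_functional_differentiable_linear_bound[OF q(1) uq coeff(2) \<epsilon>3 \<kappa>P, of "\<eta> / q"] by blast
 have "\<bar>energy_functional (%x. u x + v x) - energy_functional u - weak_form 1 1 u ?g v (weak_grad \<Omega> v)\<bar> <= \<epsilon> * W1p_norm p \<Omega> v"
  if v: "v \<in> W1p0 p \<Omega>" and small: "W1p_norm p \<Omega> v < Min {d1, d2, d3}" for v
 proof -
  let ?h = "weak_grad \<Omega> v" and ?t = "W1p_norm p \<Omega> v"
  note hL = W1p0_props(2)[OF v] and vL = W1p0_Lp_\<mu>[OF v]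
  have b1: "Lp_norm M p ?h <= ?t" by (rule Lp_norm_le_W1p_norm(2)[OF p])
  have b2: "Lp_norm \<mu> p v <= P * ?t" by (rule order_trans[OF Poincare[OF v] mult_left_mono[OF b1 P(1)]])
  have b3: "Lp_norm \<mu> q v <= \<kappa> * P * ?t"
   using order_trans[OF \<kappa>(3)[OF vL] mult_left_mono[OF b2 \<kappa>(1)]] by (simp add: mult.assoc)
  have f: "(LINT x|\<mu>. bf x * (u x + v x)) = (LINT x|\<mu>. bf x * u x) + (LINT x|\<mu>. bf x * v x)"
   using source_term(1)[OF uL] source_term(1)[OF vL] by (simp add: distrib_left)
  have split: "energy_functional (%x. u x + v x) - energy_functional u - weak_form 1 1 u ?g v ?h = 1 / p * ?R1 ?h - lam / p * ?R2 v - \<eta> / q * ?R3 v"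
   unfolding energy_functional_def weak_form_def weak_grad_add[OF u v] f using p0 q0 by (simp add: field_simps)
  have tri: "\<bar>a - b - c\<bar> <= \<epsilon> * t" if "\<bar>a\<bar> <= \<epsilon> / 3 * t" "\<bar>b\<bar> <= \<epsilon> / 3 * t" "\<bar>c\<bar> <= \<epsilon> / 3 * t" for a b c t using that by linarith
  show ?thesis unfolding split
   by (intro tri d1(2)[OF hL] d2(2)[OF vL] d3(2)[OF \<kappa>(2)[OF vL]] W1p_norm_nonneg) (use b1 b2 b3 small in auto)
 qed
 then show ?thesis using d1(1) d2(1) d3(1) by (intro exI[of _ "Min {d1, d2, d3}"]) auto
qed

theorem weak_solution_is_critical_point:
 assumes u: "u \<in> W1p0 p \<Omega>" and eq: "!!\<xi>. \<xi> \<in> W1p0 p \<Omega> ==> weak_form_at 1 1 u \<xi> = 0"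
  and J: "!!v. v \<in> borel_measurable M ==> J v = energy_functional v"
 shows "critical_point p \<Omega> J u"
 unfolding critical_point_def
proof (intro conjI u allI impI)
 fix \<epsilon> :: real assume "0 < \<epsilon>"
 then obtain \<delta> where \<delta>: "0 < \<delta>" "!!v. v \<in> W1p0 p \<Omega> ==> W1p_norm p \<Omega> v < \<delta> ==>
  \<bar>energy_functional (%x. u x + v x) - energy_functional u - weak_form_at 1 1 u v\<bar> <= \<epsilon> * W1p_norm p \<Omega> v"
  using energy_functional_expansion[OF u] by blast
 have m: "w \<in> borel_measurable M" if "w \<in> W1p0 p \<Omega>" for w using LpD(1)[OF W1p0_props(1)[OF that]] .
 show "\<exists>\<delta>>0. \<forall>v\<in>W1p0 p \<Omega>. W1p_norm p \<Omega> v < \<delta> --> \<bar>J (%x. u x + v x) - J u\<bar> <= \<epsilon> * W1p_norm p \<Omega> v"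
 proof (intro exI[of _ \<delta>] conjI ballI impI \<delta>(1))
  fix v assume v: "v \<in> W1p0 p \<Omega>" "W1p_norm p \<Omega> v < \<delta>"
  have "J (%x. u x + v x) = energy_functional (%x. u x + v x)" "J u = energy_functional u"
   by (intro J borel_measurable_add m u v)+
  then show "\<bar>J (%x. u x + v x) - J u\<bar> <= \<epsilon> * W1p_norm p \<Omega> v" using \<delta>(2)[OF v] eq[OF v(1)] by simp
 qed
qed

end

theorem theorem2p20:
  fixes \<Omega> :: "(real ^ 'n) set"
    and p q \<gamma> lam \<eta> :: real
    and m a f :: "real ^ 'n \<Rightarrow> real"
  assumes "open \<Omega>" and "connected \<Omega>" and "bounded \<Omega>" and "\<Omega> \<noteq> {}"
    and "1 < q" and "q < p"
    and "if p \<le> real CARD('n) then real CARD('n) / p < \<gamma> else \<gamma> = 1"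
    and "m \<in> Lp_space \<gamma> \<Omega>" and "a \<in> Lp_space \<gamma> \<Omega>" and "f \<in> Lp_space \<gamma> \<Omega>"
    and "\<not> ae_zero_on \<Omega> (\<lambda>x. max (m x) 0)" and "\<not> ae_zero_on \<Omega> a" and "\<not> ae_zero_on \<Omega> f"
    and "lam \<notin> p_laplace_spectrum p \<Omega> m
      \<or> (lam \<in> p_laplace_spectrum p \<Omega> m \<and>
          (\<forall>u\<in>ES p \<Omega> lam m. \<not> ae_zero_on \<Omega> u \<longrightarrow>
             \<eta> * (LINT x|lebesgue_on \<Omega>. a x * \<bar>u x\<bar> powr q) > 0))
      \<or> (lam \<in> p_laplace_spectrum p \<Omega> m \<and>
          (\<forall>u\<in>ES p \<Omega> lam m. \<not> ae_zero_on \<Omega> u \<longrightarrow>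
             \<eta> * (LINT x|lebesgue_on \<Omega>. a x * \<bar>u x\<bar> powr q) < 0))"
  shows "\<exists>u. critical_point p \<Omega> (energy p q \<Omega> m a f lam \<eta>) u \<and>
           p_laplace_solution p \<Omega>
             (\<lambda>x s. lam * m x * \<bar>s\<bar> powr (p - 2) * s + \<eta> * a x * \<bar>s\<bar> powr (q - 2) * s + f x) u"
proof -
 let ?M = "lebesgue_on \<Omega>"
 note \<Omega> = assms(1,3) and q = assms(5,6)
 have p: "1 < p" using q by simp
 (* One condition for both cases: for N < p and \<gamma> = 1 it says the same. *)
 have \<gamma>: "1 <= \<gamma>" "real CARD('n) / \<gamma> < p"
 proof -
  have "1 <= \<gamma> & real CARD('n) / \<gamma> < p"
  proof (cases "p <= real CARD('n)")
   case True
   then have "real CARD('n) / p < \<gamma>" using assms(7) by simp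
   moreover have "1 <= real CARD('n) / p" using True p by simp
   ultimately have "1 <= \<gamma>" by linarith
   moreover have "real CARD('n) < \<gamma> * p" using \<open>real CARD('n) / p < \<gamma>\<close> p by (simp add: divide_less_eq)
   ultimately show ?thesis by (simp add: divide_less_eq mult.commute)
  qed (use assms(7) in auto)
  then show "1 <= \<gamma>" "real CARD('n) / \<gamma> < p" by auto
 qed
 obtain wt where wt: "wt \<in> borel_measurable borel" "!!x. x \<in> \<Omega> ==> 1 <= wt x" "!!x. x \<notin> \<Omega> ==> wt x = 0"
   "integrable lborel wt" "integrable lborel (%x. wt x powr \<gamma>)"
  and dom: "AE x in ?M. \<bar>m x\<bar> <= wt x & \<bar>a x\<bar> <= wt x & \<bar>f x\<bar> <= wt x"
  using ex_weight[OF \<Omega> \<gamma>(1) assms(8-10)] by blast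
 have le: "AE x in ?M. \<bar>m x\<bar> <= wt x" "AE x in ?M. \<bar>a x\<bar> <= wt x" "AE x in ?M. \<bar>f x\<bar> <= wt x"
  using dom by (auto elim: eventually_mono)
 have coeff: "m \<in> borel_measurable ?M" "a \<in> borel_measurable ?M" "f \<in> borel_measurable ?M"
  using assms(8-10) by (simp_all add: Lp_space_def)
 interpret W: weighted_domain \<Omega> p \<gamma> wt
  by (rule weighted_domain.intro) (use \<Omega> p \<gamma> wt in auto)
 let ?\<mu> = "density ?M (%x. ennreal (wt x))"
 note int_m = W.density_of_integral[OF coeff(1) le(1)] and int_a = W.density_of_integral[OF coeff(2) le(2)]
  and int_f = W.density_of_integral[OF coeff(3) le(3)]
 have dual: "\<bar>s\<bar> powr (k - 2) * s * t = duality_map k s \<bullet> t" for s t k :: real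
  by (simp add: duality_map_real)
 have pairing_m: "integrable ?M (%x. m x * (duality_map k (u x) \<bullet> v x)) \<longleftrightarrow> integrable ?\<mu> (%x. W.density_of m x * (duality_map k (u x) \<bullet> v x))"
   "Lp_pairing ?M k m u v = Lp_pairing ?\<mu> k (W.density_of m) u v"
   "integrable ?M (%x. a x * (duality_map k (u x) \<bullet> v x)) \<longleftrightarrow> integrable ?\<mu> (%x. W.density_of a x * (duality_map k (u x) \<bullet> v x))"
   "Lp_pairing ?M k a u v = Lp_pairing ?\<mu> k (W.density_of a) u v"
  if [measurable]: "u \<in> borel_measurable ?M" "v \<in> borel_measurable ?M" for u v :: "real ^ 'n => real" and k
  by (intro int_m int_a; simp add: duality_map_def)+
 have meas: "u \<in> borel_measurable ?M" if "u \<in> W1p0 p \<Omega>" for u using LpD(1)[OF W.W1p0_props(1)[OF that]] .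
 have dm: "coefficient ?\<mu> (W.density_of m)" "coefficient ?\<mu> (W.density_of a)" "coefficient ?\<mu> (W.density_of f)"
  using W.density_of_measurable coeff W.density_of_bound by (simp_all add: coefficient_def W.measurable_\<mu>)
 interpret p_laplace_problem \<Omega> p \<gamma> wt q lam \<eta> "W.density_of m" "W.density_of a" "W.density_of f"
 proof
  fix u assume u: "u \<in> W1p0 p \<Omega>" and eq: "!!\<xi>. \<xi> \<in> W1p0 p \<Omega> ==> (LINT x|?M. duality_map p (weak_grad \<Omega> u x) \<bullet> weak_grad \<Omega> \<xi> x)
     = lam * Lp_pairing ?\<mu> p (W.density_of m) u \<xi>"
   and nz: "~ (AE x in ?M. u x = 0)"
  have "u \<in> ES p \<Omega> lam m" unfolding ES_def p_laplace_solution_def mem_Collect_eq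
  proof (intro conjI ballI u)
   fix \<xi> assume \<xi>: "\<xi> \<in> W1p0 p \<Omega>"
   have e: "lam * m x * \<bar>u x\<bar> powr (p - 2) * u x * \<xi> x = lam * (m x * (duality_map p (u x) \<bullet> \<xi> x))" for x
    by (simp add: duality_map_real)
   show "integrable ?M (%x. lam * m x * \<bar>u x\<bar> powr (p - 2) * u x * \<xi> x)"
    unfolding e using integrable_duality_pairing(1)[OF p W.W1p0_Lp_\<mu>[OF u] W.W1p0_Lp_\<mu>[OF \<xi>] dm(1)]
     pairing_m(1)[OF meas[OF u] meas[OF \<xi>]] by simp
   show "(LINT x|?M. (norm (weak_grad \<Omega> u x) powr (p - 2) *\<^sub>R weak_grad \<Omega> u x) \<bullet> weak_grad \<Omega> \<xi> x) = (LINT x|?M. lam * m x * \<bar>u x\<bar> powr (p - 2) * u x * \<xi> x)"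
    unfolding e using eq[OF \<xi>] pairing_m(2)[OF meas[OF u] meas[OF \<xi>], of p] by (simp add: duality_map_def)
  qed
  moreover have "~ ae_zero_on \<Omega> u" using nz by (simp add: ae_zero_on_def)
  (* Such a u shows that lam lies in the spectrum, which leaves the two alternatives with a strict sign. *)
  ultimately have "\<eta> * (LINT x|?M. a x * \<bar>u x\<bar> powr q) ~= 0"
   using assms(14) by (auto simp: p_laplace_spectrum_def)
  moreover have "(LINT x|?M. a x * \<bar>u x\<bar> powr q) = Lp_weighted ?\<mu> q (W.density_of a) u"
   using int_a(2)[of "%x. \<bar>u x\<bar> powr q"] meas[OF u] by simp
  ultimately show "\<eta> * Lp_weighted ?\<mu> q (W.density_of a) u ~= 0" by simp
 qed (use q dm in \<open>auto simp: coefficient_def W.measurable_\<mu>\<close>)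
 obtain u where u: "u \<in> W1p0 p \<Omega>" and eq: "!!\<xi>. \<xi> \<in> W1p0 p \<Omega> ==> weak_form_at 1 1 u \<xi> = 0"
  using weak_solution_exists by blast
 have energy: "energy p q \<Omega> m a f lam \<eta> v = energy_functional v" if v: "v \<in> borel_measurable ?M" for v
  unfolding energy_def energy_functional_def real_norm_def
  using int_m(2)[of "%x. \<bar>v x\<bar> powr p"] int_a(2)[of "%x. \<bar>v x\<bar> powr q"] int_f(2)[OF v] v by simp
 have "critical_point p \<Omega> (energy p q \<Omega> m a f lam \<eta>) u"
  by (rule weak_solution_is_critical_point[OF u eq energy])
 moreover have "p_laplace_solution p \<Omega> (%x s. lam * m x * \<bar>s\<bar> powr (p - 2) * s + \<eta> * a x * \<bar>s\<bar> powr (q - 2) * s + f x) u"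
  unfolding p_laplace_solution_def
 proof (intro conjI ballI u)
  fix \<xi> assume \<xi>: "\<xi> \<in> W1p0 p \<Omega>"
  note uL = W.W1p0_Lp_\<mu>[OF u] and \<xi>L = W.W1p0_Lp_\<mu>[OF \<xi>] and m2 = meas[OF u] meas[OF \<xi>]
  have e: "(lam * m x * \<bar>u x\<bar> powr (p - 2) * u x + \<eta> * a x * \<bar>u x\<bar> powr (q - 2) * u x + f x) * \<xi> x
   = lam * (m x * (duality_map p (u x) \<bullet> \<xi> x)) + \<eta> * (a x * (duality_map q (u x) \<bullet> \<xi> x)) + f x * \<xi> x" for x
   by (simp add: duality_map_real algebra_simps)
  have i: "integrable ?M (%x. m x * (duality_map p (u x) \<bullet> \<xi> x))" "integrable ?M (%x. a x * (duality_map q (u x) \<bullet> \<xi> x))" "integrable ?M (%x. f x * \<xi> x)"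
   using integrable_duality_pairing(1)[OF p uL \<xi>L dm(1)] integrable_duality_pairing(1)[OF q(1) \<kappa>(2)[OF uL] \<kappa>(2)[OF \<xi>L] dm(2)]
    source_term(1)[OF \<xi>L] pairing_m(1,3)[OF m2] int_f(1)[OF m2(2)] by simp_all
  then show "integrable ?M (%x. (lam * m x * \<bar>u x\<bar> powr (p - 2) * u x + \<eta> * a x * \<bar>u x\<bar> powr (q - 2) * u x + f x) * \<xi> x)"
   unfolding e by simp
  show "(LINT x|?M. (norm (weak_grad \<Omega> u x) powr (p - 2) *\<^sub>R weak_grad \<Omega> u x) \<bullet> weak_grad \<Omega> \<xi> x)
   = (LINT x|?M. (lam * m x * \<bar>u x\<bar> powr (p - 2) * u x + \<eta> * a x * \<bar>u x\<bar> powr (q - 2) * u x + f x) * \<xi> x)"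
   unfolding e using i eq[OF \<xi>] pairing_m(2)[OF m2, of p] pairing_m(4)[OF m2, of q] int_f(2)[OF m2(2)]
   by (simp add: weak_form_def duality_map_def)
 qed
 ultimately show ?thesis by blast
qed

end
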